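(* Let $\mathsf{X}$ be a regular diffusion with state space $J$. Suppose that $\mathsf{X}$ is on natural scale and that all regular boundaries are absorbing. Then $\mathsf{X}$ is a Feller--Dynkin (FD) process if and only if it is a $\mathbb{P}_x$-martingale for all $x\in J^\circ$.
   Context: Let $J\subset\mathbb{R}$ be a non-empty closed, open or half-open, possibly infinite interval, $J^\circ$ its interior, $\mathrm{cl}(J)$ its closure in $[-\infty,\infty]$ and $\partial J = \mathrm{cl}(J)\setminus J^\circ$. A diffusion is a path-continuous, temporally homogeneous, conservative strong Markov process $(\Omega,\mathcal{F},(\mathcal{F}_t)_{t\ge0},(\mathsf{X}_t)_{t\ge0},(\theta_t)_{t\ge0},(\mathbb{P}_x)_{x\in J})$ with state space $(J,\mathcal{B}(J))$. Put $\tau_u=\inf(t\in\mathbb{R}_+:\mathsf{X}_t=u)$. The diffusion is regular if $\mathbb{P}_x(\tau_y<\infty)>0$ for all $x\in J^\circ$, $y\in J$. Martingales are with respect to $(\mathcal{F}_t)_{t\ge 0}$. Semigroup: $T_tf(x)=\mathbb{E}_x[f(\mathsf{X}_t)]$. $C_0(J)$ is the Banach space of continuous functions $J\to\mathbb{R}$ vanishing at infinity, with the sup-norm. $\mathsf{X}$ is an FD process if $(T_t)_{t\ge0}$ is a strongly continuous semigroup on $C_0(J)$. Scale function: a continuous strictly increasing $\mathfrak{s}:J\to\mathbb{R}$ (unique up to increasing affine transformations) such that for any $I=(a,b)$ with $[a,b]\subset J$, $\mathbb{P}_x(\tau_b<\tau_a)=\frac{\mathfrak{s}(x)-\mathfrak{s}(a)}{\mathfrak{s}(b)-\mathfrak{s}(a)}$,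 $x\in I$. The diffusion is on natural scale if the identity is a scale function. Speed measure: the unique Radon measure $\mathfrak{m}$ on $(J^\circ,\mathcal{B}(J^\circ))$ such that for every bounded $I=(a,b)$ with $[a,b]\subset J$, $\mathbb{E}_x[\tau_a\wedge\tau_b]=\int G_I(x,y)\,\mathfrak{m}(dy)$, $x\in I$, where $G_I(x,y)=\frac{2(\mathfrak{s}(x)\wedge\mathfrak{s}(y)-\mathfrak{s}(a))(\mathfrak{s}(b)-\mathfrak{s}(x)\vee\mathfrak{s}(y))}{\mathfrak{s}(b)-\mathfrak{s}(a)}$ for $x,y\in I$ and $G_I(x,y)=0$ otherwise. Regular boundaries: fix $c\in J^\circ$. For $x\in J^\circ$ set $\mathfrak{u}(x)=\int_{(c,x]}\mathfrak{m}((c,z])\,\mathfrak{s}(dz)$ and $\mathfrak{v}(x)=\int_{(c,x]}(\mathfrak{s}(y)-\mathfrak{s}(c))\,\mathfrak{m}(dy)$ if $x\ge c$, and $\mathfrak{u}(x)=\int_{(x,c]}\mathfrak{m}((z,c])\,\mathfrak{s}(dz)$ and $\mathfrak{v}(x)=\int_{(x,c]}(\mathfrak{s}(c)-\mathfrak{s}(y))\,\mathfrak{m}(dy)$ if $x\le c$. For $b\in\partial J$ let $\mathfrak{u}(b),\mathfrak{v}(b)$ be the monotone limits as $x\to b$. The point $b$ is regular if $\mathfrak{u}(b)<\infty$ and $\mathfrak{v}(b)<\infty$ (independently of $c$); regular boundary points belong to $J$. Absorbing: the speed measure is extended to regular boundary points as follows. For $J=[0,\infty)$ and $\mathfrak{s}(0)=0$,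 let $\mathfrak{s}^*(x)=\mathfrak{s}(x)$, $\mathfrak{s}^*(-x)=-\mathfrak{s}(x)$ for $x\ge0$; for $I=[0,a)$, $a>0$, let $G^*_I$ be $G_{(-a,a)}$ with $\mathfrak{s}$ replaced by $\mathfrak{s}^*$, and $G^\circ_I(x,y)=G^*_I(x,y)+G^*_I(x,-y)$ for $x,y\ge 0$. Then $\mathfrak{m}(\{0\})\in[0,\infty]$ is defined so that $\mathbb{E}_x[\int_0^{\tau_a}f(\mathsf{X}_s)ds]=\int_I G^\circ_I(x,y)f(y)\,\mathfrak{m}(dy)$ for all $x\in I=[0,a)$, $a>0$, and Borel $f:\mathbb{R}_+\to\mathbb{R}_+$; in particular $\mathbb{E}_0[\int_0^{\tau_a}\mathbf{1}_{\{\mathsf{X}_s=0\}}ds]=2\mathfrak{s}(a)\mathfrak{m}(\{0\})$. The extension at a general regular boundary point is analogous (by translation and reflection). A regular boundary point $b$ is absorbing if $\mathfrak{m}(\{b\})=\infty$. *)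

theory Defs
  imports "HOL-Probability.Probability"
begin

section \<open>Diffusions\<close>

definition hitting_time :: "(real \<Rightarrow> 'w \<Rightarrow> real) \<Rightarrow> real \<Rightarrow> 'w \<Rightarrow> ennreal" where
  "hitting_time X u \<omega> = (INF t\<in>{t. 0 \<le> t \<and> X t \<omega> = u}. ennreal t)"

text \<open>Time is \<open>[0, \<infinity>)\<close>: filtrations and processes are indexed by \<open>real\<close>, and only their values at
  \<open>t \<ge> 0\<close> are ever used.  A filtration is a family of measure spaces of which only the sigma-algebras
  matter.  The library's \<open>stopping_time\<close> takes its values in the index type of the filtration; here
  the value \<open>\<infinity>\<close> is allowed as well.\<close>

definition ext_stopping_time :: "'w measure \<Rightarrow> (real \<Rightarrow> 'w measure) \<Rightarrow> ('w \<Rightarrow> ennreal) \<Rightarrow> bool" where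
  "ext_stopping_time A F \<tau> \<longleftrightarrow> (\<forall>t\<ge>0. {\<omega>\<in>space A. \<tau> \<omega> \<le> ennreal t} \<in> sets (F t))"

definition stopped_sigma :: "'w measure \<Rightarrow> (real \<Rightarrow> 'w measure) \<Rightarrow> ('w \<Rightarrow> ennreal) \<Rightarrow> 'w measure" where
  "stopped_sigma A F \<tau> =
     sigma (space A) {L \<in> sets A. \<forall>t\<ge>0. L \<inter> {\<omega>\<in>space A. \<tau> \<omega> \<le> ennreal t} \<in> sets (F t)}"

definition path_sigma :: "'w measure \<Rightarrow> (real \<Rightarrow> 'w \<Rightarrow> real) \<Rightarrow> 'w measure" where
  "path_sigma A X = sigma (space A) {X t -` B \<inter> space A | t B. 0 \<le> t \<and> B \<in> sets borel}"

text \<open>The measure space \<open>A\<close> only carries the sample space and the sigma-algebra on it.  That the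
  process is conservative is expressed by \<open>X t\<close> mapping the sample space into \<open>J\<close> for every
  \<open>t \<ge> 0\<close>.\<close>

locale diffusion =
  fixes J :: "real set"
    and A :: "'w measure"
    and F :: "real \<Rightarrow> 'w measure"
    and X :: "real \<Rightarrow> 'w \<Rightarrow> real"
    and \<theta> :: "real \<Rightarrow> 'w \<Rightarrow> 'w"
    and P :: "real \<Rightarrow> 'w measure"
  assumes interval: "is_interval J" and nonempty: "J \<noteq> {}"
    and subalgebra_F: "\<And>t. 0 \<le> t \<Longrightarrow> subalgebra A (F t)"
    and F_mono: "\<And>s t. 0 \<le> s \<Longrightarrow> s \<le> t \<Longrightarrow> sets (F s) \<subseteq> sets (F t)"
    and prob_P: "\<And>x. x \<in> J \<Longrightarrow> prob_space (P x)"
    and sets_P: "\<And>x. x \<in> J \<Longrightarrow> sets (P x) = sets A"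
    and kernel_P: "\<And>L. L \<in> sets (path_sigma A X) \<Longrightarrow>
          (\<lambda>x. emeasure (P x) L) \<in> borel_measurable (restrict_space borel J)"
    and adapted: "\<And>t. 0 \<le> t \<Longrightarrow> X t \<in> measurable (F t) (restrict_space borel J)"
    and continuous_paths: "\<And>\<omega>. \<omega> \<in> space A \<Longrightarrow> continuous_on {0..} (\<lambda>t. X t \<omega>)"
    and start: "\<And>x. x \<in> J \<Longrightarrow> AE \<omega> in P x. X 0 \<omega> = x"
    and shift_closed: "\<And>t \<omega>. 0 \<le> t \<Longrightarrow> \<omega> \<in> space A \<Longrightarrow> \<theta> t \<omega> \<in> space A"
    and shift: "\<And>s t \<omega>. 0 \<le> s \<Longrightarrow> 0 \<le> t \<Longrightarrow> \<omega> \<in> space A \<Longrightarrow> X s (\<theta> t \<omega>) = X (s + t) \<omega>"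
    and strong_Markov: "\<And>x \<tau> Z. x \<in> J \<Longrightarrow> ext_stopping_time A F \<tau> \<Longrightarrow>
          (Z :: 'w \<Rightarrow> ennreal) \<in> borel_measurable (path_sigma A X) \<Longrightarrow>
          AE \<omega> in P x.
            nn_cond_exp (P x) (stopped_sigma A F \<tau>)
              (\<lambda>\<omega>. Z (\<theta> (enn2real (\<tau> \<omega>)) \<omega>) * indicator {\<omega>. \<tau> \<omega> < \<infinity>} \<omega>) \<omega>
            = (\<integral>\<^sup>+\<omega>'. Z \<omega>' \<partial>P (X (enn2real (\<tau> \<omega>)) \<omega>)) * indicator {\<omega>. \<tau> \<omega> < \<infinity>} \<omega>"

locale regular_diffusion = diffusion J A F X \<theta> P
  for J :: "real set" and A :: "'w measure" and F X \<theta> P +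
  assumes regular: "\<And>x y. x \<in> interior J \<Longrightarrow> y \<in> J \<Longrightarrow>
          measure (P x) {\<omega>\<in>space (P x). hitting_time X y \<omega> < \<infinity>} > 0"


section \<open>Scale function and speed measure\<close>

definition scale_function ::
    "real set \<Rightarrow> (real \<Rightarrow> 'w measure) \<Rightarrow> (real \<Rightarrow> 'w \<Rightarrow> real) \<Rightarrow> (real \<Rightarrow> real) \<Rightarrow> bool" where
  "scale_function J P X s \<longleftrightarrow>
     continuous_on J s \<and> strict_mono_on J s \<and>
     (\<forall>a b x. {a..b} \<subseteq> J \<and> a < x \<and> x < b \<longrightarrow>
        measure (P x) {\<omega>\<in>space (P x). hitting_time X b \<omega> < hitting_time X a \<omega>}
          = (s x - s a) / (s b - s a))"

definition natural_scale ::
    "real set \<Rightarrow> (real \<Rightarrow> 'w measure) \<Rightarrow> (real \<Rightarrow> 'w \<Rightarrow> real) \<Rightarrow> bool" where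
  "natural_scale J P X \<longleftrightarrow> scale_function J P X (\<lambda>x. x)"

definition green :: "(real \<Rightarrow> real) \<Rightarrow> real \<Rightarrow> real \<Rightarrow> real \<Rightarrow> real \<Rightarrow> real" where
  "green s a b x y =
     (if x \<in> {a<..<b} \<and> y \<in> {a<..<b}
      then 2 * (min (s x) (s y) - s a) * (s b - max (s x) (s y)) / (s b - s a)
      else 0)"

text \<open>On an interval, a Borel measure finite on compact sets is Radon.\<close>

definition interior_speed_measure ::
    "real set \<Rightarrow> (real \<Rightarrow> 'w measure) \<Rightarrow> (real \<Rightarrow> 'w \<Rightarrow> real) \<Rightarrow> (real \<Rightarrow> real) \<Rightarrow> real measure \<Rightarrow> bool"
  where
  "interior_speed_measure J P X s m \<longleftrightarrow>
     sets m = sets (restrict_space borel (interior J)) \<and>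
     (\<forall>K. compact K \<and> K \<subseteq> interior J \<longrightarrow> emeasure m K < \<infinity>) \<and>
     (\<forall>a b x. {a..b} \<subseteq> J \<and> a < x \<and> x < b \<longrightarrow>
        (\<integral>\<^sup>+\<omega>. min (hitting_time X a \<omega>) (hitting_time X b \<omega>) \<partial>P x)
          = (\<integral>\<^sup>+y. ennreal (green s a b x y) \<partial>m))"


section \<open>Boundary points\<close>

definition boundary_points :: "real set \<Rightarrow> ereal set" where
  "boundary_points J = closure (ereal ` J) - ereal ` interior J"

text \<open>On \<open>(l, r]\<close> this is the Lebesgue-Stieltjes measure \<open>s(dz)\<close>; truncating the argument keeps the
  distribution function monotone and continuous on the whole line although \<open>s\<close> is only relevant
  on \<open>J\<close>.\<close>

definition stieltjes :: "(real \<Rightarrow> real) \<Rightarrow> real \<Rightarrow> real \<Rightarrow> real measure" where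
  "stieltjes s l r = interval_measure (\<lambda>z. s (max l (min r z)))"

definition boundary_u :: "(real \<Rightarrow> real) \<Rightarrow> real measure \<Rightarrow> real \<Rightarrow> real \<Rightarrow> ennreal" where
  "boundary_u s m c x =
     (if c \<le> x then (\<integral>\<^sup>+z\<in>{c<..x}. emeasure m {c<..z} \<partial>stieltjes s c x)
      else (\<integral>\<^sup>+z\<in>{x<..c}. emeasure m {z<..c} \<partial>stieltjes s x c))"

definition boundary_v :: "(real \<Rightarrow> real) \<Rightarrow> real measure \<Rightarrow> real \<Rightarrow> real \<Rightarrow> ennreal" where
  "boundary_v s m c x =
     (if c \<le> x then (\<integral>\<^sup>+y\<in>{c<..x}. ennreal (s y - s c) \<partial>m)
      else (\<integral>\<^sup>+y\<in>{x<..c}. ennreal (s c - s y) \<partial>m))"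

text \<open>The limit at a boundary point \<open>b\<close> of a function that increases on \<open>interior J\<close> in both
  directions away from \<open>c\<close>.\<close>

definition boundary_limit ::
    "real set \<Rightarrow> real \<Rightarrow> (real \<Rightarrow> ennreal) \<Rightarrow> ereal \<Rightarrow> ennreal" where
  "boundary_limit J c f b =
     (if ereal c < b then (SUP x\<in>{x \<in> interior J. c \<le> x}. f x)
      else (SUP x\<in>{x \<in> interior J. x \<le> c}. f x))"

definition regular_boundary ::
    "real set \<Rightarrow> (real \<Rightarrow> real) \<Rightarrow> real measure \<Rightarrow> ereal \<Rightarrow> bool" where
  "regular_boundary J s m b \<longleftrightarrow>
     b \<in> boundary_points J \<and>
     (\<exists>c\<in>interior J. boundary_limit J c (boundary_u s m c) b < \<infinity> \<and>
                     boundary_limit J c (boundary_v s m c) b < \<infinity>)"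


section \<open>Extension of the speed measure to regular boundary points\<close>

text \<open>The boundary point \<open>r\<close> is moved to \<open>0\<close> by the coordinate \<open>d * (x - r)\<close>, with \<open>d = 1\<close> if \<open>r\<close> is
  the left and \<open>d = -1\<close> if \<open>r\<close> is the right end point of \<open>J\<close>.  In this coordinate the scale
  function becomes \<open>y \<mapsto> d * (s (r + d * y) - s r)\<close>, which is extended to an odd function.\<close>

definition reflected_scale :: "(real \<Rightarrow> real) \<Rightarrow> real \<Rightarrow> real \<Rightarrow> real \<Rightarrow> real" where
  "reflected_scale s r d z =
     (if 0 \<le> z then d * (s (r + d * z) - s r) else - (d * (s (r - d * z) - s r)))"

definition boundary_green ::
    "(real \<Rightarrow> real) \<Rightarrow> real \<Rightarrow> real \<Rightarrow> real \<Rightarrow> real \<Rightarrow> real \<Rightarrow> real" where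
  "boundary_green s r d a x y =
     (let a' = d * (a - r); x' = d * (x - r); y' = d * (y - r); s' = reflected_scale s r d
      in green s' (- a') a' x' y' + green s' (- a') a' x' (- y'))"

text \<open>The mass \<open>M {r}\<close> is determined by the occupation formula below, already by its instance
  \<open>f = indicator {r}\<close>, \<open>x = r\<close>.  If \<open>M {r} = \<infinity>\<close>, then \<open>r\<close> is a trap, and the formula holds
  for \<open>f r > 0\<close> (both sides are infinite) but cannot hold for \<open>f r = 0\<close>: starting in
  \<open>r\<close>, its left-hand side is \<open>0\<close>, whereas its right-hand side does not vanish unless \<open>f\<close> does so
  almost everywhere on \<open>J\<close> between \<open>r\<close> and \<open>a\<close>.  Therefore the functions for which the boundary term
  \<open>f r * M {r}\<close> has the form \<open>0 * \<infinity>\<close> are left out.\<close>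

definition speed_measure ::
    "real set \<Rightarrow> (real \<Rightarrow> 'w measure) \<Rightarrow> (real \<Rightarrow> 'w \<Rightarrow> real) \<Rightarrow> (real \<Rightarrow> real) \<Rightarrow> real measure \<Rightarrow> bool"
  where
  "speed_measure J P X s M \<longleftrightarrow>
     (let m = restrict_space M (interior J);
          R = {r \<in> J. regular_boundary J s m (ereal r)}
      in sets M = sets (restrict_space borel (interior J \<union> R)) \<and>
         interior_speed_measure J P X s m \<and>
         (\<forall>r\<in>R. \<forall>d\<in>{1, -1}. (\<forall>y\<in>J. 0 \<le> d * (y - r)) \<longrightarrow>
            (\<forall>a\<in>J. \<forall>x\<in>J. \<forall>f. 0 \<le> d * (x - r) \<and> d * (x - r) < d * (a - r) \<and>
               f \<in> borel_measurable borel \<and> (\<forall>y. 0 \<le> f y) \<and>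
               (emeasure M {r} \<noteq> \<infinity> \<or> f r \<noteq> 0) \<longrightarrow>
               (\<integral>\<^sup>+\<omega>. (\<integral>\<^sup>+t\<in>{t. 0 \<le> t \<and> ennreal t < hitting_time X a \<omega>}.
                          ennreal (f (X t \<omega>)) \<partial>lborel) \<partial>P x)
               = (\<integral>\<^sup>+y. ennreal (boundary_green s r d a x y * f y) \<partial>M))))"

definition absorbing :: "real set \<Rightarrow> (real \<Rightarrow> real) \<Rightarrow> real measure \<Rightarrow> ereal \<Rightarrow> bool" where
  "absorbing J s M b \<longleftrightarrow>
     regular_boundary J s (restrict_space M (interior J)) b \<and>
     (\<exists>r\<in>J. b = ereal r \<and> emeasure M {r} = \<infinity>)"


section \<open>The Feller-Dynkin property and martingales\<close>

text \<open>Elements of \<open>C0 J\<close> are represented by functions on the line of which only the values on \<open>J\<close>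
  matter.\<close>

definition C0 :: "real set \<Rightarrow> (real \<Rightarrow> real) set" where
  "C0 J = {f. continuous_on J f \<and>
     (\<forall>e>0. \<exists>K. compact K \<and> K \<subseteq> J \<and> (\<forall>x\<in>J - K. \<bar>f x\<bar> < e))}"

definition sup_norm :: "real set \<Rightarrow> (real \<Rightarrow> real) \<Rightarrow> real" where
  "sup_norm J f = (SUP x\<in>J. \<bar>f x\<bar>)"

definition strongly_continuous_semigroup_C0 ::
    "real set \<Rightarrow> (real \<Rightarrow> (real \<Rightarrow> real) \<Rightarrow> real \<Rightarrow> real) \<Rightarrow> bool" where
  "strongly_continuous_semigroup_C0 J T \<longleftrightarrow>
     (\<forall>t\<ge>0. \<forall>f\<in>C0 J. T t f \<in> C0 J) \<and>
     (\<forall>t\<ge>0. \<forall>f\<in>C0 J. \<forall>g\<in>C0 J. \<forall>\<alpha> \<beta>. \<forall>x\<in>J.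
        T t (\<lambda>y. \<alpha> * f y + \<beta> * g y) x = \<alpha> * T t f x + \<beta> * T t g x) \<and>
     (\<forall>t\<ge>0. \<exists>B. \<forall>f\<in>C0 J. sup_norm J (T t f) \<le> B * sup_norm J f) \<and>
     (\<forall>f\<in>C0 J. \<forall>x\<in>J. T 0 f x = f x) \<and>
     (\<forall>s\<ge>0. \<forall>t\<ge>0. \<forall>f\<in>C0 J. \<forall>x\<in>J. T (s + t) f x = T s (T t f) x) \<and>
     (\<forall>f\<in>C0 J. ((\<lambda>t. sup_norm J (\<lambda>x. T t f x - f x)) \<longlongrightarrow> 0) (at_right 0))"

definition transition_semigroup ::
    "(real \<Rightarrow> 'w measure) \<Rightarrow> (real \<Rightarrow> 'w \<Rightarrow> real) \<Rightarrow> real \<Rightarrow> (real \<Rightarrow> real) \<Rightarrow> real \<Rightarrow> real" where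
  "transition_semigroup P X t f x = (\<integral>\<omega>. f (X t \<omega>) \<partial>P x)"

definition FD_process ::
    "real set \<Rightarrow> (real \<Rightarrow> 'w measure) \<Rightarrow> (real \<Rightarrow> 'w \<Rightarrow> real) \<Rightarrow> bool" where
  "FD_process J P X \<longleftrightarrow> strongly_continuous_semigroup_C0 J (transition_semigroup P X)"

definition martingale ::
    "'w measure \<Rightarrow> (real \<Rightarrow> 'w measure) \<Rightarrow> (real \<Rightarrow> 'w \<Rightarrow> real) \<Rightarrow> bool" where
  "martingale Q F X \<longleftrightarrow>
     (\<forall>t\<ge>0. X t \<in> borel_measurable (F t) \<and> integrable Q (X t)) \<and>
     (\<forall>s\<ge>0. \<forall>t\<ge>s. AE \<omega> in Q. real_cond_exp Q (F s) (X t) \<omega> = X s \<omega>)"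

end

theory Submission
  imports Defs
begin

text \<open>Write \<open>\<phi>(x, y)\<close> for the Laplace transform at \<open>1\<close> of the hitting time of \<open>y\<close> under \<open>P x\<close>.  Both the
  Feller-Dynkin and the martingale property are equivalent to \<open>\<phi>(x, y) \<rightarrow> 0\<close> as \<open>x\<close> tends to an end
  point outside of \<open>J\<close>, that is, to the absence of entrance boundaries.  Only infinite end points matter, as
  for a finite one the scale function gives the limit.

  The Feller-Dynkin property fails at an entrance boundary because a compactly supported function would
  be seen from infinity; conversely, path continuity and the strong Markov property give uniform estimates
  from finitely many passage times.  The martingale property at the end point \<open>\<infinity>\<close> means that
  \<open>b \<cdot> \<phi>(y, b) \<rightarrow> 0\<close> as \<open>b \<rightarrow> \<infinity>\<close>.  The two limits are related through the levels
  \<open>u k = y - 1 + 2 ^ k\<close>: by the strong Markov property \<open>\<phi>(u k, y)\<close> and \<open>1 / \<phi>(y, u k)\<close> solve the same linear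
  recursion, a perturbation of the one with the solutions \<open>1\<close> and \<open>2 ^ k\<close>.

  A boundary point \<open>r\<close> in \<open>J\<close> is a trap: otherwise the expected time to reach an interior point \<open>a\<close>
  from \<open>r\<close> is finite by a geometric tail estimate, the Green function bounds \<open>\<integral> \<bar>y - a\<bar> m(dy)\<close> by this
  time, hence \<open>r\<close> is regular, hence absorbing, and then the time is infinite by the occupation formula.\<close>

section \<open>Hitting times and the strong Markov property\<close>

text \<open>On natural scale the process stopped on leaving a compact interval in \<open>J\<close>
  is a bounded martingale; the question is what is lost when the interval grows to \<open>J\<close>.
  The loss at a high level \<open>b\<close> is about \<open>b\<close> times the probability of
  reaching \<open>b\<close> by time \<open>t\<close>, hence the weight \<open>b\<close> in the
  martingale criterion, whereas the Feller-Dynkin property concerns passage in the opposite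
  direction. Discounting makes the two comparable: for hitting probabilities at fixed times the
  strong Markov property yields convolutions, for \<open>phi\<close> it yields the product rule
  \<open>phi_mult\<close> and the linear identity \<open>phi_exit\<close>, without a generator or a
  differential equation. Discounting acts as killing; the killed mass \<open>1 - p k - q k\<close>,
  summed over the levels, is a discrete counterpart of the classical entrance test \<integral> y
  m(dy) < \<infinity>. The distances of the levels from \<open>y - 1\<close> double, which makes the
  exit probabilities without killing independent of \<open>k\<close>. Once the traps are identified,
  arguments at an end point are carried out on the right and transferred to the left by
  reflection.\<close>

lemma closure_unit_rationals: "closure ({0..1} \<inter> \<rat>) = {0..1::real}"
proof
  show "closure ({0..1} \<inter> \<rat>) \<subseteq> {0..1::real}"
    by (rule closure_minimal) auto
  have "{0<..<1::real} \<subseteq> closure ({0..1} \<inter> \<rat>)"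
  proof
    fix x :: real assume x: "x \<in> {0<..<1}"
    show "x \<in> closure ({0..1} \<inter> \<rat>)"
      unfolding closure_approachable
    proof (intro allI impI)
      fix e :: real assume "0 < e"
      then have "x < min 1 (x + e)" using x by auto
      then obtain q where q: "q \<in> \<rat>" "x < q" "q < min 1 (x + e)"
        using Rats_dense_in_real by blast
      then show "\<exists>y\<in>{0..1} \<inter> \<rat>. dist y x < e"
        using x by (intro bexI[of _ q]) (auto simp: dist_real_def)
    qed
  qed
  then have "closure {0<..<1::real} \<subseteq> closure ({0..1} \<inter> \<rat>)"
    by (rule closure_minimal) simp
  then show "{0..1::real} \<subseteq> closure ({0..1} \<inter> \<rat>)"
    by simp
qed

text \<open>With this weight, \<open>phi\<close> below is the Laplace transform of a hitting time at the argument \<open>1\<close>.\<close>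

definition ed :: "ennreal \<Rightarrow> ennreal" where
  "ed \<tau> = (if \<tau> = \<top> then 0 else ennreal (exp (- enn2real \<tau>)))"

lemma ed_top [simp]: "ed \<top> = 0"
  and ed_ennreal: "0 \<le> t \<Longrightarrow> ed (ennreal t) = ennreal (exp (- t))"
  and ed_le_1: "ed \<tau> \<le> 1"
  by (auto simp: ed_def)

lemma ed_measurable [measurable]: "ed \<in> borel_measurable borel"
  unfolding ed_def by measurable

lemma ed_add: "0 \<le> t \<Longrightarrow> ed (ennreal t + \<tau>) = ennreal (exp (- t)) * ed \<tau>"
  by (cases \<tau>) (auto simp: ed_def exp_add[symmetric] ennreal_mult'[symmetric] enn2real_plus simp flip: exp_minus exp_diff)

lemma ed_antimono: "\<sigma> \<le> \<tau> \<Longrightarrow> ed \<tau> \<le> ed \<sigma>"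
  by (cases \<sigma>; cases \<tau>) (auto simp: ed_def top_unique)

context diffusion
begin

abbreviation "hit \<equiv> hitting_time X"
abbreviation "hit_by u t \<equiv> {\<omega>\<in>space A. hit u \<omega> \<le> ennreal t}"
abbreviation "hit_before b a \<equiv> {\<omega>\<in>space A. hit b \<omega> < hit a \<omega>}"

lemma space_P [simp]: "x \<in> J \<Longrightarrow> space (P x) = space A"
  using sets_P sets_eq_imp_space_eq by blast

lemma space_F: "0 \<le> t \<Longrightarrow> space (F t) = space A"
  and sets_F: "0 \<le> t \<Longrightarrow> sets (F t) \<subseteq> sets A"
  using subalgebra_F[of t] by (auto simp: subalgebra_def)

lemma X_in_J: "0 \<le> t \<Longrightarrow> \<omega> \<in> space A \<Longrightarrow> X t \<omega> \<in> J"
  using measurable_space[OF adapted[of t], of \<omega>] space_F[of t] by (auto simp: space_restrict_space)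

lemma X_meas_F: "0 \<le> t \<Longrightarrow> X t \<in> borel_measurable (F t)"
  using adapted[of t] by (auto simp: measurable_restrict_space2_iff)

lemma X_meas_F_le: "0 \<le> s \<Longrightarrow> s \<le> t \<Longrightarrow> X s \<in> borel_measurable (F t)"
  using X_meas_F[of s] F_mono[of s t] space_F[of s] space_F[of t]
  by (auto simp: measurable_def)

lemma X_meas [measurable]: "0 \<le> t \<Longrightarrow> X t \<in> borel_measurable A"
  using X_meas_F[of t] sets_F[of t] space_F[of t] by (auto simp: measurable_def)

lemma space_path [simp]: "space (path_sigma A X) = space A"
  unfolding path_sigma_def by (rule space_measure_of) auto

lemma sets_path: "sets (path_sigma A X)
    = sigma_sets (space A) {X t -` B \<inter> space A | t B. 0 \<le> t \<and> B \<in> sets borel}"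
  unfolding path_sigma_def by (rule sets_measure_of) auto

lemma X_meas_path [measurable]: "0 \<le> t \<Longrightarrow> X t \<in> borel_measurable (path_sigma A X)"
  unfolding measurable_def by (auto simp: sets_path intro!: sigma_sets.Basic)

lemma path_sub: "sets (path_sigma A X) \<subseteq> sets A"
  unfolding sets_path
  by (rule sets.sigma_sets_subset) (auto intro!: measurable_sets[OF X_meas])

lemma path_meas: "f \<in> measurable (path_sigma A X) N \<Longrightarrow> f \<in> measurable A N"
  using path_sub by (auto simp: measurable_def)

lemma P_meas: "x \<in> J \<Longrightarrow> f \<in> measurable A N \<Longrightarrow> f \<in> measurable (P x) N"
  using sets_P[of x] measurable_cong_sets by blast

text \<open>The discretization of \<open>T\<close> by multiples of \<open>1 / (n + 1)\<close> takes
  countably many values and converges to \<open>T\<close>; path continuity carries measurability to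
  the limit.\<close>

lemma X_at_random_time:
  assumes T [measurable]: "T \<in> borel_measurable A" and T0: "\<And>\<omega>. 0 \<le> T \<omega>"
  shows "(\<lambda>\<omega>. X (T \<omega>) \<omega>) \<in> borel_measurable A"
proof -
  define U :: "nat \<Rightarrow> 'w \<Rightarrow> nat" where "U n \<omega> = nat \<lfloor>real (Suc n) * T \<omega>\<rfloor>" for n \<omega>
  have U [measurable]: "U n \<in> measurable A (count_space UNIV)" for n
    unfolding U_def by measurable
  show ?thesis
  proof (rule borel_measurable_LIMSEQ_real)
    show "(\<lambda>\<omega>. X (real (U n \<omega>) / real (Suc n)) \<omega>) \<in> borel_measurable A" for n
      by (rule measurable_compose_countable[OF _ U]) auto
    fix \<omega> assume w: "\<omega> \<in> space A"
    have U: "real (U n \<omega>) / real (Suc n) \<le> T \<omega>" "T \<omega> - 1 / real (Suc n) \<le> real (U n \<omega>) / real (Suc n)" for n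
    proof -
      have e: "real (U n \<omega>) = of_int \<lfloor>real (Suc n) * T \<omega>\<rfloor>"
        unfolding U_def using T0[of \<omega>] by (intro of_nat_nat) simp
      show "real (U n \<omega>) / real (Suc n) \<le> T \<omega>"
        unfolding e by (subst pos_divide_le_eq) (auto simp: mult.commute, (metis of_int_floor_le of_nat_Suc mult.commute)?)
      have "real (Suc n) * T \<omega> - 1 \<le> real (U n \<omega>)" unfolding e by linarith
      then show "T \<omega> - 1 / real (Suc n) \<le> real (U n \<omega>) / real (Suc n)"
        by (subst pos_le_divide_eq) (simp_all add: algebra_simps)
    qed
    have lim: "(\<lambda>n. real (U n \<omega>) / real (Suc n)) \<longlonglongrightarrow> T \<omega>"
    proof (rule tendsto_sandwich[OF _ _ _ tendsto_const])
      have "(\<lambda>n. T \<omega> - 1 / real (Suc n)) \<longlonglongrightarrow> T \<omega> - 0"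
        by (intro tendsto_diff tendsto_const LIMSEQ_Suc[OF lim_1_over_n])
      then show "(\<lambda>n. T \<omega> - 1 / real (Suc n)) \<longlonglongrightarrow> T \<omega>" by simp
    qed (use U in auto)
    show "(\<lambda>n. X (real (U n \<omega>) / real (Suc n)) \<omega>) \<longlonglongrightarrow> X (T \<omega>) \<omega>"
      by (rule continuous_on_tendsto_compose[OF continuous_paths[OF w] lim]) (use T0 in auto)
  qed
qed

text \<open>The shift is only known through the coordinates of \<open>X\<close>, so the target
  carries \<open>path_sigma A X\<close> and not \<open>A\<close>. Functionals of the future are
  therefore always required to be path measurable.\<close>

lemma theta_meas:
  assumes [measurable]: "T \<in> borel_measurable A" and T0: "\<And>\<omega>. 0 \<le> T \<omega>"
  shows "(\<lambda>\<omega>. \<theta> (T \<omega>) \<omega>) \<in> measurable A (path_sigma A X)"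
  unfolding path_sigma_def
proof (rule measurable_measure_of)
  show "(\<lambda>\<omega>. \<theta> (T \<omega>) \<omega>) \<in> space A \<rightarrow> space A"
    using T0 shift_closed by auto
  fix y assume "y \<in> {X t -` B \<inter> space A |t B. 0 \<le> t \<and> B \<in> sets borel}"
  then obtain t B where y: "y = X t -` B \<inter> space A" "0 \<le> t" and [measurable]: "B \<in> sets borel" by auto
  have "(\<lambda>\<omega>. \<theta> (T \<omega>) \<omega>) -` y \<inter> space A = (\<lambda>\<omega>. X (t + T \<omega>) \<omega>) -` B \<inter> space A"
    using y T0 shift shift_closed by auto
  moreover have "(\<lambda>\<omega>. X (t + T \<omega>) \<omega>) \<in> borel_measurable A"
    by (rule X_at_random_time) (use y T0 in auto)
  ultimately show "(\<lambda>\<omega>. \<theta> (T \<omega>) \<omega>) -` y \<inter> space A \<in> sets A"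
    by (auto intro: measurable_sets)
qed auto

lemma ext_stopping_meas:
  assumes "ext_stopping_time A F \<tau>" shows "\<tau> \<in> borel_measurable A"
proof (rule borel_measurableI_le)
  fix y :: ennreal
  show "{\<omega> \<in> space A. \<tau> \<omega> \<le> y} \<in> sets A"
  proof (cases y)
    case (real r)
    then show ?thesis using assms sets_F[of r] by (auto simp: ext_stopping_time_def)
  qed auto
qed

lemma stopped_sigma_sub: "subalgebra A (stopped_sigma A F \<tau>)"
  unfolding subalgebra_def stopped_sigma_def
  by (auto simp: space_measure_of_conv sets_measure_of_conv intro!: sets.sigma_sets_subset split: if_splits)

lemma stopped_sigmaI:
  assumes "L \<in> sets A" "\<And>t. 0 \<le> t \<Longrightarrow> L \<inter> {\<omega>\<in>space A. \<tau> \<omega> \<le> ennreal t} \<in> sets (F t)"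
  shows "L \<in> sets (stopped_sigma A F \<tau>)"
  unfolding stopped_sigma_def
  using assms by (subst sets_measure_of) (auto dest: sets.sets_into_space)

lemma space_stopped [simp]: "space (stopped_sigma A F \<tau>) = space A"
  using stopped_sigma_sub[of \<tau>] by (simp add: subalgebra_def)

lemma stopping_time_stopped_meas:
  assumes st: "ext_stopping_time A F \<tau>"
  shows "\<tau> \<in> borel_measurable (stopped_sigma A F \<tau>)"
proof (rule borel_measurableI_le, simp)
  fix y :: ennreal
  show "{\<omega> \<in> space A. \<tau> \<omega> \<le> y} \<in> sets (stopped_sigma A F \<tau>)"
  proof (rule stopped_sigmaI)
    show "{\<omega> \<in> space A. \<tau> \<omega> \<le> y} \<in> sets A"
      using ext_stopping_meas[OF st] by measurable
    fix t :: real assume t: "0 \<le> t"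
    show "{\<omega> \<in> space A. \<tau> \<omega> \<le> y} \<inter> {\<omega> \<in> space A. \<tau> \<omega> \<le> ennreal t} \<in> sets (F t)"
    proof (cases "ennreal t \<le> y")
      case True
      then have "{\<omega> \<in> space A. \<tau> \<omega> \<le> y} \<inter> {\<omega> \<in> space A. \<tau> \<omega> \<le> ennreal t} = {\<omega> \<in> space A. \<tau> \<omega> \<le> ennreal t}"
        by auto
      then show ?thesis using st t by (simp add: ext_stopping_time_def)
    next
      case False
      then obtain r where r: "y = ennreal r" "0 \<le> r" "r \<le> t"
        by (cases y) (auto simp: ennreal_leI leI)
      have "{\<omega> \<in> space A. \<tau> \<omega> \<le> y} \<inter> {\<omega> \<in> space A. \<tau> \<omega> \<le> ennreal t} = {\<omega> \<in> space A. \<tau> \<omega> \<le> ennreal r}"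
        using r order_trans[OF _ ennreal_leI[of r t]] by auto
      moreover have "\<dots> \<in> sets (F r)" using st r by (simp add: ext_stopping_time_def)
      ultimately show ?thesis using F_mono[of r t] r by auto
    qed
  qed
qed

text \<open>The conditional expectation in the strong Markov property is integrated against a test
  function \<open>f\<close> of the past. Later arguments work with this form and need no almost sure
  versions.\<close>

lemma strong_Markov_integral:
  assumes x: "x \<in> J" and st: "ext_stopping_time A F \<tau>"
    and Z: "Z \<in> borel_measurable (path_sigma A X)"
    and f: "f \<in> borel_measurable (stopped_sigma A F \<tau>)"
  shows "(\<integral>\<^sup>+\<omega>. f \<omega> * (Z (\<theta> (enn2real (\<tau> \<omega>)) \<omega>) * indicator {\<omega>. \<tau> \<omega> < \<infinity>} \<omega>) \<partial>P x)
       = (\<integral>\<^sup>+\<omega>. f \<omega> * ((\<integral>\<^sup>+\<omega>'. Z \<omega>' \<partial>P (X (enn2real (\<tau> \<omega>)) \<omega>)) * indicator {\<omega>. \<tau> \<omega> < \<infinity>} \<omega>) \<partial>P x)"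
proof -
  interpret prob_space "P x" by (rule prob_P[OF x])
  have sub: "subalgebra (P x) (stopped_sigma A F \<tau>)"
    using stopped_sigma_sub[of \<tau>] sets_P[OF x] space_P[OF x] by (simp add: subalgebra_def)
  interpret finite_measure_subalgebra "P x" "stopped_sigma A F \<tau>"
    by unfold_locales (rule sub)
  have tm[measurable]: "\<tau> \<in> borel_measurable A" by (rule ext_stopping_meas[OF st])
  have "(\<lambda>\<omega>. Z (\<theta> (enn2real (\<tau> \<omega>)) \<omega>)) \<in> borel_measurable A"
    by (rule measurable_compose[OF theta_meas Z]) auto
  then have "(\<lambda>\<omega>. Z (\<theta> (enn2real (\<tau> \<omega>)) \<omega>) * indicator {\<omega>. \<tau> \<omega> < \<infinity>} \<omega>) \<in> borel_measurable A"
    by measurable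
  then have g: "(\<lambda>\<omega>. Z (\<theta> (enn2real (\<tau> \<omega>)) \<omega>) * indicator {\<omega>. \<tau> \<omega> < \<infinity>} \<omega>) \<in> borel_measurable (P x)"
    by (rule P_meas[OF x])
  show ?thesis
    unfolding nn_cond_exp_intg[OF f g, symmetric]
    by (rule nn_integral_cong_AE) (use strong_Markov[OF x st Z] in auto)
qed

subsection \<open>Hitting times\<close>

lemma hitting_attained:
  assumes w: "\<omega> \<in> space A" and fin: "hit u \<omega> < \<top>"
  shows "X (enn2real (hit u \<omega>)) \<omega> = u"
proof -
  define S where "S = {t. 0 \<le> t \<and> X t \<omega> = u}"
  have "S = {0..} \<inter> (\<lambda>t. X t \<omega>) -` {u}" by (auto simp: S_def)
  then have cl: "closed S"
    using continuous_closed_preimage[OF continuous_paths[OF w], of "{u}"] by simp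
  have ne: "S \<noteq> {}"
    using fin by (auto simp: hitting_time_def S_def[symmetric])
  have bd: "bdd_below S" by (auto simp: S_def bdd_below_def)
  have mem: "Inf S \<in> S" by (rule closed_contains_Inf[OF ne bd cl])
  have "hit u \<omega> = ennreal (Inf S)"
    unfolding hitting_time_def S_def[symmetric]
  proof (rule antisym)
    show "(INF t\<in>S. ennreal t) \<le> ennreal (Inf S)" by (rule INF_lower[OF mem])
    show "ennreal (Inf S) \<le> (INF t\<in>S. ennreal t)"
      by (rule INF_greatest) (auto intro!: ennreal_leI cInf_lower bd)
  qed
  then show ?thesis using mem by (simp add: S_def)
qed

lemma hitting_le: "0 \<le> s \<Longrightarrow> X s \<omega> = u \<Longrightarrow> hit u \<omega> \<le> ennreal s"
  unfolding hitting_time_def by (rule INF_lower) auto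

lemma hitting_le_iff:
  assumes w: "\<omega> \<in> space A" and t: "0 \<le> t"
  shows "hit u \<omega> \<le> ennreal t \<longleftrightarrow> (\<exists>s\<in>{0..t}. X s \<omega> = u)"
proof
  assume le: "hit u \<omega> \<le> ennreal t"
  then have fin: "hit u \<omega> < \<top>" using ennreal_less_top le_less_trans by blast
  have "enn2real (hit u \<omega>) \<le> t" using enn2real_leI[OF _ le] t by auto
  then show "\<exists>s\<in>{0..t}. X s \<omega> = u"
    using hitting_attained[OF w fin] by (intro bexI[of _ "enn2real (hit u \<omega>)"]) auto
next
  assume "\<exists>s\<in>{0..t}. X s \<omega> = u"
  then obtain s where "s \<in> {0..t}" "X s \<omega> = u" by auto
  then show "hit u \<omega> \<le> ennreal t"
    using order_trans[OF hitting_le[of s \<omega> u] ennreal_leI[of s t]] by auto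
qed

text \<open>By compactness, \<open>u\<close> is hit by time \<open>t\<close> iff the distance to
  \<open>u\<close> becomes arbitrarily small along a dense countable set of times. Writing the times
  as \<open>t * q\<close> keeps them in \<open>[0, t]\<close>. The sigma-algebra \<open>N\<close> is
  left open to serve both the filtration and \<open>path_sigma A X\<close>.\<close>

lemma hitting_le_sets:
  assumes t: "0 \<le> t" and sp: "space N = space A"
    and m: "\<And>s. 0 \<le> s \<Longrightarrow> s \<le> t \<Longrightarrow> X s \<in> borel_measurable N"
  shows "(hit_by u t) \<in> sets N"
proof -
  have eq: "(hit_by u t)
      = {\<omega>\<in>space N. \<forall>n::nat. \<exists>q\<in>{0..1} \<inter> \<rat>. \<bar>X (t * q) \<omega> - u\<bar> < 1 / real (Suc n)}"
    unfolding sp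
  proof (rule Collect_cong, rule conj_cong[OF refl])
    fix \<omega> assume w: "\<omega> \<in> space A"
    define g where "g q = \<bar>X (t * q) \<omega> - u\<bar>" for q
    have c: "continuous_on {0..1} g"
    proof -
      have "continuous_on {0..1} (\<lambda>q. X (t * q) \<omega>)"
        by (rule continuous_on_compose2[OF continuous_paths[OF w], of _ "\<lambda>q. t * q"])
          (auto intro!: continuous_intros simp: t)
      then show ?thesis unfolding g_def by (intro continuous_intros)
    qed
    have hit: "hit u \<omega> \<le> ennreal t \<longleftrightarrow> (\<exists>q\<in>{0..1}. g q = 0)"
    proof -
      have "(\<exists>s\<in>{0..t}. X s \<omega> = u) \<longleftrightarrow> (\<exists>q\<in>{0..1}. X (t * q) \<omega> = u)"
      proof
        assume "\<exists>s\<in>{0..t}. X s \<omega> = u"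
        then obtain s where s: "0 \<le> s" "s \<le> t" "X s \<omega> = u" by auto
        show "\<exists>q\<in>{0..1}. X (t * q) \<omega> = u"
        proof (cases "t = 0")
          case True then show ?thesis using s by (intro bexI[of _ 0]) auto
        next
          case False then show ?thesis using s t by (intro bexI[of _ "s / t"]) auto
        qed
      next
        assume "\<exists>q\<in>{0..1}. X (t * q) \<omega> = u"
        then obtain q where q: "0 \<le> q" "q \<le> 1" "X (t * q) \<omega> = u" by auto
        then show "\<exists>s\<in>{0..t}. X s \<omega> = u"
          using t by (intro bexI[of _ "t * q"]) (auto intro: mult_left_le)
      qed
      then show ?thesis using hitting_le_iff[OF w t] by (simp add: g_def)
    qed
    show "hit u \<omega> \<le> ennreal t
        \<longleftrightarrow> (\<forall>n::nat. \<exists>q\<in>{0..1} \<inter> \<rat>. \<bar>X (t * q) \<omega> - u\<bar> < 1 / real (Suc n))"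
      unfolding hit g_def[symmetric]
    proof
      assume "\<exists>q\<in>{0..1}. g q = 0"
      then obtain s where s: "s \<in> {0..1}" "g s = 0" by auto
      show "\<forall>n::nat. \<exists>q\<in>{0..1} \<inter> \<rat>. g q < 1 / real (Suc n)"
      proof (rule ccontr)
        assume "\<not> ?thesis"
        then obtain n :: nat where n: "\<And>q. q \<in> {0..1} \<inter> \<rat> \<Longrightarrow> 1 / real (Suc n) \<le> g q"
          using not_less by blast
        have "1 / real (Suc n) \<le> g s"
          by (rule continuous_ge_on_closure[of "{0..1} \<inter> \<rat>" g])
            (use c s n in \<open>auto simp: closure_unit_rationals\<close>)
        then show False using s by simp
      qed
    next
      assume a: "\<forall>n::nat. \<exists>q\<in>{0..1} \<inter> \<rat>. g q < 1 / real (Suc n)"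
      obtain s where s: "s \<in> {0..1}" "\<And>q. q \<in> {0..1} \<Longrightarrow> g s \<le> g q"
        using continuous_attains_inf[OF compact_Icc _ c] by auto
      have "g s = 0"
      proof (rule ccontr)
        assume "g s \<noteq> 0"
        then have "0 < g s" by (simp add: g_def)
        then obtain n :: nat where "1 / real (Suc n) < g s"
          using nat_approx_posE by blast
        then show False using a s by (meson Int_iff less_trans not_le)
      qed
      then show "\<exists>q\<in>{0..1}. g q = 0" using s by auto
    qed
  qed
  have cnt: "countable ({0..1::real} \<inter> \<rat>)" by (intro countable_Int2 countable_rat)
  have [measurable]: "X (t * q) \<in> borel_measurable N" if "q \<in> {0..1} \<inter> \<rat>" for q
    by (rule m) (use that t in \<open>auto intro: mult_left_le\<close>)
  show ?thesis
    unfolding eq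
    by (intro sets.sets_Collect_countable_All sets.sets_Collect_countable_Ex'[OF _ cnt]) measurable
qed

lemma hitting_meas_path [measurable]: "hit u \<in> borel_measurable (path_sigma A X)"
proof (rule borel_measurableI_le)
  fix y :: ennreal
  show "{\<omega> \<in> space (path_sigma A X). hit u \<omega> \<le> y} \<in> sets (path_sigma A X)"
  proof (cases y)
    case (real r)
    then show ?thesis using hitting_le_sets[of r "path_sigma A X" u] by auto
  qed (auto simp: top_greatest intro: sets.top[of "path_sigma A X", simplified])
qed

lemma hitting_meas [measurable]: "hit u \<in> borel_measurable A"
  by (rule path_meas) measurable

lemma hitting_stopping: "ext_stopping_time A F (hit u)"
  unfolding ext_stopping_time_def
  using hitting_le_sets[OF _ space_F X_meas_F_le] by blast

lemma stopping_min:
  assumes "ext_stopping_time A F \<sigma>" "ext_stopping_time A F \<tau>"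
  shows "ext_stopping_time A F (\<lambda>\<omega>. min (\<sigma> \<omega>) (\<tau> \<omega>))"
proof -
  have "{\<omega> \<in> space A. min (\<sigma> \<omega>) (\<tau> \<omega>) \<le> ennreal t}
      = {\<omega> \<in> space A. \<sigma> \<omega> \<le> ennreal t} \<union> {\<omega> \<in> space A. \<tau> \<omega> \<le> ennreal t}" for t
    by (auto simp: min_le_iff_disj)
  then show ?thesis
    using assms unfolding ext_stopping_time_def by (metis (no_types, lifting) sets.Un)
qed

lemma stopping_const: "0 \<le> t \<Longrightarrow> ext_stopping_time A F (\<lambda>\<omega>. ennreal t)"
proof -
  assume "0 \<le> t"
  have "{\<omega> \<in> space A. ennreal t \<le> ennreal s} = (if t \<le> s then space A else {})" if "0 \<le> s" for s
    using that \<open>0 \<le> t\<close> by auto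
  then show ?thesis
    unfolding ext_stopping_time_def using space_F by (auto intro: sets.top) (metis sets.top space_F)
qed

lemma stopped_const_meas:
  assumes t: "0 \<le> t" and L: "L \<in> sets (F t)"
  shows "L \<in> sets (stopped_sigma A F (\<lambda>\<omega>. ennreal t))"
proof (rule stopped_sigmaI)
  show "L \<in> sets A" using sets_F[OF t] L by auto
  then have Ls: "L \<subseteq> space A" by (rule sets.sets_into_space)
  fix s :: real assume s: "0 \<le> s"
  have "L \<inter> {\<omega> \<in> space A. ennreal t \<le> ennreal s} = (if t \<le> s then L else {})"
    using Ls s t by auto
  then show "L \<inter> {\<omega> \<in> space A. ennreal t \<le> ennreal s} \<in> sets (F s)"
    using F_mono[OF t, of s] L by auto
qed

lemma less_stopped:
  assumes s: "ext_stopping_time A F \<sigma>" and t: "ext_stopping_time A F \<tau>"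
  shows "{\<omega>\<in>space A. \<sigma> \<omega> < \<tau> \<omega>} \<in> sets (stopped_sigma A F \<sigma>)"
proof (rule stopped_sigmaI)
  have [measurable]: "\<sigma> \<in> borel_measurable A" "\<tau> \<in> borel_measurable A"
    using s t by (auto intro: ext_stopping_meas)
  show "{\<omega>\<in>space A. \<sigma> \<omega> < \<tau> \<omega>} \<in> sets A" by measurable
  fix u :: real assume u: "0 \<le> u"
  \<comment> \<open>A rational separates the two times if both are at most \<open>u\<close>; the
    point \<open>u\<close> itself separates them if only \<sigma> is.\<close>
  define Q where "Q = insert u ({0..u} \<inter> \<rat>)"
  have cnt: "countable Q" unfolding Q_def by (intro countable_insert countable_Int2 countable_rat)
  have Q: "q \<in> Q \<Longrightarrow> 0 \<le> q \<and> q \<le> u" for q using u by (auto simp: Q_def)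
  have "{\<omega>\<in>space A. \<sigma> \<omega> < \<tau> \<omega>} \<inter> {\<omega> \<in> space A. \<sigma> \<omega> \<le> ennreal u}
      = (\<Union>q\<in>Q. {\<omega> \<in> space A. \<sigma> \<omega> \<le> ennreal q} - {\<omega> \<in> space A. \<tau> \<omega> \<le> ennreal q})"
  proof (intro equalityI subsetI)
    fix \<omega> assume w: "\<omega> \<in> {\<omega>\<in>space A. \<sigma> \<omega> < \<tau> \<omega>} \<inter> {\<omega> \<in> space A. \<sigma> \<omega> \<le> ennreal u}"
    show "\<omega> \<in> (\<Union>q\<in>Q. {\<omega> \<in> space A. \<sigma> \<omega> \<le> ennreal q} - {\<omega> \<in> space A. \<tau> \<omega> \<le> ennreal q})"
    proof (cases "\<tau> \<omega> \<le> ennreal u")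
      case False
      then show ?thesis using w by (auto simp: Q_def)
    next
      case True
      then obtain b where b: "\<tau> \<omega> = ennreal b" "0 \<le> b" "b \<le> u"
        using u by (cases "\<tau> \<omega>") (auto simp: top_unique)
      obtain a where a: "\<sigma> \<omega> = ennreal a" "0 \<le> a" "a \<le> u"
        using w u by (cases "\<sigma> \<omega>") (auto simp: top_unique)
      have "a < b" using w a b by (simp add: ennreal_less_iff)
      then obtain q where q: "q \<in> \<rat>" "a < q" "q < b" using Rats_dense_in_real by blast
      then have "q \<in> Q" using a b by (auto simp: Q_def)
      moreover have "\<omega> \<in> {\<omega> \<in> space A. \<sigma> \<omega> \<le> ennreal q} - {\<omega> \<in> space A. \<tau> \<omega> \<le> ennreal q}"
        using w a b q by auto
      ultimately show ?thesis by blast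
    qed
  next
    fix \<omega> assume "\<omega> \<in> (\<Union>q\<in>Q. {\<omega> \<in> space A. \<sigma> \<omega> \<le> ennreal q} - {\<omega> \<in> space A. \<tau> \<omega> \<le> ennreal q})"
    then obtain q where q: "q \<in> Q" "\<omega> \<in> space A" "\<sigma> \<omega> \<le> ennreal q" "ennreal q < \<tau> \<omega>"
      by (auto simp: not_le)
    then show "\<omega> \<in> {\<omega>\<in>space A. \<sigma> \<omega> < \<tau> \<omega>} \<inter> {\<omega> \<in> space A. \<sigma> \<omega> \<le> ennreal u}"
      using Q[of q] order_trans[OF _ ennreal_leI[of q u], of "\<sigma> \<omega>"] by (auto intro: le_less_trans)
  qed
  moreover have "{\<omega> \<in> space A. \<sigma> \<omega> \<le> ennreal q} - {\<omega> \<in> space A. \<tau> \<omega> \<le> ennreal q} \<in> sets (F u)" if "q \<in> Q" for q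
    using s t Q[OF that] F_mono[of q u] unfolding ext_stopping_time_def by blast
  ultimately show "{\<omega>\<in>space A. \<sigma> \<omega> < \<tau> \<omega>} \<inter> {\<omega> \<in> space A. \<sigma> \<omega> \<le> ennreal u} \<in> sets (F u)"
    using cnt by (auto intro!: sets.countable_UN')
qed

lemma hitting_shift_le:
  assumes w: "\<omega> \<in> space A" and t: "0 \<le> t"
  shows "hit u \<omega> \<le> ennreal t + hit u (\<theta> t \<omega>)"
proof (cases "hit u (\<theta> t \<omega>)")
  case (real s)
  then have "X s (\<theta> t \<omega>) = u"
    using hitting_attained[OF shift_closed[OF t w], of u] by auto
  then have "X (s + t) \<omega> = u" using shift[OF _ t w, of s] real by simp
  then show ?thesis
    using hitting_le[of "s + t" \<omega> u] real t by (simp add: add.commute)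
qed auto

lemma hitting_shift:
  assumes w: "\<omega> \<in> space A" and t: "0 \<le> t" and le: "ennreal t \<le> hit u \<omega>"
  shows "hit u \<omega> = ennreal t + hit u (\<theta> t \<omega>)"
proof (rule antisym[OF hitting_shift_le[OF w t]])
  show "ennreal t + hit u (\<theta> t \<omega>) \<le> hit u \<omega>"
  proof (cases "hit u \<omega>")
    case (real s)
    then have s: "t \<le> s" using le by auto
    have "X s \<omega> = u" using hitting_attained[OF w, of u] real by auto
    then have "X (s - t) (\<theta> t \<omega>) = u" using shift[OF _ t w, of "s - t"] s by simp
    then have "hit u (\<theta> t \<omega>) \<le> ennreal (s - t)" using s by (intro hitting_le) auto
    then have "ennreal t + hit u (\<theta> t \<omega>) \<le> ennreal t + ennreal (s - t)"
      by (rule add_left_mono)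
    also have "\<dots> = ennreal s" using s t by (simp flip: ennreal_plus)
    finally show ?thesis using real by simp
  qed auto
qed

text \<open>The intermediate value theorem. All later statements that a point must be passed on the
  way to another one go back to this.\<close>

lemma hitting_between:
  assumes w: "\<omega> \<in> space A" and y: "y \<in> closed_segment (X 0 \<omega>) z"
  shows "hit y \<omega> \<le> hit z \<omega>"
proof (cases "hit z \<omega>")
  case (real s)
  have z: "X s \<omega> = z" using hitting_attained[OF w, of z] real by auto
  have c: "continuous_on {0..s} (\<lambda>t. X t \<omega>)"
    by (rule continuous_on_subset[OF continuous_paths[OF w]]) auto
  have "\<exists>r\<ge>0. r \<le> s \<and> X r \<omega> = y"
  proof (cases "X 0 \<omega> \<le> z")
    case True
    then have "X 0 \<omega> \<le> y" "y \<le> X s \<omega>" using y z by (auto simp: closed_segment_eq_real_ivl)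
    from IVT'[OF this _ c] real show ?thesis by auto
  next
    case False
    then have "X s \<omega> \<le> y" "y \<le> X 0 \<omega>" using y z by (auto simp: closed_segment_eq_real_ivl split: if_splits)
    from IVT2'[OF this _ c] real show ?thesis by auto
  qed
  then obtain r where r: "0 \<le> r" "r \<le> s" "X r \<omega> = y" by auto
  then show ?thesis using order_trans[OF hitting_le[of r \<omega> y] ennreal_leI[of r s]] real by auto
qed auto

text \<open>A path cannot be at two points at the same time, so ties between hitting times occur
  only at infinity.\<close>

lemma hitting_eq_imp_top:
  assumes w: "\<omega> \<in> space A" and ab: "a \<noteq> b" and eq: "hit a \<omega> = hit b \<omega>"
  shows "hit a \<omega> = \<top>"
proof (rule ccontr)
  assume "hit a \<omega> \<noteq> \<top>"
  then show False
    using hitting_attained[OF w, of a] hitting_attained[OF w, of b] eq ab by (simp add: top.not_eq_extremum)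
qed

lemma nn_const: "x \<in> J \<Longrightarrow> (\<integral>\<^sup>+\<omega>. c \<partial>P x) = c"
  using prob_space.emeasure_space_1[OF prob_P] by simp

text \<open>At its hitting time the process sits at \<open>y\<close>, so the expectation after the
  restart is a constant and past and future factorize.\<close>

lemma strong_Markov_hitting:
  assumes x: "x \<in> J" 
    and Z: "Z \<in> borel_measurable (path_sigma A X)"
    and f: "f \<in> borel_measurable (stopped_sigma A F (hit y))"
  shows "(\<integral>\<^sup>+\<omega>. f \<omega> * (Z (\<theta> (enn2real (hit y \<omega>)) \<omega>) * indicator {\<omega>. hit y \<omega> < \<infinity>} \<omega>) \<partial>P x)
       = (\<integral>\<^sup>+\<omega>. f \<omega> * indicator {\<omega>. hit y \<omega> < \<infinity>} \<omega> \<partial>P x) * (\<integral>\<^sup>+\<omega>. Z \<omega> \<partial>P y)"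
proof -
  have fm: "f \<in> borel_measurable A"
    using f stopped_sigma_sub by (meson measurable_from_subalg)
  have "(\<integral>\<^sup>+\<omega>. f \<omega> * (Z (\<theta> (enn2real (hit y \<omega>)) \<omega>) * indicator {\<omega>. hit y \<omega> < \<infinity>} \<omega>) \<partial>P x)
     = (\<integral>\<^sup>+\<omega>. (f \<omega> * indicator {\<omega>. hit y \<omega> < \<infinity>} \<omega>) * (\<integral>\<^sup>+\<omega>. Z \<omega> \<partial>P y) \<partial>P x)"
    unfolding strong_Markov_integral[OF x hitting_stopping Z f]
    by (rule nn_integral_cong) (auto simp: x hitting_attained mult_ac split: split_indicator)
  also have "\<dots> = (\<integral>\<^sup>+\<omega>. f \<omega> * indicator {\<omega>. hit y \<omega> < \<infinity>} \<omega> \<partial>P x) * (\<integral>\<^sup>+\<omega>. Z \<omega> \<partial>P y)"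
  proof (rule nn_integral_multc)
    have "(\<lambda>\<omega>. f \<omega> * indicator {\<omega>. hit y \<omega> < \<infinity>} \<omega>) \<in> borel_measurable A"
      using fm by measurable
    then show "(\<lambda>\<omega>. f \<omega> * indicator {\<omega>. hit y \<omega> < \<infinity>} \<omega>) \<in> borel_measurable (P x)"
      by (rule P_meas[OF x])
  qed
  finally show ?thesis .
qed

lemma Markov_integral:
  assumes x: "x \<in> J" and t: "0 \<le> t"
    and Z: "Z \<in> borel_measurable (path_sigma A X)"
    and f: "f \<in> borel_measurable (F t)"
  shows "(\<integral>\<^sup>+\<omega>. f \<omega> * Z (\<theta> t \<omega>) \<partial>P x) = (\<integral>\<^sup>+\<omega>. f \<omega> * (\<integral>\<^sup>+\<omega>'. Z \<omega>' \<partial>P (X t \<omega>)) \<partial>P x)"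
proof -
  have "f \<in> borel_measurable (stopped_sigma A F (\<lambda>\<omega>. ennreal t))"
  proof (rule measurableI)
    fix B :: "ennreal set" assume "B \<in> sets borel"
    then have "f -` B \<inter> space A \<in> sets (F t)"
      using measurable_sets[OF f] space_F[OF t] by metis
    then show "f -` B \<inter> space (stopped_sigma A F (\<lambda>\<omega>. ennreal t)) \<in> sets (stopped_sigma A F (\<lambda>\<omega>. ennreal t))"
      unfolding space_stopped by (rule stopped_const_meas[OF t])
  qed simp
  from strong_Markov_integral[OF x stopping_const[OF t] Z this] t show ?thesis by simp
qed

end

section \<open>Laplace transforms of hitting times\<close>

context diffusion
begin

definition phi :: "real \<Rightarrow> real \<Rightarrow> ennreal" where
  "phi x y = (\<integral>\<^sup>+\<omega>. ed (hit y \<omega>) \<partial>P x)"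

text \<open>With an exponential killing time of rate one, this is the probability that the process
  started at \<open>x\<close> reaches \<open>b\<close> before \<open>a\<close> and before it is
  killed.\<close>

definition exit_ed :: "real \<Rightarrow> real \<Rightarrow> real \<Rightarrow> ennreal" where
  "exit_ed x b a = (\<integral>\<^sup>+\<omega>. ed (hit b \<omega>) *
     indicator {\<omega>. hit b \<omega> < hit a \<omega>} \<omega> \<partial>P x)"

lemma hit_P [measurable]: "x \<in> J \<Longrightarrow> hit u \<in> borel_measurable (P x)"
  by (rule P_meas) measurable

lemma sets_P_iff: "x \<in> J \<Longrightarrow> S \<in> sets (P x) \<longleftrightarrow> S \<in> sets A"
  using sets_P by simp

lemma AE_start: "x \<in> J \<Longrightarrow> AE \<omega> in P x. \<omega> \<in> space A \<and> X 0 \<omega> = x"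
  using start[of x] AE_space[of "P x"] by simp

lemma hitting_shift_hitting:
  assumes w: "\<omega> \<in> space A" and le: "hit y \<omega> \<le> hit z \<omega>"
    and fin: "hit y \<omega> < \<top>"
  shows "hit z \<omega> = hit y \<omega> + hit z (\<theta> (enn2real (hit y \<omega>)) \<omega>)"
proof -
  have e: "ennreal (enn2real (hit y \<omega>)) = hit y \<omega>"
    using fin by simp
  show ?thesis
    using hitting_shift[OF w, of "enn2real (hit y \<omega>)" z] le unfolding e by simp
qed

lemma ed_shift_hitting:
  assumes w: "\<omega> \<in> space A" and le: "hit y \<omega> \<le> hit z \<omega>"
    and fin: "hit y \<omega> < \<top>"
  shows "ed (hit z \<omega>) = ed (hit y \<omega>) * ed (hit z (\<theta> (enn2real (hit y \<omega>)) \<omega>))"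
proof -
  have e: "ennreal (enn2real (hit y \<omega>)) = hit y \<omega>"
    using fin by simp
  show ?thesis
    using ed_add[of "enn2real (hit y \<omega>)" "hit z (\<theta> (enn2real (hit y \<omega>)) \<omega>)"]
      hitting_shift_hitting[OF w le fin] ed_ennreal[of "enn2real (hit y \<omega>)"]
    unfolding e by simp
qed

lemma ed_hitting_stopped [measurable]:
  "(\<lambda>\<omega>. ed (hit y \<omega>)) \<in> borel_measurable (stopped_sigma A F (hit y))"
  by (rule measurable_compose[OF stopping_time_stopped_meas[OF hitting_stopping] ed_measurable])

lemma less_hitting_stopped:
  "(\<lambda>\<omega>. indicator {\<omega>. hit y \<omega> < hit z \<omega>} \<omega> :: ennreal)
     \<in> borel_measurable (stopped_sigma A F (hit y))"
proof -
  have "(\<lambda>\<omega>. indicator (hit_before y z) \<omega> :: ennreal)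
      \<in> borel_measurable (stopped_sigma A F (hit y))"
    using less_stopped[OF hitting_stopping hitting_stopping] by measurable
  then show ?thesis
    by (rule measurable_cong[THEN iffD1, rotated]) (auto simp: indicator_def)
qed

text \<open>The path passes \<open>y\<close> on its way to \<open>z\<close>, the time from
  \<open>y\<close> to \<open>z\<close> is added after an independent restart, and the exponential
  turns the sum into a product.\<close>

lemma phi_mult:
  assumes x: "x \<in> J" and y: "y \<in> closed_segment x z"
  shows "phi x z = phi x y * phi y z"
proof -
  have "phi x z = (\<integral>\<^sup>+\<omega>. ed (hit y \<omega>) * (ed (hit z (\<theta> (enn2real (hit y \<omega>)) \<omega>)) *
      indicator {\<omega>. hit y \<omega> < \<infinity>} \<omega>) \<partial>P x)"
    unfolding phi_def
  proof (rule nn_integral_cong_AE, use AE_start[OF x] in eventually_elim)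
    fix \<omega> assume w: "\<omega> \<in> space A \<and> X 0 \<omega> = x"
    then have le: "hit y \<omega> \<le> hit z \<omega>"
      using hitting_between[of \<omega> y z] y by auto
    show "ed (hit z \<omega>) = ed (hit y \<omega>) *
        (ed (hit z (\<theta> (enn2real (hit y \<omega>)) \<omega>)) * indicator {\<omega>. hit y \<omega> < \<infinity>} \<omega>)"
    proof (cases "hit y \<omega> < \<top>")
      case True
      then show ?thesis using ed_shift_hitting[OF _ le] w by simp
    next
      case False
      then show ?thesis using le by (simp add: top_unique not_less)
    qed
  qed
  also have "\<dots> = (\<integral>\<^sup>+\<omega>. ed (hit y \<omega>) * indicator {\<omega>. hit y \<omega> < \<infinity>} \<omega> \<partial>P x) * (\<integral>\<^sup>+\<omega>. ed (hit z \<omega>) \<partial>P y)"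
    by (rule strong_Markov_hitting[OF x]) measurable
  also have "(\<integral>\<^sup>+\<omega>. ed (hit y \<omega>) * indicator {\<omega>. hit y \<omega> < \<infinity>} \<omega> \<partial>P x) = phi x y"
    unfolding phi_def by (rule nn_integral_cong) (auto split: split_indicator simp: ed_def top.not_eq_extremum)
  finally show ?thesis by (simp add: phi_def)
qed

text \<open>Decomposition according to which of \<open>a\<close> and \<open>b\<close> is hit first;
  if it is \<open>a\<close>, the passage to \<open>b\<close> starts afresh there.\<close>

lemma phi_exit:
  assumes x: "x \<in> J" and ab: "a \<noteq> b"
  shows "phi x b = exit_ed x b a + exit_ed x a b * phi a b"
proof -
  let ?a = "hit a" and ?b = "hit b"
  have "phi x b = (\<integral>\<^sup>+\<omega>. ed (?b \<omega>) * indicator {\<omega>. ?b \<omega> < ?a \<omega>} \<omega>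
      + (ed (?a \<omega>) * indicator {\<omega>. ?a \<omega> < ?b \<omega>} \<omega>) * (ed (?b (\<theta> (enn2real (?a \<omega>)) \<omega>)) * indicator {\<omega>. ?a \<omega> < \<infinity>} \<omega>) \<partial>P x)"
    unfolding phi_def
  proof (rule nn_integral_cong)
    fix \<omega> assume "\<omega> \<in> space (P x)"
    then have w: "\<omega> \<in> space A" using x by simp
    consider "?b \<omega> < ?a \<omega>" | "?a \<omega> < ?b \<omega>" | "?a \<omega> = ?b \<omega>" by (meson linorder_neqE)
    then show "ed (?b \<omega>) = ed (?b \<omega>) * indicator {\<omega>. ?b \<omega> < ?a \<omega>} \<omega>
      + (ed (?a \<omega>) * indicator {\<omega>. ?a \<omega> < ?b \<omega>} \<omega>) * (ed (?b (\<theta> (enn2real (?a \<omega>)) \<omega>)) * indicator {\<omega>. ?a \<omega> < \<infinity>} \<omega>)"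
    proof cases
      case 2
      then have fin: "?a \<omega> < \<top>" using less_top by fastforce
      then show ?thesis using ed_shift_hitting[OF w less_imp_le[OF 2] fin] 2 by simp
    next
      case 3
      then show ?thesis using hitting_eq_imp_top[OF w ab] by simp
    qed auto
  qed
  also have "\<dots> = exit_ed x b a + (\<integral>\<^sup>+\<omega>. (ed (?a \<omega>) * indicator {\<omega>. ?a \<omega> < ?b \<omega>} \<omega>) * (ed (?b (\<theta> (enn2real (?a \<omega>)) \<omega>)) * indicator {\<omega>. ?a \<omega> < \<infinity>} \<omega>) \<partial>P x)"
    unfolding exit_ed_def
  proof (rule nn_integral_add)
    show "(\<lambda>\<omega>. ed (?b \<omega>) * indicator {\<omega>. ?b \<omega> < ?a \<omega>} \<omega>) \<in> borel_measurable (P x)"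
      using x by measurable
    have "(\<lambda>\<omega>. ed (?b (\<theta> (enn2real (?a \<omega>)) \<omega>))) \<in> borel_measurable A"
      by (rule measurable_compose[OF theta_meas]) auto
    then have "(\<lambda>\<omega>. (ed (?a \<omega>) * indicator {\<omega>. ?a \<omega> < ?b \<omega>} \<omega>) * (ed (?b (\<theta> (enn2real (?a \<omega>)) \<omega>)) * indicator {\<omega>. ?a \<omega> < \<infinity>} \<omega>)) \<in> borel_measurable A"
      by measurable
    then show "(\<lambda>\<omega>. (ed (?a \<omega>) * indicator {\<omega>. ?a \<omega> < ?b \<omega>} \<omega>) * (ed (?b (\<theta> (enn2real (?a \<omega>)) \<omega>)) * indicator {\<omega>. ?a \<omega> < \<infinity>} \<omega>)) \<in> borel_measurable (P x)"
      by (rule P_meas[OF x])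
  qed
  also have "(\<integral>\<^sup>+\<omega>. (ed (?a \<omega>) * indicator {\<omega>. ?a \<omega> < ?b \<omega>} \<omega>) * (ed (?b (\<theta> (enn2real (?a \<omega>)) \<omega>)) * indicator {\<omega>. ?a \<omega> < \<infinity>} \<omega>) \<partial>P x)
    = (\<integral>\<^sup>+\<omega>. (ed (?a \<omega>) * indicator {\<omega>. ?a \<omega> < ?b \<omega>} \<omega>) * indicator {\<omega>. ?a \<omega> < \<infinity>} \<omega> \<partial>P x) * (\<integral>\<^sup>+\<omega>. ed (?b \<omega>) \<partial>P a)"
    by (rule strong_Markov_hitting[OF x])
      (rule measurable_compose[OF hitting_meas_path ed_measurable],
        intro borel_measurable_times_ennreal ed_hitting_stopped less_hitting_stopped)
  also have "(\<integral>\<^sup>+\<omega>. (ed (?a \<omega>) * indicator {\<omega>. ?a \<omega> < ?b \<omega>} \<omega>) * indicator {\<omega>. ?a \<omega> < \<infinity>} \<omega> \<partial>P x) = exit_ed x a b"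
    unfolding exit_ed_def by (rule nn_integral_cong) (auto split: split_indicator simp: less_top[symmetric])
  finally show ?thesis by (simp add: phi_def)
qed

lemma phi_le_1: "x \<in> J \<Longrightarrow> phi x y \<le> 1"
  using nn_integral_mono[of "P x" "\<lambda>\<omega>. ed (hit y \<omega>)" "\<lambda>_. 1"] ed_le_1 nn_const[of x 1]
  by (simp add: phi_def)

lemma exit_ed_le_emeasure: "x \<in> J \<Longrightarrow> exit_ed x b a \<le> emeasure (P x) (hit_before b a)"
proof -
  assume x: "x \<in> J"
  have "exit_ed x b a \<le> (\<integral>\<^sup>+\<omega>. indicator (hit_before b a) \<omega> \<partial>P x)"
    unfolding exit_ed_def
    by (rule nn_integral_mono) (auto simp: x ed_le_1 split: split_indicator)
  also have "\<dots> = emeasure (P x) (hit_before b a)"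
    by (rule nn_integral_indicator) (use x in \<open>simp add: sets_P_iff\<close>)
  finally show ?thesis .
qed

lemma exit_ed_le_1: "x \<in> J \<Longrightarrow> exit_ed x b a \<le> 1"
  using exit_ed_le_emeasure[of x b a] prob_space.emeasure_le_1[OF prob_P] order_trans by blast

lemma hit_sets [measurable]: "{\<omega>\<in>space A. hit y \<omega> \<le> c} \<in> sets A"
  "{\<omega>\<in>space A. hit y \<omega> < c} \<in> sets A"
  "{\<omega>\<in>space A. c < hit y \<omega>} \<in> sets A"
  "(hit_before y z) \<in> sets A"
  by measurable

lemma emeasure_P_eq: "x \<in> J \<Longrightarrow> emeasure (P x) S = ennreal (measure (P x) S)"
  using prob_space.finite_measure[OF prob_P] by (simp add: finite_measure.emeasure_eq_measure)

lemma emeasure_eq_nn: "x \<in> J \<Longrightarrow> {\<omega>\<in>space A. Q \<omega>} \<in> sets A \<Longrightarrow> emeasure (P x) {\<omega>\<in>space A. Q \<omega>} = (\<integral>\<^sup>+\<omega>. indicator {\<omega>. Q \<omega>} \<omega> \<partial>P x)"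
  by (subst nn_integral_indicator[symmetric], simp add: sets_P_iff)
    (auto intro!: nn_integral_cong split: split_indicator)

text \<open>Markov's inequality for the discount factor. Together with the next estimate it makes
  small \<open>phi\<close> equivalent to small hitting probabilities at fixed times.\<close>

lemma prob_le_phi:
  assumes x: "x \<in> J" and t: "0 \<le> t"
  shows "emeasure (P x) (hit_by y t) \<le> ennreal (exp t) * phi x y"
proof -
  have "emeasure (P x) (hit_by y t)
      = (\<integral>\<^sup>+\<omega>. indicator {\<omega>. hit y \<omega> \<le> ennreal t} \<omega> \<partial>P x)"
    by (rule emeasure_eq_nn[OF x]) measurable
  also have "\<dots> \<le> (\<integral>\<^sup>+\<omega>. ennreal (exp t) * ed (hit y \<omega>) \<partial>P x)"
  proof (rule nn_integral_mono)
    fix \<omega>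
    show "indicator {\<omega>. hit y \<omega> \<le> ennreal t} \<omega> \<le> ennreal (exp t) * ed (hit y \<omega>)"
    proof (cases "hit y \<omega> \<le> ennreal t")
      case True
      then have "ed (ennreal t) \<le> ed (hit y \<omega>)" by (rule ed_antimono)
      then have "ennreal (exp t) * ed (ennreal t) \<le> ennreal (exp t) * ed (hit y \<omega>)"
        by (rule mult_left_mono) simp
      moreover have "ennreal (exp t) * ed (ennreal t) = 1"
        using t by (simp add: ed_ennreal ennreal_mult'[symmetric] exp_minus)
      ultimately show ?thesis using True by simp
    qed simp
  qed
  also have "\<dots> = ennreal (exp t) * phi x y"
    unfolding phi_def by (rule nn_integral_cmult) (use x in measurable)
  finally show ?thesis .
qed

text \<open>Paths that have not hit \<open>y\<close> by time \<open>t\<close> contribute at most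
  \<open>exp (- t)\<close>.\<close>

lemma phi_le_prob:
  assumes x: "x \<in> J" and t: "0 \<le> t"
  shows "phi x y \<le> emeasure (P x) (hit_by y t) + ennreal (exp (-t))"
proof -
  have "phi x y \<le> (\<integral>\<^sup>+\<omega>. indicator {\<omega>. hit y \<omega> \<le> ennreal t} \<omega> + ennreal (exp (-t)) \<partial>P x)"
    unfolding phi_def
  proof (rule nn_integral_mono)
    fix \<omega>
    show "ed (hit y \<omega>) \<le> indicator {\<omega>. hit y \<omega> \<le> ennreal t} \<omega> + ennreal (exp (-t))"
    proof (cases "hit y \<omega> \<le> ennreal t")
      case True
      then show ?thesis using add_mono[OF ed_le_1[of "hit y \<omega>"], of 0 "ennreal (exp (-t))"] by simp
    next
      case False
      then have "ed (hit y \<omega>) \<le> ed (ennreal t)" by (intro ed_antimono) auto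
      then show ?thesis using False t by (simp add: ed_ennreal)
    qed
  qed
  also have "\<dots> = (\<integral>\<^sup>+\<omega>. indicator {\<omega>. hit y \<omega> \<le> ennreal t} \<omega> \<partial>P x) + (\<integral>\<^sup>+\<omega>. ennreal (exp (-t)) \<partial>P x)"
    by (rule nn_integral_add) (use x in measurable)
  also have "(\<integral>\<^sup>+\<omega>. indicator {\<omega>. hit y \<omega> \<le> ennreal t} \<omega> \<partial>P x) = emeasure (P x) (hit_by y t)"
    by (rule emeasure_eq_nn[OF x, symmetric]) measurable
  finally show ?thesis using nn_const[OF x] by simp
qed

text \<open>Hits later than \<open>t\<close> keep the factor of the undiscounted exit probability
  besides \<open>exp (- t)\<close>. For a high level \<open>b\<close> that factor is of order
  \<open>1 / b\<close>, which the plain bound \<open>phi_le_prob\<close> would lose.\<close>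

lemma exit_ed_le_prob:
  assumes x: "x \<in> J" and t: "0 \<le> t"
  shows "exit_ed x b a \<le> emeasure (P x) (hit_by b t)
     + ennreal (exp (-t)) * emeasure (P x) (hit_before b a)"
proof -
  have "exit_ed x b a \<le> (\<integral>\<^sup>+\<omega>. indicator {\<omega>. hit b \<omega> \<le> ennreal t} \<omega>
      + ennreal (exp (-t)) * indicator {\<omega>. hit b \<omega> < hit a \<omega>} \<omega> \<partial>P x)"
    unfolding exit_ed_def
  proof (rule nn_integral_mono)
    fix \<omega>
    show "ed (hit b \<omega>) * indicator {\<omega>. hit b \<omega> < hit a \<omega>} \<omega>
      \<le> indicator {\<omega>. hit b \<omega> \<le> ennreal t} \<omega>
      + ennreal (exp (-t)) * indicator {\<omega>. hit b \<omega> < hit a \<omega>} \<omega>"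
    proof (cases "hit b \<omega> \<le> ennreal t")
      case True
      then show ?thesis using add_mono[OF ed_le_1[of "hit b \<omega>"], of 0 "ennreal (exp (-t))"]
        by (simp split: split_indicator)
    next
      case False
      then have "ed (hit b \<omega>) \<le> ed (ennreal t)" by (intro ed_antimono) auto
      then show ?thesis using False t by (simp add: ed_ennreal split: split_indicator)
    qed
  qed
  also have "\<dots> = (\<integral>\<^sup>+\<omega>. indicator {\<omega>. hit b \<omega> \<le> ennreal t} \<omega> \<partial>P x)
     + ennreal (exp (-t)) * (\<integral>\<^sup>+\<omega>. indicator {\<omega>. hit b \<omega> < hit a \<omega>} \<omega> \<partial>P x)"
    by (subst nn_integral_add, use x in measurable) (subst nn_integral_cmult, use x in measurable)
  also have "(\<integral>\<^sup>+\<omega>. indicator {\<omega>. hit b \<omega> \<le> ennreal t} \<omega> \<partial>P x) = emeasure (P x) (hit_by b t)"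
    by (rule emeasure_eq_nn[OF x, symmetric]) measurable
  also have "(\<integral>\<^sup>+\<omega>. indicator {\<omega>. hit b \<omega> < hit a \<omega>} \<omega> \<partial>P x) = emeasure (P x) (hit_before b a)"
    by (rule emeasure_eq_nn[OF x, symmetric]) measurable
  finally show ?thesis .
qed

lemma hit_mass_le_1: "x \<in> J \<Longrightarrow> (\<integral>\<^sup>+\<omega>. 1 * indicator {\<omega>. hit y \<omega> < \<infinity>} \<omega> \<partial>P x) \<le> 1"
  using nn_integral_mono[of "P x" "\<lambda>\<omega>. 1 * indicator {\<omega>. hit y \<omega> < \<infinity>} \<omega>" "\<lambda>_. 1"] nn_const[of x 1]
  by (auto split: split_indicator)

text \<open>Starting further along the way saves the time needed to get there. This makes an
  estimate from one starting point uniform over all points behind it.\<close>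

lemma hit_between_prob:
  assumes x: "x \<in> J" and y: "y \<in> closed_segment x z" "y \<in> J" and c: "c < \<top>"
  shows "emeasure (P x) {\<omega>\<in>space A. hit z \<omega> \<le> c} \<le> emeasure (P y) {\<omega>\<in>space A. hit z \<omega> \<le> c}"
proof -
  let ?Z = "\<lambda>\<omega>. indicator {\<omega>. hit z \<omega> \<le> c} \<omega> :: ennreal"
  have "emeasure (P x) {\<omega>\<in>space A. hit z \<omega> \<le> c} = (\<integral>\<^sup>+\<omega>. ?Z \<omega> \<partial>P x)"
    by (rule emeasure_eq_nn[OF x]) measurable
  also have "\<dots> \<le> (\<integral>\<^sup>+\<omega>. 1 * (?Z (\<theta> (enn2real (hit y \<omega>)) \<omega>) * indicator {\<omega>. hit y \<omega> < \<infinity>} \<omega>) \<partial>P x)"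
  proof (rule nn_integral_mono_AE, use AE_start[OF x] in eventually_elim)
    fix \<omega> assume w: "\<omega> \<in> space A \<and> X 0 \<omega> = x"
    then have le: "hit y \<omega> \<le> hit z \<omega>"
      using hitting_between[of \<omega> y z] y by auto
    show "?Z \<omega> \<le> 1 * (?Z (\<theta> (enn2real (hit y \<omega>)) \<omega>) * indicator {\<omega>. hit y \<omega> < \<infinity>} \<omega>)"
    proof (cases "hit y \<omega> < \<top>")
      case True
      have "hit z (\<theta> (enn2real (hit y \<omega>)) \<omega>) \<le> hit z \<omega>"
        using hitting_shift_hitting[OF _ le True] w add_increasing[of "hit y \<omega>"] by fastforce
      then show ?thesis using True by (auto split: split_indicator)
    next
      case False
      then have "hit z \<omega> = \<top>" using le by (simp add: top_unique not_less)
      then show ?thesis using c by (simp add: not_le[symmetric])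
    qed
  qed
  also have "\<dots> = (\<integral>\<^sup>+\<omega>. 1 * indicator {\<omega>. hit y \<omega> < \<infinity>} \<omega> \<partial>P x) * (\<integral>\<^sup>+\<omega>. ?Z \<omega> \<partial>P y)"
    by (rule strong_Markov_hitting[OF x]) measurable
  also have "(\<integral>\<^sup>+\<omega>. ?Z \<omega> \<partial>P y) = emeasure (P y) {\<omega>\<in>space A. hit z \<omega> \<le> c}"
    by (rule emeasure_eq_nn[OF y(2), symmetric]) measurable
  also have "(\<integral>\<^sup>+\<omega>. 1 * indicator {\<omega>. hit y \<omega> < \<infinity>} \<omega> \<partial>P x) \<le> 1"
    by (rule hit_mass_le_1[OF x])
  finally show ?thesis by (simp add: mult_right_mono)
qed

text \<open>The events of hitting \<open>u\<close> within \<open>1 / (n + 1)\<close> decrease to the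
  event of starting at \<open>u\<close>, which is null.\<close>

lemma hit_small:
  assumes x: "x \<in> J" and u: "u \<noteq> x" and e: "0 < e"
  shows "\<exists>h>0. \<forall>t\<in>{0..h}. measure (P x) (hit_by u t) < e"
proof -
  interpret prob_space "P x" by (rule prob_P[OF x])
  let ?A = "\<lambda>n. (hit_by u (1 / real (Suc n)))"
  have sA: "?A n \<in> sets (P x)" for n using x by (simp add: sets_P_iff)
  have dec: "decseq ?A"
  proof (rule decseq_SucI, rule Collect_mono, rule impI)
    fix n \<omega> assume "\<omega> \<in> space A \<and> hit u \<omega> \<le> ennreal (1 / real (Suc (Suc n)))"
    moreover have "ennreal (1 / real (Suc (Suc n))) \<le> ennreal (1 / real (Suc n))"
      by (intro ennreal_leI) (simp add: field_simps)
    ultimately show "\<omega> \<in> space A \<and> hit u \<omega> \<le> ennreal (1 / real (Suc n))"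
      by (blast intro: order_trans)
  qed
  have lim: "(\<lambda>n. measure (P x) (?A n)) \<longlonglongrightarrow> measure (P x) (\<Inter>n. ?A n)"
    by (rule finite_Lim_measure_decseq[OF _ dec]) (use sA in auto)
  have "AE \<omega> in P x. \<omega> \<notin> (\<Inter>n. ?A n)"
    using AE_start[OF x]
  proof eventually_elim
    fix \<omega> assume w: "\<omega> \<in> space A \<and> X 0 \<omega> = x"
    show "\<omega> \<notin> (\<Inter>n. ?A n)"
    proof
      assume a: "\<omega> \<in> (\<Inter>n. ?A n)"
      then have fin: "hit u \<omega> < \<top>" by (auto intro: le_less_trans[OF _ ennreal_less_top])
      define r where "r = enn2real (hit u \<omega>)"
      have r: "hit u \<omega> = ennreal r" "0 \<le> r" using fin by (auto simp: r_def)
      have "r \<le> 1 / real (Suc n)" for n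
      proof -
        have "hit u \<omega> \<le> ennreal (1 / real (Suc n))" using a by blast
        then show ?thesis unfolding r(1) by (subst (asm) ennreal_le_iff) auto
      qed
      then have "r = 0" using r(2) nat_approx_posE[of r] by (metis leD order_le_less)
      then have "X 0 \<omega> = u" using hitting_attained[of \<omega> u] fin w r_def by auto
      then show False using w u by simp
    qed
  qed
  then have "measure (P x) (\<Inter>n. ?A n) = 0"
    using sA by (subst prob_eq_0) auto
  then have "\<forall>\<^sub>F n in sequentially. measure (P x) (?A n) < e"
    using lim e by (auto dest: order_tendstoD(2))
  then obtain n where n: "measure (P x) (?A n) < e" by (auto simp: eventually_sequentially)
  have "measure (P x) (hit_by u t) < e" if t: "t \<in> {0..1 / real (Suc n)}" for t
  proof -
    have "measure (P x) (hit_by u t) \<le> measure (P x) (?A n)"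
      using t by (intro finite_measure_mono sA Collect_mono) (auto intro: order_trans[OF _ ennreal_leI])
    then show ?thesis using n by simp
  qed
  then show ?thesis by (intro exI[of _ "1 / real (Suc n)"]) auto
qed

text \<open>With probability more than 1/2 the point \<open>u\<close> is not hit by a small time
  \<open>h\<close>, and such paths are discounted by at least \<open>exp (- h)\<close>.\<close>

lemma phi_less_1:
  assumes x: "x \<in> J" and u: "u \<noteq> x"
  shows "phi x u < 1"
proof -
  obtain h where h: "0 < h" "\<forall>t\<in>{0..h}. measure (P x) (hit_by u t) < 1/2"
    using hit_small[OF x u, of "1/2"] by auto
  interpret prob_space "P x" by (rule prob_P[OF x])
  let ?S = "hit_by u h"
  have "phi x u \<le> (\<integral>\<^sup>+\<omega>. ennreal (exp (-h)) + ennreal (1 - exp (-h)) * indicator {\<omega>. hit u \<omega> \<le> ennreal h} \<omega> \<partial>P x)"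
    unfolding phi_def
  proof (rule nn_integral_mono)
    fix \<omega>
    show "ed (hit u \<omega>) \<le> ennreal (exp (-h)) + ennreal (1 - exp (-h)) * indicator {\<omega>. hit u \<omega> \<le> ennreal h} \<omega>"
    proof (cases "hit u \<omega> \<le> ennreal h")
      case True
      have "ennreal (exp (-h)) + ennreal (1 - exp (-h)) = 1"
        using h by (subst ennreal_plus[symmetric]) auto
      then show ?thesis using True ed_le_1[of "hit u \<omega>"] by simp
    next
      case False
      then have "ed (hit u \<omega>) \<le> ed (ennreal h)" by (intro ed_antimono) auto
      then show ?thesis using False h by (simp add: ed_ennreal)
    qed
  qed
  also have "\<dots> = ennreal (exp (-h)) + ennreal (1 - exp (-h)) * (\<integral>\<^sup>+\<omega>. indicator {\<omega>. hit u \<omega> \<le> ennreal h} \<omega> \<partial>P x)"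
    using x by (subst nn_integral_add, measurable) (subst nn_integral_cmult, use x nn_const[OF x] in simp_all)
  also have "(\<integral>\<^sup>+\<omega>. indicator {\<omega>. hit u \<omega> \<le> ennreal h} \<omega> \<partial>P x) = ennreal (measure (P x) ?S)"
    unfolding emeasure_P_eq[OF x, symmetric] by (rule emeasure_eq_nn[OF x, symmetric]) measurable
  also have "ennreal (exp (-h)) + ennreal (1 - exp (-h)) * ennreal (measure (P x) ?S)
      = ennreal (exp (-h) + (1 - exp (-h)) * measure (P x) ?S)"
    using h by (simp add: ennreal_mult'[symmetric])
  also have "\<dots> < 1"
  proof -
    have "(1 - exp (-h)) * measure (P x) ?S < (1 - exp (-h)) * 1"
    proof (rule mult_strict_left_mono)
      have "measure (P x) ?S < 1/2" using h by auto
      then show "measure (P x) ?S < 1" by simp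
    qed (use h in auto)
    then show ?thesis by (simp add: ennreal_less_one_iff)
  qed
  finally show ?thesis .
qed

text \<open>Before \<open>b\<close> is hit, \<open>exp (- t) * phi (X t) b\<close> is the
  conditional expectation of the discount factor of \<open>b\<close> given the past; the paths that
  have already hit \<open>b\<close> are dropped.\<close>

lemma Markov_phi:
  assumes y: "y \<in> J" and t: "0 \<le> t"
  shows "(\<integral>\<^sup>+\<omega>. indicator {\<omega>. ennreal t < hit b \<omega>} \<omega> * phi (X t \<omega>) b \<partial>P y) \<le> ennreal (exp t) * phi y b"
proof -
  let ?f = "\<lambda>\<omega>. indicator {\<omega>\<in>space A. ennreal t < hit b \<omega>} \<omega> :: ennreal"
  have Ft: "{\<omega>\<in>space A. ennreal t < hit b \<omega>} \<in> sets (F t)"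
  proof -
    have "{\<omega>\<in>space A. ennreal t < hit b \<omega>} = space (F t) - (hit_by b t)"
      using space_F[OF t] by auto
    then show ?thesis using hitting_stopping t by (auto simp: ext_stopping_time_def)
  qed
  have "(\<integral>\<^sup>+\<omega>. indicator {\<omega>. ennreal t < hit b \<omega>} \<omega> * phi (X t \<omega>) b \<partial>P y)
    = (\<integral>\<^sup>+\<omega>. ?f \<omega> * (\<integral>\<^sup>+\<omega>'. ed (hit b \<omega>') \<partial>P (X t \<omega>)) \<partial>P y)"
    unfolding phi_def by (rule nn_integral_cong) (auto simp: y split: split_indicator)
  also have "\<dots> = (\<integral>\<^sup>+\<omega>. ?f \<omega> * ed (hit b (\<theta> t \<omega>)) \<partial>P y)"
    by (rule Markov_integral[OF y t, symmetric]) (use Ft in measurable)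
  also have "\<dots> \<le> (\<integral>\<^sup>+\<omega>. ennreal (exp t) * ed (hit b \<omega>) \<partial>P y)"
  proof (rule nn_integral_mono)
    fix \<omega> assume "\<omega> \<in> space (P y)"
    then have w: "\<omega> \<in> space A" using y by simp
    show "?f \<omega> * ed (hit b (\<theta> t \<omega>)) \<le> ennreal (exp t) * ed (hit b \<omega>)"
    proof (cases "ennreal t < hit b \<omega>")
      case True
      have "ed (hit b \<omega>) = ennreal (exp (-t)) * ed (hit b (\<theta> t \<omega>))"
        using hitting_shift[OF w t less_imp_le[OF True]] ed_add[OF t] by metis
      then have "ennreal (exp t) * ed (hit b \<omega>) = ennreal (exp t * exp (-t)) * ed (hit b (\<theta> t \<omega>))"
        by (simp add: ennreal_mult' mult.assoc)
      then show ?thesis using True w by (simp add: exp_minus)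
    qed simp
  qed
  also have "\<dots> = ennreal (exp t) * phi y b"
    unfolding phi_def by (rule nn_integral_cmult) (use y in measurable)
  finally show ?thesis .
qed

lemma path_below:
  assumes w: "\<omega> \<in> space A" and y: "X 0 \<omega> < b" and t: "0 \<le> t" "ennreal t < hit b \<omega>"
  shows "X t \<omega> < b"
proof (rule ccontr)
  assume "\<not> X t \<omega> < b"
  then have "b \<in> closed_segment (X 0 \<omega>) (X t \<omega>)" using y by (auto simp: closed_segment_eq_real_ivl)
  then have "hit b \<omega> \<le> ennreal t"
    using order_trans[OF hitting_between[OF w] hitting_le[OF t(1) refl]] by blast
  then show False using t by auto
qed

lemma path_above:
  assumes w: "\<omega> \<in> space A" and y: "b < X 0 \<omega>" and t: "0 \<le> t" "ennreal t < hit b \<omega>"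
  shows "b < X t \<omega>"
proof (rule ccontr)
  assume "\<not> b < X t \<omega>"
  then have "b \<in> closed_segment (X 0 \<omega>) (X t \<omega>)" using y by (auto simp: closed_segment_eq_real_ivl)
  then have "hit b \<omega> \<le> ennreal t"
    using order_trans[OF hitting_between[OF w] hitting_le[OF t(1) refl]] by blast
  then show False using t by auto
qed

subsection \<open>Reflection\<close>

text \<open>Sample space, filtration and shift stay the same; only the state space changes its
  orientation. Results at the right end point thereby hold at the left one.\<close>

lemma reflect: "diffusion (uminus ` J) A F (\<lambda>t \<omega>. - X t \<omega>) \<theta> (\<lambda>x. P (- x))"
proof -
  have ps: "path_sigma A (\<lambda>t \<omega>. - X t \<omega>) = path_sigma A X"
  proof -
    have "{(\<lambda>\<omega>. - X t \<omega>) -` B \<inter> space A |t B. 0 \<le> t \<and> B \<in> sets borel} = {X t -` B \<inter> space A |t B. 0 \<le> t \<and> B \<in> sets borel}"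
    proof (intro Collect_cong iffI; clarify)
      fix t :: real and B :: "real set" assume "0 \<le> t" "B \<in> sets borel"
      have m: "uminus -` B \<in> sets borel"
        using measurable_sets[of uminus borel borel B] \<open>B \<in> sets borel\<close> by simp
      show "\<exists>t' B'. (\<lambda>\<omega>. - X t \<omega>) -` B \<inter> space A = X t' -` B' \<inter> space A \<and> 0 \<le> t' \<and> B' \<in> sets borel"
        using m \<open>0 \<le> t\<close> by (intro exI[of _ t] exI[of _ "uminus -` B"]) auto
      show "\<exists>t' B'. X t -` B \<inter> space A = (\<lambda>\<omega>. - X t' \<omega>) -` B' \<inter> space A \<and> 0 \<le> t' \<and> B' \<in> sets borel"
        using m \<open>0 \<le> t\<close> by (intro exI[of _ t] exI[of _ "uminus -` B"]) auto
    qed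
    then show ?thesis by (simp add: path_sigma_def)
  qed
  show ?thesis
  proof (rule diffusion.intro, unfold ps)
    show "is_interval (uminus ` J)" using interval by simp
    show "uminus ` J \<noteq> {}" using nonempty by simp
    fix x L assume L: "L \<in> sets (path_sigma A X)"
    show "(\<lambda>x. emeasure (P (- x)) L) \<in> borel_measurable (restrict_space borel (uminus ` J))"
      by (rule measurable_compose[OF _ kernel_P[OF L]])
        (auto simp: measurable_restrict_space2_iff space_restrict_space intro: measurable_restrict_space1)
  next
    fix t :: real assume t: "0 \<le> t"
    show "(\<lambda>\<omega>. - X t \<omega>) \<in> F t \<rightarrow>\<^sub>M restrict_space borel (uminus ` J)"
      using X_meas_F[OF t] X_in_J[OF t] space_F[OF t] by (auto simp: measurable_restrict_space2_iff)
  next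
    fix \<omega> assume "\<omega> \<in> space A"
    then show "continuous_on {0..} (\<lambda>t. - X t \<omega>)" by (intro continuous_intros continuous_paths)
  next
    fix x assume "x \<in> uminus ` J"
    then have "- x \<in> J" by auto
    from start[OF this] show "AE \<omega> in P (- x). - X 0 \<omega> = x" by eventually_elim auto
  next
    fix x \<tau> and Z :: "'w \<Rightarrow> ennreal"
    assume "x \<in> uminus ` J" "ext_stopping_time A F \<tau>" "Z \<in> borel_measurable (path_sigma A X)"
    then show "AE \<omega> in P (- x).
            nn_cond_exp (P (- x)) (stopped_sigma A F \<tau>)
              (\<lambda>\<omega>. Z (\<theta> (enn2real (\<tau> \<omega>)) \<omega>) * indicator {\<omega>. \<tau> \<omega> < \<infinity>} \<omega>) \<omega>
            = (\<integral>\<^sup>+\<omega>'. Z \<omega>' \<partial>P (- (- X (enn2real (\<tau> \<omega>)) \<omega>))) * indicator {\<omega>. \<tau> \<omega> < \<infinity>} \<omega>"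
      using strong_Markov[of "- x" \<tau> Z] by auto
  next
    fix s t :: real assume "0 \<le> s" "s \<le> t"
    then show "sets (F s) \<subseteq> sets (F t)" by (rule F_mono)
  next
    fix x assume "x \<in> uminus ` J"
    then have x: "- x \<in> J" by auto
    show "prob_space (P (- x))" by (rule prob_P[OF x])
    show "sets (P (- x)) = sets A" by (rule sets_P[OF x])
  next
    fix s t :: real and \<omega> assume "0 \<le> s" "0 \<le> t" "\<omega> \<in> space A"
    then show "- X s (\<theta> t \<omega>) = - X (s + t) \<omega>" by (simp add: shift)
  qed (auto intro: subalgebra_F shift_closed)
qed

lemma hitting_reflect: "hitting_time (\<lambda>t \<omega>. - X t \<omega>) u \<omega> = hit (- u) \<omega>"
  unfolding hitting_time_def by (rule arg_cong[where f=Inf], rule image_cong) auto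

end

section \<open>Diffusions on natural scale with absorbing boundaries\<close>

text \<open>An interface free of the speed measure and invariant under reflection, on which the
  equivalence itself rests. \<open>attain\<close> says that an interior point is reached quickly
  from nearby; it provides the continuity of the semigroup in the interior.\<close>

locale absorbed_diffusion = diffusion J A F X \<theta> P
  for J :: "real set" and A :: "'w measure" and F X \<theta> P +
  assumes exit_prob: "\<And>a b x. a \<in> J \<Longrightarrow> b \<in> J \<Longrightarrow> a < x \<and> x < b \<or> b < x \<and> x < a \<Longrightarrow>
       measure (P x) (hit_before b a) = \<bar>x - a\<bar> / \<bar>b - a\<bar>"
    and trap: "\<And>r. r \<in> J \<Longrightarrow> r \<notin> interior J \<Longrightarrow> AE \<omega> in P r. \<forall>t\<ge>0. X t \<omega> = r"
    and attain: "\<And>x \<delta>. x \<in> interior J \<Longrightarrow> 0 < \<delta> \<Longrightarrow>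
       ((\<lambda>z. measure (P z) {\<omega>\<in>space A. ennreal \<delta> < hit x \<omega>}) \<longlongrightarrow> 0) (at x)"

lemma min_ennreal_add: "min (c + a) (c + b) = c + min a (b :: ennreal)"
  by (rule min_of_mono) (intro monoI add_left_mono)

lemma interior_uminus_image: "interior (uminus ` S) = uminus ` interior (S :: real set)"
  by (rule interior_negations)

lemma (in absorbed_diffusion) reflect_absorbed:
  "absorbed_diffusion (uminus ` J) A F (\<lambda>t \<omega>. - X t \<omega>) \<theta> (\<lambda>x. P (- x))"
proof -
  interpret R: diffusion "uminus ` J" A F "\<lambda>t \<omega>. - X t \<omega>" \<theta> "\<lambda>x. P (- x)"
    by (rule reflect)
  show ?thesis
  proof (unfold_locales, unfold hitting_reflect)
    fix a b x :: real
    assume "a \<in> uminus ` J" "b \<in> uminus ` J" "a < x \<and> x < b \<or> b < x \<and> x < a"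
    then show "measure (P (- x)) (hit_before (- b) (- a)) = \<bar>x - a\<bar> / \<bar>b - a\<bar>"
      using exit_prob[of "- a" "- b" "- x"] by (auto simp: abs_minus_commute)
  next
    fix r assume "r \<in> uminus ` J" "r \<notin> interior (uminus ` J)"
    then have "- r \<in> J" "- r \<notin> interior J" by (auto simp: interior_uminus_image image_iff)
    from trap[OF this] show "AE \<omega> in P (- r). \<forall>t\<ge>0. - X t \<omega> = r"
      by eventually_elim auto
  next
    fix x \<delta> :: real assume "x \<in> interior (uminus ` J)" "0 < \<delta>"
    then have *: "- x \<in> interior J" by (auto simp: interior_uminus_image)
    have "filterlim uminus (at (- x)) (at x)"
      by (rule filterlim_atI) (auto intro!: tendsto_intros simp: eventually_at_filter)
    from filterlim_compose[OF attain[OF * \<open>0 < \<delta>\<close>] this]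
    show "((\<lambda>z. measure (P (- z)) {\<omega>\<in>space A. ennreal \<delta> < hit (- x) \<omega>}) \<longlongrightarrow> 0) (at x)" .
  qed
qed

section \<open>Finiteness of expected exit times\<close>

context diffusion
begin

lemma J_Icc: "a \<in> J \<Longrightarrow> b \<in> J \<Longrightarrow> {a..b} \<subseteq> J"
  using mem_is_interval_1_I[OF interval, of a b] by (meson atLeastAtMost_iff subsetI)

lemma J_seg: "a \<in> J \<Longrightarrow> b \<in> J \<Longrightarrow> closed_segment a b \<subseteq> J"
  using interval by (meson closed_segment_subset is_interval_convex)

lemma interior_between: "a \<in> J \<Longrightarrow> b \<in> J \<Longrightarrow> a < x \<Longrightarrow> x < b \<Longrightarrow> x \<in> interior J"
  using interior_maximal[of "{a<..<b}" J] J_Icc[of a b] greaterThanLessThan_subseteq_atLeastAtMost_iff[of a b a b]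
  by (meson greaterThanLessThan_iff open_greaterThanLessThan order_refl order_trans subsetD)

lemma end_point: "r \<in> J \<Longrightarrow> r \<notin> interior J \<Longrightarrow> (\<forall>y\<in>J. y \<le> r) \<or> (\<forall>y\<in>J. r \<le> y)"
  using interior_between by (meson not_le)

text \<open>In each period of length \<open>t\<close> the exit happens with probability at least
  \<open>p\<close>, whatever the current position in \<open>S\<close>, so the Markov property makes
  the tails geometric.\<close>

lemma geometric_tail:
  assumes x: "x \<in> J" and t: "0 < t" and p: "0 < p"
    and S: "\<And>z. z \<in> S \<Longrightarrow> p \<le> measure (P z) {\<omega>\<in>space A. min (hit a \<omega>) (hit b \<omega>) \<le> ennreal t}"
    and stay: "AE \<omega> in P x. \<forall>s\<ge>0. ennreal s < min (hit a \<omega>) (hit b \<omega>) \<longrightarrow> X s \<omega> \<in> S"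
  shows "(\<integral>\<^sup>+\<omega>. min (hit a \<omega>) (hit b \<omega>) \<partial>P x) < \<infinity>"
proof -
  interpret prob_space "P x" by (rule prob_P[OF x])
  define \<sigma> where "\<sigma> \<omega> = min (hit a \<omega>) (hit b \<omega>)" for \<omega>
  have [measurable]: "\<sigma> \<in> borel_measurable A" unfolding \<sigma>_def by measurable
  have sp: "\<sigma> \<in> borel_measurable (path_sigma A X)" unfolding \<sigma>_def by measurable
  have st: "ext_stopping_time A F \<sigma>"
    unfolding \<sigma>_def by (intro stopping_min hitting_stopping)
  have sP[measurable]: "\<sigma> \<in> borel_measurable (P z)" if "z \<in> J" for z
    by (rule P_meas[OF that]) measurable
  have p1: "p \<le> 1" if "z \<in> S" "z \<in> J" for z
    using order_trans[OF S[OF that(1)]] prob_space.prob_le_1[OF prob_P[OF that(2)]] by blast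
  \<comment> \<open>The maximum keeps the ratio nonnegative even when no bound on \<open>p\<close>
    is available because \<open>S\<close> contains no point of \<open>J\<close>.\<close>
  define c where "c = max 0 (1 - p)"
  have c: "0 \<le> c" "c < 1" using p by (auto simp: c_def)
  define tail where "tail n = (\<integral>\<^sup>+\<omega>. indicator {\<omega>. ennreal (real n * t) < \<sigma> \<omega>} \<omega> \<partial>P x)" for n :: nat
  have tail_le: "tail n \<le> ennreal (c ^ n)" for n
  proof (induction n)
    case 0
    have "tail 0 \<le> (\<integral>\<^sup>+\<omega>. 1 \<partial>P x)" unfolding tail_def by (rule nn_integral_mono) (auto split: split_indicator)
    then show ?case using nn_const[OF x, of 1] by simp
  next
    case (Suc n)
    let ?t = "real n * t"
    let ?f = "\<lambda>\<omega>. indicator {\<omega>\<in>space A. ennreal ?t < \<sigma> \<omega>} \<omega> :: ennreal"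
    let ?Z = "\<lambda>\<omega>. indicator {\<omega>. ennreal t < \<sigma> \<omega>} \<omega> :: ennreal"
    have t0: "0 \<le> ?t" using t by simp
    have "{\<omega>\<in>space A. ennreal ?t < \<sigma> \<omega>} = space (F ?t) - {\<omega>\<in>space A. \<sigma> \<omega> \<le> ennreal ?t}"
      using space_F[OF t0] by auto
    then have Ft: "{\<omega>\<in>space A. ennreal ?t < \<sigma> \<omega>} \<in> sets (F ?t)"
      using st t0 by (auto simp: ext_stopping_time_def)
    have "tail (Suc n) \<le> (\<integral>\<^sup>+\<omega>. ?f \<omega> * ?Z (\<theta> ?t \<omega>) \<partial>P x)"
      unfolding tail_def
    proof (rule nn_integral_mono)
      fix \<omega> assume "\<omega> \<in> space (P x)"
      then have w: "\<omega> \<in> space A" using x by simp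
      show "indicator {\<omega>. ennreal (real (Suc n) * t) < \<sigma> \<omega>} \<omega> \<le> ?f \<omega> * ?Z (\<theta> ?t \<omega>)"
      proof (cases "ennreal (real (Suc n) * t) < \<sigma> \<omega>")
        case True
        have "ennreal ?t \<le> ennreal (real (Suc n) * t)" using t by (intro ennreal_leI) (simp add: algebra_simps)
        then have lt: "ennreal ?t < \<sigma> \<omega>" using True by simp
        have "\<sigma> \<omega> = ennreal ?t + \<sigma> (\<theta> ?t \<omega>)"
        proof -
          have "ennreal ?t \<le> hit a \<omega>" "ennreal ?t \<le> hit b \<omega>"
            using lt by (auto simp: \<sigma>_def)
          then have "hit a \<omega> = ennreal ?t + hit a (\<theta> ?t \<omega>)"
            "hit b \<omega> = ennreal ?t + hit b (\<theta> ?t \<omega>)"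
            by (auto intro!: hitting_shift[OF w t0])
          then show ?thesis
            unfolding \<sigma>_def by (simp only: min_ennreal_add)
        qed
        moreover have "ennreal (real (Suc n) * t) = ennreal ?t + ennreal t"
          using t by (simp add: algebra_simps flip: ennreal_plus)
        ultimately have "ennreal t < \<sigma> (\<theta> ?t \<omega>)"
          using True add_left_mono[of "\<sigma> (\<theta> ?t \<omega>)" "ennreal t" "ennreal ?t"] by (simp add: not_le[symmetric])
        then show ?thesis using lt w by (simp split: split_indicator)
      qed simp
    qed
    also have "\<dots> = (\<integral>\<^sup>+\<omega>. ?f \<omega> * (\<integral>\<^sup>+\<omega>'. ?Z \<omega>' \<partial>P (X ?t \<omega>)) \<partial>P x)"
      by (rule Markov_integral[OF x t0]) (use Ft sp in measurable)
    also have "\<dots> \<le> (\<integral>\<^sup>+\<omega>. ennreal c * indicator {\<omega>. ennreal ?t < \<sigma> \<omega>} \<omega> \<partial>P x)"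
    proof (rule nn_integral_mono_AE, use AE_start[OF x] stay in eventually_elim)
      fix \<omega> assume w: "\<omega> \<in> space A \<and> X 0 \<omega> = x"
        and stay: "\<forall>s\<ge>0. ennreal s < min (hit a \<omega>) (hit b \<omega>) \<longrightarrow> X s \<omega> \<in> S"
      show "?f \<omega> * (\<integral>\<^sup>+\<omega>'. ?Z \<omega>' \<partial>P (X ?t \<omega>)) \<le> ennreal c * indicator {\<omega>. ennreal ?t < \<sigma> \<omega>} \<omega>"
      proof (cases "ennreal ?t < \<sigma> \<omega>")
        case True
        then have zS: "X ?t \<omega> \<in> S" using stay t0 by (auto simp: \<sigma>_def)
        have zJ: "X ?t \<omega> \<in> J" using X_in_J[OF t0] w by auto
        interpret Z: prob_space "P (X ?t \<omega>)" by (rule prob_P[OF zJ])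
        have "(\<integral>\<^sup>+\<omega>'. ?Z \<omega>' \<partial>P (X ?t \<omega>)) = emeasure (P (X ?t \<omega>)) {\<omega>\<in>space A. ennreal t < \<sigma> \<omega>}"
          by (rule emeasure_eq_nn[OF zJ, symmetric]) measurable
        also have "\<dots> = ennreal (1 - measure (P (X ?t \<omega>)) {\<omega>\<in>space A. \<sigma> \<omega> \<le> ennreal t})"
          unfolding emeasure_P_eq[OF zJ]
        proof (rule arg_cong[of _ _ ennreal])
          have m: "{\<omega>\<in>space A. \<sigma> \<omega> \<le> ennreal t} \<in> sets (P (X ?t \<omega>))"
            unfolding sets_P_iff[OF zJ] by measurable
          have "{\<omega>\<in>space A. ennreal t < \<sigma> \<omega>} = space (P (X ?t \<omega>)) - {\<omega>\<in>space A. \<sigma> \<omega> \<le> ennreal t}"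
            using zJ by auto
          then show "measure (P (X ?t \<omega>)) {\<omega>\<in>space A. ennreal t < \<sigma> \<omega>} = 1 - measure (P (X ?t \<omega>)) {\<omega>\<in>space A. \<sigma> \<omega> \<le> ennreal t}"
            using Z.prob_compl[OF m] by simp
        qed
        also have "\<dots> \<le> ennreal c"
          using S[OF zS] by (intro ennreal_leI) (auto simp: c_def \<sigma>_def)
        finally show ?thesis using True w by simp
      qed simp
    qed
    also have "\<dots> = ennreal c * tail n"
      unfolding tail_def by (rule nn_integral_cmult) (use x in measurable)
    also have "\<dots> \<le> ennreal c * ennreal (c ^ n)" by (rule mult_left_mono[OF Suc]) simp
    finally show ?case using c by (simp add: ennreal_mult'[symmetric])
  qed
  have summ: "summable (\<lambda>n. t * c ^ n)" by (intro summable_mult summable_geometric) (use c in auto)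
  \<comment> \<open>The sum is \<open>t\<close> times the number of \<open>n\<close> with
    \<open>n * t\<close> below the exit time, that is, the exit time rounded up to a multiple of
    \<open>t\<close>.\<close>
  have "(\<integral>\<^sup>+\<omega>. \<sigma> \<omega> \<partial>P x) \<le> (\<integral>\<^sup>+\<omega>. (\<Sum>n. ennreal t * indicator {\<omega>. ennreal (real n * t) < \<sigma> \<omega>} \<omega>) \<partial>P x)"
  proof (rule nn_integral_mono)
    fix \<omega>
    show "\<sigma> \<omega> \<le> (\<Sum>n. ennreal t * indicator {\<omega>. ennreal (real n * t) < \<sigma> \<omega>} \<omega>)"
    proof -
      have part: "(\<Sum>n<N. ennreal t * indicator {\<omega>. ennreal (real n * t) < \<sigma> \<omega>} \<omega>)
           \<le> (\<Sum>n. ennreal t * indicator {\<omega>. ennreal (real n * t) < \<sigma> \<omega>} \<omega>)" for N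
        by (rule sum_le_suminf) auto
      have full: "(\<Sum>n<N. ennreal t * indicator {\<omega>. ennreal (real n * t) < \<sigma> \<omega>} \<omega>) = ennreal (real N * t)"
        if "\<And>n. n < N \<Longrightarrow> ennreal (real n * t) < \<sigma> \<omega>" for N
      proof -
        have "(\<Sum>n<N. ennreal t * indicator {\<omega>. ennreal (real n * t) < \<sigma> \<omega>} \<omega>) = (\<Sum>n<N. ennreal t)"
          by (rule sum.cong) (use that in auto)
        also have "\<dots> = ennreal (real N * t)" using t by (simp add: ennreal_mult ennreal_of_nat_eq_real_of_nat)
        finally show ?thesis .
      qed
      show ?thesis
      proof (cases "\<sigma> \<omega>")
        case (real r)
        define N where "N = nat \<lceil>r / t\<rceil>"
        have N: "r \<le> real N * t" "\<And>n. n < N \<Longrightarrow> real n * t < r"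
        proof -
          have "r / t \<le> real N" unfolding N_def by linarith
          then show "r \<le> real N * t" using t by (simp add: pos_divide_le_eq)
          fix n assume "n < N"
          then have "real n < r / t" unfolding N_def by linarith
          then show "real n * t < r" using t by (simp add: pos_less_divide_eq)
        qed
        have "\<sigma> \<omega> \<le> ennreal (real N * t)" using real N by (simp add: ennreal_leI)
        also have "\<dots> = (\<Sum>n<N. ennreal t * indicator {\<omega>. ennreal (real n * t) < \<sigma> \<omega>} \<omega>)"
          using full[of N] N(2) real t by (simp add: ennreal_less_iff)
        also note part
        finally show ?thesis .
      next
        case top
        have "ennreal (real N * t) \<le> (\<Sum>n. ennreal t * indicator {\<omega>. ennreal (real n * t) < \<sigma> \<omega>} \<omega>)" for N
          using full[of N] part[of N] top by simp
        moreover have "\<exists>N. b < real N * t" for b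
          using reals_Archimedean3[OF t] by blast
        ultimately have "(\<Sum>n. ennreal t * indicator {\<omega>. ennreal (real n * t) < \<sigma> \<omega>} \<omega>) = \<top>"
        proof -
          let ?s = "\<Sum>n. ennreal t * indicator {\<omega>. ennreal (real n * t) < \<sigma> \<omega>} \<omega>"
          show "?s = \<top>"
          proof (cases ?s)
            case (real r)
            obtain N :: nat where "r < real N * t" using \<open>\<exists>N. r < real N * t\<close> by auto
            then have "ennreal r < ennreal (real N * t)" using real by (simp add: ennreal_less_iff)
            also have "\<dots> \<le> ?s" by fact
            finally show ?thesis using real by simp
          qed
        qed
        then show ?thesis by simp
      qed
    qed
  qed
  also have "\<dots> = (\<Sum>n. ennreal t * tail n)"
    unfolding tail_def
    by (subst nn_integral_suminf, use x in measurable) (subst nn_integral_cmult, use x in measurable)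
  also have "\<dots> \<le> (\<Sum>n. ennreal (t * c ^ n))"
    using tail_le t by (intro suminf_le) (auto simp: ennreal_mult' intro!: mult_left_mono)
  also have "\<dots> = ennreal (\<Sum>n. t * c ^ n)"
    using t c by (intro suminf_ennreal2 summ) auto
  finally show ?thesis unfolding \<sigma>_def using le_less_trans ennreal_less_top by (metis infinity_ennreal_def)
qed

text \<open>A path that leaves \<open>r\<close> crosses a rational interior point, and there are
  only countably many of those to exclude.\<close>

lemma AE_not_hit_imp_stay:
  assumes r: "r \<in> J" and h: "\<And>a. a \<in> interior J \<Longrightarrow> a \<noteq> r \<Longrightarrow> AE \<omega> in P r. hit a \<omega> = \<top>"
  shows "AE \<omega> in P r. \<forall>t\<ge>0. X t \<omega> = r"
proof -
  have "AE \<omega> in P r. \<forall>a\<in>(interior J - {r}) \<inter> \<rat>. hit a \<omega> = \<top>"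
    by (subst AE_ball_countable) (use h in \<open>auto intro: countable_Int2 countable_rat\<close>)
  then show ?thesis using AE_start[OF r]
  proof eventually_elim
    fix \<omega> assume n: "\<forall>a\<in>(interior J - {r}) \<inter> \<rat>. hit a \<omega> = \<top>" and w: "\<omega> \<in> space A \<and> X 0 \<omega> = r"
    show "\<forall>t\<ge>0. X t \<omega> = r"
    proof (intro allI impI, rule ccontr)
      fix t :: real assume t: "0 \<le> t" "X t \<omega> \<noteq> r"
      have xj: "X t \<omega> \<in> J" using X_in_J t w by auto
      have "\<exists>q\<in>\<rat>. min r (X t \<omega>) < q \<and> q < max r (X t \<omega>)"
        by (rule Rats_dense_in_real) (use t in auto)
      then obtain q where q: "q \<in> \<rat>" "min r (X t \<omega>) < q" "q < max r (X t \<omega>)" by auto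
      have "q \<in> interior J" using interior_between[of r "X t \<omega>" q] interior_between[of "X t \<omega>" r q] q r xj
        by (auto simp: min_def max_def split: if_splits)
      then have "hit q \<omega> = \<top>" using n q by (auto simp: min_def max_def split: if_splits)
      moreover have "q \<in> closed_segment (X 0 \<omega>) (X t \<omega>)"
        using q w by (auto simp: closed_segment_eq_real_ivl min_def max_def split: if_splits)
      then have "hit q \<omega> \<le> ennreal t"
        using order_trans[OF hitting_between hitting_le[OF t(1) refl]] w by blast
      ultimately show False by (simp add: top_unique)
    qed
  qed
qed

end

section \<open>From scale and speed to exit probabilities and exit times\<close>

locale absorbing_natural_scale = regular_diffusion J A F X \<theta> P
  for J :: "real set" and A :: "'w measure" and F X \<theta> P +
  fixes M :: "real measure"
  assumes natural: "natural_scale J P X"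
    and speed: "speed_measure J P X (\<lambda>x. x) M"
    and absorb: "\<And>b. b \<in> boundary_points J \<Longrightarrow>
           regular_boundary J (\<lambda>x. x) (restrict_space M (interior J)) b \<Longrightarrow>
           absorbing J (\<lambda>x. x) M b"
begin

abbreviation "m \<equiv> restrict_space M (interior J)"

lemma interior_speed: "interior_speed_measure J P X (\<lambda>x. x) m"
  using speed by (simp add: speed_measure_def Let_def)

lemma sets_m: "sets m = sets (restrict_space borel (interior J))"
  and compact_m: "compact K \<Longrightarrow> K \<subseteq> interior J \<Longrightarrow> emeasure m K < \<infinity>"
  and green_m: "{a..b} \<subseteq> J \<Longrightarrow> a < x \<Longrightarrow> x < b \<Longrightarrow>
     (\<integral>\<^sup>+\<omega>. min (hit a \<omega>) (hit b \<omega>) \<partial>P x) = (\<integral>\<^sup>+y. ennreal (green (\<lambda>x. x) a b x y) \<partial>m)"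
  using interior_speed unfolding interior_speed_measure_def by blast+

lemma sets_m_Int: "S \<in> sets borel \<Longrightarrow> S \<subseteq> interior J \<Longrightarrow> S \<in> sets m"
  unfolding sets_m by (subst sets_restrict_space_iff) auto

lemma green_le:
  assumes "a < x" "x < b"
  shows "green (\<lambda>x. x) a b x y \<le> 2 * (x - a)" "green (\<lambda>x. x) a b x y \<le> 2 * (b - x)"
proof -
  have ba: "a < b" using assms by simp
  show "green (\<lambda>x. x) a b x y \<le> 2 * (x - a)"
  proof (cases "y \<in> {a<..<b}")
    case True
    have "2 * (min x y - a) * (b - max x y) \<le> 2 * (x - a) * (b - a)"
      using assms True by (intro mult_mono) auto
    then show ?thesis using assms True ba unfolding green_def by (simp add: pos_divide_le_eq)
  qed (use assms in \<open>auto simp: green_def\<close>)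
  show "green (\<lambda>x. x) a b x y \<le> 2 * (b - x)"
  proof (cases "y \<in> {a<..<b}")
    case True
    have "2 * (min x y - a) * (b - max x y) \<le> 2 * (b - a) * (b - x)"
      using assms True by (intro mult_mono) auto
    also have "\<dots> = 2 * (b - x) * (b - a)" by (simp add: algebra_simps)
    finally show ?thesis using assms True ba unfolding green_def by (simp add: pos_divide_le_eq)
  qed (use assms in \<open>auto simp: green_def\<close>)
qed

text \<open>Either distance may be chosen as the factor, so the bound vanishes as \<open>x\<close>
  approaches the end point that is of interest.\<close>

lemma exit_time_le:
  assumes ab: "a \<in> interior J" "b \<in> interior J" and x: "a < x" "x < b" and c: "c = x - a \<or> c = b - x"
  shows "(\<integral>\<^sup>+\<omega>. min (hit a \<omega>) (hit b \<omega>) \<partial>P x) \<le> ennreal (2 * c) * emeasure m {a..b}"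
proof -
  have sub: "{a..b} \<subseteq> interior J"
    using ab interior_between[of a b] interior_subset[of J] by (force simp: le_less)
  have "(\<integral>\<^sup>+\<omega>. min (hit a \<omega>) (hit b \<omega>) \<partial>P x) = (\<integral>\<^sup>+y. ennreal (green (\<lambda>x. x) a b x y) \<partial>m)"
    using sub interior_subset[of J] x by (intro green_m) auto
  also have "\<dots> \<le> (\<integral>\<^sup>+y. ennreal (2 * c) * indicator {a..b} y \<partial>m)"
  proof (rule nn_integral_mono)
    fix y
    show "ennreal (green (\<lambda>x. x) a b x y) \<le> ennreal (2 * c) * indicator {a..b} y"
      using green_le[OF x, of y] c by (auto simp: green_def split: split_indicator intro!: ennreal_leI)
  qed
  also have "\<dots> = ennreal (2 * c) * emeasure m {a..b}"
    by (rule nn_integral_cmult_indicator) (use sub in \<open>auto intro: sets_m_Int\<close>)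
  finally show ?thesis .
qed

lemma scale_up: "a \<in> J \<Longrightarrow> b \<in> J \<Longrightarrow> a < x \<Longrightarrow> x < b \<Longrightarrow>
   measure (P x) (hit_before b a) = (x - a) / (b - a)"
proof -
  assume a: "a \<in> J" "b \<in> J" "a < x" "x < b"
  then have x: "x \<in> J" using interior_between interior_subset by blast
  show ?thesis
    using natural a J_Icc[OF a(1,2)] unfolding natural_scale_def scale_function_def space_P[OF x, symmetric] by blast
qed

lemma hit_pos_time:
  assumes x: "x \<in> J" and pos: "0 < measure (P x) {\<omega>\<in>space A. hit y \<omega> < \<infinity>}"
  shows "\<exists>T. \<forall>t\<ge>T. 0 < measure (P x) (hit_by y t)"
proof -
  interpret prob_space "P x" by (rule prob_P[OF x])
  let ?A = "\<lambda>n. (hit_by y (real n))"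
  have sA: "?A n \<in> sets (P x)" for n using x by (simp add: sets_P_iff)
  have "incseq ?A"
    by (rule incseq_SucI) (auto simp del: of_nat_Suc intro: order_trans[OF _ ennreal_leI])
  from finite_Lim_measure_incseq[OF _ this] sA
  have lim: "(\<lambda>n. measure (P x) (?A n)) \<longlonglongrightarrow> measure (P x) (\<Union>n. ?A n)" by auto
  have "(\<Union>n. ?A n) = {\<omega>\<in>space A. hit y \<omega> < \<infinity>}"
  proof (intro equalityI subsetI)
    fix \<omega> assume w: "\<omega> \<in> {\<omega>\<in>space A. hit y \<omega> < \<infinity>}"
    then obtain r where r: "hit y \<omega> = ennreal r" by (cases "hit y \<omega>") auto
    obtain n :: nat where "r < real n" using reals_Archimedean2 by blast
    then show "\<omega> \<in> (\<Union>n. ?A n)" using w r by (auto intro!: exI[of _ n] ennreal_leI)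
  qed (auto intro: le_less_trans)
  then have "\<forall>\<^sub>F n in sequentially. 0 < measure (P x) (?A n)"
    using lim pos by (auto dest: order_tendstoD(1))
  then obtain n where n: "0 < measure (P x) (?A n)" by (auto simp: eventually_sequentially)
  show ?thesis
  proof (intro exI allI impI)
    fix t assume "real n \<le> t"
    then have "measure (P x) (?A n) \<le> measure (P x) (hit_by y t)"
      using x by (intro finite_measure_mono Collect_mono) (auto simp: sets_P_iff intro: order_trans[OF _ ennreal_leI])
    then show "0 < measure (P x) (hit_by y t)" using n by simp
  qed
qed

lemma hit_between_prob':
  assumes "x \<in> J" "y \<in> closed_segment x z" "z \<in> J"
  shows "measure (P x) (hit_by z t) \<le> measure (P y) (hit_by z t)"
proof -
  have y: "y \<in> J" using assms J_seg[of x z] by auto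
  show ?thesis
    using hit_between_prob[OF assms(1,2) y, of "ennreal t"]
    by (simp add: emeasure_P_eq assms(1) y)
qed

text \<open>A start \<open>z\<close> to the left of \<open>x\<close> lies on the way from
  \<open>x\<close> to \<open>a\<close>, a start to the right on the way to \<open>b\<close>. Hence
  the positive hitting probabilities from the single point \<open>x\<close> bound those from the
  whole interval, as the geometric tail requires.\<close>

lemma exit_finite:
  assumes ab: "a \<in> J" "b \<in> J" and x: "a < x" "x < b"
  shows "AE \<omega> in P x. min (hit a \<omega>) (hit b \<omega>) < \<top>"
proof -
  have xi: "x \<in> interior J" and xJ: "x \<in> J" using interior_between[OF ab x] interior_subset by auto
  obtain T where T: "\<forall>t\<ge>T. 0 < measure (P x) (hit_by a t)"
    using hit_pos_time[OF xJ, of a] regular[OF xi ab(1)] xJ by auto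
  obtain T' where T': "\<forall>t\<ge>T'. 0 < measure (P x) (hit_by b t)"
    using hit_pos_time[OF xJ, of b] regular[OF xi ab(2)] xJ by auto
  define t where "t = max 1 (max T T')"
  define p where "p = min (measure (P x) (hit_by a t)) (measure (P x) (hit_by b t))"
  have "(\<integral>\<^sup>+\<omega>. min (hit a \<omega>) (hit b \<omega>) \<partial>P x) < \<infinity>"
  proof (rule geometric_tail[OF xJ, of t p "{a<..<b}"])
    show "0 < t" "0 < p" using T T' by (auto simp: t_def p_def)
    fix z assume z: "z \<in> {a<..<b}"
    then have zJ: "z \<in> J" using J_Icc[OF ab] by auto
    interpret prob_space "P z" by (rule prob_P[OF zJ])
    have sub: "measure (P z) (hit_by c t)
        \<le> measure (P z) {\<omega>\<in>space A. min (hit a \<omega>) (hit b \<omega>) \<le> ennreal t}" if "c = a \<or> c = b" for c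
      using that zJ by (intro finite_measure_mono) (auto simp: sets_P_iff min_le_iff_disj)
    show "p \<le> measure (P z) {\<omega>\<in>space A. min (hit a \<omega>) (hit b \<omega>) \<le> ennreal t}"
    proof (cases "z \<le> x")
      case True
      have "p \<le> measure (P x) (hit_by a t)" by (simp add: p_def)
      also have "\<dots> \<le> measure (P z) (hit_by a t)"
        by (rule hit_between_prob'[OF xJ _ ab(1)]) (use True z in \<open>auto simp: closed_segment_eq_real_ivl\<close>)
      finally show ?thesis using sub[of a] by auto
    next
      case False
      have "p \<le> measure (P x) (hit_by b t)" by (simp add: p_def)
      also have "\<dots> \<le> measure (P z) (hit_by b t)"
        by (rule hit_between_prob'[OF xJ _ ab(2)]) (use False z in \<open>auto simp: closed_segment_eq_real_ivl\<close>)
      finally show ?thesis using sub[of b] by auto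
    qed
  next
    show "AE \<omega> in P x. \<forall>s\<ge>0. ennreal s < min (hit a \<omega>) (hit b \<omega>) \<longrightarrow> X s \<omega> \<in> {a<..<b}"
      using AE_start[OF xJ] by eventually_elim (use x path_above path_below in auto)
  qed
  then have "(\<integral>\<^sup>+\<omega>. min (hit a \<omega>) (hit b \<omega>) \<partial>P x) \<noteq> \<infinity>" by simp
  then have "AE \<omega> in P x. min (hit a \<omega>) (hit b \<omega>) \<noteq> \<infinity>"
    by (intro nn_integral_noteq_infinite) (use xJ in measurable)
  then show ?thesis by eventually_elim (auto simp: less_top)
qed

text \<open>The scale function prescribes the probability of leaving at the upper end; that the
  complementary event is leaving at the lower end requires the exit to happen at all.\<close>

lemma scale_down: 
  assumes ab: "a \<in> J" "b \<in> J" and x: "a < x" "x < b"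
  shows "measure (P x) (hit_before a b) = (b - x) / (b - a)"
proof -
  have xJ: "x \<in> J" using interior_between[OF ab x] interior_subset by auto
  interpret prob_space "P x" by (rule prob_P[OF xJ])
  have "measure (P x) (hit_before a b)
      = measure (P x) (space (P x) - (hit_before b a))"
  proof (rule finite_measure_eq_AE)
    show "AE \<omega> in P x. (\<omega> \<in> (hit_before a b))
        = (\<omega> \<in> space (P x) - (hit_before b a))"
      using exit_finite[OF ab x] AE_start[OF xJ]
    proof eventually_elim
      fix \<omega> assume f: "min (hit a \<omega>) (hit b \<omega>) < \<top>" and w: "\<omega> \<in> space A \<and> X 0 \<omega> = x"
      have "hit a \<omega> \<noteq> hit b \<omega>"
        using hitting_eq_imp_top[of \<omega> a b] f w x by auto
      then show "(\<omega> \<in> (hit_before a b))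
        = (\<omega> \<in> space (P x) - (hit_before b a))"
        using w xJ by auto
    qed
  qed (use xJ in \<open>auto simp: sets_P_iff\<close>)
  also have "\<dots> = 1 - (x - a) / (b - a)"
    using scale_up[OF ab x] xJ by (subst prob_compl) (auto simp: sets_P_iff)
  also have "\<dots> = (b - x) / (b - a)" using x by (simp add: field_simps)
  finally show ?thesis .
qed

lemma exit_two_sided:
  assumes "a \<in> J" "b \<in> J" "a < x \<and> x < b \<or> b < x \<and> x < a"
  shows "measure (P x) (hit_before b a) = \<bar>x - a\<bar> / \<bar>b - a\<bar>"
  using assms scale_up[of a b x] scale_down[of b a x] by auto

text \<open>If \<open>a\<close> is late although it precedes \<open>b\<close>, then the exit time
  itself exceeds \<delta>, which Markov's inequality controls.\<close>

lemma time_gt_le: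
  assumes x: "x \<in> J" and d: "0 < \<delta>"
  shows "emeasure (P x) {\<omega>\<in>space A. ennreal \<delta> < hit a \<omega>}
    \<le> emeasure (P x) (hit_before b a)
     + ennreal (1 / \<delta>) * (\<integral>\<^sup>+\<omega>. min (hit a \<omega>) (hit b \<omega>) \<partial>P x)"
proof -
  have "emeasure (P x) {\<omega>\<in>space A. ennreal \<delta> < hit a \<omega>} = (\<integral>\<^sup>+\<omega>. indicator {\<omega>. ennreal \<delta> < hit a \<omega>} \<omega> \<partial>P x)"
    by (rule emeasure_eq_nn[OF x]) measurable
  also have "\<dots> \<le> (\<integral>\<^sup>+\<omega>. indicator {\<omega>. hit b \<omega> < hit a \<omega>} \<omega>
      + ennreal (1 / \<delta>) * min (hit a \<omega>) (hit b \<omega>) \<partial>P x)"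
  proof (rule nn_integral_mono)
    fix \<omega>
    show "indicator {\<omega>. ennreal \<delta> < hit a \<omega>} \<omega> \<le> indicator {\<omega>. hit b \<omega> < hit a \<omega>} \<omega>
      + ennreal (1 / \<delta>) * min (hit a \<omega>) (hit b \<omega>)"
    proof (cases "ennreal \<delta> < hit a \<omega> \<and> hit a \<omega> \<le> hit b \<omega>")
      case True
      have "1 = ennreal (1 / \<delta>) * ennreal \<delta>" using d by (simp flip: ennreal_mult)
      also have "\<dots> \<le> ennreal (1 / \<delta>) * min (hit a \<omega>) (hit b \<omega>)"
        by (rule mult_left_mono) (use True in auto)
      finally show ?thesis using True by (simp add: indicator_def)
    qed (auto split: split_indicator simp: not_le)
  qed
  also have "\<dots> = (\<integral>\<^sup>+\<omega>. indicator {\<omega>. hit b \<omega> < hit a \<omega>} \<omega> \<partial>P x)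
      + ennreal (1 / \<delta>) * (\<integral>\<^sup>+\<omega>. min (hit a \<omega>) (hit b \<omega>) \<partial>P x)"
    by (subst nn_integral_add, use x in measurable) (subst nn_integral_cmult, use x in measurable)
  also have "(\<integral>\<^sup>+\<omega>. indicator {\<omega>. hit b \<omega> < hit a \<omega>} \<omega> \<partial>P x)
     = emeasure (P x) (hit_before b a)"
    by (rule emeasure_eq_nn[OF x, symmetric]) measurable
  finally show ?thesis .
qed

text \<open>Near \<open>x\<close> both terms of \<open>time_gt_le\<close> are linear in the distance
  to \<open>x\<close>: the first by the scale function, the second by the Green function and the
  finite mass of a compact interval. The two sides are estimated separately.\<close>

lemma attain_interior:
  assumes x: "x \<in> interior J" and d: "0 < \<delta>"
  shows "((\<lambda>z. measure (P z) {\<omega>\<in>space A. ennreal \<delta> < hit x \<omega>}) \<longlongrightarrow> 0) (at x)"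
proof -
  obtain e where e: "0 < e" "ball x e \<subseteq> interior J"
    using x open_interior openE by blast
  define a where "a = x - e / 2"
  define b where "b = x + e / 2"
  have ab: "a < x" "x < b" "a \<in> interior J" "b \<in> interior J"
    using e by (auto simp: a_def b_def dist_real_def subset_iff)
  have xJ: "x \<in> J" "a \<in> J" "b \<in> J" using ab x interior_subset by auto
  let ?f = "\<lambda>z. measure (P z) {\<omega>\<in>space A. ennreal \<delta> < hit x \<omega>}"
  have "{a..b} \<subseteq> interior J"
    using ab interior_between[of a b] xJ by (force simp: le_less)
  have fin: "emeasure m {c..d} = ennreal (measure m {c..d})" if "a \<le> c" "d \<le> b" for c d
    using that compact_m[of "{c..d}"] \<open>{a..b} \<subseteq> interior J\<close>
    by (intro emeasure_eq_ennreal_measure) (auto simp: subset_iff)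
  have r: "?f z \<le> (z - x) / (b - x) + 1 / \<delta> * (2 * (z - x) * measure m {x..b})" if z: "x < z" "z < b" for z
  proof -
    have zJ: "z \<in> J" using z J_Icc[OF xJ(1,3)] by auto
    have "ennreal (?f z) \<le> ennreal ((z - x) / (b - x)) + ennreal (1 / \<delta>) * (ennreal (2 * (z - x)) * emeasure m {x..b})"
      unfolding emeasure_P_eq[OF zJ, symmetric]
      by (rule order_trans[OF time_gt_le[OF zJ d, where b=b]])
        (use z ab xJ x zJ scale_up[of x b z] exit_time_le[of x b z "z - x"] in
          \<open>auto intro!: add_mono mult_left_mono simp: emeasure_P_eq\<close>)
    also have "\<dots> = ennreal ((z - x) / (b - x) + 1 / \<delta> * (2 * (z - x) * measure m {x..b}))"
      using z d ab by (simp add: fin ennreal_mult'[symmetric] flip: ennreal_plus)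
    finally show ?thesis
      using z d by (subst (asm) ennreal_le_iff) (auto intro!: add_nonneg_nonneg mult_nonneg_nonneg divide_nonneg_nonneg)
  qed
  have l: "?f z \<le> (x - z) / (x - a) + 1 / \<delta> * (2 * (x - z) * measure m {a..x})" if z: "a < z" "z < x" for z
  proof -
    have zJ: "z \<in> J" using z J_Icc[OF xJ(2,1)] by auto
    have "ennreal (?f z) \<le> ennreal ((x - z) / (x - a)) + ennreal (1 / \<delta>) * (ennreal (2 * (x - z)) * emeasure m {a..x})"
      unfolding emeasure_P_eq[OF zJ, symmetric]
      by (rule order_trans[OF time_gt_le[OF zJ d, where b=a]])
        (use z ab xJ x zJ scale_down[of a x z] exit_time_le[of a x z "x - z"] in
          \<open>auto intro!: add_mono mult_left_mono simp: emeasure_P_eq min.commute\<close>)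
    also have "\<dots> = ennreal ((x - z) / (x - a) + 1 / \<delta> * (2 * (x - z) * measure m {a..x}))"
      using z d ab by (simp add: fin ennreal_mult'[symmetric] flip: ennreal_plus)
    finally show ?thesis
      using z d by (subst (asm) ennreal_le_iff) (auto intro!: add_nonneg_nonneg mult_nonneg_nonneg divide_nonneg_nonneg)
  qed
  have "(?f \<longlongrightarrow> 0) (at_right x)"
  proof (rule tendsto_sandwich[OF _ _ tendsto_const])
    show "\<forall>\<^sub>F z in at_right x. ?f z \<le> (z - x) / (b - x) + 1 / \<delta> * (2 * (z - x) * measure m {x..b})"
      using r ab unfolding eventually_at_right_field by blast
    have "((\<lambda>z. (z - x) / (b - x) + 1 / \<delta> * (2 * (z - x) * measure m {x..b})) \<longlongrightarrow> (x - x) / (b - x) + 1 / \<delta> * (2 * (x - x) * measure m {x..b})) (at_right x)"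
      using ab by (intro tendsto_intros) auto
    then show "((\<lambda>z. (z - x) / (b - x) + 1 / \<delta> * (2 * (z - x) * measure m {x..b})) \<longlongrightarrow> 0) (at_right x)"
      by simp
  qed auto
  moreover have "(?f \<longlongrightarrow> 0) (at_left x)"
  proof (rule tendsto_sandwich[OF _ _ tendsto_const])
    show "\<forall>\<^sub>F z in at_left x. ?f z \<le> (x - z) / (x - a) + 1 / \<delta> * (2 * (x - z) * measure m {a..x})"
      using l ab unfolding eventually_at_left_field by blast
    have "((\<lambda>z. (x - z) / (x - a) + 1 / \<delta> * (2 * (x - z) * measure m {a..x})) \<longlongrightarrow> (x - x) / (x - a) + 1 / \<delta> * (2 * (x - x) * measure m {a..x})) (at_left x)"
      using ab by (intro tendsto_intros) auto
    then show "((\<lambda>z. (x - z) / (x - a) + 1 / \<delta> * (2 * (x - z) * measure m {a..x})) \<longlongrightarrow> 0) (at_left x)"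
      by simp
  qed auto
  ultimately show ?thesis by (simp add: filterlim_at_split)
qed

end

section \<open>End points in the state space are traps\<close>

context absorbing_natural_scale
begin

text \<open>Let \<open>w\<close> be the expected time from \<open>r\<close> to \<open>a\<close>. The
  time from \<open>x\<close> is at most \<open>w\<close>, since \<open>x\<close> lies on the way,
  and at least the exit time plus the probability of returning to \<open>r\<close> times
  \<open>w\<close>. As \<open>w\<close> is finite, it can be subtracted.\<close>

lemma return_inequality:
  assumes r: "r \<in> J" and a: "a \<in> J" and x: "a < x \<and> x < r \<or> r < x \<and> x < a"
    and fin: "(\<integral>\<^sup>+\<omega>. hit a \<omega> \<partial>P r) < \<infinity>"
  shows "(\<integral>\<^sup>+\<omega>. min (hit a \<omega>) (hit r \<omega>) \<partial>P x)
     \<le> ennreal (\<bar>r - x\<bar> / \<bar>r - a\<bar>) * (\<integral>\<^sup>+\<omega>. hit a \<omega> \<partial>P r)"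
proof -
  have xJ: "x \<in> J" using x interior_between[OF a r] interior_between[OF r a] interior_subset by blast
  let ?w = "\<integral>\<^sup>+\<omega>. hit a \<omega> \<partial>P r" and ?v = "\<integral>\<^sup>+\<omega>. hit a \<omega> \<partial>P x"
  let ?h = "\<integral>\<^sup>+\<omega>. min (hit a \<omega>) (hit r \<omega>) \<partial>P x"
  let ?x = "hit x" and ?a = "hit a" and ?r = "hit r"
  have shm: "(\<lambda>\<omega>. ?a (\<theta> (enn2real (hit z \<omega>)) \<omega>)) \<in> borel_measurable A" for z
    by (rule measurable_compose[OF theta_meas]) auto
  have hit: "AE \<omega> in P r. ?a \<omega> \<noteq> \<infinity>"
    by (rule nn_integral_noteq_infinite) (use r fin in auto)
  have seg: "x \<in> closed_segment r a" using x by (auto simp: closed_segment_eq_real_ivl)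
  have "?v \<le> ?w"
  proof -
    have "?v = (\<integral>\<^sup>+\<omega>. 1 * indicator {\<omega>. ?x \<omega> < \<infinity>} \<omega> \<partial>P r) * ?v"
    proof -
      have "(\<integral>\<^sup>+\<omega>. 1 * indicator {\<omega>. ?x \<omega> < \<infinity>} \<omega> \<partial>P r) = (\<integral>\<^sup>+\<omega>. 1 \<partial>P r)"
      proof (rule nn_integral_cong_AE, use AE_start[OF r] hit in eventually_elim)
        fix \<omega> assume "\<omega> \<in> space A \<and> X 0 \<omega> = r" "?a \<omega> \<noteq> \<infinity>"
        then show "1 * indicator {\<omega>. ?x \<omega> < \<infinity>} \<omega> = (1::ennreal)"
          using hitting_between[of \<omega> x a] seg by (auto simp: less_top top_unique intro: le_less_trans)
      qed
      then show ?thesis using nn_const[OF r, of 1] by simp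
    qed
    also have "\<dots> = (\<integral>\<^sup>+\<omega>. 1 * (?a (\<theta> (enn2real (?x \<omega>)) \<omega>) * indicator {\<omega>. ?x \<omega> < \<infinity>} \<omega>) \<partial>P r)"
      by (rule strong_Markov_hitting[OF r, symmetric]) auto
    also have "\<dots> \<le> ?w"
    proof (rule nn_integral_mono_AE, use AE_start[OF r] in eventually_elim)
      fix \<omega> assume w: "\<omega> \<in> space A \<and> X 0 \<omega> = r"
      then have le: "?x \<omega> \<le> ?a \<omega>" using hitting_between[of \<omega> x a] seg by auto
      show "1 * (?a (\<theta> (enn2real (?x \<omega>)) \<omega>) * indicator {\<omega>. ?x \<omega> < \<infinity>} \<omega>) \<le> ?a \<omega>"
      proof (cases "?x \<omega> < \<top>")
        case True
        then show ?thesis using hitting_shift_hitting[OF _ le True] w by simp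
      qed simp
    qed
    finally show ?thesis .
  qed
  moreover have "?h + ennreal (\<bar>x - a\<bar> / \<bar>r - a\<bar>) * ?w \<le> ?v"
  proof -
    let ?f = "\<lambda>\<omega>. indicator {\<omega>. ?r \<omega> < ?a \<omega>} \<omega> :: ennreal"
    have "(\<integral>\<^sup>+\<omega>. ?f \<omega> * indicator {\<omega>. ?r \<omega> < \<infinity>} \<omega> \<partial>P x) = (\<integral>\<^sup>+\<omega>. ?f \<omega> \<partial>P x)"
      by (rule nn_integral_cong) (auto split: split_indicator simp: less_top[symmetric])
    also have "\<dots> = emeasure (P x) {\<omega>\<in>space A. ?r \<omega> < ?a \<omega>}"
      by (rule emeasure_eq_nn[OF xJ, symmetric]) measurable
    also have "\<dots> = ennreal (\<bar>x - a\<bar> / \<bar>r - a\<bar>)"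
      unfolding emeasure_P_eq[OF xJ] using exit_two_sided[OF a r x] by simp
    finally have "ennreal (\<bar>x - a\<bar> / \<bar>r - a\<bar>) * ?w = (\<integral>\<^sup>+\<omega>. ?f \<omega> * indicator {\<omega>. ?r \<omega> < \<infinity>} \<omega> \<partial>P x) * ?w"
      by simp
    also have "\<dots> = (\<integral>\<^sup>+\<omega>. ?f \<omega> * (?a (\<theta> (enn2real (?r \<omega>)) \<omega>) * indicator {\<omega>. ?r \<omega> < \<infinity>} \<omega>) \<partial>P x)"
      by (rule strong_Markov_hitting[OF xJ, symmetric]) (auto intro: less_hitting_stopped)
    finally have "?h + ennreal (\<bar>x - a\<bar> / \<bar>r - a\<bar>) * ?w = ?h + \<dots>" by simp
    also have "\<dots> = (\<integral>\<^sup>+\<omega>. min (?a \<omega>) (?r \<omega>) + ?f \<omega> * (?a (\<theta> (enn2real (?r \<omega>)) \<omega>) * indicator {\<omega>. ?r \<omega> < \<infinity>} \<omega>) \<partial>P x)"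
      by (rule nn_integral_add[symmetric]; rule P_meas[OF xJ]) (use shm in measurable)
    also have "\<dots> \<le> ?v"
    proof (rule nn_integral_mono)
      fix \<omega> assume "\<omega> \<in> space (P x)"
      then have w: "\<omega> \<in> space A" using xJ by simp
      show "min (?a \<omega>) (?r \<omega>) + ?f \<omega> * (?a (\<theta> (enn2real (?r \<omega>)) \<omega>) * indicator {\<omega>. ?r \<omega> < \<infinity>} \<omega>) \<le> ?a \<omega>"
      proof (cases "?r \<omega> < ?a \<omega>")
        case True
        then have f: "?r \<omega> < \<top>" using less_top by fastforce
        show ?thesis using hitting_shift_hitting[OF w less_imp_le[OF True] f] f True by (simp add: min_absorb2)
      qed auto
    qed
    finally show ?thesis .
  qed
  ultimately have le: "?h + ennreal (\<bar>x - a\<bar> / \<bar>r - a\<bar>) * ?w \<le> ?w" by (rule order_trans[rotated])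
  obtain w where w: "?w = ennreal w" "0 \<le> w" using fin by (cases ?w) auto
  have "?h \<noteq> \<top>" using le fin by (auto simp: top_unique)
  then obtain h where h: "?h = ennreal h" "0 \<le> h" by (cases ?h) auto
  have "h + \<bar>x - a\<bar> / \<bar>r - a\<bar> * w \<le> w"
    using le h(2) w(2) unfolding h(1) w(1)
    by (simp add: ennreal_mult'[symmetric] flip: ennreal_plus)
  moreover have "\<bar>x - a\<bar> / \<bar>r - a\<bar> + \<bar>r - x\<bar> / \<bar>r - a\<bar> = 1"
    using x by (auto simp: add_divide_distrib[symmetric])
  then have "\<bar>x - a\<bar> / \<bar>r - a\<bar> * w + \<bar>r - x\<bar> / \<bar>r - a\<bar> * w = w"
    by (metis distrib_right mult_1)
  ultimately have "h \<le> \<bar>r - x\<bar> / \<bar>r - a\<bar> * w" by linarith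
  then show ?thesis
    unfolding h(1) w(1) by (subst ennreal_mult'[symmetric]) (auto intro: ennreal_leI)
qed

lemma m_meas: "f \<in> measurable borel N \<Longrightarrow> f \<in> measurable m N"
  unfolding measurable_cong_sets[OF sets_m refl] by (rule measurable_restrict_space1)

text \<open>On \<open>(a, x]\<close> the Green function dominates
  \<open>(y - a) * (r - x) / (r - a)\<close>. The factor \<open>(r - x) / (r - a)\<close> is exactly
  the one in \<open>return_inequality\<close>, so it cancels and the bound is uniform in
  \<open>x\<close>.\<close>

lemma boundary_v_right:
  assumes r: "r \<in> J" and a: "a \<in> interior J" and x: "a < x" "x < r"
    and fin: "(\<integral>\<^sup>+\<omega>. hit a \<omega> \<partial>P r) < \<infinity>"
  shows "(\<integral>\<^sup>+y\<in>{a<..x}. ennreal (y - a) \<partial>m) \<le> (\<integral>\<^sup>+\<omega>. hit a \<omega> \<partial>P r)"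
proof -
  let ?w = "\<integral>\<^sup>+\<omega>. hit a \<omega> \<partial>P r"
  have aJ: "a \<in> J" using a interior_subset by auto
  have xJ: "x \<in> interior J" using interior_between[OF aJ r x] .
  have sub: "{a<..x} \<subseteq> interior J" using interior_between[OF aJ r] x by auto
  let ?c = "(r - x) / (r - a)"
  have c: "0 < ?c" using x by auto
  have "ennreal ?c * (\<integral>\<^sup>+y\<in>{a<..x}. ennreal (y - a) \<partial>m) = (\<integral>\<^sup>+y. ennreal ?c * (ennreal (y - a) * indicator {a<..x} y) \<partial>m)"
    by (rule nn_integral_cmult[symmetric], rule m_meas) measurable
  also have "\<dots> \<le> (\<integral>\<^sup>+y. ennreal (green (\<lambda>x. x) a r x y) \<partial>m)"
  proof (rule nn_integral_mono)
    fix y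
    show "ennreal ?c * (ennreal (y - a) * indicator {a<..x} y) \<le> ennreal (green (\<lambda>x. x) a r x y)"
    proof (cases "y \<in> {a<..x}")
      case True
      have "?c * (y - a) \<le> 2 * (y - a) * (r - x) / (r - a)"
        using True x by (simp add: divide_right_mono)
      then have "ennreal (?c * (y - a)) \<le> ennreal (green (\<lambda>x. x) a r x y)"
        using True x by (intro ennreal_leI) (auto simp: green_def)
      moreover have "ennreal ?c * ennreal (y - a) = ennreal (?c * (y - a))"
        by (rule ennreal_mult[symmetric]) (use c True in auto)
      ultimately show ?thesis using True by (simp only: indicator_simps mult_1_right)
    qed simp
  qed
  also have "\<dots> = (\<integral>\<^sup>+\<omega>. min (hit a \<omega>) (hit r \<omega>) \<partial>P x)"
    by (rule green_m[symmetric]) (use J_Icc[OF aJ r] x in auto)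
  also have "\<dots> \<le> ennreal (\<bar>r - x\<bar> / \<bar>r - a\<bar>) * ?w"
    by (rule return_inequality[OF r aJ _ fin]) (use x in auto)
  also have "\<dots> = ennreal ?c * ?w" using x by simp
  finally have le: "ennreal ?c * (\<integral>\<^sup>+y\<in>{a<..x}. ennreal (y - a) \<partial>m) \<le> ennreal ?c * ?w" .
  have "ennreal ?c \<noteq> 0" "ennreal ?c \<noteq> \<top>" using c by auto
  then show ?thesis using le ennreal_mult_le_mult_iff by blast
qed

lemma boundary_v_left:
  assumes r: "r \<in> J" and a: "a \<in> interior J" and x: "r < x" "x < a"
    and fin: "(\<integral>\<^sup>+\<omega>. hit a \<omega> \<partial>P r) < \<infinity>"
  shows "(\<integral>\<^sup>+y\<in>{x<..a}. ennreal (a - y) \<partial>m) \<le> (\<integral>\<^sup>+\<omega>. hit a \<omega> \<partial>P r)"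
proof -
  let ?w = "\<integral>\<^sup>+\<omega>. hit a \<omega> \<partial>P r"
  have aJ: "a \<in> J" using a interior_subset by auto
  let ?c = "(x - r) / (a - r)"
  have c: "0 < ?c" using x by auto
  have "ennreal ?c * (\<integral>\<^sup>+y\<in>{x<..a}. ennreal (a - y) \<partial>m) = (\<integral>\<^sup>+y. ennreal ?c * (ennreal (a - y) * indicator {x<..a} y) \<partial>m)"
    by (rule nn_integral_cmult[symmetric], rule m_meas) measurable
  also have "\<dots> \<le> (\<integral>\<^sup>+y. ennreal (green (\<lambda>x. x) r a x y) \<partial>m)"
  proof (rule nn_integral_mono)
    fix y
    show "ennreal ?c * (ennreal (a - y) * indicator {x<..a} y) \<le> ennreal (green (\<lambda>x. x) r a x y)"
    \<comment> \<open>The interval is closed at \<open>a\<close>, where the Green function is zero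
      by convention but the integrand vanishes as well.\<close>
    proof (cases "y \<in> {x<..<a}")
      case True
      have "?c * (a - y) \<le> 2 * (x - r) * (a - y) / (a - r)"
        using True x by (simp add: divide_right_mono)
      then have "ennreal (?c * (a - y)) \<le> ennreal (green (\<lambda>x. x) r a x y)"
        using True x by (intro ennreal_leI) (auto simp: green_def)
      moreover have "ennreal ?c * ennreal (a - y) = ennreal (?c * (a - y))"
        by (rule ennreal_mult[symmetric]) (use c True in auto)
      moreover have "y \<in> {x<..a}" using True by simp
      ultimately show ?thesis by (simp only: indicator_simps mult_1_right)
    next
      case False
      then have "ennreal (a - y) * indicator {x<..a} y = 0"
        by (cases "y = a") (auto split: split_indicator)
      then show ?thesis by (simp only: mult_zero_right zero_le)
    qed
  qed
  also have "\<dots> = (\<integral>\<^sup>+\<omega>. min (hit a \<omega>) (hit r \<omega>) \<partial>P x)"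
    by (subst min.commute, rule green_m[symmetric]) (use J_Icc[OF r aJ] x in auto)
  also have "\<dots> \<le> ennreal (\<bar>r - x\<bar> / \<bar>r - a\<bar>) * ?w"
    by (rule return_inequality[OF r aJ _ fin]) (use x in auto)
  also have "\<dots> = ennreal ?c * ?w" using x by simp
  finally have le: "ennreal ?c * (\<integral>\<^sup>+y\<in>{x<..a}. ennreal (a - y) \<partial>m) \<le> ennreal ?c * ?w" .
  have "ennreal ?c \<noteq> 0" "ennreal ?c \<noteq> \<top>" using c by auto
  then show ?thesis using le ennreal_mult_le_mult_iff by blast
qed

lemma emeasure_stieltjes: "l \<le> r \<Longrightarrow> emeasure (stieltjes (\<lambda>x. x) l r) {l<..r} = ennreal (r - l)"
  unfolding stieltjes_def
  by (subst emeasure_interval_measure_Ioc)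
    (auto intro!: continuous_intros continuous_on_imp_continuous_within[of UNIV])

lemma sets_stieltjes: "sets (stieltjes s l r) = sets borel"
  by (simp add: stieltjes_def)

text \<open>Chebyshev's inequality where \<open>g\<close> is at least \<open>d\<close>. On the
  exceptional set \<open>K\<close>, where \<open>g\<close> may be small, compactness bounds the
  mass.\<close>

lemma mass_bound:
  assumes fin: "w < \<infinity>" and S: "S \<in> sets borel" "S \<subseteq> interior J" and K: "compact K" "K \<subseteq> interior J" and d: "0 < d"
    and g: "\<And>y. y \<in> S - K \<Longrightarrow> d \<le> g y" and gm: "g \<in> borel_measurable borel"
    and le: "(\<integral>\<^sup>+y\<in>S. ennreal (g y) \<partial>m) \<le> w"
  shows "emeasure m S \<le> emeasure m K + ennreal (1 / d) * w"
proof -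
  have Km: "K \<in> sets m" using K by (intro sets_m_Int borel_closed compact_imp_closed)
  have [measurable]: "g \<in> borel_measurable m" by (rule m_meas[OF gm])
  have "emeasure m S = (\<integral>\<^sup>+y. indicator S y \<partial>m)" using sets_m_Int[OF S] by simp
  also have "\<dots> \<le> (\<integral>\<^sup>+y. indicator K y + ennreal (1 / d) * (ennreal (g y) * indicator S y) \<partial>m)"
  proof (rule nn_integral_mono)
    fix y
    show "indicator S y \<le> indicator K y + ennreal (1 / d) * (ennreal (g y) * indicator S y)"
    proof (cases "y \<in> S - K")
      case True
      have "1 \<le> 1 / d * g y" using g[OF True] d by (simp add: field_simps)
      then have "1 \<le> ennreal (1 / d * g y)" by simp
      also have "ennreal (1 / d * g y) = ennreal (1 / d) * ennreal (g y)"
        by (rule ennreal_mult') (use d in auto)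
      finally show ?thesis using True by simp
    qed (auto split: split_indicator)
  qed
  also have "\<dots> = emeasure m K + ennreal (1 / d) * (\<integral>\<^sup>+y\<in>S. ennreal (g y) \<partial>m)"
    using Km sets_m_Int[OF S] by (simp add: nn_integral_add nn_integral_cmult)
  also have "\<dots> \<le> emeasure m K + ennreal (1 / d) * w"
    by (intro add_left_mono mult_left_mono le) simp
  finally show ?thesis .
qed

text \<open>The limit of \<open>boundary_v\<close> is bounded by the preceding estimates. For
  \<open>boundary_u\<close> they bound the mass up to the boundary by a number independent of
  \<open>x\<close>, and on natural scale \<open>boundary_u\<close> is at most this mass times the
  length of the interval.\<close>

lemma finite_return_imp_regular:
  assumes r: "r \<in> J" "r \<notin> interior J" and a: "a \<in> interior J"
    and fin: "(\<integral>\<^sup>+\<omega>. hit a \<omega> \<partial>P r) < \<infinity>"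
  shows "regular_boundary J (\<lambda>x. x) m (ereal r)"
proof -
  let ?w = "\<integral>\<^sup>+\<omega>. hit a \<omega> \<partial>P r"
  have aJ: "a \<in> J" using a interior_subset by auto
  have bp: "ereal r \<in> boundary_points J"
    using r closure_subset[of "ereal ` J"] by (auto simp: boundary_points_def)
  have "r \<noteq> a" using a r by auto
  have goal: "boundary_limit J a (boundary_u (\<lambda>x. x) m a) (ereal r) < \<infinity> \<and>
    boundary_limit J a (boundary_v (\<lambda>x. x) m a) (ereal r) < \<infinity>"
  proof (cases "a < r")
    case True
    have up: "x < r" if "x \<in> interior J" for x
    proof -
      have "x \<in> J" using that interior_subset by auto
      then have "x \<noteq> r" "\<not> r < x" using that r interior_between[OF aJ, of x r] True by auto
      then show ?thesis by auto
    qed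
    \<comment> \<open>Beyond the midpoint the weight \<open>y - a\<close> is bounded below; up to
      the midpoint the mass is finite by compactness.\<close>
    define c where "c = (a + r) / 2"
    have c: "a < c" "c < r" using True by (auto simp: c_def)
    have sub: "{a..c} \<subseteq> interior J"
      using interior_between[OF aJ r(1)] a c by (auto simp: le_less)
    define B where "B = ennreal (r - a) * (emeasure m {a..c} + ennreal (1 / (c - a)) * ?w)"
    have B: "B < \<infinity>"
      using compact_m[OF compact_Icc sub] fin by (simp add: B_def ennreal_mult_less_top)
    have v: "boundary_v (\<lambda>x. x) m a x \<le> ?w" if "x \<in> interior J" "a \<le> x" for x
      using that boundary_v_right[OF r(1) a _ up fin] by (cases "x = a") (auto simp: boundary_v_def)
    have u: "boundary_u (\<lambda>x. x) m a x \<le> B" if x: "x \<in> interior J" "a \<le> x" for x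
    proof (cases "x = a")
      case False
      then have ax: "a < x" using x by simp
      have subx: "{a<..x} \<subseteq> interior J"
        using interior_between[OF aJ r(1)] up[OF x(1)] by auto
      have "boundary_u (\<lambda>x. x) m a x = (\<integral>\<^sup>+z\<in>{a<..x}. emeasure m {a<..z} \<partial>stieltjes (\<lambda>x. x) a x)"
        using ax by (simp add: boundary_u_def)
      also have "\<dots> \<le> (\<integral>\<^sup>+z. emeasure m {a<..x} * indicator {a<..x} z \<partial>stieltjes (\<lambda>x. x) a x)"
        by (rule nn_integral_mono) (auto split: split_indicator intro!: emeasure_mono sets_m_Int subx)
      also have "\<dots> = emeasure m {a<..x} * ennreal (x - a)"
        using ax by (subst nn_integral_cmult_indicator) (auto simp: sets_stieltjes emeasure_stieltjes)
      also have "\<dots> \<le> (emeasure m {a..c} + ennreal (1 / (c - a)) * ?w) * ennreal (r - a)"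
      proof (rule mult_mono)
        show "emeasure m {a<..x} \<le> emeasure m {a..c} + ennreal (1 / (c - a)) * ?w"
          by (rule mass_bound[OF fin _ subx compact_Icc sub, where g="\<lambda>y. y - a"])
            (use c boundary_v_right[OF r(1) a ax up[OF x(1)] fin] in auto)
      qed (use up[OF x(1)] ax in \<open>auto intro: ennreal_leI\<close>)
      finally show ?thesis by (simp add: B_def mult.commute)
    qed (simp add: boundary_u_def)
    have "boundary_limit J a (boundary_u (\<lambda>x. x) m a) (ereal r) \<le> B"
      "boundary_limit J a (boundary_v (\<lambda>x. x) m a) (ereal r) \<le> ?w"
      using True u v by (auto simp: boundary_limit_def intro!: SUP_least)
    then show ?thesis using B fin by (auto intro: le_less_trans)
  next
    case False
    then have ra: "r < a" using \<open>r \<noteq> a\<close> by simp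
    have low: "r < x" if "x \<in> interior J" for x
    proof -
      have "x \<in> J" using that interior_subset by auto
      then have "x \<noteq> r" "\<not> x < r" using that r interior_between[OF _ aJ, of x r] ra by auto
      then show ?thesis by auto
    qed
    define c where "c = (a + r) / 2"
    have c: "c < a" "r < c" using ra by (auto simp: c_def)
    have sub: "{c..a} \<subseteq> interior J"
      using interior_between[OF r(1) aJ] a c by (auto simp: le_less)
    define B where "B = ennreal (a - r) * (emeasure m {c..a} + ennreal (1 / (a - c)) * ?w)"
    have B: "B < \<infinity>"
      using compact_m[OF compact_Icc sub] fin by (simp add: B_def ennreal_mult_less_top)
    have v: "boundary_v (\<lambda>x. x) m a x \<le> ?w" if "x \<in> interior J" "x \<le> a" for x
      using that boundary_v_left[OF r(1) a low _ fin] by (cases "x = a") (auto simp: boundary_v_def)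
    have u: "boundary_u (\<lambda>x. x) m a x \<le> B" if x: "x \<in> interior J" "x \<le> a" for x
    proof (cases "x = a")
      case False
      then have ax: "x < a" using x by simp
      have subx: "{x<..a} \<subseteq> interior J"
        using interior_between[OF r(1) aJ] low[OF x(1)] a by (auto simp: le_less)
      have "boundary_u (\<lambda>x. x) m a x = (\<integral>\<^sup>+z\<in>{x<..a}. emeasure m {z<..a} \<partial>stieltjes (\<lambda>x. x) x a)"
        using ax by (simp add: boundary_u_def)
      also have "\<dots> \<le> (\<integral>\<^sup>+z. emeasure m {x<..a} * indicator {x<..a} z \<partial>stieltjes (\<lambda>x. x) x a)"
        by (rule nn_integral_mono) (auto split: split_indicator intro!: emeasure_mono sets_m_Int subx)
      also have "\<dots> = emeasure m {x<..a} * ennreal (a - x)"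
        using ax by (subst nn_integral_cmult_indicator) (auto simp: sets_stieltjes emeasure_stieltjes)
      also have "\<dots> \<le> (emeasure m {c..a} + ennreal (1 / (a - c)) * ?w) * ennreal (a - r)"
      proof (rule mult_mono)
        show "emeasure m {x<..a} \<le> emeasure m {c..a} + ennreal (1 / (a - c)) * ?w"
          by (rule mass_bound[OF fin _ subx compact_Icc sub, where g="\<lambda>y. a - y"])
            (use c boundary_v_left[OF r(1) a low[OF x(1)] ax fin] in auto)
      qed (use low[OF x(1)] ax in \<open>auto intro: ennreal_leI\<close>)
      finally show ?thesis by (simp add: B_def mult.commute)
    qed (simp add: boundary_u_def)
    have "boundary_limit J a (boundary_u (\<lambda>x. x) m a) (ereal r) \<le> B"
      "boundary_limit J a (boundary_v (\<lambda>x. x) m a) (ereal r) \<le> ?w"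
      using False u v by (auto simp: boundary_limit_def intro!: SUP_least)
    then show ?thesis using B fin by (auto intro: le_less_trans)
  qed
  show ?thesis unfolding regular_boundary_def using bp a goal by blast
qed

lemma occupation_le_hitting:
  assumes "\<And>y. f y \<le> 1"
  shows "(\<integral>\<^sup>+t\<in>{t. 0 \<le> t \<and> ennreal t < \<tau>}. ennreal (f (X t \<omega>)) \<partial>lborel) \<le> \<tau>"
proof (cases \<tau>)
  case (real s)
  have "(\<integral>\<^sup>+t\<in>{t. 0 \<le> t \<and> ennreal t < \<tau>}. ennreal (f (X t \<omega>)) \<partial>lborel) \<le> (\<integral>\<^sup>+t. indicator {0..s} t \<partial>lborel)"
    using assms real
    by (intro nn_integral_mono) (auto split: split_indicator simp: ennreal_less_iff)
  then show ?thesis using real by simp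
qed auto

lemma occupation_formula:
  assumes "r \<in> J" "regular_boundary J (\<lambda>x. x) m (ereal r)" "d \<in> {1, -1}" "\<forall>y\<in>J. 0 \<le> d * (y - r)"
    "a \<in> J" "x \<in> J" "0 \<le> d * (x - r)" "d * (x - r) < d * (a - r)"
    "f \<in> borel_measurable borel" "\<forall>y. 0 \<le> f y" "emeasure M {r} \<noteq> \<infinity> \<or> f r \<noteq> 0"
  shows "(\<integral>\<^sup>+\<omega>. (\<integral>\<^sup>+t\<in>{t. 0 \<le> t \<and> ennreal t < hit a \<omega>}. ennreal (f (X t \<omega>)) \<partial>lborel) \<partial>P x)
       = (\<integral>\<^sup>+y. ennreal (boundary_green (\<lambda>x. x) r d a x y * f y) \<partial>M)"
proof -
  have "r \<in> {r \<in> J. regular_boundary J (\<lambda>x. x) m (ereal r)}" using assms by simp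
  note * = conjunct2[OF conjunct2[OF speed[unfolded speed_measure_def Let_def]], THEN bspec, OF this, THEN bspec, OF assms(3), THEN mp, OF assms(4),
      THEN bspec, OF assms(5), THEN bspec, OF assms(6), THEN spec, THEN mp, of f]
  show ?thesis by (rule *) (use assms in blast)
qed

text \<open>The occupation formula for the indicator of \<open>r\<close> has a right-hand side of
  infinite mass times a positive Green function, while the time spent at \<open>r\<close> before
  \<open>a\<close> is at most the hitting time of \<open>a\<close>.\<close>

lemma infinite_return:
  assumes r: "r \<in> J" "r \<notin> interior J" and a: "a \<in> interior J"
    and fin: "(\<integral>\<^sup>+\<omega>. hit a \<omega> \<partial>P r) < \<infinity>"
  shows False
proof -
  have aJ: "a \<in> J" using a interior_subset by auto
  have ar: "a \<noteq> r" using a r by auto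
  have reg: "regular_boundary J (\<lambda>x. x) m (ereal r)"
    by (rule finite_return_imp_regular[OF r a fin])
  then have "absorbing J (\<lambda>x. x) M (ereal r)"
    by (intro absorb) (auto simp: regular_boundary_def)
  then have inf: "emeasure M {r} = \<infinity>" by (auto simp: absorbing_def)
  then have "emeasure M {r} \<noteq> 0" by simp
  then have rM: "{r} \<in> sets M" using emeasure_neq_0_sets by blast
  define d :: real where "d = (if r < a then 1 else -1)"
  have d: "d \<in> {1, -1}" by (simp add: d_def)
  have dJ: "\<forall>y\<in>J. 0 \<le> d * (y - r)"
    using end_point[OF r] aJ ar by (auto simp: d_def)
  have da: "0 < d * (a - r)" using ar by (auto simp: d_def)
  have occ: "(\<integral>\<^sup>+\<omega>. (\<integral>\<^sup>+t\<in>{t. 0 \<le> t \<and> ennreal t < hit a \<omega>}. ennreal (indicator {r} (X t \<omega>)) \<partial>lborel) \<partial>P r)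
       = (\<integral>\<^sup>+y. ennreal (boundary_green (\<lambda>x. x) r d a r y * indicator {r} y) \<partial>M)"
  proof (rule occupation_formula[OF r(1) reg d dJ aJ r(1)])
    show "0 \<le> d * (r - r)" "d * (r - r) < d * (a - r)" using da by auto
    show "indicator {r} \<in> borel_measurable borel" by simp
    show "\<forall>y. 0 \<le> (indicator {r} y :: real)" by simp
    \<comment> \<open>The indicator is one at \<open>r\<close>, so the formula is available despite
      the infinite mass there.\<close>
    show "emeasure M {r} \<noteq> \<infinity> \<or> indicator {r} r \<noteq> (0 :: real)" by simp
  qed
  \<comment> \<open>Both summands of \<open>boundary_green\<close> contribute
    \<open>d * (a - r)\<close>, the value at the centre of the Green function of the symmetric
    interval.\<close>
  have g: "boundary_green (\<lambda>x. x) r d a r r = 2 * (d * (a - r))"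
    using da d by (auto simp: boundary_green_def green_def reflected_scale_def Let_def field_simps)
  have "(\<integral>\<^sup>+y. ennreal (boundary_green (\<lambda>x. x) r d a r y * indicator {r} y) \<partial>M)
      = (\<integral>\<^sup>+y. ennreal (2 * (d * (a - r))) * indicator {r} y \<partial>M)"
    by (rule nn_integral_cong) (auto split: split_indicator simp: g)
  also have "\<dots> = \<infinity>"
    using rM inf da ar by (auto simp: nn_integral_cmult_indicator ennreal_mult_top d_def)
  finally have "\<infinity> = (\<integral>\<^sup>+\<omega>. (\<integral>\<^sup>+t\<in>{t. 0 \<le> t \<and> ennreal t < hit a \<omega>}. ennreal (indicator {r} (X t \<omega>)) \<partial>lborel) \<partial>P r)"
    unfolding occ by simp
  also have "\<dots> \<le> (\<integral>\<^sup>+\<omega>. hit a \<omega> \<partial>P r)"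
    by (intro nn_integral_mono occupation_le_hitting indicator_le_1)
  finally show False using fin by simp
qed

lemma end_point_trap:
  assumes r: "r \<in> J" "r \<notin> interior J"
  shows "AE \<omega> in P r. \<forall>t\<ge>0. X t \<omega> = r"
proof (rule AE_not_hit_imp_stay[OF r(1)])
  fix a assume a: "a \<in> interior J" "a \<noteq> r"
  then have aJ: "a \<in> J" using interior_subset by auto
  interpret prob_space "P r" by (rule prob_P[OF r(1)])
  have seg: "z \<in> closed_segment r a \<or> a \<in> closed_segment r z" if "z \<in> J" for z
    using end_point[OF r] that aJ a by (auto simp: closed_segment_eq_real_ivl)
  have "measure (P r) {\<omega>\<in>space A. hit a \<omega> < \<infinity>} = 0"
  proof (rule ccontr)
    assume "measure (P r) {\<omega>\<in>space A. hit a \<omega> < \<infinity>} \<noteq> 0"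
    then have "0 < measure (P r) {\<omega>\<in>space A. hit a \<omega> < \<infinity>}" by (simp add: zero_less_measure_iff)
    from hit_pos_time[OF r(1) this] obtain T where
      T: "\<forall>t\<ge>T. 0 < measure (P r) (hit_by a t)" by auto
    \<comment> \<open>Equal targets turn the two-sided tail estimate into a one-sided one; as
      \<open>r\<close> is an end point, the path stays between \<open>r\<close> and \<open>a\<close>
      until it hits \<open>a\<close>.\<close>
    have "(\<integral>\<^sup>+\<omega>. min (hit a \<omega>) (hit a \<omega>) \<partial>P r) < \<infinity>"
    proof (rule geometric_tail[OF r(1), of "max 1 T" "measure (P r) (hit_by a (max 1 T))" "closed_segment r a"])
      fix z assume "z \<in> closed_segment r a"
      then show "measure (P r) (hit_by a (max 1 T))
        \<le> measure (P z) {\<omega>\<in>space A. min (hit a \<omega>) (hit a \<omega>) \<le> ennreal (max 1 T)}"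
        using hit_between_prob'[OF r(1) _ aJ] by simp
    next
      show "AE \<omega> in P r. \<forall>s\<ge>0. ennreal s < min (hit a \<omega>) (hit a \<omega>) \<longrightarrow> X s \<omega> \<in> closed_segment r a"
        using AE_start[OF r(1)]
      proof eventually_elim
        fix \<omega> assume w: "\<omega> \<in> space A \<and> X 0 \<omega> = r"
        show "\<forall>s\<ge>0. ennreal s < min (hit a \<omega>) (hit a \<omega>) \<longrightarrow> X s \<omega> \<in> closed_segment r a"
        proof (intro allI impI, rule ccontr)
          fix s :: real assume s: "0 \<le> s" "ennreal s < min (hit a \<omega>) (hit a \<omega>)"
            and n: "X s \<omega> \<notin> closed_segment r a"
          have "X s \<omega> \<in> J" using X_in_J s w by auto
          then have "a \<in> closed_segment (X 0 \<omega>) (X s \<omega>)" using seg n w by blast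
          then have "hit a \<omega> \<le> ennreal s"
            using order_trans[OF hitting_between hitting_le[OF s(1) refl]] w by blast
          then show False using s by auto
        qed
      qed
    qed (use T in auto)
    then show False using infinite_return[OF r a(1)] by simp
  qed
  then have "AE \<omega> in P r. \<omega> \<notin> {\<omega>\<in>space A. hit a \<omega> < \<infinity>}"
    by (subst (asm) prob_eq_0) (use r in \<open>auto simp: sets_P_iff\<close>)
  then show "AE \<omega> in P r. hit a \<omega> = \<top>"
    using AE_start[OF r(1)] by eventually_elim (auto simp flip: top.not_eq_extremum)
qed

lemma absorbed: "absorbed_diffusion J A F X \<theta> P"
  by unfold_locales (use exit_two_sided end_point_trap attain_interior in auto)

end

section \<open>A discrete dichotomy\<close>

text \<open>\<open>D\<close> and \<open>G\<close> are perturbations of the solutions \<open>1\<close> and \<open>2 ^ k\<close> of the recursion with \<open>p k = 1/3\<close> and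
  \<open>q k = 2/3\<close>, the exit probabilities of Brownian motion from the point \<open>2 * a\<close> of the interval \<open>(a, 4 * a)\<close>.  Both
  limits in the dichotomy are decided by the summability of the perturbation.\<close>

locale discrete_harmonic =
  fixes p q D G :: "nat \<Rightarrow> real"
  assumes p: "\<And>k. 0 \<le> p k" "\<And>k. p k \<le> 1 / 3" and q: "\<And>k. 0 \<le> q k" "\<And>k. q k \<le> 2 / 3"
    and D: "\<And>k. 0 < D k" "\<And>k. D (Suc k) \<le> D k" "\<And>k. D (Suc k) = p k * D (k + 2) + q k * D k"
    and G: "G 0 = 1" "1 < G 1" "\<And>k. G k \<le> G (Suc k)" "\<And>k. G (Suc k) = p k * G (k + 2) + q k * G k"
begin

text \<open>The probability of being killed before the exit from the \<open>k\<close>-th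
  interval.\<close>

definition defect :: "nat \<Rightarrow> real" where "defect k = 1 - p k - q k"
text \<open>Equal to one for \<open>2 ^ k\<close> and to zero for the constant solution: the
  coefficient of the growing solution contained in \<open>G\<close>.\<close>

definition slope :: "nat \<Rightarrow> real" where "slope k = (G (Suc k) - G k) / 2 ^ k"

lemma defect_nonneg: "0 \<le> defect k"
  using p(2)[of k] q(2)[of k] by (simp add: defect_def)

lemma D_antimono: "i \<le> j \<Longrightarrow> D j \<le> D i"
  by (rule lift_Suc_antimono_le[of D]) (use D(2) in auto)

text \<open>Without killing the decrements double at each step, so a bounded solution is constant;
  the perturbation is isolated on the right.\<close>

lemma D_step: "D (Suc k) - D (Suc (Suc k)) = 2 * (D k - D (Suc k)) - 3 * ((1/3 - p k) * D (Suc (Suc k)) + (2/3 - q k) * D k)"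
  using D(3)[of k] by (simp add: algebra_simps)

lemma D_step_lower: "3 / 2 * (defect k * D (Suc (Suc k))) \<le> D k - D (Suc k)"
proof -
  have "defect k * D (Suc (Suc k)) = (1/3 - p k) * D (Suc (Suc k)) + (2/3 - q k) * D (Suc (Suc k))"
    by (simp add: defect_def algebra_simps)
  also have "\<dots> \<le> (1/3 - p k) * D (Suc (Suc k)) + (2/3 - q k) * D k"
    using q(2)[of k] D_antimono[of k "Suc (Suc k)"] by (intro add_left_mono mult_left_mono) auto
  finally show ?thesis using D_step[of k] D(2)[of "Suc k"] by simp
qed

lemma D_step_upper: "D k - D (Suc k) \<le> (D (Suc k) - D (Suc (Suc k))) / 2 + 3 / 2 * (defect k * D k)"
proof -
  have "(1/3 - p k) * D (Suc (Suc k)) + (2/3 - q k) * D k \<le> (1/3 - p k) * D k + (2/3 - q k) * D k"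
    using p(2)[of k] D_antimono[of k "Suc (Suc k)"] by (intro add_right_mono mult_left_mono) auto
  also have "\<dots> = defect k * D k" by (simp add: defect_def algebra_simps)
  finally show ?thesis using D_step[of k] by argo
qed

text \<open>Without killing the slope is constant; killing adds a nonnegative term.\<close>

lemma slope_step: "slope (Suc k) = slope k + 3 * ((1/3 - p k) * G (Suc (Suc k)) + (2/3 - q k) * G k) / 2 ^ Suc k"
proof -
  have "G (Suc (Suc k)) - G (Suc k) = 2 * (G (Suc k) - G k) + 3 * ((1/3 - p k) * G (Suc (Suc k)) + (2/3 - q k) * G k)"
    using G(4)[of k] by (simp add: algebra_simps)
  then show ?thesis unfolding slope_def by (simp add: field_simps)
qed

lemma G_mono: "i \<le> j \<Longrightarrow> G i \<le> G j"
  by (rule lift_Suc_mono_le[of G]) (use G(3) in auto)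

lemma G_ge_1: "1 \<le> G k"
  using G_mono[of 0 k] G(1) by simp

lemma slope_incr: "slope k + 3 * (defect k * G k) / 2 ^ Suc k \<le> slope (Suc k)"
proof -
  have "defect k * G k = (1/3 - p k) * G k + (2/3 - q k) * G k" by (simp add: defect_def algebra_simps)
  also have "\<dots> \<le> (1/3 - p k) * G (Suc (Suc k)) + (2/3 - q k) * G k"
    using p(2)[of k] G_mono[of k "Suc (Suc k)"] by (intro add_right_mono mult_left_mono) auto
  finally show ?thesis unfolding slope_step by (simp add: divide_right_mono)
qed

lemma slope_incr_upper: "slope (Suc k) \<le> slope k + 3 * (defect k * G (Suc (Suc k))) / 2 ^ Suc k"
proof -
  have "(1/3 - p k) * G (Suc (Suc k)) + (2/3 - q k) * G k \<le> (1/3 - p k) * G (Suc (Suc k)) + (2/3 - q k) * G (Suc (Suc k))"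
    using q(2)[of k] G_mono[of k "Suc (Suc k)"] by (intro add_left_mono mult_left_mono) auto
  also have "\<dots> = defect k * G (Suc (Suc k))" by (simp add: defect_def algebra_simps)
  finally show ?thesis unfolding slope_step by (simp add: divide_right_mono)
qed

lemma slope_mono: "i \<le> j \<Longrightarrow> slope i \<le> slope j"
proof (rule lift_Suc_mono_le[of slope])
  fix k
  have "0 \<le> 3 * (defect k * G k) / 2 ^ Suc k" using defect_nonneg[of k] G_ge_1[of k] by simp
  then show "slope k \<le> slope (Suc k)" using slope_incr[of k] by linarith
qed

lemma slope_0_pos: "0 < slope 0"
  using G(1,2) by (simp add: slope_def)

lemma G_growth: "min 1 (slope 0) * 2 ^ k \<le> G k"
proof (induction k)
  case (Suc k)
  have "min 1 (slope 0) * 2 ^ k \<le> slope k * 2 ^ k"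
    using slope_mono[of 0 k] by (intro mult_right_mono) auto
  then have "min 1 (slope 0) * 2 ^ k \<le> G (Suc k) - G k" by (simp add: slope_def)
  then show ?case using Suc by simp
qed (use G(1) in simp)

lemma D_limit: "\<exists>L\<ge>0. D \<longlonglongrightarrow> L \<and> (\<forall>k. L \<le> D k)"
proof -
  have dec: "decseq D" using D_antimono by (auto simp: decseq_def)
  have "Bseq D"
    by (rule BseqI'[of _ "D 0"]) (use D(1) D_antimono[of 0] in \<open>auto simp: less_imp_le abs_of_pos\<close>)
  then obtain L where L: "D \<longlonglongrightarrow> L"
    using Bseq_monoseq_convergent dec decseq_imp_monoseq by (metis convergent_def)
  then have "0 \<le> L" by (rule LIMSEQ_le_const) (use D(1) in \<open>auto intro: less_imp_le\<close>)
  then show ?thesis using L decseq_ge[OF dec L] by blast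
qed

text \<open>With a positive limit \<open>L\<close>, the decrements would dominate a multiple of
  \<open>defect k * L\<close>, but they telescope to a finite sum.\<close>

lemma not_summable_D: "\<not> summable defect \<Longrightarrow> D \<longlonglongrightarrow> 0"
proof (rule ccontr)
  assume ns: "\<not> summable defect" and nz: "\<not> D \<longlonglongrightarrow> 0"
  obtain L where L: "0 \<le> L" "D \<longlonglongrightarrow> L" "\<And>k. L \<le> D k" using D_limit by blast
  then have L0: "0 < L" using nz by (auto simp: le_less)
  have s: "summable (\<lambda>k. D k - D (Suc k))" using telescope_summable'[OF L(2)] .
  have "summable (\<lambda>k. 2 / 3 / L * (D k - D (Suc k)))" by (intro summable_mult s)
  then have "summable defect"
  proof (rule summable_comparison_test'[of _ 0])
    fix k
    have "defect k * L \<le> defect k * D (Suc (Suc k))" by (intro mult_left_mono L defect_nonneg)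
    then have "3 / 2 * (defect k * L) \<le> D k - D (Suc k)" using D_step_lower[of k] by linarith
    then show "norm (defect k) \<le> 2 / 3 / L * (D k - D (Suc k))"
      using L0 defect_nonneg[of k] by (simp add: field_simps)
  qed
  then show False using ns by simp
qed

text \<open>Summing \<open>D_step_upper\<close> over a tail, half of the total decrease is absorbed
  on the right. With a small tail of defects, \<open>D\<close> cannot lose more than a fixed
  fraction of \<open>D N\<close>.\<close>

lemma summable_D:
  assumes s: "summable defect" shows "\<not> D \<longlonglongrightarrow> 0"
proof
  assume D0: "D \<longlonglongrightarrow> 0"
  \<comment> \<open>With 1/6 the loss is at most 1/2 + 3/2 * 1/6 = 3/4 of
    \<open>D N\<close>.\<close>
  obtain N where N: "\<And>n. norm (sum defect {N..<n}) < 1/6"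
    using s[unfolded summable_Cauchy, rule_format, of "1/6"] by auto
  have tele: "(\<Sum>k=N..<n. f k - f (Suc k)) = f N - f n" if "N \<le> n" for n and f :: "nat \<Rightarrow> real"
    using that by (induction n rule: dec_induct) auto
  have bound: "D N - D n \<le> 3/4 * D N" if "N \<le> n" for n
  proof -
    have "D N - D n = (\<Sum>k=N..<n. D k - D (Suc k))" using tele[OF that, of D] by simp
    also have "\<dots> \<le> (\<Sum>k=N..<n. (D (Suc k) - D (Suc (Suc k))) / 2 + 3 / 2 * (defect k * D N))"
    proof (rule sum_mono)
      fix k assume "k \<in> {N..<n}"
      then have "defect k * D k \<le> defect k * D N" by (intro mult_left_mono D_antimono defect_nonneg) auto
      then show "D k - D (Suc k) \<le> (D (Suc k) - D (Suc (Suc k))) / 2 + 3 / 2 * (defect k * D N)"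
        using D_step_upper[of k] by linarith
    qed
    also have "\<dots> = (D (Suc N) - D (Suc n)) / 2 + 3 / 2 * (sum defect {N..<n} * D N)"
      using tele[OF that, of "\<lambda>k. D (Suc k)"]
      by (simp add: sum.distrib sum_divide_distrib[symmetric] sum_distrib_left[symmetric] sum_distrib_right[symmetric])
    also have "\<dots> \<le> D N / 2 + 3 / 2 * (1/6 * D N)"
    proof -
      have "sum defect {N..<n} * D N \<le> 1/6 * D N"
        using N[of n] D(1)[of N] by (intro mult_right_mono) auto
      then show ?thesis using D(1)[of "Suc n"] D(2)[of N] by argo
    qed
    finally show ?thesis by simp
  qed
  have "(\<lambda>n. D N - D n) \<longlonglongrightarrow> D N - 0" by (intro tendsto_intros D0)
  then have "D N - 0 \<le> 3/4 * D N" by (rule LIMSEQ_le_const2) (use bound in auto)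
  then show False using D(1)[of N] by simp
qed

text \<open>Since \<open>G\<close> grows at least like \<open>2 ^ k\<close>, each defect raises the
  slope by a fixed multiple of itself. The slope is then unbounded, and it is at most
  \<open>G (Suc k) / 2 ^ k\<close>.\<close>

lemma not_summable_G:
  assumes ns: "\<not> summable defect" shows "(\<lambda>k. 2 ^ k / G k) \<longlonglongrightarrow> 0"
proof -
  let ?c = "min 1 (slope 0)"
  have c: "0 < ?c" using slope_0_pos by simp
  have lower: "slope 0 + 3 / 2 * ?c * sum defect {..<n} \<le> slope n" for n
  proof (induction n)
    case (Suc n)
    have "defect n * (?c * 2 ^ n) \<le> defect n * G n" by (intro mult_left_mono G_growth defect_nonneg)
    then have "3 * (defect n * (?c * 2 ^ n)) / 2 ^ Suc n \<le> 3 * (defect n * G n) / 2 ^ Suc n"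
      by (intro divide_right_mono mult_left_mono G_growth defect_nonneg) auto
    moreover have "3 * (defect n * (?c * 2 ^ n)) / 2 ^ Suc n = 3 / 2 * ?c * defect n" by simp
    ultimately have "3 / 2 * ?c * defect n \<le> 3 * (defect n * G n) / 2 ^ Suc n" by linarith
    moreover have "3 / 2 * ?c * sum defect {..<Suc n} = 3 / 2 * ?c * sum defect {..<n} + 3 / 2 * ?c * defect n"
      by (simp only: sum.lessThan_Suc distrib_left)
    ultimately show ?case using Suc slope_incr[of n] by linarith
  qed simp
  have unb: "\<exists>n. B < slope n" for B
  proof (rule ccontr)
    assume "\<not> ?thesis"
    then have B: "slope n \<le> B" for n by (simp add: not_less)
    have "sum defect {..<n} \<le> (B - slope 0) / (3 / 2 * ?c)" for n
    proof (subst pos_le_divide_eq)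
      show "0 < 3 / 2 * ?c" using c by simp
      show "sum defect {..<n} * (3 / 2 * ?c) \<le> B - slope 0"
        using lower[of n] B[of n] by (simp add: mult.commute del: min_less_iff_conj)
    qed
    then have "summable defect"
      by (intro summableI_nonneg_bounded) (use defect_nonneg in auto)
    then show False using ns by simp
  qed
  show ?thesis
  proof (rule LIMSEQ_imp_Suc, rule metric_LIMSEQ_I)
    fix e :: real assume e: "0 < e"
    obtain n where n: "2 / e < slope n" using unb by blast
    show "\<exists>no. \<forall>k\<ge>no. dist (2 ^ Suc k / G (Suc k)) 0 < e"
    proof (intro exI allI impI)
      fix k assume "n \<le> k"
      then have "2 / e < slope k" using n slope_mono[of n k] by simp
      then have "2 / e * 2 ^ k < G (Suc k) - G k" by (simp add: slope_def pos_less_divide_eq)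
      then have "2 / e * 2 ^ k < G (Suc k)" using G_ge_1[of k] by linarith
      then have "2 * 2 ^ k < e * G (Suc k)" using e by (simp add: field_simps)
      then show "dist (2 ^ Suc k / G (Suc k)) 0 < e"
        using G_ge_1[of "Suc k"] by (simp add: dist_real_def pos_divide_less_eq)
    qed
  qed
qed

text \<open>A discrete Gronwall argument: the larger of \<open>G k / 2 ^ k\<close> and the slope
  grows in each step by a factor at most \<open>exp (12 * defect k)\<close>, so it stays
  bounded.\<close>

lemma summable_G:
  assumes s: "summable defect" shows "\<not> (\<lambda>k. 2 ^ k / G k) \<longlonglongrightarrow> 0"
proof
  assume lim: "(\<lambda>k. 2 ^ k / G k) \<longlonglongrightarrow> 0"
  define g where "g k = G k / 2 ^ k" for k
  \<comment> \<open>The new \<open>g\<close> is the mean of \<open>g\<close> and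
    \<open>slope\<close>, and the increase of \<open>slope\<close> is controlled by
    \<open>g\<close>; only the maximum of both obeys a closed estimate.\<close>
  define Mx where "Mx k = max (g k) (slope k)" for k
  have gS: "g (Suc k) = g k / 2 + slope k / 2" for k
    by (simp add: g_def slope_def field_simps)
  have g0: "0 < g k" for k using G_ge_1[of k] by (simp add: g_def)
  have M0: "0 < Mx k" for k using g0[of k] by (simp add: Mx_def)
  have "defect \<longlonglongrightarrow> 0" by (rule summable_LIMSEQ_zero[OF s])
  then have "\<forall>\<^sub>F k in sequentially. defect k < 1/6" by (rule order_tendstoD) simp
  then obtain N where N: "\<And>k. N \<le> k \<Longrightarrow> defect k < 1/6" by (auto simp: eventually_sequentially)
  have step: "Mx (Suc k) \<le> exp (12 * defect k) * Mx k" if "N \<le> k" for k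
  proof -
    let ?d = "defect k"
    have d: "0 \<le> ?d" "?d < 1/6" using defect_nonneg N[OF that] by auto
    have g1: "g (Suc k) \<le> Mx k" unfolding gS by (auto simp: Mx_def)
    have "3 * (?d * G (Suc (Suc k))) / 2 ^ Suc k = 6 * (?d * g (Suc (Suc k)))" by (simp add: g_def)
    then have "slope (Suc k) \<le> slope k + 6 * (?d * g (Suc (Suc k)))" using slope_incr_upper[of k] by simp
    also have "\<dots> = slope k + 3 * ?d * (g (Suc k) + slope (Suc k))" unfolding gS[of "Suc k"] by (simp add: algebra_simps)
    also have "\<dots> \<le> Mx k + 3 * ?d * (Mx k + slope (Suc k))"
      using d g1 by (intro add_mono mult_left_mono) (auto simp: Mx_def)
    finally have "slope (Suc k) * (1 - 3 * ?d) \<le> (1 + 3 * ?d) * Mx k" by (simp add: algebra_simps)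
    also have "\<dots> \<le> ((1 + 12 * ?d) * (1 - 3 * ?d)) * Mx k"
    proof (rule mult_right_mono)
      \<comment> \<open>The required inequality amounts to \<open>36 * d * d \<le> 6 * d\<close>;
        this is where the threshold 1/6 comes from.\<close>
      have "?d * ?d \<le> ?d * (1/6)" using d by (intro mult_left_mono) auto
      then show "1 + 3 * ?d \<le> (1 + 12 * ?d) * (1 - 3 * ?d)" by (simp add: algebra_simps)
    qed (use M0[of k] in simp)
    finally have "slope (Suc k) * (1 - 3 * ?d) \<le> ((1 + 12 * ?d) * Mx k) * (1 - 3 * ?d)" by (simp add: algebra_simps)
    then have "slope (Suc k) \<le> (1 + 12 * ?d) * Mx k" using d by (subst (asm) mult_le_cancel_right) auto
    moreover have "g (Suc k) \<le> (1 + 12 * ?d) * Mx k"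
      using g1 mult_right_mono[of 1 "1 + 12 * ?d" "Mx k"] d M0[of k] by linarith
    ultimately have "Mx (Suc k) \<le> (1 + 12 * ?d) * Mx k" by (simp add: Mx_def)
    also have "\<dots> \<le> exp (12 * ?d) * Mx k"
      using M0[of k] exp_ge_add_one_self[of "12 * ?d"] by (intro mult_right_mono) auto
    finally show ?thesis .
  qed
  have bound: "Mx (N + k) \<le> exp (12 * suminf defect) * Mx N" for k
  proof -
    have "Mx (N + k) \<le> exp (12 * sum defect {N..<N + k}) * Mx N"
    proof (induction k)
      case (Suc k)
      have "Mx (N + Suc k) \<le> exp (12 * defect (N + k)) * Mx (N + k)" using step[of "N + k"] by simp
      also have "\<dots> \<le> exp (12 * defect (N + k)) * (exp (12 * sum defect {N..<N + k}) * Mx N)"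
        by (intro mult_left_mono Suc) simp
      also have "\<dots> = exp (12 * sum defect {N..<N + Suc k}) * Mx N"
        by (simp add: exp_add[symmetric] mult.assoc[symmetric] algebra_simps)
      finally show ?case .
    qed simp
    also have "\<dots> \<le> exp (12 * suminf defect) * Mx N"
      using M0[of N] sum_le_suminf[OF s, of "{N..<N+k}"] defect_nonneg
      by (intro mult_right_mono) auto
    finally show ?thesis .
  qed
  let ?C = "exp (12 * suminf defect) * Mx N"
  have C: "0 < ?C" using M0[of N] by simp
  have "\<forall>\<^sub>F k in sequentially. 2 ^ k / G k < 1 / ?C" using lim C by (intro order_tendstoD(2)[OF lim]) auto
  then obtain K where K: "\<And>k. K \<le> k \<Longrightarrow> 2 ^ k / G k < 1 / ?C" by (auto simp: eventually_sequentially)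
  have "g (N + K) \<le> ?C" using bound[of K] by (simp add: Mx_def)
  then have "1 / ?C \<le> 1 / g (N + K)" using g0[of "N + K"] by (intro divide_left_mono) (use C in auto)
  then show False using K[of "N + K"] by (simp add: g_def)
qed

text \<open>Each side holds exactly if the defects are not summable.\<close>

theorem D_vanishes_iff: "D \<longlonglongrightarrow> 0 \<longleftrightarrow> (\<lambda>k. 2 ^ k / G k) \<longlonglongrightarrow> 0"
  using summable_D not_summable_D summable_G not_summable_G by blast

end

section \<open>Entrance and exit at an infinite end point\<close>

context absorbed_diffusion
begin

lemma phi_self: "x \<in> J \<Longrightarrow> phi x x = 1"
proof -
  assume x: "x \<in> J"
  have "phi x x = (\<integral>\<^sup>+\<omega>. 1 \<partial>P x)"
    unfolding phi_def
  proof (rule nn_integral_cong_AE, use AE_start[OF x] in eventually_elim)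
    fix \<omega> assume w: "\<omega> \<in> space A \<and> X 0 \<omega> = x"
    then have "hit x \<omega> \<le> ennreal 0" by (intro hitting_le) auto
    then show "ed (hit x \<omega>) = 1" by (simp add: ed_def)
  qed
  then show ?thesis using nn_const[OF x, of 1] by (rule trans)
qed

text \<open>With an auxiliary point \<open>a\<close> on the other side of \<open>x\<close>, the
  event of hitting \<open>y\<close> before \<open>a\<close> has positive probability by the scale
  function, and the discount is strictly positive on it.\<close>

lemma phi_pos:
  assumes x: "x \<in> interior J" and y: "y \<in> J" shows "0 < phi x y"
proof (rule ccontr)
  assume "\<not> 0 < phi x y"
  then have z: "phi x y = 0" by simp
  have xJ: "x \<in> J" using x interior_subset by auto
  then have ne: "x \<noteq> y" using z phi_self[of x] by auto
  obtain e where e: "0 < e" "ball x e \<subseteq> J" using x by (meson mem_interior)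
  define a where "a = (if x < y then x - e / 2 else x + e / 2)"
  have aJ: "a \<in> J" using e by (auto simp: a_def dist_real_def subset_iff)
  have o: "a < x \<and> x < y \<or> y < x \<and> x < a" using ne e by (auto simp: a_def)
  have "exit_ed x y a + exit_ed x a y * phi a y = 0"
    using phi_exit[OF xJ, of a y] o z by (auto simp: phi_def)
  then have "exit_ed x y a = 0" by (simp add: add_eq_0_iff_both_eq_0)
  then have "AE \<omega> in P x. ed (hit y \<omega>) * indicator {\<omega>. hit y \<omega> < hit a \<omega>} \<omega> = 0"
    unfolding exit_ed_def by (subst (asm) nn_integral_0_iff_AE) (use xJ in measurable)
  then have "AE \<omega> in P x. \<omega> \<notin> (hit_before y a)"
    by eventually_elim (auto simp: ed_def split: if_splits)
  then have "measure (P x) (hit_before y a) = 0"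
    using xJ by (subst prob_space.prob_eq_0[OF prob_P]) (auto simp: sets_P_iff)
  then show False using exit_prob[OF aJ y o] o by auto
qed

text \<open>The right end point is no entrance boundary. If it belongs to \<open>J\<close>, the
  condition holds trivially with \<open>q\<close> equal to it.\<close>

definition right_natural :: bool where
  "right_natural \<longleftrightarrow> (\<forall>y\<in>interior J. \<forall>e>0. \<exists>q\<in>J. \<forall>x\<in>J. q < x \<longrightarrow> phi x y < ennreal e)"

text \<open>The offset makes level 0 equal to \<open>y\<close>, while the doubling distances from
  \<open>y - 1\<close> give the upward exit probability \<open>(2 - 1) / (4 - 1) = 1/3\<close> from
  every middle level.\<close>

definition level :: "real \<Rightarrow> nat \<Rightarrow> real" where "level y k = y - 1 + 2 ^ k"

lemma level_0 [simp]: "level y 0 = y"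
  and level_mono: "i \<le> j \<Longrightarrow> level y i \<le> level y j"
  and level_less: "level y k < level y (Suc k)"
  and level_ge: "y \<le> level y k"
  by (auto simp: level_def)

lemma exit_ed_real:
  assumes "x \<in> J" "a \<in> J" "b \<in> J" "a < x \<and> x < b \<or> b < x \<and> x < a"
  shows "enn2real (exit_ed x b a) \<le> \<bar>x - a\<bar> / \<bar>b - a\<bar>"
  using exit_ed_le_emeasure[OF assms(1), of b a] exit_prob[OF assms(2,3,4)]
  by (intro enn2real_leI) (auto simp: emeasure_P_eq[OF assms(1)])

lemma phi_finite: "x \<in> J \<Longrightarrow> phi x y < \<top>"
  using phi_le_1[of x y] by (auto intro: le_less_trans)

lemma exit_ed_finite: "x \<in> J \<Longrightarrow> exit_ed x b a < \<top>"
  using exit_ed_le_1[of x b a] by (auto intro: le_less_trans)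

lemma phi_real_mult:
  assumes "x \<in> J" "y \<in> closed_segment x z"
  shows "enn2real (phi x z) = enn2real (phi x y) * enn2real (phi y z)"
  using phi_mult[OF assms] by (simp add: enn2real_mult)

lemma phi_real_exit:
  assumes "x \<in> J" "a \<in> J" "a \<noteq> b"
  shows "enn2real (phi x b) = enn2real (exit_ed x b a) + enn2real (exit_ed x a b) * enn2real (phi a b)"
  using phi_exit[OF assms(1,3)] exit_ed_finite[OF assms(1)] phi_finite[OF assms(2)]
  by (simp add: enn2real_plus enn2real_mult ennreal_mult_less_top)

text \<open>The quotients \<open>h / g\<close> and \<open>h / f\<close> will be passage transforms
  from two levels to a common higher one. Dividing by \<open>h\<close> removes the common target and
  leaves a recursion for the reciprocals.\<close>

lemma harmonic_inverse:
  fixes f g h p q :: real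
  assumes "0 < f" "0 < g" "0 < h" "h / g = p + q * (h / f)"
  shows "1 / g = p * (1 / h) + q * (1 / f)"
proof -
  have "1 / g = (h / g) * (1 / h)" using assms(3) by simp
  also have "\<dots> = p * (1 / h) + q * (1 / f)" unfolding assms(4) using assms(3) by (simp add: add_divide_distrib)
  finally show ?thesis .
qed

text \<open>Passage down to \<open>y\<close> gives a decreasing solution of the recursion, and
  reciprocal passage up from \<open>y\<close> an increasing one, both with the same killed exit
  probabilities. Hence the discrete dichotomy relates the two.\<close>

lemma levels_dichotomy:
  assumes y: "y \<in> interior J" and inf: "{y..} \<subseteq> J"
  shows "(\<lambda>k. enn2real (phi (level y k) y)) \<longlonglongrightarrow> 0
    \<longleftrightarrow> (\<lambda>k. 2 ^ k * enn2real (phi y (level y k))) \<longlonglongrightarrow> 0"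
proof -
  let ?u = "level y"
  have uJ: "?u k \<in> J" for k using inf level_ge[of y k] by auto
  have ui: "?u k \<in> interior J" for k
  proof (cases "?u k = y")
    case False
    then have "y < ?u k" using level_ge[of y k] by simp
    moreover have "y \<in> J" "?u k + 1 \<in> J" using inf level_ge[of y k] by auto
    ultimately show ?thesis by (intro interior_between[of y "?u k + 1"]) auto
  qed (use y in simp)
  define p where "p k = enn2real (exit_ed (?u (Suc k)) (?u (Suc (Suc k))) (?u k))" for k
  define q where "q k = enn2real (exit_ed (?u (Suc k)) (?u k) (?u (Suc (Suc k))))" for k
  define D where "D k = enn2real (phi (?u k) y)" for k
  define G where "G k = 1 / enn2real (phi y (?u k))" for k
  have yJ: "y \<in> J" using y interior_subset by auto
  have pos: "0 < enn2real (phi x z)" if "x \<in> interior J" "z \<in> J" for x z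
    using phi_pos[OF that] phi_finite[of x z] that interior_subset by (auto simp: enn2real_positive_iff)
  have le1: "enn2real (phi x z) \<le> 1" if "x \<in> J" for x z
    using phi_le_1[OF that, of z] by (intro enn2real_leI) auto
  note lt = level_less[of y]
  have "discrete_harmonic p q D G"
  proof
    fix k
    show "0 \<le> p k" "0 \<le> q k" by (auto simp: p_def q_def)
    have "p k \<le> \<bar>?u (Suc k) - ?u k\<bar> / \<bar>?u (Suc (Suc k)) - ?u k\<bar>"
      unfolding p_def by (rule exit_ed_real) (use uJ lt in auto)
    then show "p k \<le> 1 / 3" by (simp add: level_def)
    have "q k \<le> \<bar>?u (Suc k) - ?u (Suc (Suc k))\<bar> / \<bar>?u k - ?u (Suc (Suc k))\<bar>"
      unfolding q_def by (rule exit_ed_real) (use uJ lt in auto)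
    then show "q k \<le> 2 / 3" by (simp add: level_def)
    show "0 < D k" unfolding D_def by (rule pos[OF ui yJ])
    have seg: "?u k \<in> closed_segment (?u (Suc k)) y" "?u k \<in> closed_segment y (?u (Suc k))"
      "?u k \<in> closed_segment (?u (Suc (Suc k))) y" "?u k \<in> closed_segment y (?u (Suc (Suc k)))"
      "?u (Suc k) \<in> closed_segment y (?u (Suc (Suc k)))"
      using lt[of k] lt[of "Suc k"] level_ge[of y k] by (auto simp: closed_segment_eq_real_ivl)
    have DS: "D (Suc k) = enn2real (phi (?u (Suc k)) (?u k)) * D k"
      unfolding D_def by (rule phi_real_mult[OF uJ seg(1)])
    show "D (Suc k) \<le> D k"
      using DS le1[OF uJ, of "Suc k" "?u k"] \<open>0 < D k\<close> by (simp add: mult_left_le_one_le)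
    \<comment> \<open>First exit from the interval around the middle level, with the lower end as
      target; multiplication by \<open>D k\<close> continues the passage down to
      \<open>y\<close>.\<close>
    have "enn2real (phi (?u (Suc k)) (?u k)) = q k + p k * enn2real (phi (?u (Suc (Suc k))) (?u k))"
      unfolding p_def q_def by (rule phi_real_exit[OF uJ uJ]) (use lt[of k] lt[of "Suc k"] in auto)
    moreover have "D (Suc (Suc k)) = enn2real (phi (?u (Suc (Suc k))) (?u k)) * D k"
      unfolding D_def by (rule phi_real_mult[OF uJ seg(3)])
    ultimately show "D (Suc k) = p k * D (k + 2) + q k * D k"
      using DS by (simp add: algebra_simps)
    show "G 0 = 1" by (simp add: G_def phi_self[OF yJ])
    have fpos: "0 < enn2real (phi y (?u j))" for j by (rule pos[OF y uJ])
    show "1 < G 1"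
    proof -
      have "phi y (?u 1) < 1" using phi_less_1[OF yJ, of "?u 1"] lt[of 0] by simp
      then have "enn2real (phi y (?u 1)) < 1" using phi_finite[OF yJ]
        by (simp add: enn2real_less_iff)
      then show ?thesis using fpos[of 1] by (simp add: G_def)
    qed
    have GS: "enn2real (phi y (?u (Suc k))) = enn2real (phi y (?u k)) * enn2real (phi (?u k) (?u (Suc k)))"
      by (rule phi_real_mult[OF yJ seg(2)])
    then have "enn2real (phi y (?u (Suc k))) \<le> enn2real (phi y (?u k))"
      using le1[OF uJ, of k] fpos[of k] by (simp add: mult_left_le)
    then show "G k \<le> G (Suc k)"
      unfolding G_def using fpos by (intro divide_left_mono) auto
    \<comment> \<open>The same exit with the upper end as target; the product rule then expresses
      both transforms by passages that start at \<open>y\<close>.\<close>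
    have "enn2real (phi (?u (Suc k)) (?u (Suc (Suc k)))) = p k + q k * enn2real (phi (?u k) (?u (Suc (Suc k))))"
      unfolding p_def q_def by (rule phi_real_exit[OF uJ uJ]) (use lt[of k] lt[of "Suc k"] in auto)
    moreover have "enn2real (phi (?u (Suc k)) (?u (Suc (Suc k)))) = enn2real (phi y (?u (Suc (Suc k)))) / enn2real (phi y (?u (Suc k)))"
      using phi_real_mult[OF yJ seg(5)] fpos[of "Suc k"] by simp
    moreover have "enn2real (phi (?u k) (?u (Suc (Suc k)))) = enn2real (phi y (?u (Suc (Suc k)))) / enn2real (phi y (?u k))"
      using phi_real_mult[OF yJ seg(4)] fpos[of k] by simp
    ultimately have "enn2real (phi y (?u (Suc (Suc k)))) / enn2real (phi y (?u (Suc k))) =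
        p k + q k * (enn2real (phi y (?u (Suc (Suc k)))) / enn2real (phi y (?u k)))"
      by simp
    then show "G (Suc k) = p k * G (k + 2) + q k * G k"
      using harmonic_inverse[OF fpos[of k] fpos[of "Suc k"] fpos[of "Suc (Suc k)"]] by (simp add: G_def)
  qed
  from discrete_harmonic.D_vanishes_iff[OF this] show ?thesis by (simp add: D_def[abs_def] G_def)
qed

text \<open>This removes the killing at \<open>c\<close>: the process can return from \<open>c\<close> to \<open>y\<close> only at the cost of a factor
  \<open>phi c y < 1\<close>, so that the excursions below \<open>c\<close> sum up to a geometric series.\<close>

lemma passage_le_exit:
  assumes y: "y \<in> J" and c: "c \<in> J" "c < y" and b: "y < b"
  shows "enn2real (phi y b) * (1 - enn2real (phi c y)) \<le> enn2real (exit_ed y b c)"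
proof -
  have "enn2real (phi c b) = enn2real (phi c y) * enn2real (phi y b)"
    by (rule phi_real_mult) (use assms in \<open>auto simp: closed_segment_eq_real_ivl\<close>)
  moreover have "enn2real (phi y b) = enn2real (exit_ed y b c) + enn2real (exit_ed y c b) * enn2real (phi c b)"
    by (rule phi_real_exit) (use assms in auto)
  moreover have "enn2real (exit_ed y c b) * enn2real (phi c b) \<le> 1 * enn2real (phi c b)"
    using exit_ed_le_1[OF y, of c b] by (intro mult_right_mono enn2real_leI) auto
  ultimately show ?thesis by (simp add: algebra_simps)
qed

lemma one_minus_phi_pos: "c \<in> J \<Longrightarrow> c \<noteq> y \<Longrightarrow> 0 < 1 - enn2real (phi c y)"
  using phi_less_1[of c y] phi_finite[of c y] by (simp add: enn2real_less_iff)

text \<open>The martingale property tested on events of the past. This form passes directly to the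
  reflected process and to the positive part.\<close>

definition mart_prop :: "real \<Rightarrow> bool" where
  "mart_prop x \<longleftrightarrow> (\<forall>t\<ge>0. integrable (P x) (X t)) \<and>
     (\<forall>s\<ge>0. \<forall>t\<ge>s. \<forall>B\<in>sets (F s). (\<integral>\<omega>\<in>B. X t \<omega> \<partial>P x) = (\<integral>\<omega>\<in>B. X s \<omega> \<partial>P x))"

lemma integral_le_nn: "integrable M f \<Longrightarrow> ennreal (\<integral>x. f x \<partial>M) \<le> (\<integral>\<^sup>+x. ennreal (f x) \<partial>M)"
proof -
  assume f: "integrable M f"
  then have i: "integrable M (\<lambda>x. max 0 (f x))" by (intro integrable_max) auto
  have "(\<integral>x. f x \<partial>M) \<le> (\<integral>x. max 0 (f x) \<partial>M)" by (intro integral_mono f i) auto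
  then have "ennreal (\<integral>x. f x \<partial>M) \<le> ennreal (\<integral>x. max 0 (f x) \<partial>M)" by (rule ennreal_leI)
  also have "\<dots> = (\<integral>\<^sup>+x. ennreal (max 0 (f x)) \<partial>M)" by (rule nn_integral_eq_integral[symmetric, OF i]) auto
  also have "\<dots> = (\<integral>\<^sup>+x. ennreal (f x) \<partial>M)" by (intro nn_integral_cong) (auto simp: max_def ennreal_neg)
  finally show ?thesis .
qed

text \<open>The martingale property is tested on the part of \<open>B\<close> where
  \<open>X s\<close> is positive; there \<open>X s\<close> agrees with its positive part, and
  \<open>X t\<close> is at most its own.\<close>

lemma positive_part_submart:
  assumes x: "x \<in> J" and m: "mart_prop x" and st: "0 \<le> s" "s \<le> t" and B: "B \<in> sets (F s)"
  shows "(\<integral>\<^sup>+\<omega>. ennreal (X s \<omega>) * indicator B \<omega> \<partial>P x) \<le> (\<integral>\<^sup>+\<omega>. ennreal (X t \<omega>) * indicator B \<omega> \<partial>P x)"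
proof -
  define C where "C = B \<inter> {\<omega>\<in>space (F s). 0 < X s \<omega>}"
  have C: "C \<in> sets (F s)" unfolding C_def using B X_meas_F[OF st(1)] by measurable
  have CA: "C \<in> sets (P x)" using C sets_F[OF st(1)] x by (auto simp: sets_P_iff)
  have Xint: "integrable (P x) (X s)" "integrable (P x) (X t)" using m st by (auto simp: mart_prop_def)
  have ii: "integrable (P x) (\<lambda>\<omega>. indicator C \<omega> * X r \<omega>)" if "integrable (P x) (X r)" for r
    using integrable_mult_indicator[OF CA that] by simp
  have "(\<integral>\<^sup>+\<omega>. ennreal (X s \<omega>) * indicator B \<omega> \<partial>P x) = (\<integral>\<^sup>+\<omega>. ennreal (indicator C \<omega> * X s \<omega>) \<partial>P x)"
    by (rule nn_integral_cong) (auto simp: C_def x space_F[OF st(1)] ennreal_neg not_less split: split_indicator)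
  also have "\<dots> = ennreal (\<integral>\<omega>. indicator C \<omega> * X s \<omega> \<partial>P x)"
    by (rule nn_integral_eq_integral[OF ii[OF Xint(1)]]) (auto simp: C_def split: split_indicator)
  also have "\<dots> = ennreal (\<integral>\<omega>. indicator C \<omega> * X t \<omega> \<partial>P x)"
  proof -
    have "(\<integral>\<omega>\<in>C. X t \<omega> \<partial>P x) = (\<integral>\<omega>\<in>C. X s \<omega> \<partial>P x)"
      using m C st unfolding mart_prop_def by blast
    then show ?thesis by (simp add: set_lebesgue_integral_def)
  qed
  also have "\<dots> \<le> (\<integral>\<^sup>+\<omega>. ennreal (indicator C \<omega> * X t \<omega>) \<partial>P x)"
    by (rule integral_le_nn[OF ii[OF Xint(2)]])
  also have "\<dots> \<le> (\<integral>\<^sup>+\<omega>. ennreal (X t \<omega>) * indicator B \<omega> \<partial>P x)"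
    by (rule nn_integral_mono) (auto simp: C_def split: split_indicator)
  finally show ?thesis .
qed

lemma X_P [measurable]: "x \<in> J \<Longrightarrow> 0 \<le> t \<Longrightarrow> X t \<in> borel_measurable (P x)"
  by (rule P_meas) measurable

text \<open>Doob's inequality in continuous time, with the indicator kept on the right: for
  \<open>b\<close> tending to the end point, the right-hand side then vanishes by dominated
  convergence, which makes the left-hand side small even with the factor \<open>b\<close>.\<close>

lemma maximal_inequality:
  assumes y: "y \<in> J" and m: "mart_prop y" and b: "y \<noteq> b" and t: "0 < t"
  shows "ennreal b * emeasure (P y) (hit_by b t)
     \<le> (\<integral>\<^sup>+\<omega>. ennreal (X t \<omega>) * indicator {\<omega>. hit b \<omega> \<le> ennreal t} \<omega> \<partial>P y)" (is "_ \<le> ?K")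
proof -
  let ?\<tau> = "hit b"
  define g where "g n i = t * real i / real (Suc n)" for n i :: nat
  define S where "S n i = {\<omega>\<in>space A. ?\<tau> \<omega> \<le> ennreal (g n i)}" for n i
  \<comment> \<open>The positive part of the process at the first grid time not before the hitting
    time. Path continuity and Fatou's lemma recover the value \<open>b\<close>.\<close>
  define R where "R n \<omega> = (\<Sum>i<Suc n. ennreal (X (g n (Suc i)) \<omega>) * indicator (S n (Suc i) - S n i) \<omega>)" for n \<omega>
  have g: "0 \<le> g n i" "g n i \<le> g n (Suc i)" "g n (Suc n) = t" for n i
    using t by (auto simp: g_def divide_right_mono mult_left_mono)
  have gt: "g n i \<le> t" if "i \<le> Suc n" for n i
  proof -
    have "t * real i \<le> t * real (Suc n)" using that t by (intro mult_left_mono) auto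
    then show ?thesis by (simp add: g_def pos_divide_le_eq del: of_nat_Suc)
  qed
  have SF: "S n i \<in> sets (F (g n i))" for n i
    unfolding S_def using hitting_stopping g by (auto simp: ext_stopping_time_def)
  have Sm: "S n i \<subseteq> S n (Suc i)" for n i
    unfolding S_def using ennreal_leI[OF g(2)] order_trans by blast
  have SA: "S n i \<in> sets (P y)" for n i using subsetD[OF sets_F[OF g(1)] SF] y by (simp add: sets_P_iff)
  note [measurable] = SA X_P[OF y g(1)] X_P[OF y less_imp_le[OF t]]
  have Rm: "R n \<in> borel_measurable (P y)" for n
    unfolding R_def by measurable
  have RK: "(\<integral>\<^sup>+\<omega>. R n \<omega> \<partial>P y) \<le> ?K" for n
  proof -
    have part: "(\<Sum>i<k. \<integral>\<^sup>+\<omega>. ennreal (X t \<omega>) * indicator (S n (Suc i) - S n i) \<omega> \<partial>P y)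
       \<le> (\<integral>\<^sup>+\<omega>. ennreal (X t \<omega>) * indicator (S n k) \<omega> \<partial>P y)" for k
    proof (induction k)
      case (Suc k)
      have "(\<Sum>i<Suc k. \<integral>\<^sup>+\<omega>. ennreal (X t \<omega>) * indicator (S n (Suc i) - S n i) \<omega> \<partial>P y)
         \<le> (\<integral>\<^sup>+\<omega>. ennreal (X t \<omega>) * indicator (S n k) \<omega> \<partial>P y) + (\<integral>\<^sup>+\<omega>. ennreal (X t \<omega>) * indicator (S n (Suc k) - S n k) \<omega> \<partial>P y)"
        using Suc by (simp add: add_right_mono)
      also have "\<dots> = (\<integral>\<^sup>+\<omega>. ennreal (X t \<omega>) * indicator (S n k) \<omega> + ennreal (X t \<omega>) * indicator (S n (Suc k) - S n k) \<omega> \<partial>P y)"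
        by (rule nn_integral_add[symmetric]) measurable
      also have "\<dots> = (\<integral>\<^sup>+\<omega>. ennreal (X t \<omega>) * indicator (S n (Suc k)) \<omega> \<partial>P y)"
        by (rule nn_integral_cong) (use Sm[of n k] in \<open>auto split: split_indicator\<close>)
      finally show ?case .
    qed simp
    have "(\<integral>\<^sup>+\<omega>. R n \<omega> \<partial>P y) = (\<Sum>i<Suc n. \<integral>\<^sup>+\<omega>. ennreal (X (g n (Suc i)) \<omega>) * indicator (S n (Suc i) - S n i) \<omega> \<partial>P y)"
      unfolding R_def by (rule nn_integral_sum) measurable
    also have "\<dots> \<le> (\<Sum>i<Suc n. \<integral>\<^sup>+\<omega>. ennreal (X t \<omega>) * indicator (S n (Suc i) - S n i) \<omega> \<partial>P y)"
    proof (rule sum_mono)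
      fix i assume i: "i \<in> {..<Suc n}"
      have "S n i \<in> sets (F (g n (Suc i)))" using SF[of n i] F_mono[OF g(1,2)] by auto
      then have "S n (Suc i) - S n i \<in> sets (F (g n (Suc i)))" using SF by auto
      then show "(\<integral>\<^sup>+\<omega>. ennreal (X (g n (Suc i)) \<omega>) * indicator (S n (Suc i) - S n i) \<omega> \<partial>P y)
        \<le> (\<integral>\<^sup>+\<omega>. ennreal (X t \<omega>) * indicator (S n (Suc i) - S n i) \<omega> \<partial>P y)"
        by (intro positive_part_submart[OF y m g(1)] gt) (use i in auto)
    qed
    also have "\<dots> \<le> (\<integral>\<^sup>+\<omega>. ennreal (X t \<omega>) * indicator (S n (Suc n)) \<omega> \<partial>P y)" by (rule part)
    also have "\<dots> = ?K"
      by (rule nn_integral_cong) (auto simp: S_def g(3) y split: split_indicator)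
    finally show ?thesis .
  qed
  have "ennreal b * emeasure (P y) {\<omega>\<in>space A. ?\<tau> \<omega> \<le> ennreal t}
     = (\<integral>\<^sup>+\<omega>. ennreal b * indicator {\<omega>\<in>space A. ?\<tau> \<omega> \<le> ennreal t} \<omega> \<partial>P y)"
    by (rule nn_integral_cmult_indicator[symmetric]) (use y in \<open>simp add: sets_P_iff\<close>)
  also have "\<dots> \<le> (\<integral>\<^sup>+\<omega>. liminf (\<lambda>n. R n \<omega>) \<partial>P y)"
  proof (rule nn_integral_mono_AE, use AE_start[OF y] in eventually_elim)
    fix \<omega> assume w: "\<omega> \<in> space A \<and> X 0 \<omega> = y"
    show "ennreal b * indicator {\<omega>\<in>space A. ?\<tau> \<omega> \<le> ennreal t} \<omega> \<le> liminf (\<lambda>n. R n \<omega>)"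
    proof (cases "?\<tau> \<omega> \<le> ennreal t")
      case True
      then obtain s where s: "?\<tau> \<omega> = ennreal s" "0 \<le> s" "s \<le> t"
        using t by (cases "?\<tau> \<omega>") (auto simp: top_unique)
      have Xs: "X s \<omega> = b" using hitting_attained[of \<omega> b] s w by auto
      \<comment> \<open>A hit at time 0 lies in none of the windows
        \<open>S n (Suc i) - S n i\<close>; it is excluded by \<open>y \<noteq> b\<close>.\<close>
      then have s0: "0 < s" using w b s by (cases "s = 0") auto
      \<comment> \<open>The index of the window, open on the left and closed on the right, that
        contains the hitting time \<open>s\<close>.\<close>
      define I where "I n = nat \<lceil>s * real (Suc n) / t\<rceil> - 1" for n
      have I: "I n < Suc n" "s \<le> g n (Suc (I n))" "g n (I n) < s" "g n (Suc (I n)) \<le> s + t / real (Suc n)" for n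
      proof -
        let ?z = "s * real (Suc n) / t"
        have z: "0 < ?z" using s0 t by simp
        have "?z \<le> real (Suc n)" using s(3) t by (simp add: pos_divide_le_eq mult_right_mono mult.commute)
        then have c: "1 \<le> \<lceil>?z\<rceil>" "\<lceil>?z\<rceil> \<le> int (Suc n)" using z by (auto simp: ceiling_le_iff)
        then have ri: "real (Suc (I n)) = of_int \<lceil>?z\<rceil>" unfolding I_def by (simp add: of_nat_diff nat_diff_distrib)
        show "I n < Suc n" using c unfolding I_def by linarith
        have a: "?z \<le> real (Suc (I n))" "real (Suc (I n)) < ?z + 1" unfolding ri by linarith+
        show "s \<le> g n (Suc (I n))"
          using a(1) t by (simp add: g_def field_simps del: of_nat_Suc)
        have "real (I n) < ?z" using a(2) by simp
        then show "g n (I n) < s"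
          using t by (simp add: g_def field_simps del: of_nat_Suc)
        show "g n (Suc (I n)) \<le> s + t / real (Suc n)"
          using a(2) t by (simp add: g_def field_simps del: of_nat_Suc)
      qed
      have lim: "(\<lambda>n. g n (Suc (I n))) \<longlonglongrightarrow> s"
      proof (rule tendsto_sandwich[OF _ _ tendsto_const])
        have "(\<lambda>n. s + t * (1 / real (Suc n))) \<longlonglongrightarrow> s + t * 0"
          by (intro tendsto_intros LIMSEQ_Suc[OF lim_1_over_n])
        then show "(\<lambda>n. s + t / real (Suc n)) \<longlonglongrightarrow> s" by simp
      qed (use I in auto)
      have "(\<lambda>n. X (g n (Suc (I n))) \<omega>) \<longlonglongrightarrow> X s \<omega>"
        by (rule continuous_on_tendsto_compose[OF continuous_paths lim]) (use w s g in auto)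
      then have "(\<lambda>n. ennreal (X (g n (Suc (I n))) \<omega>)) \<longlonglongrightarrow> ennreal b"
        unfolding Xs by (rule tendsto_ennrealI)
      then have "ennreal b = liminf (\<lambda>n. ennreal (X (g n (Suc (I n))) \<omega>))"
        by (simp add: lim_imp_Liminf)
      also have "\<dots> \<le> liminf (\<lambda>n. R n \<omega>)"
      proof (rule Liminf_mono, rule always_eventually, rule allI)
        fix n
        have "ennreal (X (g n (Suc (I n))) \<omega>) = ennreal (X (g n (Suc (I n))) \<omega>) * indicator (S n (Suc (I n)) - S n (I n)) \<omega>"
          using I[of n] w s g(1)[of n] by (auto simp: S_def ennreal_le_iff split: split_indicator)
        also have "\<dots> \<le> R n \<omega>"
          unfolding R_def using I(1)[of n]
          by (intro member_le_sum[of "I n" _ "\<lambda>i. ennreal (X (g n (Suc i)) \<omega>) * indicator (S n (Suc i) - S n i) \<omega>"]) auto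
        finally show "ennreal (X (g n (Suc (I n))) \<omega>) \<le> R n \<omega>" .
      qed
      finally show ?thesis using True by (auto split: split_indicator)
    qed (auto split: split_indicator)
  qed
  also have "\<dots> \<le> liminf (\<lambda>n. \<integral>\<^sup>+\<omega>. R n \<omega> \<partial>P y)"
    by (rule nn_integral_liminf[OF Rm])
  also have "\<dots> \<le> ?K"
    using RK by (intro Liminf_le) auto
  finally show ?thesis .
qed

end

section \<open>The martingale property\<close>

context absorbed_diffusion
begin

text \<open>A continuous path attains its maximum on a compact time interval, and this maximum is a
  point of \<open>J\<close>; no higher level is hit by then.\<close>

lemma path_bounded:
  assumes w: "\<omega> \<in> space A" and T: "0 \<le> T"
  shows "\<exists>\<beta>\<in>J. \<forall>b>\<beta>. ennreal T < hit b \<omega>"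
proof -
  have "continuous_on {0..T} (\<lambda>t. X t \<omega>)"
    by (rule continuous_on_subset[OF continuous_paths[OF w]]) auto
  then obtain s where s: "s \<in> {0..T}" "\<And>t. t \<in> {0..T} \<Longrightarrow> X t \<omega> \<le> X s \<omega>"
    using continuous_attains_sup[of "{0..T}" "\<lambda>t. X t \<omega>"] T by auto
  show ?thesis
  proof (intro bexI allI impI)
    show "X s \<omega> \<in> J" using X_in_J s w by auto
    fix b assume "X s \<omega> < b"
    then show "ennreal T < hit b \<omega>"
      using hitting_le_iff[OF w T, of b] s(2) by (fastforce simp: not_le[symmetric])
  qed
qed

text \<open>For \<open>J\<close> without a largest element, a sequence \<open>b\<close> as below tends to its right end point.\<close>

lemma hit_vanish:
  fixes b :: "nat \<Rightarrow> real"
  assumes y: "y \<in> J" and t: "0 \<le> t" and b: "\<And>z. z \<in> J \<Longrightarrow> \<forall>\<^sub>F n in sequentially. z < b n"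
    and f: "f \<in> borel_measurable (P y)" "(\<integral>\<^sup>+\<omega>. f \<omega> \<partial>P y) < \<infinity>"
  shows "(\<lambda>n. \<integral>\<^sup>+\<omega>. f \<omega> * indicator {\<omega>. hit (b n) \<omega> \<le> ennreal t} \<omega> \<partial>P y) \<longlonglongrightarrow> 0"
proof -
  have "(\<lambda>n. \<integral>\<^sup>+\<omega>. f \<omega> * indicator {\<omega>. hit (b n) \<omega> \<le> ennreal t} \<omega> \<partial>P y) \<longlonglongrightarrow> (\<integral>\<^sup>+\<omega>. 0 \<partial>P y)"
  proof (rule nn_integral_dominated_convergence[where w=f])
    show "(\<lambda>\<omega>. f \<omega> * indicator {\<omega>. hit (b n) \<omega> \<le> ennreal t} \<omega>) \<in> borel_measurable (P y)" for n
      using f(1) hit_P[OF y] by measurable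
    show "AE \<omega> in P y. (\<lambda>n. f \<omega> * indicator {\<omega>. hit (b n) \<omega> \<le> ennreal t} \<omega>) \<longlonglongrightarrow> 0"
      using AE_start[OF y]
    proof eventually_elim
      fix \<omega> assume w: "\<omega> \<in> space A \<and> X 0 \<omega> = y"
      obtain \<beta> where \<beta>: "\<beta> \<in> J" "\<And>c. \<beta> < c \<Longrightarrow> ennreal t < hit c \<omega>"
        using path_bounded[OF _ t] w by blast
      have "\<forall>\<^sub>F n in sequentially. f \<omega> * indicator {\<omega>. hit (b n) \<omega> \<le> ennreal t} \<omega> = 0"
        using b[OF \<beta>(1)] by eventually_elim (use \<beta>(2) in \<open>auto simp: not_le split: split_indicator\<close>)
      then show "(\<lambda>n. f \<omega> * indicator {\<omega>. hit (b n) \<omega> \<le> ennreal t} \<omega>) \<longlonglongrightarrow> 0"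
        by (rule tendsto_eventually)
    qed
  qed (use f in \<open>auto split: split_indicator\<close>)
  then show ?thesis by simp
qed

lemma level_eventually: "\<forall>\<^sub>F k in sequentially. z < level y k"
proof -
  obtain N where N: "z - y + 1 < 2 ^ N" using real_arch_pow[of 2 "z - y + 1"] by auto
  show ?thesis
  proof (rule eventually_sequentiallyI)
    fix k assume "N \<le> k"
    then have "level y N \<le> level y k" by (rule level_mono)
    then show "z < level y k" using N unfolding level_def by linarith
  qed
qed

lemma nn_abs_finite: "integrable M f \<Longrightarrow> (\<integral>\<^sup>+x. ennreal \<bar>f x\<bar> \<partial>M) < \<infinity>" for f :: "'b \<Rightarrow> real"
  using integrable_iff_bounded[of M f] by simp

text \<open>The maximal inequality handles hits by a fixed time \<open>t\<close>; later hits
  contribute \<open>exp (- t)\<close> times a bounded quantity after multiplication by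
  \<open>2 ^ k\<close>. The limit in \<open>k\<close> is taken first, then the one in
  \<open>t\<close>.\<close>

lemma mart_levels:
  assumes y: "y \<in> interior J" and inf: "{y..} \<subseteq> J" and m: "mart_prop y"
  shows "(\<lambda>k. 2 ^ k * enn2real (phi y (level y k))) \<longlonglongrightarrow> 0"
proof -
  have yJ: "y \<in> J" using y interior_subset by auto
  interpret prob_space "P y" by (rule prob_P[OF yJ])
  obtain e where e: "0 < e" "ball y e \<subseteq> J" using y by (meson mem_interior)
  \<comment> \<open>The point \<open>c\<close> serves as a killing point: the probability of a high
    level before \<open>c\<close> is of order \<open>2 ^ - k\<close>, which compensates the weight
    in the contribution of late hits.\<close>
  define c where "c = y - e / 2"
  have c: "c \<in> J" "c < y" using e by (auto simp: c_def dist_real_def subset_iff)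
  define \<kappa> where "\<kappa> = 1 - enn2real (phi c y)"
  have \<kappa>: "0 < \<kappa>" unfolding \<kappa>_def by (rule one_minus_phi_pos) (use c in auto)
  let ?u = "level y"
  have uJ: "?u k \<in> J" for k using inf level_ge[of y k] by auto
  let ?pr = "\<lambda>t k. measure (P y) (hit_by (?u k) t)"
  have lim: "(\<lambda>k. 2 ^ k * ?pr t k) \<longlonglongrightarrow> 0" if t: "0 < t" for t
  proof -
    have Xt: "integrable (P y) (X t)" using m t by (auto simp: mart_prop_def)
    have "(\<lambda>k. \<integral>\<^sup>+\<omega>. ennreal \<bar>X t \<omega>\<bar> * indicator {\<omega>. hit (?u k) \<omega> \<le> ennreal t} \<omega> \<partial>P y) \<longlonglongrightarrow> 0"
      by (rule hit_vanish[OF yJ]) (use t level_eventually Xt nn_abs_finite[OF Xt] in auto)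
    then have "(\<lambda>k. 2 * enn2real (\<integral>\<^sup>+\<omega>. ennreal \<bar>X t \<omega>\<bar> * indicator {\<omega>. hit (?u k) \<omega> \<le> ennreal t} \<omega> \<partial>P y)) \<longlonglongrightarrow> 2 * enn2real 0"
      by (intro tendsto_intros) auto
    then have l: "(\<lambda>k. 2 * enn2real (\<integral>\<^sup>+\<omega>. ennreal \<bar>X t \<omega>\<bar> * indicator {\<omega>. hit (?u k) \<omega> \<le> ennreal t} \<omega> \<partial>P y)) \<longlonglongrightarrow> 0"
      by simp
    show ?thesis
    proof (rule tendsto_sandwich[OF _ _ tendsto_const l])
      show "\<forall>\<^sub>F k in sequentially. 2 ^ k * ?pr t k \<le> 2 * enn2real (\<integral>\<^sup>+\<omega>. ennreal \<bar>X t \<omega>\<bar> * indicator {\<omega>. hit (?u k) \<omega> \<le> ennreal t} \<omega> \<partial>P y)"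
        using level_eventually[of "max (y + 1) (max 0 (1 - y))" y]
      proof eventually_elim
        \<comment> \<open>The three bounds give, in turn, a level different from \<open>y\<close>, a
          positive level, and \<open>2 ^ k \<le> 2 * ?u k\<close>.\<close>
        fix k assume k: "max (y + 1) (max 0 (1 - y)) < ?u k"
        let ?I = "\<integral>\<^sup>+\<omega>. ennreal \<bar>X t \<omega>\<bar> * indicator {\<omega>. hit (?u k) \<omega> \<le> ennreal t} \<omega> \<partial>P y"
        have "ennreal (?u k) * emeasure (P y) (hit_by (?u k) t)
           \<le> (\<integral>\<^sup>+\<omega>. ennreal (X t \<omega>) * indicator {\<omega>. hit (?u k) \<omega> \<le> ennreal t} \<omega> \<partial>P y)"
          by (rule maximal_inequality[OF yJ m _ t]) (use k in auto)
        also have "\<dots> \<le> ?I"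
          by (rule nn_integral_mono) (auto intro!: ennreal_leI split: split_indicator)
        finally have "ennreal (?u k * ?pr t k) \<le> ?I"
          using k by (simp add: emeasure_P_eq[OF yJ] ennreal_mult)
        moreover have "?I < \<top>"
        proof (rule le_less_trans)
          show "?I \<le> (\<integral>\<^sup>+\<omega>. ennreal \<bar>X t \<omega>\<bar> \<partial>P y)" by (rule nn_integral_mono) (auto split: split_indicator)
        qed (use nn_abs_finite[OF Xt] in simp)
        ultimately have "?u k * ?pr t k \<le> enn2real ?I"
          using k enn2real_mono[of "ennreal (?u k * ?pr t k)" ?I] by simp
        moreover have "2 ^ k * ?pr t k \<le> 2 * ?u k * ?pr t k"
          by (rule mult_right_mono) (use k in \<open>auto simp: level_def\<close>)
        ultimately show "2 ^ k * ?pr t k \<le> 2 * enn2real ?I" by simp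
      qed
    qed auto
  qed
  have bound: "2 ^ Suc k * enn2real (phi y (?u (Suc k))) \<le> (2 ^ Suc k * ?pr t (Suc k) + exp (- t) * (2 * (y - c))) / \<kappa>"
    if t: "0 < t" for t k
  proof -
    let ?b = "?u (Suc k)"
    have yb: "y < ?b" using level_less[of y k] level_ge[of y k] by simp
    have "enn2real (phi y ?b) * \<kappa> \<le> enn2real (exit_ed y ?b c)"
      unfolding \<kappa>_def by (rule passage_le_exit[OF yJ c yb])
    also have "\<dots> \<le> ?pr t (Suc k) + exp (-t) * ((y - c) / (?b - c))"
    proof (rule enn2real_leI)
      show "exit_ed y ?b c \<le> ennreal (?pr t (Suc k) + exp (-t) * ((y - c) / (?b - c)))"
        using exit_ed_le_prob[OF yJ less_imp_le[OF t], of ?b c] exit_prob[OF c(1) uJ, of y "Suc k"] c yb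
        by (simp add: emeasure_P_eq[OF yJ] ennreal_mult'[symmetric] flip: ennreal_plus)
    qed (use c yb in auto)
    finally have "2 ^ Suc k * (enn2real (phi y ?b) * \<kappa>) \<le> 2 ^ Suc k * (?pr t (Suc k) + exp (-t) * ((y - c) / (?b - c)))"
      by (rule mult_left_mono) simp
    also have "\<dots> = 2 ^ Suc k * ?pr t (Suc k) + exp (-t) * ((2 ^ Suc k / (?b - c)) * (y - c))"
      by (simp add: algebra_simps)
    also have "\<dots> \<le> 2 ^ Suc k * ?pr t (Suc k) + exp (-t) * (2 * (y - c))"
    proof (intro add_left_mono mult_left_mono mult_right_mono)
      \<comment> \<open>Since \<open>c < y\<close>, the distance from \<open>c\<close> to the level
        is more than \<open>2 ^ Suc k - 1\<close>, hence at least \<open>2 ^ k\<close>.\<close>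
      have one: "(1::real) \<le> 2 ^ k" by simp
      have "2 ^ Suc k \<le> 2 * (?b - c)"
        using c(2) one unfolding level_def power_Suc by argo
      then show "2 ^ Suc k / (?b - c) \<le> 2" using c yb by (simp add: pos_divide_le_eq)
    qed (use c in auto)
    finally show ?thesis using \<kappa> by (simp add: pos_le_divide_eq mult.assoc)
  qed
  show ?thesis
  proof (rule LIMSEQ_imp_Suc, rule metric_LIMSEQ_I)
    fix \<epsilon> :: real assume \<epsilon>: "0 < \<epsilon>"
    have "((\<lambda>t. exp (-t) * (2 * (y - c))) \<longlongrightarrow> 0 * (2 * (y - c))) at_top"
      by (intro tendsto_intros filterlim_compose[OF exp_at_bot filterlim_uminus_at_bot_at_top])
    then have "\<forall>\<^sub>F t in at_top. exp (-t) * (2 * (y - c)) < \<epsilon> * \<kappa> / 2"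
      using \<epsilon> \<kappa> by (intro order_tendstoD(2)[where y="0 * (2 * (y - c))"]) auto
    then have "\<forall>\<^sub>F t in at_top. exp (-t) * (2 * (y - c)) < \<epsilon> * \<kappa> / 2 \<and> 0 < (t::real)"
      using eventually_gt_at_top[of 0] by eventually_elim auto
    then obtain t :: real where t: "exp (-t) * (2 * (y - c)) < \<epsilon> * \<kappa> / 2" "0 < t"
      by (auto simp: eventually_at_top_linorder)
    have "\<forall>\<^sub>F k in sequentially. 2 ^ Suc k * ?pr t (Suc k) < \<epsilon> * \<kappa> / 2"
      using LIMSEQ_Suc[OF lim[OF t(2)]] \<epsilon> \<kappa> by (intro order_tendstoD(2)) auto
    then obtain N where N: "\<And>k. N \<le> k \<Longrightarrow> 2 ^ Suc k * ?pr t (Suc k) < \<epsilon> * \<kappa> / 2"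
      by (auto simp: eventually_sequentially)
    show "\<exists>no. \<forall>k\<ge>no. dist (2 ^ Suc k * enn2real (phi y (?u (Suc k)))) 0 < \<epsilon>"
    proof (intro exI allI impI)
      fix k assume "N \<le> k"
      then have "2 ^ Suc k * ?pr t (Suc k) + exp (- t) * (2 * (y - c)) < \<epsilon> * \<kappa>" using N[of k] t(1) by linarith
      then have "(2 ^ Suc k * ?pr t (Suc k) + exp (- t) * (2 * (y - c))) / \<kappa> < \<epsilon>" using \<kappa> by (simp add: pos_divide_less_eq)
      then have "2 ^ Suc k * enn2real (phi y (?u (Suc k))) < \<epsilon>" using bound[OF t(2), of k] by linarith
      then show "dist (2 ^ Suc k * enn2real (phi y (?u (Suc k)))) 0 < \<epsilon>"
        by (simp add: dist_real_def abs_mult)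
    qed
  qed
qed

lemma phi_antimono:
  assumes "x \<in> J" "q \<in> J" "q \<in> closed_segment x y" shows "phi x y \<le> phi q y"
  using phi_mult[OF assms(1,3)] mult_right_mono[OF phi_le_1[OF assms(1), of q], of "phi q y"] by simp

lemma open_end_seq:
  assumes nomax: "\<And>x. x \<in> J \<Longrightarrow> \<exists>z\<in>J. x < z" and bdd: "bdd_above J" and x: "x \<in> J"
  shows "\<exists>b. \<forall>n. b n \<in> J \<and> x < b n \<and> b n < Sup J \<and> (\<forall>z\<in>J. \<forall>\<^sub>F n in sequentially. z < (b n :: real))"
proof -
  define r where "r = Sup J"
  have ub: "x < r" if "x \<in> J" for x
    using nomax[OF that] cSup_upper[OF _ bdd] by (force simp: r_def intro: less_le_trans)
  have ex: "\<exists>q\<in>J. x < q" if "x < r" for x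
    using that nonempty bdd less_cSup_iff[of J x] by (auto simp: r_def)
  \<comment> \<open>Denominators from 2 on keep even the first term strictly above
    \<open>x\<close>.\<close>
  define b where "b n = r - (r - x) / real (n + 2)" for n :: nat
  have b: "x < b n" "b n < r" for n
  proof -
    have "(r - x) * 1 < (r - x) * real (n + 2)" using ub[OF x] by (intro mult_strict_left_mono) auto
    then have "(r - x) / real (n + 2) < r - x" by (simp add: pos_divide_less_eq)
    then show "x < b n" by (simp add: b_def)
    show "b n < r" using ub[OF x] by (simp add: b_def)
  qed
  have bJ: "b n \<in> J" for n
  proof -
    obtain z where "z \<in> J" "b n < z" using ex[OF b(2)] by auto
    then show ?thesis using J_Icc[OF x, of z] b(1)[of n] by auto
  qed
  have blim: "b \<longlonglongrightarrow> r"
  proof -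
    have "(\<lambda>n. r - (r - x) * (1 / real (n + 2))) \<longlonglongrightarrow> r - (r - x) * 0"
      by (intro tendsto_intros LIMSEQ_ignore_initial_segment[OF lim_1_over_n])
    then show ?thesis by (simp add: b_def[abs_def])
  qed
  have "\<forall>\<^sub>F n in sequentially. z < b n" if "z \<in> J" for z
    using blim ub[OF that] by (rule order_tendstoD(1))
  then show ?thesis using b bJ unfolding r_def by blast
qed

text \<open>A path that hits \<open>y\<close> in finite time does so before it hits some
  \<open>b\<close> close to the missing end point \<open>r\<close>. Letting \<open>b\<close> tend to
  \<open>r\<close> bounds the hitting probability by \<open>(r - x) / (r - y)\<close>, which
  vanishes at \<open>r\<close>.\<close>

lemma finite_open_end:
  assumes nomax: "\<And>x. x \<in> J \<Longrightarrow> \<exists>z\<in>J. x < z" and bdd: "bdd_above J" and y: "y \<in> J" and e: "0 < e"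
  shows "\<exists>q\<in>J. \<forall>x\<in>J. q < x \<longrightarrow> phi x y < ennreal e"
proof -
  define r where "r = Sup J"
  have ub: "x < r" if "x \<in> J" for x
    using nomax[OF that] cSup_upper[OF _ bdd] by (force simp: r_def intro: less_le_trans)
  have ex: "\<exists>q\<in>J. x < q" if "x < r" for x
    using that nonempty bdd less_cSup_iff[of J x] by (auto simp: r_def)
  have est: "phi x y \<le> ennreal ((r - x) / (r - y))" if x: "x \<in> J" "y < x" for x
  proof -
    obtain b where bb: "\<forall>n. b n \<in> J \<and> x < b n \<and> b n < r \<and> (\<forall>z\<in>J. \<forall>\<^sub>F n in sequentially. z < b n)"
      using open_end_seq[OF nomax bdd x(1)] unfolding r_def by blast
    have b: "x < b n" "b n < r" and bJ: "b n \<in> J" for n using bb by auto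
    have ev: "\<forall>\<^sub>F n in sequentially. z < b n" if "z \<in> J" for z using bb that by auto
    have "phi x y \<le> (\<integral>\<^sup>+\<omega>. liminf (\<lambda>n. indicator {\<omega>. hit y \<omega> < hit (b n) \<omega>} \<omega>) \<partial>P x)"
      unfolding phi_def
    proof (rule nn_integral_mono)
      fix \<omega> assume "\<omega> \<in> space (P x)"
      then have w: "\<omega> \<in> space A" using x by simp
      show "ed (hit y \<omega>) \<le> liminf (\<lambda>n. indicator {\<omega>. hit y \<omega> < hit (b n) \<omega>} \<omega>)"
      proof (cases "hit y \<omega>")
        case (real s)
        obtain \<beta> where \<beta>: "\<beta> \<in> J" "\<And>c. \<beta> < c \<Longrightarrow> ennreal s < hit c \<omega>"
          using path_bounded[OF w] real by blast
        have "1 \<le> liminf (\<lambda>n. indicator {\<omega>. hit y \<omega> < hit (b n) \<omega>} \<omega> :: ennreal)"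
          by (rule Liminf_bounded, use ev[OF \<beta>(1)] in eventually_elim) (use \<beta>(2) real in auto)
        then show ?thesis using ed_le_1 order_trans by blast
      qed simp
    qed
    also have "\<dots> \<le> liminf (\<lambda>n. \<integral>\<^sup>+\<omega>. indicator {\<omega>. hit y \<omega> < hit (b n) \<omega>} \<omega> \<partial>P x)"
      by (rule nn_integral_liminf) (use hit_P[OF x(1)] in measurable)
    also have "\<dots> \<le> ennreal ((r - x) / (r - y))"
    proof (rule Liminf_le, simp, rule always_eventually, rule allI)
      fix n
      have "(\<integral>\<^sup>+\<omega>. indicator {\<omega>. hit y \<omega> < hit (b n) \<omega>} \<omega> \<partial>P x)
        = ennreal (measure (P x) (hit_before y (b n)))"
        unfolding emeasure_P_eq[OF x(1), symmetric] by (rule emeasure_eq_nn[OF x(1), symmetric]) measurable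
      also have "\<dots> = ennreal ((b n - x) / (b n - y))"
        using exit_prob[OF bJ y, of n x] x b(1)[of n] by (simp add: abs_if)
      also have "\<dots> \<le> ennreal ((r - x) / (r - y))"
      proof (rule ennreal_leI)
        have "(b n - x) * (r - y) \<le> (r - x) * (b n - y)"
        proof -
          have "(r - x) * (b n - y) - (b n - x) * (r - y) = (r - b n) * (x - y)" by (simp add: algebra_simps)
          also have "0 \<le> \<dots>" using b(2)[of n] x by simp
          finally show ?thesis by simp
        qed
        then show "(b n - x) / (b n - y) \<le> (r - x) / (r - y)"
          using b[of n] x by (simp add: frac_le_eq divide_le_0_iff)
      qed
      finally show "(\<integral>\<^sup>+\<omega>. indicator {\<omega>. hit y \<omega> < hit (b n) \<omega>} \<omega> \<partial>P x) \<le> ennreal ((r - x) / (r - y))" .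
    qed
    finally show ?thesis .
  qed
  have "max y (r - e * (r - y)) < r" using ub[OF y] e by simp
  from ex[OF this] obtain q where q: "q \<in> J" "y < q" "r - e * (r - y) < q" by auto
  show ?thesis
  proof (intro bexI[OF _ q(1)] ballI impI)
    fix x assume x: "x \<in> J" "q < x"
    have "phi x y \<le> ennreal ((r - x) / (r - y))" using x q by (intro est) auto
    also have "\<dots> < ennreal e"
      using x q ub[OF x(1)] ub[OF y] e by (intro ennreal_lessI) (auto simp: pos_divide_less_eq)
    finally show "phi x y < ennreal e" .
  qed
qed

lemma unbounded_Ici: "\<not> bdd_above J \<Longrightarrow> y \<in> J \<Longrightarrow> {y..} \<subseteq> J"
proof
  fix x assume "\<not> bdd_above J" "y \<in> J" "x \<in> {y..}"
  moreover from this obtain z where "z \<in> J" "x < z" by (auto simp: bdd_above_def not_le)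
  ultimately show "x \<in> J" using J_Icc[of y z] by auto
qed

text \<open>The martingale property is used only if the right end point is infinite. The dichotomy
  yields the limit along the levels, and monotonicity of \<open>phi\<close> fills the gaps.\<close>

lemma mart_imp_right_natural:
  assumes m: "\<And>y. y \<in> interior J \<Longrightarrow> mart_prop y"
  shows right_natural
  unfolding right_natural_def
proof (intro ballI allI impI)
  fix y e :: real assume y: "y \<in> interior J" and e: "0 < e"
  have yJ: "y \<in> J" using y interior_subset by auto
  show "\<exists>q\<in>J. \<forall>x\<in>J. q < x \<longrightarrow> phi x y < ennreal e"
  proof (cases "\<exists>r\<in>J. \<forall>x\<in>J. x \<le> r")
    case True then show ?thesis by force
  next
    case False
    then have nomax: "\<exists>z\<in>J. x < z" if "x \<in> J" for x using that by force
    show ?thesis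
    proof (cases "bdd_above J")
      case True
      show ?thesis by (rule finite_open_end[OF nomax True yJ e])
    next
      case False
      from unbounded_Ici[OF this yJ] have inf: "{y..} \<subseteq> J" .
      have "(\<lambda>k. enn2real (phi (level y k) y)) \<longlonglongrightarrow> 0"
        using mart_levels[OF y inf m[OF y]] levels_dichotomy[OF y inf] by simp
      then have "\<forall>\<^sub>F k in sequentially. enn2real (phi (level y k) y) < e"
        using e by (intro order_tendstoD(2)) auto
      then obtain k where k: "enn2real (phi (level y k) y) < e" by (auto simp: eventually_sequentially)
      have qJ: "level y k \<in> J" using inf level_ge[of y k] by auto
      then have q: "phi (level y k) y < ennreal e"
        using k phi_finite[OF qJ, of y] e by (metis enn2real_nonneg ennreal_enn2real ennreal_lessI)
      show ?thesis
      proof (intro bexI[OF _ qJ] ballI impI)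
        fix x assume x: "x \<in> J" "level y k < x"
        have "phi x y \<le> phi (level y k) y"
          using x level_ge[of y k] by (intro phi_antimono qJ) (auto simp: closed_segment_eq_real_ivl)
        then show "phi x y < ennreal e" using q by simp
      qed
    qed
  qed
qed

end

section \<open>Integrability and stopping errors\<close>

context absorbed_diffusion
begin

text \<open>As a function of the starting point below \<open>b\<close>, \<open>phi\<close> with
  target \<open>b\<close> grows at least linearly relative to its value at \<open>y\<close>, while
  \<open>Markov_phi\<close> bounds its expectation at time \<open>t\<close> by \<open>exp t\<close>
  times that value. So the truncated first moment has a bound independent of
  \<open>b\<close>.\<close>

lemma positive_part_finite:
  assumes y: "y \<in> interior J" and t: "0 \<le> t"
  shows "(\<integral>\<^sup>+\<omega>. ennreal (X t \<omega>) \<partial>P y) < \<infinity>"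
proof (cases "bdd_above J")
  case True
  have yJ: "y \<in> J" using y interior_subset by auto
  have "(\<integral>\<^sup>+\<omega>. ennreal (X t \<omega>) \<partial>P y) \<le> (\<integral>\<^sup>+\<omega>. ennreal (Sup J) \<partial>P y)"
    by (rule nn_integral_mono) (use yJ X_in_J[OF t] True in \<open>auto intro!: ennreal_leI cSup_upper\<close>)
  then show ?thesis using nn_const[OF yJ] by (auto intro: le_less_trans)
next
  case False
  have yJ: "y \<in> J" using y interior_subset by auto
  from unbounded_Ici[OF False yJ] have inf: "{y..} \<subseteq> J" .
  obtain e where e: "0 < e" "ball y e \<subseteq> J" using y by (meson mem_interior)
  define c where "c = y - e / 2"
  have c: "c \<in> J" "c < y" using e by (auto simp: c_def dist_real_def subset_iff)
  define \<kappa> where "\<kappa> = 1 - enn2real (phi c y)"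
  have \<kappa>: "0 < \<kappa>" unfolding \<kappa>_def by (rule one_minus_phi_pos) (use c in auto)
  let ?B = "exp t * (y - c) / \<kappa>"
  let ?f = "\<lambda>\<omega>. ennreal (X t \<omega> - c) * indicator {\<omega>. y < X t \<omega>} \<omega>"
  have [measurable]: "X t \<in> borel_measurable (P y)" by (rule X_P[OF yJ t])
  have bound: "(\<integral>\<^sup>+\<omega>. ?f \<omega> * indicator {\<omega>. ennreal t < hit b \<omega>} \<omega> \<partial>P y) \<le> ennreal ?B" if b: "y < b" for b
  proof -
    have bJ: "b \<in> J" using inf b by auto
    define g where "g = enn2real (phi y b)"
    have g: "0 < g" "phi y b = ennreal g"
      using phi_pos[OF y bJ] phi_finite[OF yJ, of b] by (auto simp: g_def enn2real_positive_iff)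
    let ?k = "g * \<kappa> / (y - c)"
    have k: "0 < ?k" using g \<kappa> c by simp
    \<comment> \<open>Passage from \<open>y\<close> up to \<open>x\<close> costs a factor of order
      \<open>1 / (x - c)\<close>; the product rule turns this into growth of \<open>phi\<close> in
      \<open>x\<close>.\<close>
    have le: "?k * (x - c) \<le> enn2real (phi x b)" if x: "y < x" "x < b" for x
    proof -
      have xJ: "x \<in> J" using inf x by auto
      have "enn2real (phi y x) * \<kappa> \<le> enn2real (exit_ed y x c)"
        unfolding \<kappa>_def by (rule passage_le_exit[OF yJ c x(1)])
      also have "\<dots> \<le> \<bar>y - c\<bar> / \<bar>x - c\<bar>" by (rule exit_ed_real) (use yJ xJ c x in auto)
      finally have "enn2real (phi y x) * \<kappa> * (x - c) \<le> y - c" using c x by (simp add: pos_le_divide_eq)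
      then have "enn2real (phi x b) * (enn2real (phi y x) * \<kappa> * (x - c)) \<le> enn2real (phi x b) * (y - c)"
        by (rule mult_left_mono) simp
      moreover have "g = enn2real (phi y x) * enn2real (phi x b)"
        unfolding g_def by (rule phi_real_mult[OF yJ]) (use x in \<open>auto simp: closed_segment_eq_real_ivl\<close>)
      ultimately show ?thesis using c by (simp add: pos_divide_le_eq mult_ac)
    qed
    have "ennreal ?k * (\<integral>\<^sup>+\<omega>. ?f \<omega> * indicator {\<omega>. ennreal t < hit b \<omega>} \<omega> \<partial>P y)
       = (\<integral>\<^sup>+\<omega>. ennreal ?k * (?f \<omega> * indicator {\<omega>. ennreal t < hit b \<omega>} \<omega>) \<partial>P y)"
      by (rule nn_integral_cmult[symmetric]) (use hit_P[OF yJ] in measurable)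
    also have "\<dots> \<le> (\<integral>\<^sup>+\<omega>. indicator {\<omega>. ennreal t < hit b \<omega>} \<omega> * phi (X t \<omega>) b \<partial>P y)"
    proof (rule nn_integral_mono_AE, use AE_start[OF yJ] in eventually_elim)
      fix \<omega> assume w: "\<omega> \<in> space A \<and> X 0 \<omega> = y"
      show "ennreal ?k * (?f \<omega> * indicator {\<omega>. ennreal t < hit b \<omega>} \<omega>)
         \<le> indicator {\<omega>. ennreal t < hit b \<omega>} \<omega> * phi (X t \<omega>) b"
      proof (cases "ennreal t < hit b \<omega> \<and> y < X t \<omega>")
        case True
        then have "X t \<omega> < b" using path_below[of \<omega> b t] w b t by auto
        then have "ennreal (?k * (X t \<omega> - c)) \<le> ennreal (enn2real (phi (X t \<omega>) b))"
          using True by (intro ennreal_leI le) auto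
        also have "\<dots> = phi (X t \<omega>) b"
          using phi_finite[OF X_in_J[OF t]] w by simp
        finally have "ennreal ?k * ennreal (X t \<omega> - c) \<le> phi (X t \<omega>) b"
          using k True c by (subst ennreal_mult'[symmetric]) auto
        then show ?thesis using True by simp
      qed (auto split: split_indicator)
    qed
    also have "\<dots> \<le> ennreal (exp t) * phi y b" by (rule Markov_phi[OF yJ t])
    also have "\<dots> = ennreal ?k * ennreal ?B"
      unfolding g(2) using k \<kappa> c g(1) by (simp add: ennreal_mult'[symmetric] mult_ac)
    finally show ?thesis
      using k by (subst (asm) ennreal_mult_le_mult_iff) auto
  qed
  have "(\<integral>\<^sup>+\<omega>. ?f \<omega> \<partial>P y) \<le> (\<integral>\<^sup>+\<omega>. liminf (\<lambda>n. ?f \<omega> * indicator {\<omega>. ennreal t < hit (level y (Suc n)) \<omega>} \<omega>) \<partial>P y)"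
  proof (rule nn_integral_mono)
    fix \<omega> assume "\<omega> \<in> space (P y)"
    then have w: "\<omega> \<in> space A" using yJ by simp
    obtain \<beta> where \<beta>: "\<beta> \<in> J" "\<And>c. \<beta> < c \<Longrightarrow> ennreal t < hit c \<omega>"
      using path_bounded[OF w t] by blast
    have ev: "\<forall>\<^sub>F n in sequentially. \<beta> < level y (Suc n)"
      using level_eventually[of \<beta> y] eventually_sequentially_Suc[of "\<lambda>n. \<beta> < level y n"] by blast
    show "?f \<omega> \<le> liminf (\<lambda>n. ?f \<omega> * indicator {\<omega>. ennreal t < hit (level y (Suc n)) \<omega>} \<omega>)"
      by (rule Liminf_bounded, use ev in eventually_elim) (use \<beta>(2) in auto)
  qed
  also have "\<dots> \<le> liminf (\<lambda>n. \<integral>\<^sup>+\<omega>. ?f \<omega> * indicator {\<omega>. ennreal t < hit (level y (Suc n)) \<omega>} \<omega> \<partial>P y)"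
    by (rule nn_integral_liminf) (use hit_P[OF yJ] in measurable)
  also have "\<dots> \<le> ennreal ?B"
  proof (rule Liminf_le, simp, rule always_eventually, rule allI)
    fix n show "(\<integral>\<^sup>+\<omega>. ?f \<omega> * indicator {\<omega>. ennreal t < hit (level y (Suc n)) \<omega>} \<omega> \<partial>P y) \<le> ennreal ?B"
      using level_less[of y n] level_ge[of y n] by (intro bound) linarith
  qed
  finally have f: "(\<integral>\<^sup>+\<omega>. ?f \<omega> \<partial>P y) \<le> ennreal ?B" .
  have "(\<integral>\<^sup>+\<omega>. ennreal (X t \<omega>) \<partial>P y) \<le> (\<integral>\<^sup>+\<omega>. ennreal (\<bar>y\<bar> + \<bar>c\<bar>) + ?f \<omega> \<partial>P y)"
  proof (rule nn_integral_mono)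
    fix \<omega>
    show "ennreal (X t \<omega>) \<le> ennreal (\<bar>y\<bar> + \<bar>c\<bar>) + ?f \<omega>"
    proof (cases "y < X t \<omega>")
      case True
      then have "ennreal (X t \<omega>) \<le> ennreal ((\<bar>y\<bar> + \<bar>c\<bar>) + (X t \<omega> - c))" using c by (intro ennreal_leI) auto
      also have "\<dots> = ennreal (\<bar>y\<bar> + \<bar>c\<bar>) + ennreal (X t \<omega> - c)" using True c by (intro ennreal_plus) auto
      finally show ?thesis using True by simp
    next
      case False
      then have "ennreal (X t \<omega>) \<le> ennreal (\<bar>y\<bar> + \<bar>c\<bar>)" by (intro ennreal_leI) auto
      then show ?thesis using False by simp
    qed
  qed
  also have "\<dots> = ennreal (\<bar>y\<bar> + \<bar>c\<bar>) + (\<integral>\<^sup>+\<omega>. ?f \<omega> \<partial>P y)"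
    using nn_const[OF yJ] by (subst nn_integral_add) auto
  also have "\<dots> < \<infinity>" using f by (auto intro: le_less_trans)
  finally show ?thesis .
qed

lemma X_integrable:
  assumes y: "y \<in> interior J" and t: "0 \<le> t"
  shows "integrable (P y) (X t)"
proof -
  interpret R: absorbed_diffusion "uminus ` J" A F "\<lambda>t \<omega>. - X t \<omega>" \<theta> "\<lambda>x. P (- x)"
    by (rule reflect_absorbed)
  have yJ: "y \<in> J" using y interior_subset by auto
  have neg: "(\<integral>\<^sup>+\<omega>. ennreal (- X t \<omega>) \<partial>P y) < \<infinity>"
    using R.positive_part_finite[of "- y" t] y t by (simp add: interior_uminus_image)
  have [measurable]: "X t \<in> borel_measurable (P y)" by (rule X_P[OF yJ t])
  show ?thesis
    unfolding real_integrable_def using positive_part_finite[OF y t] neg by auto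
qed

text \<open>The strong Markov property transports the behaviour of paths started at \<open>r\<close>
  to the path after its hitting time. A countable set of later times keeps the exceptional event
  path measurable, and continuity covers the others.\<close>

lemma stay_at_trap:
  assumes r: "r \<in> J" "r \<notin> interior J" and x: "x \<in> J" and t: "0 \<le> t"
  shows "AE \<omega> in P x. hit r \<omega> \<le> ennreal t \<longrightarrow> X t \<omega> = r"
proof -
  let ?L = "{\<omega>\<in>space A. \<exists>q\<in>{0..1} \<inter> \<rat>. X (t * q) \<omega> \<noteq> r}"
  let ?Z = "indicator ?L :: _ \<Rightarrow> ennreal"
  have cnt: "countable ({0..1::real} \<inter> \<rat>)" by (intro countable_Int2 countable_rat)
  have [measurable]: "X (t * q) \<in> borel_measurable (path_sigma A X)" if "q \<in> {0..1} \<inter> \<rat>" for q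
    using that t by auto
  have "{\<omega>\<in>space (path_sigma A X). \<exists>q\<in>{0..1} \<inter> \<rat>. X (t * q) \<omega> \<noteq> r} \<in> sets (path_sigma A X)"
    by (intro sets.sets_Collect_countable_Ex'[OF _ cnt]) measurable
  then have L: "?L \<in> sets (path_sigma A X)" by simp
  have Zm: "?Z \<in> borel_measurable (path_sigma A X)" using L by measurable
  have Zr: "(\<integral>\<^sup>+\<omega>. ?Z \<omega> \<partial>P r) = 0"
  proof -
    have "(\<integral>\<^sup>+\<omega>. ?Z \<omega> \<partial>P r) = (\<integral>\<^sup>+\<omega>. 0 \<partial>P r)"
      by (rule nn_integral_cong_AE, use trap[OF r] in eventually_elim) (use t in auto)
    then show ?thesis by simp
  qed
  have shm: "(\<lambda>\<omega>. ?Z (\<theta> (enn2real (hit r \<omega>)) \<omega>)) \<in> borel_measurable A"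
    by (rule measurable_compose[OF theta_meas Zm]) auto
  have "(\<integral>\<^sup>+\<omega>. 1 * (?Z (\<theta> (enn2real (hit r \<omega>)) \<omega>) * indicator {\<omega>. hit r \<omega> < \<infinity>} \<omega>) \<partial>P x) = 0"
    using strong_Markov_hitting[OF x Zm, of "\<lambda>_. 1" r] Zr by simp
  then have "AE \<omega> in P x. 1 * (?Z (\<theta> (enn2real (hit r \<omega>)) \<omega>) * indicator {\<omega>. hit r \<omega> < \<infinity>} \<omega>) = 0"
    by (subst (asm) nn_integral_0_iff_AE, intro P_meas[OF x]) (use shm in measurable)
  then show ?thesis using AE_start[OF x]
  proof eventually_elim
    fix \<omega> assume z: "1 * (?Z (\<theta> (enn2real (hit r \<omega>)) \<omega>) * indicator {\<omega>. hit r \<omega> < \<infinity>} \<omega>) = 0"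
      and w: "\<omega> \<in> space A \<and> X 0 \<omega> = x"
    show "hit r \<omega> \<le> ennreal t \<longrightarrow> X t \<omega> = r"
    proof
      assume le: "hit r \<omega> \<le> ennreal t"
      then obtain s where s: "hit r \<omega> = ennreal s" "0 \<le> s" "s \<le> t"
        using t by (cases "hit r \<omega>") (auto simp: top_unique)
      have q: "X (t * q + s) \<omega> = r" if "q \<in> {0..1} \<inter> \<rat>" for q
      proof -
        have "\<theta> s \<omega> \<notin> ?L" using z s by (auto split: split_indicator_asm)
        then have "X (t * q) (\<theta> s \<omega>) = r" using that shift_closed[OF s(2)] w by auto
        then show ?thesis using shift[of "t * q" s \<omega>] that t s w by auto
      qed
      have c: "continuous_on {0..1} (\<lambda>q. X (t * q + s) \<omega>)"
        by (rule continuous_on_compose2[OF continuous_paths[of \<omega>], of _ "\<lambda>q. t * q + s"])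
          (use w t s in \<open>auto intro!: continuous_intros\<close>)
      have all: "X (t * q + s) \<omega> = r" if "q \<in> {0..1}" for q
        by (rule continuous_constant_on_closure[of "{0..1} \<inter> \<rat>" "\<lambda>q. X (t * q + s) \<omega>"])
          (use c q that in \<open>auto simp: closure_unit_rationals\<close>)
      show "X t \<omega> = r"
      proof (cases "t = 0")
        case True then show ?thesis using all[of 0] s by simp
      next
        case False
        then have "t * ((t - s) / t) + s = t" using t by simp
        then show ?thesis using all[of "(t - s) / t"] s t False by simp
      qed
    qed
  qed
qed

text \<open>The levels \<open>b n\<close> tend to the right end point of \<open>J\<close>, or are equal to it if it is a trap.\<close>

lemma right_localization:
  assumes rn: right_natural and y: "y \<in> interior J" and t: "0 \<le> t"
  shows "\<exists>b. (\<forall>n. b n \<in> J \<and> y < b n) \<and>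
    (\<lambda>n. \<integral>\<^sup>+\<omega>. ennreal \<bar>b n - X t \<omega>\<bar> * indicator {\<omega>. hit (b n) \<omega> \<le> ennreal t} \<omega> \<partial>P y) \<longlonglongrightarrow> 0"
proof -
  have yJ: "y \<in> J" using y interior_subset by auto
  have [measurable]: "X t \<in> borel_measurable (P y)" by (rule X_P[OF yJ t])
  note [measurable] = hit_P[OF yJ]
  have fin: "(\<integral>\<^sup>+\<omega>. ennreal \<bar>X t \<omega>\<bar> \<partial>P y) < \<infinity>" by (rule nn_abs_finite[OF X_integrable[OF y t]])
  show ?thesis
  proof (cases "\<exists>r\<in>J. \<forall>x\<in>J. x \<le> r")
    case True
    then obtain r where r: "r \<in> J" "\<forall>x\<in>J. x \<le> r" by auto
    have ni: "r \<notin> interior J"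
    proof
      assume "r \<in> interior J"
      then obtain e where "0 < e" "ball r e \<subseteq> J" by (meson mem_interior)
      then have "r + e / 2 \<in> J" by (auto simp: dist_real_def subset_iff)
      then show False using r(2) \<open>0 < e\<close> by auto
    qed
    have "(\<integral>\<^sup>+\<omega>. ennreal \<bar>r - X t \<omega>\<bar> * indicator {\<omega>. hit r \<omega> \<le> ennreal t} \<omega> \<partial>P y) = (\<integral>\<^sup>+\<omega>. 0 \<partial>P y)"
      by (rule nn_integral_cong_AE, use stay_at_trap[OF r(1) ni yJ t] in eventually_elim)
        (auto split: split_indicator)
    moreover have "y < r" using r y yJ ni by (metis order_le_less)
    ultimately show ?thesis using r by (intro exI[of _ "\<lambda>_. r"]) simp
  next
    case False
    then have nomax: "\<exists>z\<in>J. x < z" if "x \<in> J" for x using that by force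
    show ?thesis
    proof (cases "bdd_above J")
      case True
      obtain b where b: "\<forall>n. b n \<in> J \<and> y < b n \<and> b n < Sup J \<and> (\<forall>z\<in>J. \<forall>\<^sub>F n in sequentially. z < b n)"
        using open_end_seq[OF nomax True yJ] by blast
      let ?f = "\<lambda>\<omega>. ennreal (\<bar>y\<bar> + \<bar>Sup J\<bar>) + ennreal \<bar>X t \<omega>\<bar>"
      have "(\<integral>\<^sup>+\<omega>. ?f \<omega> \<partial>P y) < \<infinity>"
        using fin nn_const[OF yJ] by (subst nn_integral_add) auto
      then have lim: "(\<lambda>n. \<integral>\<^sup>+\<omega>. ?f \<omega> * indicator {\<omega>. hit (b n) \<omega> \<le> ennreal t} \<omega> \<partial>P y) \<longlonglongrightarrow> 0"
        by (intro hit_vanish[OF yJ t]) (use b in auto)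
      have "(\<lambda>n. \<integral>\<^sup>+\<omega>. ennreal \<bar>b n - X t \<omega>\<bar> * indicator {\<omega>. hit (b n) \<omega> \<le> ennreal t} \<omega> \<partial>P y) \<longlonglongrightarrow> 0"
      proof (rule tendsto_sandwich[OF _ _ tendsto_const lim])
        show "\<forall>\<^sub>F n in sequentially. (\<integral>\<^sup>+\<omega>. ennreal \<bar>b n - X t \<omega>\<bar> * indicator {\<omega>. hit (b n) \<omega> \<le> ennreal t} \<omega> \<partial>P y)
          \<le> (\<integral>\<^sup>+\<omega>. ?f \<omega> * indicator {\<omega>. hit (b n) \<omega> \<le> ennreal t} \<omega> \<partial>P y)"
        proof (intro always_eventually allI nn_integral_mono mult_right_mono)
          fix n \<omega>
          have "\<bar>b n - X t \<omega>\<bar> \<le> (\<bar>y\<bar> + \<bar>Sup J\<bar>) + \<bar>X t \<omega>\<bar>"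
            using b[rule_format, of n] by linarith
          then have "ennreal \<bar>b n - X t \<omega>\<bar> \<le> ennreal ((\<bar>y\<bar> + \<bar>Sup J\<bar>) + \<bar>X t \<omega>\<bar>)"
            by (rule ennreal_leI)
          also have "\<dots> = ?f \<omega>" by (rule ennreal_plus) auto
          finally show "ennreal \<bar>b n - X t \<omega>\<bar> \<le> ?f \<omega>" .
        qed auto
      qed auto
      then show ?thesis using b by blast
    next
      case False
      from unbounded_Ici[OF this yJ] have inf: "{y..} \<subseteq> J" .
      \<comment> \<open>The index is shifted because level 0 is \<open>y\<close> itself, while the
        levels have to lie strictly above \<open>y\<close>.\<close>
      let ?b = "\<lambda>n. level y (Suc n)"
      let ?I = "\<lambda>n \<omega>. indicator {\<omega>. hit (?b n) \<omega> \<le> ennreal t} \<omega> :: ennreal"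
      have uJ: "level y k \<in> J" for k using inf level_ge[of y k] by auto
      \<comment> \<open>Here the dichotomy is used from the descending to the ascending passage,
        opposite to its use in \<open>mart_imp_right_natural\<close>.\<close>
      have D: "(\<lambda>k. enn2real (phi (level y k) y)) \<longlonglongrightarrow> 0"
      proof (rule metric_LIMSEQ_I)
        fix e :: real assume e: "0 < e"
        obtain q where q: "q \<in> J" "\<And>x. x \<in> J \<Longrightarrow> q < x \<Longrightarrow> phi x y < ennreal e"
          using rn y e unfolding right_natural_def by meson
        obtain N where N: "\<And>k. N \<le> k \<Longrightarrow> q < level y k"
          using level_eventually[of q y] by (auto simp: eventually_sequentially)
        show "\<exists>N. \<forall>k\<ge>N. dist (enn2real (phi (level y k) y)) 0 < e"
          using q(2)[OF uJ N] e by (intro exI[of _ N]) (auto simp: dist_real_def enn2real_less_iff phi_finite[OF uJ])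
      qed
      then have l: "(\<lambda>k. 2 ^ k * enn2real (phi y (level y k))) \<longlonglongrightarrow> 0"
        using levels_dichotomy[OF y inf] by simp
      \<comment> \<open>The first factor bounds the level by a multiple of \<open>2 ^ Suc n\<close>;
        \<open>exp t\<close> comes from estimating the hitting probability by
        \<open>phi\<close>.\<close>
      let ?C = "(\<bar>y - 1\<bar> + 1) * exp t"
      have "(\<lambda>n. ennreal (?C * (2 ^ Suc n * enn2real (phi y (?b n)))) + (\<integral>\<^sup>+\<omega>. ennreal \<bar>X t \<omega>\<bar> * ?I n \<omega> \<partial>P y)) \<longlonglongrightarrow> ennreal (?C * 0) + 0"
      proof (intro tendsto_add tendsto_ennrealI tendsto_mult tendsto_const LIMSEQ_Suc[OF l])
        show "(\<lambda>n. \<integral>\<^sup>+\<omega>. ennreal \<bar>X t \<omega>\<bar> * ?I n \<omega> \<partial>P y) \<longlonglongrightarrow> 0"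
        proof (rule hit_vanish[OF yJ t])
          show "\<forall>\<^sub>F n in sequentially. z < ?b n" for z
            using level_eventually[of z y] eventually_sequentially_Suc[of "\<lambda>n. z < level y n"] by blast
        qed (use fin in auto)
      qed
      then have lim: "(\<lambda>n. ennreal (?C * (2 ^ Suc n * enn2real (phi y (?b n)))) + (\<integral>\<^sup>+\<omega>. ennreal \<bar>X t \<omega>\<bar> * ?I n \<omega> \<partial>P y)) \<longlonglongrightarrow> 0"
        by simp
      have "(\<lambda>n. \<integral>\<^sup>+\<omega>. ennreal \<bar>?b n - X t \<omega>\<bar> * ?I n \<omega> \<partial>P y) \<longlonglongrightarrow> 0"
      proof (rule tendsto_sandwich[OF _ _ tendsto_const lim], simp, rule always_eventually, rule allI)
        fix n
        have "(\<integral>\<^sup>+\<omega>. ennreal \<bar>?b n - X t \<omega>\<bar> * ?I n \<omega> \<partial>P y) \<le> (\<integral>\<^sup>+\<omega>. ennreal \<bar>?b n\<bar> * ?I n \<omega> + ennreal \<bar>X t \<omega>\<bar> * ?I n \<omega> \<partial>P y)"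
        proof (rule nn_integral_mono)
          fix \<omega>
          have "ennreal \<bar>?b n - X t \<omega>\<bar> \<le> ennreal \<bar>?b n\<bar> + ennreal \<bar>X t \<omega>\<bar>"
            unfolding ennreal_plus[OF abs_ge_zero abs_ge_zero, symmetric]
            by (rule ennreal_leI[OF abs_triangle_ineq4])
          then show "ennreal \<bar>?b n - X t \<omega>\<bar> * ?I n \<omega> \<le> ennreal \<bar>?b n\<bar> * ?I n \<omega> + ennreal \<bar>X t \<omega>\<bar> * ?I n \<omega>"
            by (auto split: split_indicator)
        qed
        also have "\<dots> = ennreal \<bar>?b n\<bar> * (\<integral>\<^sup>+\<omega>. ?I n \<omega> \<partial>P y) + (\<integral>\<^sup>+\<omega>. ennreal \<bar>X t \<omega>\<bar> * ?I n \<omega> \<partial>P y)"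
          by (subst nn_integral_add, measurable) (subst nn_integral_cmult, measurable)
        also have "\<dots> \<le> ennreal (?C * (2 ^ Suc n * enn2real (phi y (?b n)))) + (\<integral>\<^sup>+\<omega>. ennreal \<bar>X t \<omega>\<bar> * ?I n \<omega> \<partial>P y)"
        proof (rule add_right_mono)
          have "(\<integral>\<^sup>+\<omega>. ?I n \<omega> \<partial>P y) = emeasure (P y) (hit_by (?b n) t)"
            by (rule emeasure_eq_nn[OF yJ, symmetric]) measurable
          also have "\<dots> \<le> ennreal (exp t) * phi y (?b n)" by (rule prob_le_phi[OF yJ t])
          also have "\<dots> = ennreal (exp t * enn2real (phi y (?b n)))"
            using phi_finite[OF yJ, of "?b n"] by (simp add: ennreal_mult)
          finally have I: "(\<integral>\<^sup>+\<omega>. ?I n \<omega> \<partial>P y) \<le> ennreal (exp t * enn2real (phi y (?b n)))" .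
          have "(1::real) \<le> 2 ^ Suc n" by (rule one_le_power) simp
          then have "\<bar>y - 1\<bar> * 1 \<le> \<bar>y - 1\<bar> * 2 ^ Suc n" by (intro mult_left_mono) auto
          then have "\<bar>?b n\<bar> \<le> (\<bar>y - 1\<bar> + 1) * 2 ^ Suc n"
            unfolding level_def distrib_right using abs_triangle_ineq[of "y - 1" "2 ^ Suc n"] by simp
          then have "ennreal \<bar>?b n\<bar> * (\<integral>\<^sup>+\<omega>. ?I n \<omega> \<partial>P y) \<le> ennreal ((\<bar>y - 1\<bar> + 1) * 2 ^ Suc n) * ennreal (exp t * enn2real (phi y (?b n)))"
            by (intro mult_mono I ennreal_leI) auto
          also have "\<dots> = ennreal (?C * (2 ^ Suc n * enn2real (phi y (?b n))))"
            by (simp add: ennreal_mult'[symmetric] mult_ac del: power_Suc)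
          finally show "ennreal \<bar>?b n\<bar> * (\<integral>\<^sup>+\<omega>. ?I n \<omega> \<partial>P y) \<le> ennreal (?C * (2 ^ Suc n * enn2real (phi y (?b n))))" .
        qed
        finally show "(\<integral>\<^sup>+\<omega>. ennreal \<bar>?b n - X t \<omega>\<bar> * ?I n \<omega> \<partial>P y)
          \<le> ennreal (?C * (2 ^ Suc n * enn2real (phi y (?b n)))) + (\<integral>\<^sup>+\<omega>. ennreal \<bar>X t \<omega>\<bar> * ?I n \<omega> \<partial>P y)" .
      qed
      moreover have "y < ?b n" for n using level_less[of y n] level_ge[of y n] by linarith
      ultimately show ?thesis using uJ by (intro exI[of _ ?b]) auto
    qed
  qed
qed

text \<open>Optional stopping at the minimum of \<open>t\<close> and the exit time from
  \<open>(a, b)\<close>, with \<open>a\<close> subtracted so that paths stopped at \<open>a\<close>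
  contribute nothing. It follows from the Markov property at \<open>t\<close>, because the
  probability of leaving at \<open>b\<close> is an affine function of the current position.\<close>

lemma exit_formula:
  assumes ab: "a \<in> J" "b \<in> J" and y: "a < y" "y < b" and t: "0 \<le> t"
  shows "ennreal (y - a) = (\<integral>\<^sup>+\<omega>. ennreal (b - a) * indicator {\<omega>. hit b \<omega> \<le> ennreal t \<and> hit b \<omega> < hit a \<omega>} \<omega>
     + ennreal (X t \<omega> - a) * indicator {\<omega>. ennreal t < min (hit a \<omega>) (hit b \<omega>)} \<omega> \<partial>P y)"
proof -
  have yJ: "y \<in> J" using J_Icc[OF ab] y by auto
  let ?a = "hit a" and ?b = "hit b"
  note [measurable] = hit_P[OF yJ] X_P[OF yJ t]
  let ?B = "\<lambda>\<omega>. indicator {\<omega>. ?b \<omega> \<le> ennreal t \<and> ?b \<omega> < ?a \<omega>} \<omega> :: ennreal"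
  let ?C = "\<lambda>\<omega>. indicator {\<omega>. ennreal t < min (?a \<omega>) (?b \<omega>)} \<omega> :: ennreal"
  let ?CA = "{\<omega>\<in>space A. ennreal t < min (?a \<omega>) (?b \<omega>)}"
  let ?Z = "\<lambda>\<omega>. indicator {\<omega>. ?b \<omega> < ?a \<omega>} \<omega> :: ennreal"
  have Ft: "?CA \<in> sets (F t)"
  proof -
    have "?CA = space (F t) - {\<omega>\<in>space A. min (?a \<omega>) (?b \<omega>) \<le> ennreal t}"
      using space_F[OF t] by (auto simp: not_le min_le_iff_disj)
    then show ?thesis using stopping_min[OF hitting_stopping hitting_stopping, of a b] t
      by (auto simp: ext_stopping_time_def)
  qed
  have "ennreal ((y - a) / (b - a)) = emeasure (P y) {\<omega>\<in>space A. ?b \<omega> < ?a \<omega>}"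
    using exit_prob[OF ab, of y] y by (simp add: emeasure_P_eq[OF yJ])
  also have "\<dots> = (\<integral>\<^sup>+\<omega>. ?Z \<omega> \<partial>P y)" by (rule emeasure_eq_nn[OF yJ]) measurable
  also have "\<dots> = (\<integral>\<^sup>+\<omega>. ?B \<omega> + indicator ?CA \<omega> * ?Z (\<theta> t \<omega>) \<partial>P y)"
  proof (rule nn_integral_cong)
    fix \<omega> assume "\<omega> \<in> space (P y)"
    then have w: "\<omega> \<in> space A" using yJ by simp
    show "?Z \<omega> = ?B \<omega> + indicator ?CA \<omega> * ?Z (\<theta> t \<omega>)"
    proof (cases "ennreal t < min (?a \<omega>) (?b \<omega>)")
      case True
      have "?a \<omega> = ennreal t + ?a (\<theta> t \<omega>)" "?b \<omega> = ennreal t + ?b (\<theta> t \<omega>)"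
        using True by (auto intro!: hitting_shift[OF w t])
      then have "?b \<omega> < ?a \<omega> \<longleftrightarrow> ?b (\<theta> t \<omega>) < ?a (\<theta> t \<omega>)"
        using ennreal_add_left_cancel_less[of "ennreal t" "?b (\<theta> t \<omega>)" "?a (\<theta> t \<omega>)"] by simp
      then show ?thesis using True w by (auto split: split_indicator)
    next
      case False
      then show ?thesis by (auto split: split_indicator simp: not_less min_le_iff_disj)
    qed
  qed
  also have "\<dots> = (\<integral>\<^sup>+\<omega>. ?B \<omega> \<partial>P y) + (\<integral>\<^sup>+\<omega>. indicator ?CA \<omega> * ?Z (\<theta> t \<omega>) \<partial>P y)"
  proof (rule nn_integral_add)
    have "(\<lambda>\<omega>. ?Z (\<theta> t \<omega>)) \<in> borel_measurable A"
      by (rule measurable_compose[OF theta_meas[of "\<lambda>_. t"], of ?Z]) (use t in auto)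
    then have "(\<lambda>\<omega>. indicator ?CA \<omega> * ?Z (\<theta> t \<omega>)) \<in> borel_measurable A" by measurable
    then show "(\<lambda>\<omega>. indicator ?CA \<omega> * ?Z (\<theta> t \<omega>)) \<in> borel_measurable (P y)" by (rule P_meas[OF yJ])
  qed measurable
  also have "(\<integral>\<^sup>+\<omega>. indicator ?CA \<omega> * ?Z (\<theta> t \<omega>) \<partial>P y) = (\<integral>\<^sup>+\<omega>. indicator ?CA \<omega> * (\<integral>\<^sup>+\<omega>'. ?Z \<omega>' \<partial>P (X t \<omega>)) \<partial>P y)"
    by (rule Markov_integral[OF yJ t]) (use Ft in measurable)
  also have "\<dots> = (\<integral>\<^sup>+\<omega>. ennreal (1 / (b - a)) * (ennreal (X t \<omega> - a) * ?C \<omega>) \<partial>P y)"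
  proof (rule nn_integral_cong_AE, use AE_start[OF yJ] in eventually_elim)
    fix \<omega> assume w: "\<omega> \<in> space A \<and> X 0 \<omega> = y"
    show "indicator ?CA \<omega> * (\<integral>\<^sup>+\<omega>'. ?Z \<omega>' \<partial>P (X t \<omega>)) = ennreal (1 / (b - a)) * (ennreal (X t \<omega> - a) * ?C \<omega>)"
    proof (cases "ennreal t < min (?a \<omega>) (?b \<omega>)")
      case True
      have z: "a < X t \<omega>" "X t \<omega> < b"
        using True path_above[of \<omega> a t] path_below[of \<omega> b t] w y t by auto
      have zJ: "X t \<omega> \<in> J" using X_in_J[OF t] w by auto
      have "(\<integral>\<^sup>+\<omega>'. ?Z \<omega>' \<partial>P (X t \<omega>)) = emeasure (P (X t \<omega>)) {\<omega>\<in>space A. ?b \<omega> < ?a \<omega>}"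
        by (rule emeasure_eq_nn[OF zJ, symmetric]) measurable
      also have "\<dots> = ennreal ((X t \<omega> - a) / (b - a))"
        using exit_prob[OF ab, of "X t \<omega>"] z by (simp add: emeasure_P_eq[OF zJ])
      also have "\<dots> = ennreal (1 / (b - a)) * ennreal (X t \<omega> - a)"
        using z by (simp flip: ennreal_mult)
      finally show ?thesis using True w by simp
    qed auto
  qed
  also have "\<dots> = ennreal (1 / (b - a)) * (\<integral>\<^sup>+\<omega>. ennreal (X t \<omega> - a) * ?C \<omega> \<partial>P y)"
    by (rule nn_integral_cmult) measurable
  finally have e: "ennreal ((y - a) / (b - a)) = (\<integral>\<^sup>+\<omega>. ?B \<omega> \<partial>P y) + ennreal (1 / (b - a)) * (\<integral>\<^sup>+\<omega>. ennreal (X t \<omega> - a) * ?C \<omega> \<partial>P y)" .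
  have one: "ennreal (b - a) * ennreal (1 / (b - a)) = 1"
    using y by (simp flip: ennreal_mult)
  have "ennreal (y - a) = ennreal (b - a) * ennreal ((y - a) / (b - a))"
    using y by (simp flip: ennreal_mult)
  also have "\<dots> = ennreal (b - a) * (\<integral>\<^sup>+\<omega>. ?B \<omega> \<partial>P y) + (\<integral>\<^sup>+\<omega>. ennreal (X t \<omega> - a) * ?C \<omega> \<partial>P y)"
    unfolding e distrib_left mult.assoc[symmetric] one by simp
  also have "\<dots> = (\<integral>\<^sup>+\<omega>. ennreal (b - a) * ?B \<omega> + ennreal (X t \<omega> - a) * ?C \<omega> \<partial>P y)"
    by (subst nn_integral_add, measurable) (subst nn_integral_cmult, measurable)
  finally show ?thesis .
qed

end

section \<open>Constant mean and the martingale equivalence\<close>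

context absorbed_diffusion
begin

definition left_natural :: bool where
  "left_natural \<longleftrightarrow> (\<forall>y\<in>interior J. \<forall>e>0. \<exists>q\<in>J. \<forall>x\<in>J. x < q \<longrightarrow> phi x y < ennreal e)"

lemma reflect_phi: "diffusion.phi (\<lambda>t \<omega>. - X t \<omega>) (\<lambda>x. P (- x)) x y = phi (- x) (- y)"
  unfolding diffusion.phi_def[OF reflect] phi_def hitting_reflect ..

lemma reflect_right_natural:
  "absorbed_diffusion.right_natural (uminus ` J) (\<lambda>t \<omega>. - X t \<omega>) (\<lambda>x. P (- x)) \<longleftrightarrow> left_natural"
  unfolding absorbed_diffusion.right_natural_def[OF reflect_absorbed] left_natural_def reflect_phi
    interior_uminus_image by force

lemma left_localization:
  assumes ln: left_natural and y: "y \<in> interior J" and t: "0 \<le> t"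
  shows "\<exists>a. (\<forall>n. a n \<in> J \<and> a n < y) \<and>
    (\<lambda>n. \<integral>\<^sup>+\<omega>. ennreal \<bar>a n - X t \<omega>\<bar> * indicator {\<omega>. hit (a n) \<omega> \<le> ennreal t} \<omega> \<partial>P y) \<longlonglongrightarrow> 0"
proof -
  interpret R: absorbed_diffusion "uminus ` J" A F "\<lambda>t \<omega>. - X t \<omega>" \<theta> "\<lambda>x. P (- x)"
    by (rule reflect_absorbed)
  have "R.right_natural" using ln reflect_right_natural by simp
  moreover have "- y \<in> interior (uminus ` J)" using y by (simp add: interior_uminus_image)
  ultimately obtain b where b: "\<forall>n. b n \<in> uminus ` J \<and> - y < b n"
    "(\<lambda>n. \<integral>\<^sup>+\<omega>. ennreal \<bar>b n - (- X t \<omega>)\<bar> * indicator {\<omega>. hitting_time (\<lambda>t \<omega>. - X t \<omega>) (b n) \<omega> \<le> ennreal t} \<omega> \<partial>P (- (- y))) \<longlonglongrightarrow> 0"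
    using R.right_localization[OF _ _ t] by blast
  have "\<bar>b n - (- X t \<omega>)\<bar> = \<bar>- b n - X t \<omega>\<bar>" for n \<omega> by simp
  then have "(\<lambda>n. \<integral>\<^sup>+\<omega>. ennreal \<bar>- b n - X t \<omega>\<bar> * indicator {\<omega>. hit (- b n) \<omega> \<le> ennreal t} \<omega> \<partial>P y) \<longlonglongrightarrow> 0"
    using b(2) unfolding hitting_reflect by simp
  moreover have "- b n \<in> J \<and> - b n < y" for n using b(1)[rule_format, of n] by auto
  ultimately show ?thesis by (intro exI[of _ "\<lambda>n. - b n"]) simp
qed

text \<open>The stopped process has mean \<open>y\<close>. It differs from \<open>X t\<close> only
  if \<open>a n\<close> or \<open>b n\<close> is hit by \<open>t\<close>, so the error is bounded by
  the two quantities that the localizations send to zero.\<close>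

lemma interior_mean:
  assumes rn: right_natural and ln: left_natural and y: "y \<in> interior J" and t: "0 \<le> t"
  shows "(\<integral>\<omega>. X t \<omega> \<partial>P y) = y"
proof -
  have yJ: "y \<in> J" using y interior_subset by auto
  interpret prob_space "P y" by (rule prob_P[OF yJ])
  note [measurable] = hit_P[OF yJ] X_P[OF yJ t]
  have Xi: "integrable (P y) (X t)" by (rule X_integrable[OF y t])
  define E where "E = (\<integral>\<omega>. X t \<omega> \<partial>P y)"
  let ?R = "\<lambda>c. \<integral>\<^sup>+\<omega>. ennreal \<bar>c - X t \<omega>\<bar> * indicator {\<omega>. hit c \<omega> \<le> ennreal t} \<omega> \<partial>P y"
  obtain b where b: "\<And>n. b n \<in> J" "\<And>n. y < b n" "(\<lambda>n. ?R (b n)) \<longlonglongrightarrow> 0"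
    using right_localization[OF rn y t] by blast
  obtain a where a: "\<And>n. a n \<in> J" "\<And>n. a n < y" "(\<lambda>n. ?R (a n)) \<longlonglongrightarrow> 0"
    using left_localization[OF ln y t] by blast
  have le: "ennreal \<bar>y - E\<bar> \<le> ?R (b n) + ?R (a n)" for n
  proof -
    let ?a = "hit (a n)" and ?b = "hit (b n)"
    let ?B = "{\<omega>. ?b \<omega> \<le> ennreal t \<and> ?b \<omega> < ?a \<omega>}" and ?C = "{\<omega>. ennreal t < min (?a \<omega>) (?b \<omega>)}"
    \<comment> \<open>Up to null sets, \<open>W + a n\<close> is the process stopped at
      \<open>t\<close> or at the exit from \<open>(a n, b n)\<close>, whichever comes first.\<close>
    define W where "W \<omega> = (b n - a n) * indicator ?B \<omega> + (X t \<omega> - a n) * indicator ?C \<omega>" for \<omega>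
    have [measurable]: "W \<in> borel_measurable (P y)" unfolding W_def by measurable
    have C: "AE \<omega> in P y. \<omega> \<in> ?C \<longrightarrow> a n < X t \<omega>"
      using AE_start[OF yJ] by eventually_elim (use path_above[of _ "a n" t] t a(2)[of n] in auto)
    have W0: "AE \<omega> in P y. 0 \<le> W \<omega>"
      using C by eventually_elim (use a(2)[of n] b(2)[of n] in \<open>auto simp: W_def split: split_indicator\<close>)
    have "(\<integral>\<^sup>+\<omega>. ennreal (W \<omega>) \<partial>P y) = ennreal (y - a n)"
      unfolding exit_formula[OF a(1) b(1) a(2) b(2) t, of n n]
      by (rule nn_integral_cong_AE, use C in eventually_elim)
        (auto simp: W_def split: split_indicator)
    then have W: "integrable (P y) W" "(\<integral>\<omega>. W \<omega> \<partial>P y) = y - a n"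
      using nn_integral_eq_integrable[of W "P y" "y - a n"] W0 a(2)[of n] by auto
    have "(\<integral>\<omega>. (W \<omega> + a n) - X t \<omega> \<partial>P y) = y - E"
      using W Xi by (simp add: E_def prob_space)
    then have "ennreal \<bar>y - E\<bar> = ennreal (norm (\<integral>\<omega>. (W \<omega> + a n) - X t \<omega> \<partial>P y))" by simp
    also have "\<dots> \<le> (\<integral>\<^sup>+\<omega>. norm ((W \<omega> + a n) - X t \<omega>) \<partial>P y)"
      by (rule integral_norm_bound_ennreal) (use W Xi in auto)
    also have "\<dots> \<le> (\<integral>\<^sup>+\<omega>. ennreal \<bar>b n - X t \<omega>\<bar> * indicator {\<omega>. ?b \<omega> \<le> ennreal t} \<omega>
        + ennreal \<bar>a n - X t \<omega>\<bar> * indicator {\<omega>. ?a \<omega> \<le> ennreal t} \<omega> \<partial>P y)"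
    proof (rule nn_integral_mono)
      fix \<omega>
      consider "\<omega> \<in> ?C" | "\<omega> \<in> ?B" "\<omega> \<notin> ?C" | "\<omega> \<notin> ?B" "\<omega> \<notin> ?C" "?a \<omega> \<le> ennreal t"
        by (auto simp: not_less min_le_iff_disj) (meson not_le order_le_less_trans order_less_imp_le)
      then show "ennreal (norm ((W \<omega> + a n) - X t \<omega>)) \<le> ennreal \<bar>b n - X t \<omega>\<bar> * indicator {\<omega>. ?b \<omega> \<le> ennreal t} \<omega>
        + ennreal \<bar>a n - X t \<omega>\<bar> * indicator {\<omega>. ?a \<omega> \<le> ennreal t} \<omega>"
      proof cases
        case 1
        then have "\<omega> \<notin> ?B" by auto
        then have "W \<omega> = X t \<omega> - a n" using 1 by (simp add: W_def)
        then show ?thesis by simp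
      next
        case 2
        then have "W \<omega> = b n - a n" by (simp add: W_def)
        then show ?thesis using 2 by simp
      next
        case 3
        then have "W \<omega> = 0" by (simp add: W_def)
        then show ?thesis using 3 by simp
      qed
    qed
    also have "\<dots> = ?R (b n) + ?R (a n)" by (rule nn_integral_add) measurable
    finally show ?thesis .
  qed
  have "(\<lambda>n. ?R (b n) + ?R (a n)) \<longlonglongrightarrow> 0 + 0" by (intro tendsto_add a(3) b(3))
  then have "ennreal \<bar>y - E\<bar> \<le> 0 + 0" by (rule LIMSEQ_le_const) (use le in auto)
  then show ?thesis by (simp add: E_def)
qed

lemma mean:
  assumes rn: right_natural and ln: left_natural and z: "z \<in> J" and t: "0 \<le> t"
  shows "integrable (P z) (X t)" "(\<integral>\<omega>. X t \<omega> \<partial>P z) = z"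
proof -
  interpret prob_space "P z" by (rule prob_P[OF z])
  note [measurable] = X_P[OF z t]
  show "integrable (P z) (X t)" "(\<integral>\<omega>. X t \<omega> \<partial>P z) = z"
  proof (atomize (full), cases "z \<in> interior J")
    case True
    then show "integrable (P z) (X t) \<and> (\<integral>\<omega>. X t \<omega> \<partial>P z) = z"
      using X_integrable[OF True t] interior_mean[OF rn ln True t] by simp
  next
    case False
    have ae: "AE \<omega> in P z. X t \<omega> = z" using trap[OF z False] by eventually_elim (use t in auto)
    have "integrable (P z) (X t) \<longleftrightarrow> integrable (P z) (\<lambda>_. z)"
      by (rule integrable_cong_AE) (use ae in auto)
    moreover have "(\<integral>\<omega>. X t \<omega> \<partial>P z) = (\<integral>\<omega>. z \<partial>P z)"
      by (rule integral_cong_AE) (use ae in auto)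
    ultimately show "integrable (P z) (X t) \<and> (\<integral>\<omega>. X t \<omega> \<partial>P z) = z" by (simp add: prob_space)
  qed
qed

text \<open>The strong Markov property conditions on the past of a stopping time; this identifies it
  with \<open>F t\<close> for a constant time.\<close>

lemma stopped_const_sets:
  assumes t: "0 \<le> t" shows "sets (stopped_sigma A F (\<lambda>\<omega>. ennreal t)) = sets (F t)"
proof
  have "L \<in> sets (F t)" if "L \<in> sets A" "\<forall>s\<ge>0. L \<inter> {\<omega>\<in>space A. ennreal t \<le> ennreal s} \<in> sets (F s)" for L
  proof -
    have "L \<inter> {\<omega>\<in>space A. ennreal t \<le> ennreal t} = L" using sets.sets_into_space[OF that(1)] by auto
    then show ?thesis using that(2) t by metis
  qed
  then have "sigma_sets (space (F t)) {L \<in> sets A. \<forall>s\<ge>0. L \<inter> {\<omega>\<in>space A. ennreal t \<le> ennreal s} \<in> sets (F s)} \<subseteq> sets (F t)"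
    by (intro sets.sigma_sets_subset) blast
  moreover have "{L \<in> sets A. \<forall>s\<ge>0. L \<inter> {\<omega>\<in>space A. ennreal t \<le> ennreal s} \<in> sets (F s)} \<subseteq> Pow (space A)"
    by (auto dest: sets.sets_into_space)
  ultimately show "sets (stopped_sigma A F (\<lambda>\<omega>. ennreal t)) \<subseteq> sets (F t)"
    unfolding stopped_sigma_def by (simp add: sets_measure_of space_F[OF t])
  show "sets (F t) \<subseteq> sets (stopped_sigma A F (\<lambda>\<omega>. ennreal t))"
    using stopped_const_meas[OF t] by blast
qed

lemma real_cond_exp_sets_cong:
  assumes "space G = space H" "sets G = sets H"
  shows "real_cond_exp M G f = real_cond_exp M H f"
  using assms by (simp add: real_cond_exp_def nn_cond_exp_def restr_to_subalg_def subalgebra_def)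

text \<open>The Markov property at \<open>s\<close>, applied to the positive and the negative part,
  gives the mean of \<open>X (t - s)\<close> under the start \<open>X s\<close>. That mean must be
  known on all of \<open>J\<close>, because \<open>X s\<close> may already be a trap.\<close>

lemma natural_imp_martingale:
  assumes rn: right_natural and ln: left_natural and x: "x \<in> J"
  shows "martingale (P x) F X"
  unfolding martingale_def
proof (intro conjI allI impI)
  fix t :: real assume t: "0 \<le> t"
  show "X t \<in> borel_measurable (F t)" by (rule X_meas_F[OF t])
  show "integrable (P x) (X t)" by (rule mean(1)[OF rn ln x t])
next
  fix s t :: real assume s: "0 \<le> s" and st: "s \<le> t"
  interpret prob_space "P x" by (rule prob_P[OF x])
  define u where "u = t - s"
  have u: "0 \<le> u" "u + s = t" using st by (auto simp: u_def)
  let ?N = "stopped_sigma A F (\<lambda>\<omega>. ennreal s)"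
  have sub: "subalgebra (P x) ?N"
    using stopped_sigma_sub[of "\<lambda>\<omega>. ennreal s"] sets_P[OF x] space_P[OF x] by (simp add: subalgebra_def)
  interpret N: finite_measure_subalgebra "P x" ?N by unfold_locales (rule sub)
  have Xt: "X t \<in> borel_measurable (P x)" using X_P[OF x] s st by simp
  have C: "AE \<omega> in P x. nn_cond_exp (P x) ?N (\<lambda>\<omega>. g (X t \<omega>)) \<omega> = (\<integral>\<^sup>+\<omega>'. g (X u \<omega>') \<partial>P (X s \<omega>))"
    if g: "g \<in> borel_measurable borel" for g :: "real \<Rightarrow> ennreal"
  proof -
    have Z: "(\<lambda>\<omega>. g (X u \<omega>)) \<in> borel_measurable (path_sigma A X)"
      by (rule measurable_compose[OF X_meas_path[OF u(1)] g])
    have eq: "g (X u (\<theta> (enn2real (ennreal s)) \<omega>)) * indicator {\<omega>. ennreal s < \<infinity>} \<omega> = g (X t \<omega>)" if "\<omega> \<in> space A" for \<omega>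
      using shift[OF u(1) s that] u s by simp
    have m: "(\<lambda>\<omega>. g (X u (\<theta> (enn2real (ennreal s)) \<omega>)) * indicator {\<omega>. ennreal s < \<infinity>} \<omega>) \<in> borel_measurable (P x)"
      using measurable_compose[OF Xt g]
      by (rule measurable_cong[THEN iffD2, rotated]) (use eq x in auto)
    have "AE \<omega> in P x. nn_cond_exp (P x) ?N (\<lambda>\<omega>. g (X u (\<theta> (enn2real (ennreal s)) \<omega>)) * indicator {\<omega>. ennreal s < \<infinity>} \<omega>) \<omega>
        = nn_cond_exp (P x) ?N (\<lambda>\<omega>. g (X t \<omega>)) \<omega>"
      by (rule N.nn_cond_exp_cong[OF _ m measurable_compose[OF Xt g]]) (use eq x in auto)
    with strong_Markov[OF x stopping_const[OF s] Z] show ?thesis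
      by eventually_elim (use s in simp)
  qed
  have Xneg: "(\<lambda>x. ennreal (- x)) \<in> borel_measurable borel" by measurable
  have "AE \<omega> in P x. real_cond_exp (P x) ?N (X t) \<omega> = X s \<omega>"
    using C[OF measurable_ennreal] C[OF Xneg] AE_start[OF x]
  proof eventually_elim
    case (elim \<omega>)
    have zJ: "X s \<omega> \<in> J" using X_in_J[OF s] elim by auto
      have "real_cond_exp (P x) ?N (X t) \<omega> = enn2real (\<integral>\<^sup>+\<omega>'. ennreal (X u \<omega>') \<partial>P (X s \<omega>)) - enn2real (\<integral>\<^sup>+\<omega>'. ennreal (- X u \<omega>') \<partial>P (X s \<omega>))"
        unfolding real_cond_exp_def elim ..
      also have "\<dots> = (\<integral>\<omega>'. X u \<omega>' \<partial>P (X s \<omega>))"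
        by (rule real_lebesgue_integral_def[symmetric, OF mean(1)[OF rn ln zJ u(1)]])
      also have "\<dots> = X s \<omega>" by (rule mean(2)[OF rn ln zJ u(1)])
      finally show ?case .
  qed
  then show "AE \<omega> in P x. real_cond_exp (P x) (F s) (X t) \<omega> = X s \<omega>"
    using real_cond_exp_sets_cong[of ?N "F s" "P x" "X t"] stopped_const_sets[OF s] space_F[OF s] by simp
qed

lemma martingale_mart_prop:
  assumes x: "x \<in> J" and m: "martingale (P x) F X" shows "mart_prop x"
  unfolding mart_prop_def
proof (intro conjI allI impI ballI)
  fix t :: real assume "0 \<le> t"
  then show "integrable (P x) (X t)" using m by (simp add: martingale_def)
next
  fix s t :: real and B assume s: "0 \<le> s" and st: "s \<le> t" and B: "B \<in> sets (F s)"
  interpret prob_space "P x" by (rule prob_P[OF x])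
  have sub: "subalgebra (P x) (F s)"
    using subalgebra_F[OF s] sets_P[OF x] space_P[OF x] by (simp add: subalgebra_def)
  interpret N: finite_measure_subalgebra "P x" "F s" by unfold_locales (rule sub)
  have it: "integrable (P x) (X t)" using m s st by (simp add: martingale_def)
  have BP: "B \<in> sets (P x)" using B sub by (auto simp: subalgebra_def)
  have "(\<integral>\<omega>\<in>B. X t \<omega> \<partial>P x) = (\<integral>\<omega>\<in>B. real_cond_exp (P x) (F s) (X t) \<omega> \<partial>P x)"
    by (rule N.real_cond_exp_intA[OF it B])
  also have "\<dots> = (\<integral>\<omega>\<in>B. X s \<omega> \<partial>P x)"
  proof (rule set_lebesgue_integral_cong_AE[OF BP])
    show "real_cond_exp (P x) (F s) (X t) \<in> borel_measurable (P x)" by simp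
    show "X s \<in> borel_measurable (P x)" by (rule X_P[OF x s])
    have "AE \<omega> in P x. real_cond_exp (P x) (F s) (X t) \<omega> = X s \<omega>"
      using m s st unfolding martingale_def by blast
    then show "AE \<omega>\<in>B in P x. real_cond_exp (P x) (F s) (X t) \<omega> = X s \<omega>"
      by eventually_elim simp
  qed
  finally show "(\<integral>\<omega>\<in>B. X t \<omega> \<partial>P x) = (\<integral>\<omega>\<in>B. X s \<omega> \<partial>P x)" .
qed

theorem martingale_iff_natural:
  "(\<forall>x\<in>interior J. martingale (P x) F X) \<longleftrightarrow> right_natural \<and> left_natural"
proof
  assume m: "\<forall>x\<in>interior J. martingale (P x) F X"
  have mp: "mart_prop x" if "x \<in> interior J" for x
    using martingale_mart_prop[of x] m that interior_subset by blast
  interpret R: absorbed_diffusion "uminus ` J" A F "\<lambda>t \<omega>. - X t \<omega>" \<theta> "\<lambda>x. P (- x)"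
    by (rule reflect_absorbed)
  have "R.mart_prop x" if "x \<in> interior (uminus ` J)" for x
  proof -
    have mx: "mart_prop (- x)" using mp that by (auto simp: interior_uminus_image)
    show ?thesis
      unfolding R.mart_prop_def
    proof (intro conjI allI impI ballI)
      fix t :: real assume "0 \<le> t"
      then have "integrable (P (- x)) (X t)" using mx by (simp add: mart_prop_def)
      then show "integrable (P (- x)) (\<lambda>\<omega>. - X t \<omega>)" by (rule integrable_minus)
    next
      fix s t B assume "0 \<le> s" "s \<le> t" "B \<in> sets (F s)"
      then have "(\<integral>\<omega>\<in>B. X t \<omega> \<partial>P (- x)) = (\<integral>\<omega>\<in>B. X s \<omega> \<partial>P (- x))"
        using mx unfolding mart_prop_def by blast
      then show "(\<integral>\<omega>\<in>B. - X t \<omega> \<partial>P (- x)) = (\<integral>\<omega>\<in>B. - X s \<omega> \<partial>P (- x))"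
        by (simp add: set_lebesgue_integral_def)
    qed
  qed
  then have "R.right_natural" by (rule R.mart_imp_right_natural)
  then show "right_natural \<and> left_natural"
    using mart_imp_right_natural[OF mp] reflect_right_natural by simp
next
  assume "right_natural \<and> left_natural"
  then show "\<forall>x\<in>interior J. martingale (P x) F X"
    using natural_imp_martingale interior_subset by blast
qed

end

section \<open>The Feller-Dynkin property\<close>

context absorbed_diffusion
begin

abbreviation "T \<equiv> transition_semigroup P X"

lemma C0_bounded:
  assumes "f \<in> C0 J" shows "\<exists>B\<ge>0. \<forall>x\<in>J. \<bar>f x\<bar> \<le> B"
proof -
  obtain K where K: "compact K" "K \<subseteq> J" "\<forall>x\<in>J - K. \<bar>f x\<bar> < 1"
    using assms unfolding C0_def by (force dest: spec[of _ 1])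
  have "continuous_on K f" using assms K(2) by (auto simp: C0_def intro: continuous_on_subset)
  then have "bounded (f ` K)" using K(1) by (intro compact_imp_bounded compact_continuous_image)
  then obtain B where B: "\<forall>x\<in>K. \<bar>f x\<bar> \<le> B" by (auto simp: bounded_iff)
  have "\<forall>x\<in>J. \<bar>f x\<bar> \<le> max B 1" using B K(3) by (metis DiffI less_imp_le max.coboundedI1 max.coboundedI2)
  then show ?thesis by (intro exI[of _ "max B 1"]) auto
qed

lemma fX_path_meas:
  assumes "continuous_on J f" "0 \<le> t"
  shows "(\<lambda>\<omega>. f (X t \<omega>) :: real) \<in> borel_measurable (path_sigma A X)"
proof -
  have X: "X t \<in> measurable (path_sigma A X) (restrict_space borel J)"
    using X_in_J[OF assms(2)] X_meas_path[OF assms(2)] by (auto simp: measurable_restrict_space2_iff)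
  show ?thesis by (rule measurable_compose[OF X borel_measurable_continuous_on_restrict[OF assms(1)]])
qed

lemma fX_meas: "continuous_on J f \<Longrightarrow> 0 \<le> t \<Longrightarrow> (\<lambda>\<omega>. f (X t \<omega>) :: real) \<in> borel_measurable A"
  by (rule path_meas[OF fX_path_meas])

lemma fX_integrable:
  assumes x: "x \<in> J" and t: "0 \<le> t" and m: "(\<lambda>\<omega>. f (X t \<omega>) :: real) \<in> borel_measurable A" and B: "\<forall>x\<in>J. \<bar>f x\<bar> \<le> B"
  shows "integrable (P x) (\<lambda>\<omega>. f (X t \<omega>))"
proof -
  interpret prob_space "P x" by (rule prob_P[OF x])
  show ?thesis
    by (rule integrable_const_bound[of _ B])
      (use B X_in_J[OF t] x P_meas[OF x m] in \<open>auto intro!: AE_I2\<close>)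
qed

text \<open>Time is cut into windows of length \<open>h\<close>.  If \<open>y\<close> is hit during a window, then with probability at least
  \<open>1/2\<close> the process is still near \<open>y\<close> at the end of the window, and there a bump function around \<open>y\<close>
  detects it.\<close>

lemma FD_escape:
  assumes FD: "\<And>t f. 0 \<le> t \<Longrightarrow> f \<in> C0 J \<Longrightarrow> T t f \<in> C0 J" and y: "y \<in> interior J" and e: "0 < e"
  shows "\<exists>K. compact K \<and> K \<subseteq> J \<and> (\<forall>x\<in>J - K. phi x y < ennreal e)"
proof -
  have yJ: "y \<in> J" using y interior_subset by auto
  obtain d0 where d0: "0 < d0" "ball y d0 \<subseteq> J" using y by (meson mem_interior)
  define d where "d = d0 / 3"
  have d: "0 < d" "cball y (2 * d) \<subseteq> J" using d0 by (auto simp: d_def subset_iff dist_real_def)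
  \<comment> \<open>A tent cut off at height one: equal to 1 within distance \<open>d\<close> of
    \<open>y\<close> and to 0 from distance \<open>2 * d\<close> on.\<close>
  define f where "f z = max 0 (min 1 (2 - \<bar>z - y\<bar> / d))" for z
  have f: "0 \<le> f z" "f z \<le> 1" "\<bar>z - y\<bar> \<le> d \<Longrightarrow> f z = 1" "2 * d \<le> \<bar>z - y\<bar> \<Longrightarrow> f z = 0" for z
    using d(1) by (auto simp: f_def divide_simps)
  have fc: "continuous_on S f" for S unfolding f_def by (intro continuous_intros) (use d in auto)
  have fC0: "f \<in> C0 J"
    unfolding C0_def
  proof (intro CollectI conjI allI impI)
    fix e :: real assume "0 < e"
    then show "\<exists>K. compact K \<and> K \<subseteq> J \<and> (\<forall>x\<in>J - K. \<bar>f x\<bar> < e)"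
      using d f(4) by (intro exI[of _ "cball y (2 * d)"]) (auto simp: dist_real_def abs_minus_commute)
  qed (rule fc)
  obtain h1 where h1: "0 < h1" "\<forall>t\<in>{0..h1}. measure (P y) (hit_by (y + d) t) < 1/4"
    using hit_small[OF yJ, of "y + d" "1/4"] d by auto
  obtain h2 where h2: "0 < h2" "\<forall>t\<in>{0..h2}. measure (P y) (hit_by (y - d) t) < 1/4"
    using hit_small[OF yJ, of "y - d" "1/4"] d by auto
  \<comment> \<open>Within this time each of \<open>y + d\<close> and \<open>y - d\<close> is hit
    with probability below 1/4, so the process stays between them with probability at least
    1/2.\<close>
  define h where "h = min h1 h2"
  have h: "0 < h" using h1 h2 by (simp add: h_def)
  let ?S = "{\<omega>\<in>space A. ennreal h < hit (y + d) \<omega> \<and> ennreal h < hit (y - d) \<omega>}"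
  let ?Z = "\<lambda>\<omega>. indicator {\<omega>. ennreal h < hit (y + d) \<omega> \<and> ennreal h < hit (y - d) \<omega>} \<omega> :: ennreal"
  have Zhalf: "ennreal (1/2) \<le> (\<integral>\<^sup>+\<omega>. ?Z \<omega> \<partial>P y)"
  proof -
    interpret prob_space "P y" by (rule prob_P[OF yJ])
    let ?E1 = "hit_by (y + d) h" and ?E2 = "hit_by (y - d) h"
    have s: "?E1 \<in> sets (P y)" "?E2 \<in> sets (P y)" by (auto simp: sets_P_iff[OF yJ])
    have "measure (P y) (?E1 \<union> ?E2) \<le> measure (P y) ?E1 + measure (P y) ?E2" by (rule measure_Un_le[OF s])
    moreover have "h \<in> {0..h1}" "h \<in> {0..h2}" using h by (auto simp: h_def)
    ultimately have "measure (P y) (?E1 \<union> ?E2) \<le> 1/2" using h1(2) h2(2) by fastforce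
    moreover have "?S = space (P y) - (?E1 \<union> ?E2)" using yJ by auto
    ultimately have "1/2 \<le> measure (P y) ?S" using prob_compl[of "?E1 \<union> ?E2"] s by auto
    then have "ennreal (1/2) \<le> emeasure (P y) ?S" unfolding emeasure_P_eq[OF yJ] by (rule ennreal_leI)
    also have "\<dots> = (\<integral>\<^sup>+\<omega>. ?Z \<omega> \<partial>P y)" by (rule emeasure_eq_nn[OF yJ]) measurable
    finally show ?thesis .
  qed
  let ?\<tau> = "hit y"
  let ?W = "\<lambda>i. {\<omega>\<in>space A. ennreal (real i * h) \<le> ?\<tau> \<omega> \<and> ?\<tau> \<omega> \<le> ennreal (real (Suc i) * h)}"
  let ?t = "\<lambda>i. real (Suc i) * h"
  have t0: "0 \<le> ?t i" for i using h by simp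
  \<comment> \<open>If \<open>y\<close> is hit in the \<open>i\<close>-th window, at most
    \<open>h\<close> remains until its end, and with probability at least 1/2 the bump function
    equals one there.\<close>
  have W: "measure (P x) (?W i) \<le> 2 * T (?t i) f x" if x: "x \<in> J" for x i
  proof -
    have WA: "?W i \<in> sets A" by measurable
    have We: "emeasure (P x) (?W i) = (\<integral>\<^sup>+\<omega>. indicator (?W i) \<omega> * indicator {\<omega>. ?\<tau> \<omega> < \<infinity>} \<omega> \<partial>P x)"
    proof -
      have "(\<integral>\<^sup>+\<omega>. indicator (?W i) \<omega> * indicator {\<omega>. ?\<tau> \<omega> < \<infinity>} \<omega> \<partial>P x) = (\<integral>\<^sup>+\<omega>. indicator (?W i) \<omega> \<partial>P x)"
        by (rule nn_integral_cong) (auto split: split_indicator dest: le_less_trans[OF _ ennreal_less_top])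
      also have "\<dots> = emeasure (P x) (?W i)"
        by (rule nn_integral_indicator) (use WA x in \<open>simp add: sets_P_iff\<close>)
      finally show ?thesis ..
    qed
    have "emeasure (P x) (?W i) * ennreal (1/2) \<le> emeasure (P x) (?W i) * (\<integral>\<^sup>+\<omega>. ?Z \<omega> \<partial>P y)"
      by (rule mult_left_mono[OF Zhalf]) simp
    also have "\<dots>
      = (\<integral>\<^sup>+\<omega>. indicator (?W i) \<omega> * (?Z (\<theta> (enn2real (?\<tau> \<omega>)) \<omega>) * indicator {\<omega>. ?\<tau> \<omega> < \<infinity>} \<omega>) \<partial>P x)"
      unfolding We
    proof (rule strong_Markov_hitting[OF x, symmetric])
      have [measurable]: "?\<tau> \<in> borel_measurable (stopped_sigma A F ?\<tau>)"
        by (rule stopping_time_stopped_meas[OF hitting_stopping])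
      have "{\<omega>\<in>space (stopped_sigma A F ?\<tau>). ennreal (real i * h) \<le> ?\<tau> \<omega> \<and> ?\<tau> \<omega> \<le> ennreal (real (Suc i) * h)} \<in> sets (stopped_sigma A F ?\<tau>)"
        by measurable
      then show "indicator (?W i) \<in> borel_measurable (stopped_sigma A F ?\<tau>)" by simp
    qed measurable
    also have "\<dots> \<le> (\<integral>\<^sup>+\<omega>. ennreal (f (X (?t i) \<omega>)) \<partial>P x)"
    proof (rule nn_integral_mono)
      fix \<omega> assume "\<omega> \<in> space (P x)"
      then have w: "\<omega> \<in> space A" using x by simp
      show "indicator (?W i) \<omega> * (?Z (\<theta> (enn2real (?\<tau> \<omega>)) \<omega>) * indicator {\<omega>. ?\<tau> \<omega> < \<infinity>} \<omega>) \<le> ennreal (f (X (?t i) \<omega>))"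
      proof (cases "\<omega> \<in> ?W i \<and> ?\<tau> \<omega> < \<infinity> \<and> ennreal h < hit (y + d) (\<theta> (enn2real (?\<tau> \<omega>)) \<omega>) \<and> ennreal h < hit (y - d) (\<theta> (enn2real (?\<tau> \<omega>)) \<omega>)")
        case True
        then obtain s where s: "?\<tau> \<omega> = ennreal s" "0 \<le> s" by (cases "?\<tau> \<omega>") auto
        have si: "real i * h \<le> s" "s \<le> ?t i"
          using True s h t0[of i] by (auto simp: ennreal_le_iff ennreal_le_iff2 simp del: of_nat_Suc)
        have Xs: "X s \<omega> = y" using hitting_attained[OF w, of y] s by auto
        let ?v = "\<theta> s \<omega>"
        have v: "?v \<in> space A" by (rule shift_closed[OF s(2) w])
        have X0: "X 0 ?v = y" using shift[OF _ s(2) w, of 0] Xs by simp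
        have Xt: "X (?t i - s) ?v = X (?t i) \<omega>" using shift[OF _ s(2) w, of "?t i - s"] si by simp
        have ts: "0 \<le> ?t i - s" "?t i - s \<le> h" using si by (auto simp: algebra_simps)
        have lt: "ennreal (?t i - s) < hit (y + d) ?v" "ennreal (?t i - s) < hit (y - d) ?v"
          using True s le_less_trans[OF ennreal_leI[OF ts(2)]] by auto
        have "X (?t i - s) ?v < y + d" "y - d < X (?t i - s) ?v"
          using path_below[OF v _ ts(1) lt(1)] path_above[OF v _ ts(1) lt(2)] X0 d by auto
        then have "f (X (?t i) \<omega>) = 1" unfolding Xt by (intro f(3)) auto
        then show ?thesis by (auto split: split_indicator)
      qed (auto split: split_indicator)
    qed
    also have "\<dots> = ennreal (T (?t i) f x)"
    proof -
      have "integrable (P x) (\<lambda>\<omega>. f (X (?t i) \<omega>))"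
        by (rule fX_integrable[OF x t0 fX_meas[OF fc t0], where B=1]) (use f in auto)
      then show ?thesis
        unfolding transition_semigroup_def by (rule nn_integral_eq_integral) (use f in auto)
    qed
    finally have "ennreal (measure (P x) (?W i)) * ennreal (1/2) \<le> ennreal (T (?t i) f x)"
      unfolding emeasure_P_eq[OF x] .
    then have "ennreal (measure (P x) (?W i) * (1/2)) \<le> ennreal (T (?t i) f x)"
      by (subst ennreal_mult) auto
    moreover have "0 \<le> T (?t i) f x" unfolding transition_semigroup_def by (rule Bochner_Integration.integral_nonneg) (use f in auto)
    ultimately show ?thesis by simp
  qed
  obtain n0 :: nat where "- ln (e / 2) / h < real n0" using reals_Archimedean2 by blast
  define n where "n = Suc n0"
  have n: "0 < n" "exp (- (real n * h)) < e / 2"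
  proof -
    have "- ln (e / 2) < real n0 * h" using \<open>- ln (e / 2) / h < real n0\<close> by (simp only: pos_divide_less_eq[OF h])
    also have "\<dots> \<le> real n * h" using h by (intro mult_right_mono) (auto simp: n_def)
    finally have "- ln (e / 2) < real n * h" .
    then have "exp (- (real n * h)) < exp (ln (e / 2))" by simp
    then show "exp (- (real n * h)) < e / 2" using e by simp
  qed (simp add: n_def)
  \<comment> \<open>Each of the \<open>n\<close> windows contributes at most \<open>2 * e'\<close>,
    together \<open>e / 2\<close>; the other half is the discount beyond time
    \<open>n * h\<close>.\<close>
  define e' where "e' = e / (4 * real n)"
  have e': "0 < e'" using e n by (simp add: e'_def)
  have "\<forall>i. \<exists>K. compact K \<and> K \<subseteq> J \<and> (\<forall>x\<in>J - K. \<bar>T (?t i) f x\<bar> < e')"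
    using FD[OF t0 fC0] e' unfolding C0_def by blast
  then obtain K where K: "\<And>i. compact (K i)" "\<And>i. K i \<subseteq> J" "\<And>i x. x \<in> J - K i \<Longrightarrow> \<bar>T (?t i) f x\<bar> < e'"
    by metis
  show ?thesis
  proof (intro exI conjI ballI)
    show "compact (\<Union>i<n. K i)" using K(1) by (intro compact_UN) auto
    show "(\<Union>i<n. K i) \<subseteq> J" using K(2) by auto
    fix x assume x: "x \<in> J - (\<Union>i<n. K i)"
    then have xJ: "x \<in> J" by simp
    interpret prob_space "P x" by (rule prob_P[OF xJ])
    have nh: "0 \<le> real n * h" using h by simp
    have WP: "?W i \<in> sets (P x)" for i unfolding sets_P_iff[OF xJ] by measurable
    have "{\<omega>\<in>space A. ?\<tau> \<omega> \<le> ennreal (real n * h)} \<subseteq> (\<Union>i<n. ?W i)"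
    proof
      fix \<omega> assume w: "\<omega> \<in> {\<omega>\<in>space A. ?\<tau> \<omega> \<le> ennreal (real n * h)}"
      then obtain s where s: "?\<tau> \<omega> = ennreal s" "0 \<le> s" "s \<le> real n * h"
        using nh by (cases "?\<tau> \<omega>") (auto simp: top_unique)
      \<comment> \<open>The final time \<open>n * h\<close> would be rounded to the window
        \<open>n\<close>, which is not among those considered, and is assigned to the last one
        instead.\<close>
      define i where "i = (if s = real n * h then n - 1 else nat \<lfloor>s / h\<rfloor>)"
      have "i < n \<and> real i * h \<le> s \<and> s \<le> real (Suc i) * h"
      proof (cases "s = real n * h")
        case True
        have "real (n - 1) * h \<le> real n * h" using h by (intro mult_right_mono) auto
        then show ?thesis using True n by (simp add: i_def)
      next
        case False
        then have "s / h < real n" using s h by (simp add: pos_divide_less_eq)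
        moreover have "0 \<le> s / h" using s h by simp
        ultimately have i: "i < n" "real i \<le> s / h" "s / h \<le> real (Suc i)"
          unfolding i_def using False by (simp; linarith)+
        then show ?thesis using h by (simp add: pos_le_divide_eq pos_divide_le_eq del: of_nat_Suc)
      qed
      then show "\<omega> \<in> (\<Union>i<n. ?W i)" using w s by (auto intro!: ennreal_leI bexI[of _ i])
    qed
    then have "measure (P x) {\<omega>\<in>space A. ?\<tau> \<omega> \<le> ennreal (real n * h)} \<le> measure (P x) (\<Union>i<n. ?W i)"
      by (intro finite_measure_mono sets.finite_UN) (use WP in auto)
    also have "\<dots> \<le> (\<Sum>i<n. measure (P x) (?W i))"
      by (rule finite_measure_subadditive_finite) (use WP in auto)
    also have "\<dots> \<le> (\<Sum>i<n. 2 * e')"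
    proof (rule sum_mono)
      fix i assume "i \<in> {..<n}"
      then have "\<bar>T (?t i) f x\<bar> < e'" using x by (intro K(3)) auto
      then show "measure (P x) (?W i) \<le> 2 * e'" using W[OF xJ, of i] by linarith
    qed
    also have "\<dots> = e / 2" using n by (simp add: e'_def)
    finally have m: "measure (P x) {\<omega>\<in>space A. ?\<tau> \<omega> \<le> ennreal (real n * h)} \<le> e / 2" .
    have "phi x y \<le> emeasure (P x) {\<omega>\<in>space A. ?\<tau> \<omega> \<le> ennreal (real n * h)} + ennreal (exp (- (real n * h)))"
      by (rule phi_le_prob[OF xJ nh])
    also have "\<dots> = ennreal (measure (P x) {\<omega>\<in>space A. ?\<tau> \<omega> \<le> ennreal (real n * h)} + exp (- (real n * h)))"
      by (simp add: emeasure_P_eq[OF xJ])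
    also have "\<dots> < ennreal e" using m n(2) e by (intro ennreal_lessI) auto
    finally show "phi x y < ennreal e" .
  qed
qed

lemma FD_imp_natural:
  assumes FD: "\<And>t f. 0 \<le> t \<Longrightarrow> f \<in> C0 J \<Longrightarrow> T t f \<in> C0 J"
  shows right_natural left_natural
proof -
  have ends: "(\<exists>q\<in>J. \<forall>x\<in>J. q < x \<longrightarrow> phi x y < ennreal e) \<and> (\<exists>q\<in>J. \<forall>x\<in>J. x < q \<longrightarrow> phi x y < ennreal e)"
    if y: "y \<in> interior J" and e: "0 < e" for y e
  proof -
    obtain K where K: "compact K" "K \<subseteq> J" "\<forall>x\<in>J - K. phi x y < ennreal e"
      using FD_escape[OF FD y e] by blast
    show ?thesis
    proof (cases "K = {}")
      case True
      then show ?thesis using K y interior_subset by blast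
    next
      case False
      obtain q where q: "q \<in> K" "\<forall>x\<in>K. x \<le> q" using compact_attains_sup[OF K(1) False] by auto
      obtain p where p: "p \<in> K" "\<forall>x\<in>K. p \<le> x" using compact_attains_inf[OF K(1) False] by auto
      have "\<forall>x\<in>J. q < x \<longrightarrow> phi x y < ennreal e" "\<forall>x\<in>J. x < p \<longrightarrow> phi x y < ennreal e"
        using K(3) q(2) p(2) by (meson DiffI not_le)+
      then show ?thesis using p q K(2) by blast
    qed
  qed
  show right_natural using ends unfolding right_natural_def by blast
  show left_natural using ends unfolding left_natural_def by blast
qed

end

section \<open>Continuity of the semigroup in the starting point\<close>

context absorbed_diffusion
begin

text \<open>The value zero outside of \<open>J\<close> admits neighbourhoods that stick out of
  \<open>J\<close>, so that interior points and end points are treated alike.\<close>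

definition hit_prob :: "real \<Rightarrow> real \<Rightarrow> real \<Rightarrow> real" where
  "hit_prob x v t = (if v \<in> J then measure (P x) (hit_by v t) else 0)"

lemma semigroup_near:
  fixes f :: "real \<Rightarrow> real"
  assumes x: "x \<in> J" and t: "0 \<le> t" and m: "(\<lambda>\<omega>. f (X t \<omega>)) \<in> borel_measurable A"
    and B: "\<forall>z\<in>J. \<bar>f z\<bar> \<le> B" and c: "\<bar>c\<bar> \<le> B" and E: "E \<in> sets A" and \<eta>: "0 \<le> \<eta>"
    and near: "AE \<omega> in P x. \<omega> \<notin> E \<longrightarrow> \<bar>f (X t \<omega>) - c\<bar> \<le> \<eta>"
  shows "\<bar>T t f x - c\<bar> \<le> \<eta> + 2 * B * measure (P x) E"
proof -
  interpret prob_space "P x" by (rule prob_P[OF x])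
  have int: "integrable (P x) (\<lambda>\<omega>. f (X t \<omega>))" by (rule fX_integrable[OF x t m B])
  have EP: "E \<in> sets (P x)" using E x by (simp add: sets_P_iff)
  have "T t f x - c = (\<integral>\<omega>. f (X t \<omega>) - c \<partial>P x)"
    using int by (simp add: transition_semigroup_def prob_space)
  then have "\<bar>T t f x - c\<bar> \<le> (\<integral>\<omega>. \<bar>f (X t \<omega>) - c\<bar> \<partial>P x)"
    using integral_abs_bound[of "P x" "\<lambda>\<omega>. f (X t \<omega>) - c"] by simp
  also have "\<dots> \<le> (\<integral>\<omega>. \<eta> + 2 * B * indicator E \<omega> \<partial>P x)"
  proof (rule integral_mono_AE)
    show "integrable (P x) (\<lambda>\<omega>. \<bar>f (X t \<omega>) - c\<bar>)" using int by auto
    show "integrable (P x) (\<lambda>\<omega>. \<eta> + 2 * B * indicator E \<omega>)" using EP by (auto simp: emeasure_P_eq[OF x])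
    show "AE \<omega> in P x. \<bar>f (X t \<omega>) - c\<bar> \<le> \<eta> + 2 * B * indicator E \<omega>"
      using near AE_start[OF x]
    proof eventually_elim
      case (elim \<omega>)
      have "\<bar>f (X t \<omega>)\<bar> \<le> B" using B X_in_J[OF t] elim by auto
      then have "\<bar>f (X t \<omega>) - c\<bar> \<le> 2 * B" using c by linarith
      then show ?case using elim \<eta> by (cases "\<omega> \<in> E") auto
    qed
  qed
  also have "\<dots> = \<eta> + 2 * B * measure (P x) E"
    using EP by (simp add: prob_space emeasure_P_eq[OF x])
  finally show ?thesis .
qed

text \<open>The path can leave \<open>(v1, v2)\<close> only through \<open>v1\<close> or
  \<open>v2\<close>; on these events the integrand differs from \<open>c\<close> by at most
  \<open>2 * B\<close>.\<close>

lemma semigroup_local: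
  fixes f :: "real \<Rightarrow> real"
  assumes x: "x \<in> J" "v1 < x" "x < v2" and t: "0 \<le> t" and m: "(\<lambda>\<omega>. f (X t \<omega>)) \<in> borel_measurable A"
    and B: "\<forall>z\<in>J. \<bar>f z\<bar> \<le> B" and c: "\<bar>c\<bar> \<le> B" and \<eta>: "0 \<le> \<eta>"
    and near: "\<And>z. z \<in> J \<Longrightarrow> v1 < z \<Longrightarrow> z < v2 \<Longrightarrow> \<bar>f z - c\<bar> \<le> \<eta>"
  shows "\<bar>T t f x - c\<bar> \<le> \<eta> + 2 * B * (hit_prob x v1 t + hit_prob x v2 t)"
proof -
  let ?E = "\<lambda>v. if v \<in> J then hit_by v t else {}"
  have EA: "?E v \<in> sets A" for v by auto
  have hE: "hit_prob x v t = measure (P x) (?E v)" for v by (simp add: hit_prob_def)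
  have B0: "0 \<le> B" using c by linarith
  have "\<bar>T t f x - c\<bar> \<le> \<eta> + 2 * B * measure (P x) (?E v1 \<union> ?E v2)"
  proof (rule semigroup_near[OF x(1) t m B c _ \<eta>])
    show "?E v1 \<union> ?E v2 \<in> sets A" using EA by blast
    show "AE \<omega> in P x. \<omega> \<notin> ?E v1 \<union> ?E v2 \<longrightarrow> \<bar>f (X t \<omega>) - c\<bar> \<le> \<eta>"
      using AE_start[OF x(1)]
    proof eventually_elim
      fix \<omega> assume w: "\<omega> \<in> space A \<and> X 0 \<omega> = x"
      have zJ: "X t \<omega> \<in> J" using X_in_J[OF t] w by auto
      have hit: "\<omega> \<in> ?E v" if "v \<in> closed_segment x (X t \<omega>)" for v
      proof -
        have "v \<in> J" using that J_seg[OF x(1) zJ] by auto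
        moreover have "hit v \<omega> \<le> ennreal t"
          using order_trans[OF hitting_between hitting_le[OF t refl]] that w by blast
        ultimately show ?thesis using w by simp
      qed
      show "\<omega> \<notin> ?E v1 \<union> ?E v2 \<longrightarrow> \<bar>f (X t \<omega>) - c\<bar> \<le> \<eta>"
      proof
        assume n: "\<omega> \<notin> ?E v1 \<union> ?E v2"
        have "v1 < X t \<omega>" using hit[of v1] n x by (force simp: closed_segment_eq_real_ivl)
        moreover have "X t \<omega> < v2" using hit[of v2] n x by (force simp: closed_segment_eq_real_ivl)
        ultimately show "\<bar>f (X t \<omega>) - c\<bar> \<le> \<eta>" using near zJ by blast
      qed
    qed
  qed
  also have "measure (P x) (?E v1 \<union> ?E v2) \<le> hit_prob x v1 t + hit_prob x v2 t"
    unfolding hE by (rule measure_Un_le) (use EA x in \<open>auto simp: sets_P_iff\<close>)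
  finally show ?thesis using B0 by (simp add: mult_left_mono)
qed

lemma hit_prob_phi:
  assumes x: "x \<in> J" and t: "0 \<le> t" shows "hit_prob x v t \<le> exp t * enn2real (phi x v)"
proof (cases "v \<in> J")
  case True
  have "ennreal (hit_prob x v t) \<le> ennreal (exp t) * phi x v"
    using prob_le_phi[OF x t, of v] True by (simp add: hit_prob_def emeasure_P_eq[OF x])
  also have "\<dots> = ennreal (exp t * enn2real (phi x v))"
    using phi_finite[OF x, of v] by (simp add: ennreal_mult)
  finally show ?thesis by simp
qed (simp add: hit_prob_def)

lemma hit_prob_between:
  assumes "x \<in> J" "w \<in> closed_segment x v" shows "hit_prob x v t \<le> hit_prob w v t"
proof (cases "v \<in> J")
  case True
  then have w: "w \<in> J" using assms J_seg by blast
  show ?thesis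
    using hit_between_prob[OF assms w, of "ennreal t"] True
    by (simp add: hit_prob_def emeasure_P_eq assms(1) w)
qed (simp add: hit_prob_def)

lemma trap_phi:
  assumes r: "r \<in> J" "r \<notin> interior J" and v: "v \<noteq> r" shows "phi r v = 0"
proof -
  have "phi r v = (\<integral>\<^sup>+\<omega>. 0 \<partial>P r)"
    unfolding phi_def
  proof (rule nn_integral_cong_AE, use trap[OF r] AE_start[OF r(1)] in eventually_elim)
    fix \<omega> assume s: "\<forall>t\<ge>0. X t \<omega> = r" and w: "\<omega> \<in> space A \<and> X 0 \<omega> = r"
    have "\<not> hit v \<omega> < \<top>" using hitting_attained[of \<omega> v] s w v by auto
    then show "ed (hit v \<omega>) = 0" by (simp add: ed_def top.not_eq_extremum)
  qed
  then show ?thesis by simp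
qed

text \<open>From a point near the trap \<open>r\<close> the process can reach \<open>v\<close> only
  before it reaches \<open>r\<close>, which on natural scale has probability
  \<open>\<bar>x - r\<bar> / \<bar>v - r\<bar>\<close>.\<close>

lemma phi_near_trap:
  assumes r: "r \<in> J" "r \<notin> interior J" and v: "v \<in> J" "v \<noteq> r" and e: "0 < e"
  shows "\<exists>d>0. \<forall>x\<in>J. \<bar>x - r\<bar> < d \<longrightarrow> enn2real (phi x v) \<le> e"
proof (intro exI conjI ballI impI)
  \<comment> \<open>The bound by 1 places \<open>x\<close> between \<open>r\<close> and
    \<open>v\<close>; the factor \<open>e\<close> gives the estimate.\<close>
  show "0 < min 1 e * \<bar>v - r\<bar>" using v e by simp
  fix x assume x: "x \<in> J" "\<bar>x - r\<bar> < min 1 e * \<bar>v - r\<bar>"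
  show "enn2real (phi x v) \<le> e"
  proof (cases "x = r")
    case True
    then show ?thesis using trap_phi[OF r v(2)] e by simp
  next
    case False
    have "min 1 e * \<bar>v - r\<bar> \<le> 1 * \<bar>v - r\<bar>" by (rule mult_right_mono) auto
    then have lt: "\<bar>x - r\<bar> < \<bar>v - r\<bar>" using x by simp
    have o: "r < x \<and> x < v \<or> v < x \<and> x < r"
      using end_point[OF r] x(1) v lt False by (fastforce simp: abs_if split: if_splits)
    have "enn2real (phi x v) = enn2real (exit_ed x v r) + enn2real (exit_ed x r v) * enn2real (phi r v)"
      by (rule phi_real_exit) (use x r v in auto)
    also have "\<dots> = enn2real (exit_ed x v r)" using trap_phi[OF r v(2)] by simp
    also have "\<dots> \<le> \<bar>x - r\<bar> / \<bar>v - r\<bar>" by (rule exit_ed_real[OF x(1) r(1) v(1) o])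
    also have "\<dots> \<le> e"
    proof -
      have "min 1 e * \<bar>v - r\<bar> \<le> e * \<bar>v - r\<bar>" by (rule mult_right_mono) auto
      then have "\<bar>x - r\<bar> \<le> e * \<bar>v - r\<bar>" using x(2) by linarith
      then show ?thesis using v by (simp add: pos_divide_le_eq)
    qed
    finally show ?thesis .
  qed
qed

lemma hit_prob_near_trap:
  assumes r: "r \<in> J" "r \<notin> interior J" and v: "v \<noteq> r" and e: "0 < e" and t: "0 \<le> t"
  shows "\<exists>d>0. \<forall>x\<in>J. \<bar>x - r\<bar> < d \<longrightarrow> hit_prob x v t \<le> e"
proof (cases "v \<in> J")
  case True
  obtain d where d: "d > 0" "\<forall>x\<in>J. \<bar>x - r\<bar> < d \<longrightarrow> enn2real (phi x v) \<le> e / exp t"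
    using phi_near_trap[OF r True v, of "e / exp t"] e by auto
  show ?thesis
  proof (intro exI conjI ballI impI)
    fix x assume x: "x \<in> J" "\<bar>x - r\<bar> < d"
    have "hit_prob x v t \<le> exp t * enn2real (phi x v)" by (rule hit_prob_phi[OF x(1) t])
    also have "\<dots> \<le> exp t * (e / exp t)" by (rule mult_left_mono) (use d x in auto)
    finally show "hit_prob x v t \<le> e" by simp
  qed (rule d(1))
qed (use e in \<open>auto simp: hit_prob_def intro: exI[of _ 1]\<close>)

text \<open>Here \<open>t\<close> is fixed and not small: a start close to the trap stays close up
  to time \<open>t\<close>, because reaching a given distance from the trap is unlikely at any
  time.\<close>

lemma semigroup_continuous_trap:
  assumes r: "r \<in> J" "r \<notin> interior J" and t: "0 \<le> t" and f: "continuous_on J f"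
    and B: "\<forall>z\<in>J. \<bar>f z\<bar> \<le> B" and e: "0 < e"
  shows "\<exists>d>0. \<forall>x\<in>J. \<bar>x - r\<bar> < d \<longrightarrow> \<bar>T t f x - T t f r\<bar> < e"
proof -
  have m: "(\<lambda>\<omega>. f (X t \<omega>)) \<in> borel_measurable A" by (rule fX_meas[OF f t])
  have B0: "0 \<le> B" using B r(1) by (meson abs_ge_zero order_trans)
  have Tr: "T t f r = f r"
  proof -
    interpret prob_space "P r" by (rule prob_P[OF r(1)])
    have "T t f r = (\<integral>\<omega>. f r \<partial>P r)"
      unfolding transition_semigroup_def
      by (rule integral_cong_AE) (use trap[OF r] t P_meas[OF r(1) m] in \<open>auto elim: AE_mp\<close>)
    then show ?thesis by (simp add: prob_space)
  qed
  obtain d0 where d0: "0 < d0" "\<And>z. z \<in> J \<Longrightarrow> \<bar>z - r\<bar> < d0 \<Longrightarrow> \<bar>f z - f r\<bar> < e / 4"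
    using f[unfolded continuous_on_iff, rule_format, OF r(1), of "e / 4"] e by (auto simp: dist_real_def)
  define v1 where "v1 = r - d0 / 2"
  define v2 where "v2 = r + d0 / 2"
  \<comment> \<open>Chosen so that two hitting probabilities, weighted by \<open>2 * B\<close>, add
    up to at most \<open>e / 4\<close>; the summand 1 allows \<open>B = 0\<close>.\<close>
  define e' where "e' = e / (16 * (B + 1))"
  have e': "0 < e'" using e B0 by (simp add: e'_def)
  obtain d1 where d1: "d1 > 0" "\<forall>x\<in>J. \<bar>x - r\<bar> < d1 \<longrightarrow> hit_prob x v1 t \<le> e'"
    using hit_prob_near_trap[OF r _ e' t, of v1] d0 by (auto simp: v1_def)
  obtain d2 where d2: "d2 > 0" "\<forall>x\<in>J. \<bar>x - r\<bar> < d2 \<longrightarrow> hit_prob x v2 t \<le> e'"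
    using hit_prob_near_trap[OF r _ e' t, of v2] d0 by (auto simp: v2_def)
  show ?thesis
  proof (intro exI conjI ballI impI)
    show "0 < min (d0 / 2) (min d1 d2)" using d0 d1 d2 by simp
    fix x assume x: "x \<in> J" "\<bar>x - r\<bar> < min (d0 / 2) (min d1 d2)"
    have "\<bar>T t f x - f r\<bar> \<le> e / 4 + 2 * B * (hit_prob x v1 t + hit_prob x v2 t)"
    proof (rule semigroup_local[OF x(1) _ _ t m B])
      show "v1 < x" "x < v2" using x(2) unfolding v1_def v2_def by linarith+
      show "\<bar>f r\<bar> \<le> B" using B r by simp
      fix z assume "z \<in> J" "v1 < z" "z < v2"
      then show "\<bar>f z - f r\<bar> \<le> e / 4"
        using d0(1) by (intro less_imp_le d0(2)) (auto simp: v1_def v2_def abs_if)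
    qed (use e in auto)
    also have "\<dots> \<le> e / 4 + 2 * B * (e' + e')"
      using d1(2) d2(2) x B0 by (intro add_left_mono mult_left_mono add_mono) auto
    also have "\<dots> \<le> e / 4 + e / 4"
    proof -
      have "e' * (16 * (B + 1)) = e" using B0 by (simp add: e'_def)
      then have "16 * (B * e') + 16 * e' = e" by (simp add: algebra_simps)
      then show ?thesis using e' by (simp add: algebra_simps)
    qed
    also have "\<dots> < e" using e by simp
    finally show "\<bar>T t f x - T t f r\<bar> < e" unfolding Tr .
  qed
qed

text \<open>Restricting the supremum to rational \<open>q\<close> keeps it measurable.\<close>

definition osc :: "(real \<Rightarrow> real) \<Rightarrow> real \<Rightarrow> real \<Rightarrow> 'w \<Rightarrow> ennreal" where
  "osc f t \<delta> \<omega> = (SUP q\<in>{0..1} \<inter> \<rat>. ennreal \<bar>f (X (t - \<delta> * q) \<omega>) - f (X t \<omega>)\<bar>)"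

lemma fX_continuous:
  assumes "continuous_on J f" "\<omega> \<in> space A" shows "continuous_on {0..} (\<lambda>s. f (X s \<omega>))"
  by (rule continuous_on_compose2[OF assms(1) continuous_paths[OF assms(2)]])
    (use X_in_J assms in auto)

lemma osc_bound:
  assumes f: "continuous_on J f" and w: "\<omega> \<in> space A" and d: "0 < \<delta>" "\<delta> \<le> t" and s: "0 \<le> s" "s \<le> \<delta>"
  shows "ennreal \<bar>f (X (t - s) \<omega>) - f (X t \<omega>)\<bar> \<le> osc f t \<delta> \<omega>"
proof (cases "osc f t \<delta> \<omega>")
  case (real r)
  let ?g = "\<lambda>q. \<bar>f (X (t - \<delta> * q) \<omega>) - f (X t \<omega>)\<bar>"
  have dq: "0 \<le> t - \<delta> * q" if "q \<in> {0..1}" for q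
  proof -
    have "\<delta> * q \<le> \<delta> * 1" using that d by (intro mult_left_mono) auto
    then show ?thesis using d by linarith
  qed
  have "continuous_on {0..1} (\<lambda>q. f (X (t - \<delta> * q) \<omega>))"
    by (rule continuous_on_compose2[OF fX_continuous[OF f w], of _ "\<lambda>q. t - \<delta> * q"])
      (use dq in \<open>auto intro!: continuous_intros\<close>)
  then have c: "continuous_on {0..1} ?g" by (intro continuous_intros)
  have le: "?g q \<le> r" if "q \<in> {0..1} \<inter> \<rat>" for q
  proof -
    have "ennreal (?g q) \<le> osc f t \<delta> \<omega>" unfolding osc_def by (rule SUP_upper[OF that])
    then show ?thesis using real by simp
  qed
  have "?g (s / \<delta>) \<le> r"
  proof (rule continuous_le_on_closure[of "{0..1} \<inter> \<rat>" ?g])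
    show "continuous_on (closure ({0..1} \<inter> \<rat>)) ?g" unfolding closure_unit_rationals by (rule c)
    show "s / \<delta> \<in> closure ({0..1} \<inter> \<rat>)" unfolding closure_unit_rationals using d s by simp
  qed (rule le)
  then show ?thesis using real d by (simp add: ennreal_leI)
qed simp

lemma osc_meas:
  assumes f: "continuous_on J f" and d: "0 < \<delta>" "\<delta> \<le> t"
  shows "osc f t \<delta> \<in> borel_measurable (path_sigma A X)"
  unfolding osc_def
proof (rule borel_measurable_SUP)
  show "countable ({0..1::real} \<inter> \<rat>)" by (intro countable_Int2 countable_rat)
  fix q :: real assume q: "q \<in> {0..1} \<inter> \<rat>"
  have "\<delta> * q \<le> \<delta> * 1" using q d by (intro mult_left_mono) auto
  then have tq: "0 \<le> t - \<delta> * q" using d by linarith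
  show "(\<lambda>\<omega>. ennreal \<bar>f (X (t - \<delta> * q) \<omega>) - f (X t \<omega>)\<bar>) \<in> borel_measurable (path_sigma A X)"
    using fX_path_meas[OF f tq] fX_path_meas[OF f order_trans[OF less_imp_le[OF d(1)] d(2)]] by measurable
qed

text \<open>The oscillation over a shrinking window before \<open>t\<close> tends to zero along each
  continuous path and is bounded by \<open>2 * B\<close>, so dominated convergence applies.\<close>

lemma osc_vanishes:
  assumes f: "continuous_on J f" and B: "\<forall>z\<in>J. \<bar>f z\<bar> \<le> B" and x: "x \<in> J" and t: "0 < t" and e: "0 < e"
  shows "\<exists>\<delta>>0. \<delta> \<le> t \<and> (\<integral>\<^sup>+\<omega>. osc f t \<delta> \<omega> \<partial>P x) < ennreal e"
proof -
  define \<delta> where "\<delta> n = t / real (Suc n)" for n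
  have d: "0 < \<delta> n" "\<delta> n \<le> t" for n using t by (auto simp: \<delta>_def divide_simps)
  have dlim: "\<delta> \<longlonglongrightarrow> 0"
  proof -
    have "(\<lambda>n. t * (1 / real (Suc n))) \<longlonglongrightarrow> t * 0"
      by (intro tendsto_intros LIMSEQ_Suc[OF lim_1_over_n])
    then show ?thesis by (simp add: \<delta>_def[abs_def])
  qed
  have qt: "0 \<le> t - \<delta> n * q" "\<delta> n * q \<le> \<delta> n" if "q \<in> {0..1}" for n q
  proof -
    show "\<delta> n * q \<le> \<delta> n" using that d(1)[of n] by (intro mult_left_le) auto
    then show "0 \<le> t - \<delta> n * q" using d(2)[of n] by simp
  qed
  have "(\<lambda>n. \<integral>\<^sup>+\<omega>. osc f t (\<delta> n) \<omega> \<partial>P x) \<longlonglongrightarrow> (\<integral>\<^sup>+\<omega>. 0 \<partial>P x)"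
  proof (rule nn_integral_dominated_convergence[where w="\<lambda>_. ennreal (2 * B)"])
    show "osc f t (\<delta> n) \<in> borel_measurable (P x)" for n
      by (intro P_meas[OF x] path_meas osc_meas f d)
    show "(\<integral>\<^sup>+\<omega>. ennreal (2 * B) \<partial>P x) < \<infinity>" using nn_const[OF x] by simp
    show "AE \<omega> in P x. osc f t (\<delta> n) \<omega> \<le> ennreal (2 * B)" for n
      using AE_start[OF x]
    proof eventually_elim
      case (elim \<omega>)
      show ?case unfolding osc_def
      proof (intro SUP_least ennreal_leI)
        fix q :: real assume "q \<in> {0..1} \<inter> \<rat>"
        then have "\<bar>f (X (t - \<delta> n * q) \<omega>)\<bar> \<le> B" "\<bar>f (X t \<omega>)\<bar> \<le> B"
          using B X_in_J qt[of q n] elim t by auto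
        then show "\<bar>f (X (t - \<delta> n * q) \<omega>) - f (X t \<omega>)\<bar> \<le> 2 * B" by linarith
      qed
    qed
    show "AE \<omega> in P x. (\<lambda>n. osc f t (\<delta> n) \<omega>) \<longlonglongrightarrow> 0"
      using AE_start[OF x]
    proof eventually_elim
      case (elim \<omega>)
      show ?case
      proof (rule order_tendstoI)
        fix a :: ennreal assume "0 < a"
        obtain r where r: "0 < r" "ennreal r < a"
          using \<open>0 < a\<close> by (metis dense ennreal_less_zero_iff ennreal_cases less_top top_greatest order.strict_trans2 ennreal_0 ennreal_eq_0_iff not_less)
        have c: "continuous_on {0..} (\<lambda>s. f (X s \<omega>))" by (rule fX_continuous[OF f]) (use elim in auto)
        then obtain \<eta> where \<eta>: "0 < \<eta>" "\<And>s. 0 \<le> s \<Longrightarrow> \<bar>s - t\<bar> < \<eta> \<Longrightarrow> \<bar>f (X s \<omega>) - f (X t \<omega>)\<bar> < r"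
          using r(1) t unfolding continuous_on_iff dist_real_def by (metis atLeast_iff less_imp_le)
        have "\<forall>\<^sub>F n in sequentially. \<delta> n < \<eta>" using dlim \<eta>(1) by (rule order_tendstoD(2))
        then show "\<forall>\<^sub>F n in sequentially. osc f t (\<delta> n) \<omega> < a"
        proof eventually_elim
          fix n assume n: "\<delta> n < \<eta>"
          have "osc f t (\<delta> n) \<omega> \<le> ennreal r" unfolding osc_def
          proof (intro SUP_least ennreal_leI)
            fix q :: real assume q: "q \<in> {0..1} \<inter> \<rat>"
            have "0 \<le> \<delta> n * q" using q d(1)[of n] by simp
            then have "\<bar>(t - \<delta> n * q) - t\<bar> < \<eta>" using qt(2)[of q n] q n by auto
            then show "\<bar>f (X (t - \<delta> n * q) \<omega>) - f (X t \<omega>)\<bar> \<le> r"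
              using qt(1)[of q n] q by (intro less_imp_le[OF \<eta>(2)]) auto
          qed
          then show "osc f t (\<delta> n) \<omega> < a" using r(2) by simp
        qed
      qed simp
    qed
  qed measurable
  then have "(\<lambda>n. \<integral>\<^sup>+\<omega>. osc f t (\<delta> n) \<omega> \<partial>P x) \<longlonglongrightarrow> 0" by simp
  then have "\<forall>\<^sub>F n in sequentially. (\<integral>\<^sup>+\<omega>. osc f t (\<delta> n) \<omega> \<partial>P x) < ennreal e"
    by (rule order_tendstoD(2)) (use e in simp)
  then show ?thesis using d by (auto simp: eventually_sequentially)
qed

text \<open>A coupling through the strong Markov property: from \<open>x\<close> near
  \<open>y\<close> the point \<open>y\<close> is hit within \<delta> with high probability. After
  that the process is one started at \<open>y\<close> with its clock off by at most \<delta>, and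
  the oscillation before \<open>t\<close> measures the effect.\<close>

lemma semigroup_continuous_interior:
  assumes y: "y \<in> interior J" and t: "0 < t" and f: "continuous_on J f"
    and B: "\<forall>z\<in>J. \<bar>f z\<bar> \<le> B" and e: "0 < e"
  shows "\<exists>d>0. \<forall>x\<in>J. \<bar>x - y\<bar> < d \<longrightarrow> \<bar>T t f x - T t f y\<bar> < e"
proof -
  have yJ: "y \<in> J" using y interior_subset by auto
  have B0: "0 \<le> B" using B yJ by (meson abs_ge_zero order_trans)
  have t0: "0 \<le> t" using t by simp
  have m: "(\<lambda>\<omega>. f (X t \<omega>)) \<in> borel_measurable A" by (rule fX_meas[OF f t0])
  obtain \<delta> where \<delta>: "0 < \<delta>" "\<delta> \<le> t" "(\<integral>\<^sup>+\<omega>. osc f t \<delta> \<omega> \<partial>P y) < ennreal (e / 2)"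
    using osc_vanishes[OF f B yJ t, of "e / 2"] e by auto
  define e' where "e' = e / (8 * (B + 1))"
  have e': "0 < e'" using e B0 by (simp add: e'_def)
  have "\<forall>\<^sub>F z in at y. measure (P z) {\<omega>\<in>space A. ennreal \<delta> < hit y \<omega>} < e'"
    using attain[OF y \<delta>(1)] e' by (rule order_tendstoD(2))
  then obtain d where d: "0 < d" "\<And>z. z \<noteq> y \<Longrightarrow> \<bar>z - y\<bar> < d \<Longrightarrow> measure (P z) {\<omega>\<in>space A. ennreal \<delta> < hit y \<omega>} < e'"
    unfolding eventually_at by (auto simp: dist_real_def)
  show ?thesis
  proof (intro exI conjI ballI impI)
    show "0 < d" by fact
    fix x assume x: "x \<in> J" "\<bar>x - y\<bar> < d"
    show "\<bar>T t f x - T t f y\<bar> < e"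
    proof (cases "x = y")
      case False
      interpret prob_space "P x" by (rule prob_P[OF x(1)])
      let ?\<tau> = "hit y"
      let ?late = "{\<omega>\<in>space A. ennreal \<delta> < ?\<tau> \<omega>}"
      let ?in = "{\<omega>\<in>space A. ?\<tau> \<omega> \<le> ennreal \<delta>}"
      \<comment> \<open>The strong Markov property is available for nonnegative functionals, hence
        the shift by \<open>B\<close>.\<close>
      define g where "g z = f z + B" for z
      have g: "\<forall>z\<in>J. 0 \<le> g z \<and> g z \<le> 2 * B" using B by (auto simp: g_def abs_le_iff)
      have g2: "\<forall>z\<in>J. \<bar>g z\<bar> \<le> 2 * B" using g by auto
      have gc: "continuous_on J g" unfolding g_def by (intro continuous_intros f)
      have gm: "(\<lambda>\<omega>. g (X t \<omega>)) \<in> borel_measurable A" by (rule fX_meas[OF gc t0])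
      have late: "measure (P x) ?late < e'" by (rule d(2)) (use False x in auto)
      have lateP: "?late \<in> sets (P x)" "?in \<in> sets (P x)" by (auto simp: sets_P_iff[OF x(1)])
      have p: "measure (P x) ?in = 1 - measure (P x) ?late"
      proof -
        have "?in = space (P x) - ?late" using x(1) by auto
        then show ?thesis using prob_compl[OF lateP(1)] by simp
      qed
      \<comment> \<open>Here the process runs for the full time \<open>t\<close> after hitting
        \<open>y\<close>. The expectation of \<open>V\<close> factorizes into the probability of an
        early hit and the value of the semigroup at \<open>y\<close>.\<close>
      define V where "V \<omega> = indicator ?in \<omega> * g (X t (\<theta> (enn2real (?\<tau> \<omega>)) \<omega>))" for \<omega>
      define Gy where "Gy = (\<integral>\<omega>. g (X t \<omega>) \<partial>P y)"
      have Gyi: "integrable (P y) (\<lambda>\<omega>. g (X t \<omega>))" by (rule fX_integrable[OF yJ t0 gm g2])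
      have Gy: "Gy = T t f y + B"
      proof -
        interpret Y: prob_space "P y" by (rule prob_P[OF yJ])
        show ?thesis
          unfolding Gy_def g_def transition_semigroup_def using fX_integrable[OF yJ t0 m B] by (simp add: Y.prob_space)
      qed
      have Gx: "(\<integral>\<omega>. g (X t \<omega>) \<partial>P x) = T t f x + B"
        unfolding g_def transition_semigroup_def using fX_integrable[OF x(1) t0 m B] by (simp add: prob_space)
      have Gxi: "integrable (P x) (\<lambda>\<omega>. g (X t \<omega>))" by (rule fX_integrable[OF x(1) t0 gm g2])
      have Gy0: "0 \<le> Gy" "Gy \<le> 2 * B"
      proof -
        interpret Y: prob_space "P y" by (rule prob_P[OF yJ])
        show "0 \<le> Gy" unfolding Gy_def
          by (rule integral_nonneg_AE) (use AE_start[OF yJ] g X_in_J[OF t0] in \<open>auto elim!: AE_mp\<close>)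
        have "Gy \<le> (\<integral>\<omega>. 2 * B \<partial>P y)" unfolding Gy_def
          by (rule integral_mono_AE) (use AE_start[OF yJ] g X_in_J[OF t0] Gyi in \<open>auto elim!: AE_mp\<close>)
        then show "Gy \<le> 2 * B" by (simp add: Y.prob_space)
      qed
      have Zm: "(\<lambda>\<omega>. ennreal (g (X t \<omega>))) \<in> borel_measurable (path_sigma A X)"
        using fX_path_meas[OF gc t0] by measurable
      have instop: "indicator ?in \<in> borel_measurable (stopped_sigma A F ?\<tau>)"
      proof -
        have [measurable]: "?\<tau> \<in> borel_measurable (stopped_sigma A F ?\<tau>)"
          by (rule stopping_time_stopped_meas[OF hitting_stopping])
        have "{\<omega>\<in>space (stopped_sigma A F ?\<tau>). ?\<tau> \<omega> \<le> ennreal \<delta>} \<in> sets (stopped_sigma A F ?\<tau>)" by measurable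
        then show ?thesis by simp
      qed
      have thJ: "X t (\<theta> (enn2real (?\<tau> \<omega>)) \<omega>) \<in> J" if "\<omega> \<in> space A" for \<omega>
        by (rule X_in_J[OF t0 shift_closed]) (use that in auto)
      have Vm: "V \<in> borel_measurable (P x)"
      proof (rule P_meas[OF x(1)])
        have "(\<lambda>\<omega>. g (X t (\<theta> (enn2real (?\<tau> \<omega>)) \<omega>))) \<in> borel_measurable A"
          by (rule measurable_compose[OF theta_meas fX_path_meas[OF gc t0]]) auto
        then show "V \<in> borel_measurable A" unfolding V_def by measurable
      qed
      have Vb: "AE \<omega> in P x. 0 \<le> V \<omega> \<and> V \<omega> \<le> 2 * B"
        using AE_start[OF x(1)] by eventually_elim (use g thJ B0 in \<open>auto simp: V_def split: split_indicator\<close>)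
      have Vi: "integrable (P x) V"
        by (rule integrable_const_bound[OF _ Vm, of "2 * B"]) (use Vb in \<open>auto elim!: AE_mp\<close>)
      have Vint: "(\<integral>\<omega>. V \<omega> \<partial>P x) = measure (P x) ?in * Gy"
      proof -
        have "(\<integral>\<^sup>+\<omega>. ennreal (V \<omega>) \<partial>P x) = (\<integral>\<^sup>+\<omega>. indicator ?in \<omega> * (ennreal (g (X t (\<theta> (enn2real (?\<tau> \<omega>)) \<omega>))) * indicator {\<omega>. ?\<tau> \<omega> < \<infinity>} \<omega>) \<partial>P x)"
          by (rule nn_integral_cong) (auto simp: V_def split: split_indicator dest: le_less_trans[OF _ ennreal_less_top])
        also have "\<dots> = (\<integral>\<^sup>+\<omega>. indicator ?in \<omega> * indicator {\<omega>. ?\<tau> \<omega> < \<infinity>} \<omega> \<partial>P x) * (\<integral>\<^sup>+\<omega>. ennreal (g (X t \<omega>)) \<partial>P y)"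
          by (rule strong_Markov_hitting[OF x(1) Zm instop])
        also have "(\<integral>\<^sup>+\<omega>. indicator ?in \<omega> * indicator {\<omega>. ?\<tau> \<omega> < \<infinity>} \<omega> \<partial>P x) = (\<integral>\<^sup>+\<omega>. indicator ?in \<omega> \<partial>P x)"
          by (rule nn_integral_cong) (auto split: split_indicator dest: le_less_trans[OF _ ennreal_less_top])
        also have "\<dots> = ennreal (measure (P x) ?in)"
          using lateP(2) by (simp add: emeasure_P_eq[OF x(1)])
        also have "(\<integral>\<^sup>+\<omega>. ennreal (g (X t \<omega>)) \<partial>P y) = ennreal Gy"
          unfolding Gy_def by (rule nn_integral_eq_integral[OF Gyi])
            (use AE_start[OF yJ] g X_in_J[OF t0] in \<open>auto elim!: AE_mp\<close>)
        finally have "(\<integral>\<^sup>+\<omega>. ennreal (V \<omega>) \<partial>P x) = ennreal (measure (P x) ?in * Gy)"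
          using Gy0 by (simp add: ennreal_mult)
        then show ?thesis
          using nn_integral_eq_integrable[of V "P x" "measure (P x) ?in * Gy"] Vm Vb Gy0 by (auto elim!: AE_mp)
      qed
      have "ennreal \<bar>(\<integral>\<omega>. g (X t \<omega>) - V \<omega> \<partial>P x)\<bar> \<le> (\<integral>\<^sup>+\<omega>. ennreal \<bar>g (X t \<omega>) - V \<omega>\<bar> \<partial>P x)"
        using integral_norm_bound_ennreal[of "P x" "\<lambda>\<omega>. g (X t \<omega>) - V \<omega>"] Gxi Vi by simp
      also have "\<dots> \<le> (\<integral>\<^sup>+\<omega>. 1 * (osc f t \<delta> (\<theta> (enn2real (?\<tau> \<omega>)) \<omega>) * indicator {\<omega>. ?\<tau> \<omega> < \<infinity>} \<omega>) + ennreal (2 * B) * indicator ?late \<omega> \<partial>P x)"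
      proof (rule nn_integral_mono)
        fix \<omega> assume "\<omega> \<in> space (P x)"
        then have w: "\<omega> \<in> space A" using x by simp
        show "ennreal \<bar>g (X t \<omega>) - V \<omega>\<bar> \<le> 1 * (osc f t \<delta> (\<theta> (enn2real (?\<tau> \<omega>)) \<omega>) * indicator {\<omega>. ?\<tau> \<omega> < \<infinity>} \<omega>) + ennreal (2 * B) * indicator ?late \<omega>"
        proof (cases "\<omega> \<in> ?late")
          case True
          then have "V \<omega> = 0" by (auto simp: V_def)
          moreover have "\<bar>g (X t \<omega>)\<bar> \<le> 2 * B" using g2 X_in_J[OF t0 w] by simp
          ultimately have "ennreal \<bar>g (X t \<omega>) - V \<omega>\<bar> \<le> ennreal (2 * B)" by (auto intro: ennreal_leI)
          then show ?thesis using True by (auto intro: order_trans)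
        next
          case False
          then have le: "?\<tau> \<omega> \<le> ennreal \<delta>" using w by auto
          then obtain s where s: "?\<tau> \<omega> = ennreal s" "0 \<le> s" "s \<le> \<delta>"
            using \<delta>(1) by (cases "?\<tau> \<omega>") (auto simp: top_unique)
          \<comment> \<open>Seen from the hit at time \<open>s\<close>, the original process is
            observed at \<open>t - s\<close> and \<open>V\<close> at \<open>t\<close>; both times
            lie in the window of \<open>osc\<close>.\<close>
          have "X (t - s) (\<theta> s \<omega>) = X t \<omega>" using shift[of "t - s" s \<omega>] s \<delta> w by simp
          then have "g (X t \<omega>) - V \<omega> = f (X (t - s) (\<theta> s \<omega>)) - f (X t (\<theta> s \<omega>))"
            using le w s by (simp add: V_def g_def)
          then have "ennreal \<bar>g (X t \<omega>) - V \<omega>\<bar> \<le> osc f t \<delta> (\<theta> s \<omega>)"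
            using osc_bound[OF f shift_closed[OF s(2) w] \<delta>(1,2) s(2,3)] by simp
          then show ?thesis using s False by simp
        qed
      qed
      also have "\<dots> = (\<integral>\<^sup>+\<omega>. 1 * (osc f t \<delta> (\<theta> (enn2real (?\<tau> \<omega>)) \<omega>) * indicator {\<omega>. ?\<tau> \<omega> < \<infinity>} \<omega>) \<partial>P x) + (\<integral>\<^sup>+\<omega>. ennreal (2 * B) * indicator ?late \<omega> \<partial>P x)"
      proof (rule nn_integral_add)
        have "(\<lambda>\<omega>. osc f t \<delta> (\<theta> (enn2real (?\<tau> \<omega>)) \<omega>)) \<in> borel_measurable A"
          by (rule measurable_compose[OF theta_meas osc_meas[OF f \<delta>(1,2)]]) auto
        then have "(\<lambda>\<omega>. 1 * (osc f t \<delta> (\<theta> (enn2real (?\<tau> \<omega>)) \<omega>) * indicator {\<omega>. ?\<tau> \<omega> < \<infinity>} \<omega>)) \<in> borel_measurable A"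
          by measurable
        then show "(\<lambda>\<omega>. 1 * (osc f t \<delta> (\<theta> (enn2real (?\<tau> \<omega>)) \<omega>) * indicator {\<omega>. ?\<tau> \<omega> < \<infinity>} \<omega>)) \<in> borel_measurable (P x)"
          by (rule P_meas[OF x(1)])
      qed (use lateP in measurable)
      also have "\<dots> \<le> ennreal (e / 2 + 2 * B * measure (P x) ?late)"
      proof -
        have "(\<integral>\<^sup>+\<omega>. 1 * (osc f t \<delta> (\<theta> (enn2real (?\<tau> \<omega>)) \<omega>) * indicator {\<omega>. ?\<tau> \<omega> < \<infinity>} \<omega>) \<partial>P x)
            = (\<integral>\<^sup>+\<omega>. 1 * indicator {\<omega>. ?\<tau> \<omega> < \<infinity>} \<omega> \<partial>P x) * (\<integral>\<^sup>+\<omega>. osc f t \<delta> \<omega> \<partial>P y)"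
          by (rule strong_Markov_hitting[OF x(1) osc_meas[OF f \<delta>(1,2)]]) simp
        also have "\<dots> \<le> 1 * ennreal (e / 2)"
        proof (rule mult_mono)
          show "(\<integral>\<^sup>+\<omega>. 1 * indicator {\<omega>. ?\<tau> \<omega> < \<infinity>} \<omega> \<partial>P x) \<le> 1"
            by (rule hit_mass_le_1[OF x(1)])
        qed (use \<delta>(3) in auto)
        finally have b1: "(\<integral>\<^sup>+\<omega>. 1 * (osc f t \<delta> (\<theta> (enn2real (?\<tau> \<omega>)) \<omega>) * indicator {\<omega>. ?\<tau> \<omega> < \<infinity>} \<omega>) \<partial>P x) \<le> ennreal (e / 2)"
          by (simp only: mult_1)
        have b2: "(\<integral>\<^sup>+\<omega>. ennreal (2 * B) * indicator ?late \<omega> \<partial>P x) = ennreal (2 * B * measure (P x) ?late)"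
          using lateP B0 by (simp add: nn_integral_cmult_indicator emeasure_P_eq[OF x(1)] ennreal_mult)
        have "ennreal (e / 2 + 2 * B * measure (P x) ?late) = ennreal (e / 2) + ennreal (2 * B * measure (P x) ?late)"
          using e B0 by (intro ennreal_plus) auto
        then show ?thesis unfolding b2 by (simp only: add_right_mono[OF b1])
      qed
      finally have "\<bar>(\<integral>\<omega>. g (X t \<omega>) - V \<omega> \<partial>P x)\<bar> \<le> e / 2 + 2 * B * measure (P x) ?late"
        using e B0 by (subst (asm) ennreal_le_iff) auto
      \<comment> \<open>The last term appears because \<open>V\<close> carries the weight of early
        hits only.\<close>
      moreover have "(\<integral>\<omega>. g (X t \<omega>) - V \<omega> \<partial>P x) = (T t f x - T t f y) + measure (P x) ?late * Gy"
        using Gxi Vi Vint Gx Gy p by (simp add: algebra_simps)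
      moreover have "0 \<le> measure (P x) ?late * Gy" "measure (P x) ?late * Gy \<le> 2 * B * measure (P x) ?late"
        using Gy0 mult_left_mono[OF Gy0(2), of "measure (P x) ?late"] by (auto simp: mult_ac)
      ultimately have "\<bar>T t f x - T t f y\<bar> \<le> e / 2 + 4 * B * measure (P x) ?late" by linarith
      also have "\<dots> \<le> e / 2 + 4 * B * e'" using late B0 by (intro add_left_mono mult_left_mono) auto
      also have "\<dots> < e"
      proof -
        have "e' * (8 * (B + 1)) = e" using B0 by (simp add: e'_def)
        then have "8 * (B * e') + 8 * e' = e" by (simp add: algebra_simps)
        then show ?thesis using e' by simp
      qed
      finally show ?thesis .
    qed (use e in simp)
  qed
qed

end

section \<open>Behaviour at the ends and strong continuity\<close>

context absorbed_diffusion
begin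

lemma semigroup_zero:
  assumes f: "f \<in> C0 J" and x: "x \<in> J" shows "T 0 f x = f x"
proof -
  interpret prob_space "P x" by (rule prob_P[OF x])
  have "(\<lambda>\<omega>. f (X 0 \<omega>)) \<in> borel_measurable A" by (rule fX_meas) (use f in \<open>auto simp: C0_def\<close>)
  note m = P_meas[OF x this]
  have "T 0 f x = (\<integral>\<omega>. f x \<partial>P x)"
    unfolding transition_semigroup_def
    by (rule integral_cong_AE[OF m]) (use start[OF x] in \<open>auto elim!: AE_mp\<close>)
  then show ?thesis by (simp add: prob_space)
qed

lemma semigroup_continuous:
  assumes f: "f \<in> C0 J" and t: "0 \<le> t" shows "continuous_on J (T t f)"
proof (cases "t = 0")
  case True
  have c: "continuous_on J f" using f by (simp add: C0_def)
  show ?thesis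
    unfolding True by (rule continuous_on_eq[OF c]) (simp add: semigroup_zero[OF f])
next
  case False
  obtain B where B: "\<forall>x\<in>J. \<bar>f x\<bar> \<le> B" using C0_bounded[OF f] by auto
  have c: "continuous_on J f" using f by (simp add: C0_def)
  show ?thesis
    unfolding continuous_on_iff dist_real_def
  proof (intro ballI allI impI)
    fix x e :: real assume x: "x \<in> J" and e: "0 < e"
    show "\<exists>d>0. \<forall>x'\<in>J. \<bar>x' - x\<bar> < d \<longrightarrow> \<bar>T t f x' - T t f x\<bar> < e"
    proof (cases "x \<in> interior J")
      case True
      show ?thesis by (rule semigroup_continuous_interior[OF True _ c B e]) (use False t in simp)
    next
      case False
      show ?thesis by (rule semigroup_continuous_trap[OF x False t c B e])
    qed
  qed
qed

text \<open>Either nothing lies beyond the right end point, or there is room for two points beyond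
  \<open>K\<close>: a barrier \<open>w\<close> and a start \<open>q\<close> behind it.\<close>

lemma right_cases:
  assumes K: "compact K" "K \<subseteq> J"
  shows "(\<exists>q\<in>J. \<forall>x\<in>J. x \<le> q) \<or> (\<exists>w\<in>interior J. \<exists>q\<in>J. w < q \<and> (\<forall>z\<in>K. z < w))"
proof (cases "\<exists>q\<in>J. \<forall>x\<in>J. x \<le> q")
  case False
  then have nomax: "\<exists>z\<in>J. x < z" if "x \<in> J" for x using that by force
  have "\<exists>k\<in>J. \<forall>z\<in>K. z \<le> k"
  proof (cases "K = {}")
    case True
    then show ?thesis using nonempty by blast
  next
    case False
    then show ?thesis using compact_attains_sup[OF K(1) False] K(2) by blast
  qed
  then obtain k where k: "k \<in> J" "\<forall>z\<in>K. z \<le> k" by blast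
  obtain w where w: "w \<in> J" "k < w" using nomax[OF k(1)] by blast
  obtain q where q: "q \<in> J" "w < q" using nomax[OF w(1)] by blast
  have "w \<in> interior J" by (rule interior_between[OF k(1) q(1) w(2) q(2)])
  then show ?thesis using k w q by (meson order_le_less_trans)
qed simp

lemma semigroup_beyond:
  fixes f :: "real \<Rightarrow> real"
  assumes x: "x \<in> J" and w: "w < x" "w \<in> J" and t: "0 \<le> t" and m: "(\<lambda>\<omega>. f (X t \<omega>)) \<in> borel_measurable A"
    and B: "0 \<le> B" "\<forall>z\<in>J. \<bar>f z\<bar> \<le> B" and K: "\<forall>z\<in>K. z < w" and f: "\<forall>z\<in>J - K. \<bar>f z\<bar> \<le> \<epsilon>" and \<epsilon>: "0 \<le> \<epsilon>"
  shows "\<bar>T t f x\<bar> \<le> \<epsilon> + 2 * B * hit_prob x w t"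
proof -
  have "\<bar>T t f x - 0\<bar> \<le> \<epsilon> + 2 * B * measure (P x) (hit_by w t)"
  proof (rule semigroup_near[OF x t m B(2) _ _ \<epsilon>])
    show "AE \<omega> in P x. \<omega> \<notin> hit_by w t \<longrightarrow> \<bar>f (X t \<omega>) - 0\<bar> \<le> \<epsilon>"
      using AE_start[OF x]
    proof eventually_elim
      fix \<omega> assume o: "\<omega> \<in> space A \<and> X 0 \<omega> = x"
      show "\<omega> \<notin> hit_by w t \<longrightarrow> \<bar>f (X t \<omega>) - 0\<bar> \<le> \<epsilon>"
      proof
        assume "\<omega> \<notin> hit_by w t"
        then have "ennreal t < hit w \<omega>" using o by (simp add: not_le)
        then have "w < X t \<omega>" using path_above[of \<omega> w t] o w t by auto
        then have "X t \<omega> \<in> J - K" using K X_in_J[OF t] o by force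
        then show "\<bar>f (X t \<omega>) - 0\<bar> \<le> \<epsilon>" using f by simp
      qed
    qed
  qed (use B in auto)
  then show ?thesis using w(2) by (simp add: hit_prob_def)
qed

text \<open>From far out, the set where \<open>f\<close> is not small is reached only through the
  barrier \<open>w\<close>, and \<open>right_natural\<close> makes this unlikely by time
  \<open>t\<close>.\<close>

lemma right_vanish:
  fixes f :: "real \<Rightarrow> real"
  assumes rn: right_natural and t: "0 \<le> t" and m: "(\<lambda>\<omega>. f (X t \<omega>)) \<in> borel_measurable A"
    and B: "0 \<le> B" "\<forall>z\<in>J. \<bar>f z\<bar> \<le> B" and K: "compact K" "K \<subseteq> J"
    and f: "\<forall>z\<in>J - K. \<bar>f z\<bar> \<le> \<epsilon>" and \<epsilon>: "0 \<le> \<epsilon>" and e: "0 < e"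
  shows "\<exists>q\<in>J. \<forall>x\<in>J. q < x \<longrightarrow> \<bar>T t f x\<bar> \<le> \<epsilon> + e"
  using right_cases[OF K]
proof
  assume "\<exists>w\<in>interior J. \<exists>q\<in>J. w < q \<and> (\<forall>z\<in>K. z < w)"
  then obtain w where w: "w \<in> interior J" "\<forall>z\<in>K. z < w" by blast
  have wJ: "w \<in> J" using w interior_subset by auto
  define e' where "e' = e / (exp t * (2 * B + 1))"
  have e': "0 < e'" using e B by (simp add: e'_def)
  obtain q where q: "q \<in> J" "\<forall>x\<in>J. q < x \<longrightarrow> phi x w < ennreal e'"
    using rn w e' unfolding right_natural_def by blast
  have "max q w \<in> J" using q wJ by (simp add: max_def)
  moreover have "\<bar>T t f x\<bar> \<le> \<epsilon> + e" if x: "x \<in> J" "max q w < x" for x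
  proof -
    have "phi x w < ennreal e'" using q x by auto
    then have "enn2real (phi x w) \<le> e'" using e' by (intro enn2real_leI) auto
    then have "exp t * enn2real (phi x w) \<le> exp t * e'" by (rule mult_left_mono) simp
    then have "hit_prob x w t \<le> exp t * e'" using hit_prob_phi[OF x(1) t, of w] by linarith
    then have "2 * B * hit_prob x w t \<le> 2 * B * (exp t * e')" using B by (intro mult_left_mono) auto
    also have "exp t * e' = e / (2 * B + 1)" by (simp add: e'_def)
    also have "2 * B * (e / (2 * B + 1)) \<le> e" using B e by (simp add: pos_divide_le_eq algebra_simps)
    finally have "2 * B * hit_prob x w t \<le> e" .
    moreover have "\<bar>T t f x\<bar> \<le> \<epsilon> + 2 * B * hit_prob x w t"
      by (rule semigroup_beyond[OF x(1) _ wJ t m B w(2) f \<epsilon>]) (use x in simp)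
    ultimately show ?thesis by linarith
  qed
  ultimately show ?thesis by blast
qed (meson not_le)

text \<open>Every start beyond \<open>q\<close> has to pass \<open>q\<close> on the way to the
  barrier \<open>w\<close>, so one small-time estimate at the single point \<open>q\<close> serves
  all of them.\<close>

lemma right_uniform:
  fixes f :: "real \<Rightarrow> real"
  assumes m: "\<And>t. 0 \<le> t \<Longrightarrow> (\<lambda>\<omega>. f (X t \<omega>)) \<in> borel_measurable A"
    and B: "0 \<le> B" "\<forall>z\<in>J. \<bar>f z\<bar> \<le> B" and K: "compact K" "K \<subseteq> J"
    and f: "\<forall>z\<in>J - K. \<bar>f z\<bar> \<le> \<epsilon>" and \<epsilon>: "0 \<le> \<epsilon>" and e: "0 < e"
  shows "\<exists>q\<in>J. \<exists>\<eta>>0. \<forall>x\<in>J. q < x \<longrightarrow> (\<forall>t\<in>{0..\<eta>}. \<bar>T t f x - f x\<bar> \<le> 2 * \<epsilon> + e)"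
  using right_cases[OF K]
proof
  assume "\<exists>q\<in>J. \<forall>x\<in>J. x \<le> q"
  then obtain q where "q \<in> J" "\<forall>x\<in>J. x \<le> q" by blast
  then show ?thesis by (intro bexI[of _ q] exI[of _ 1]) auto
next
  assume "\<exists>w\<in>interior J. \<exists>q\<in>J. w < q \<and> (\<forall>z\<in>K. z < w)"
  then obtain w q where w: "w \<in> interior J" "\<forall>z\<in>K. z < w" and q: "q \<in> J" "w < q" by blast
  have wJ: "w \<in> J" using w interior_subset by auto
  define e' where "e' = e / (2 * B + 1)"
  have e': "0 < e'" using e B by (simp add: e'_def)
  have "w \<noteq> q" using q by simp
  from hit_small[OF q(1) this e'] obtain \<eta> where \<eta>: "0 < \<eta>" "\<forall>t\<in>{0..\<eta>}. hit_prob q w t < e'"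
    using wJ by (auto simp: hit_prob_def)
  have "\<bar>T t f x - f x\<bar> \<le> 2 * \<epsilon> + e" if x: "x \<in> J" "q < x" and t: "t \<in> {0..\<eta>}" for x t
  proof -
    have t0: "0 \<le> t" using t by simp
    have "hit_prob x w t \<le> hit_prob q w t"
      by (rule hit_prob_between[OF x(1)]) (use x q in \<open>auto simp: closed_segment_eq_real_ivl\<close>)
    then have "2 * B * hit_prob x w t \<le> 2 * B * e'" using \<eta>(2) t B by (intro mult_left_mono) force+
    also have "\<dots> \<le> e" using B e by (simp add: e'_def pos_divide_le_eq algebra_simps)
    finally have "2 * B * hit_prob x w t \<le> e" .
    moreover have "\<bar>T t f x\<bar> \<le> \<epsilon> + 2 * B * hit_prob x w t"
      by (rule semigroup_beyond[OF x(1) _ wJ t0 m[OF t0] B w(2) f \<epsilon>]) (use x q in simp)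
    moreover have "x \<in> J - K" using x q w(2) by force
    then have "\<bar>f x\<bar> \<le> \<epsilon>" using f by blast
    ultimately show ?thesis by linarith
  qed
  then show ?thesis using q(1) \<eta>(1) by blast
qed

lemma reflect_semigroup:
  "transition_semigroup (\<lambda>x. P (- x)) (\<lambda>t \<omega>. - X t \<omega>) t (\<lambda>z. f (- z)) x = T t f (- x)"
  by (simp add: transition_semigroup_def)

lemma left_vanish:
  fixes f :: "real \<Rightarrow> real"
  assumes ln: left_natural and t: "0 \<le> t" and m: "(\<lambda>\<omega>. f (X t \<omega>)) \<in> borel_measurable A"
    and B: "0 \<le> B" "\<forall>z\<in>J. \<bar>f z\<bar> \<le> B" and K: "compact K" "K \<subseteq> J"
    and f: "\<forall>z\<in>J - K. \<bar>f z\<bar> \<le> \<epsilon>" and \<epsilon>: "0 \<le> \<epsilon>" and e: "0 < e"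
  shows "\<exists>q\<in>J. \<forall>x\<in>J. x < q \<longrightarrow> \<bar>T t f x\<bar> \<le> \<epsilon> + e"
proof -
  interpret R: absorbed_diffusion "uminus ` J" A F "\<lambda>t \<omega>. - X t \<omega>" \<theta> "\<lambda>x. P (- x)"
    by (rule reflect_absorbed)
  have "\<exists>q\<in>uminus ` J. \<forall>x\<in>uminus ` J. q < x \<longrightarrow> \<bar>R.T t (\<lambda>z. f (- z)) x\<bar> \<le> \<epsilon> + e"
  proof (rule R.right_vanish[OF _ t _ B(1) _ _ _ _ \<epsilon> e])
    show "R.right_natural" using ln reflect_right_natural by simp
    show "compact (uminus ` K)" using K(1) by (rule compact_negations)
    show "\<forall>z\<in>uminus ` J - uminus ` K. \<bar>f (- z)\<bar> \<le> \<epsilon>" using f by force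
  qed (use m B K in auto)
  then obtain q where "q \<in> J" "\<forall>x\<in>J. - q < - x \<longrightarrow> \<bar>R.T t (\<lambda>z. f (- z)) (- x)\<bar> \<le> \<epsilon> + e" by blast
  then show ?thesis unfolding reflect_semigroup by auto
qed

lemma left_uniform:
  fixes f :: "real \<Rightarrow> real"
  assumes m: "\<And>t. 0 \<le> t \<Longrightarrow> (\<lambda>\<omega>. f (X t \<omega>)) \<in> borel_measurable A"
    and B: "0 \<le> B" "\<forall>z\<in>J. \<bar>f z\<bar> \<le> B" and K: "compact K" "K \<subseteq> J"
    and f: "\<forall>z\<in>J - K. \<bar>f z\<bar> \<le> \<epsilon>" and \<epsilon>: "0 \<le> \<epsilon>" and e: "0 < e"
  shows "\<exists>q\<in>J. \<exists>\<eta>>0. \<forall>x\<in>J. x < q \<longrightarrow> (\<forall>t\<in>{0..\<eta>}. \<bar>T t f x - f x\<bar> \<le> 2 * \<epsilon> + e)"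
proof -
  interpret R: absorbed_diffusion "uminus ` J" A F "\<lambda>t \<omega>. - X t \<omega>" \<theta> "\<lambda>x. P (- x)"
    by (rule reflect_absorbed)
  have "\<exists>q\<in>uminus ` J. \<exists>\<eta>>0. \<forall>x\<in>uminus ` J. q < x \<longrightarrow> (\<forall>t\<in>{0..\<eta>}. \<bar>R.T t (\<lambda>z. f (- z)) x - f (- x)\<bar> \<le> 2 * \<epsilon> + e)"
  proof (rule R.right_uniform[OF _ B(1) _ _ _ _ \<epsilon> e])
    show "compact (uminus ` K)" using K(1) by (rule compact_negations)
    show "\<forall>z\<in>uminus ` J - uminus ` K. \<bar>f (- z)\<bar> \<le> \<epsilon>" using f by force
  qed (use m B K in auto)
  then obtain q \<eta> where "q \<in> J" "0 < \<eta>"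
    "\<forall>x\<in>J. - q < - x \<longrightarrow> (\<forall>t\<in>{0..\<eta>}. \<bar>R.T t (\<lambda>z. f (- z)) (- x) - f (- (- x))\<bar> \<le> 2 * \<epsilon> + e)" by blast
  then show ?thesis unfolding reflect_semigroup by (intro bexI[of _ q] exI[of _ \<eta>]) auto
qed

lemma C0_D:
  assumes "f \<in> C0 J" "0 < e" obtains K where "compact K" "K \<subseteq> J" "\<forall>x\<in>J - K. \<bar>f x\<bar> \<le> e"
proof -
  obtain K where K: "compact K" "K \<subseteq> J" "\<forall>x\<in>J - K. \<bar>f x\<bar> < e"
    using assms unfolding C0_def by blast
  from K(3) have "\<forall>x\<in>J - K. \<bar>f x\<bar> \<le> e" by (meson less_imp_le)
  then show thesis by (rule that[OF K(1,2)])
qed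

lemma semigroup_C0:
  assumes rn: right_natural and ln: left_natural and f: "f \<in> C0 J" and t: "0 \<le> t"
  shows "T t f \<in> C0 J"
  unfolding C0_def
proof (intro CollectI conjI allI impI)
  show "continuous_on J (T t f)" by (rule semigroup_continuous[OF f t])
  fix e :: real assume e: "0 < e"
  obtain B where B: "0 \<le> B" "\<forall>x\<in>J. \<bar>f x\<bar> \<le> B" using C0_bounded[OF f] by blast
  obtain K where K: "compact K" "K \<subseteq> J" "\<forall>x\<in>J - K. \<bar>f x\<bar> \<le> e / 4" using C0_D[OF f, of "e / 4"] e by auto
  have m: "(\<lambda>\<omega>. f (X t \<omega>)) \<in> borel_measurable A" by (rule fX_meas[OF _ t]) (use f in \<open>simp add: C0_def\<close>)
  have e4: "0 \<le> e / 4" "0 < e / 4" using e by auto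
  obtain q where q: "q \<in> J" "\<forall>x\<in>J. q < x \<longrightarrow> \<bar>T t f x\<bar> \<le> e / 4 + e / 4"
    using right_vanish[OF rn t m B K e4] by blast
  obtain p where p: "p \<in> J" "\<forall>x\<in>J. x < p \<longrightarrow> \<bar>T t f x\<bar> \<le> e / 4 + e / 4"
    using left_vanish[OF ln t m B K e4] by blast
  show "\<exists>K. compact K \<and> K \<subseteq> J \<and> (\<forall>x\<in>J - K. \<bar>T t f x\<bar> < e)"
  proof (intro exI conjI ballI)
    show "compact {p..q}" by simp
    show "{p..q} \<subseteq> J" by (rule J_Icc[OF p(1) q(1)])
    fix x assume x: "x \<in> J - {p..q}"
    then have "x < p \<or> q < x" by auto
    then have "\<bar>T t f x\<bar> \<le> e / 4 + e / 4" using x p(2) q(2) by blast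
    then show "\<bar>T t f x\<bar> < e" using e by simp
  qed
qed

text \<open>A start within \<open>d0 / 4\<close> of \<open>r\<close> passes the intermediate point
  at distance \<open>d0 / 4\<close> before it moves out to \<open>d0 / 2\<close>. The small-time
  estimate at that point is therefore uniform in the start.\<close>

lemma semigroup_locally_uniform:
  fixes f :: "real \<Rightarrow> real"
  assumes f: "continuous_on J f" and B: "0 \<le> B" "\<forall>z\<in>J. \<bar>f z\<bar> \<le> B" and r: "r \<in> J" and e: "0 < e"
  shows "\<exists>d>0. \<exists>\<eta>>0. \<forall>x\<in>J. \<bar>x - r\<bar> < d \<longrightarrow> (\<forall>t\<in>{0..\<eta>}. \<bar>T t f x - f x\<bar> \<le> e)"
proof -
  obtain d0 where d0: "0 < d0" "\<And>z. z \<in> J \<Longrightarrow> \<bar>z - r\<bar> < d0 \<Longrightarrow> \<bar>f z - f r\<bar> < e / 4"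
    using f[unfolded continuous_on_iff, rule_format, OF r, of "e / 4"] e by (auto simp: dist_real_def)
  define e' where "e' = e / (16 * (B + 1))"
  have e': "0 < e'" using e B by (simp add: e'_def)
  have bound: "\<exists>\<eta>>0. \<forall>x\<in>J. \<bar>x - r\<bar> < d0 / 4 \<longrightarrow> (\<forall>t\<in>{0..\<eta>}. hit_prob x (r + c * (d0 / 2)) t \<le> e')"
    if c: "c = 1 \<or> c = -1" for c
  proof (cases "r + c * (d0 / 2) \<in> J")
    case True
    let ?v = "r + c * (d0 / 2)" and ?w = "r + c * (d0 / 4)"
    have "?w \<in> closed_segment r ?v" using c d0 by (auto simp: closed_segment_eq_real_ivl)
    then have wJ: "?w \<in> J" using J_seg[OF r True] by auto
    have "?v \<noteq> ?w" using c d0 by auto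
    from hit_small[OF wJ this e'] obtain \<eta> where \<eta>: "0 < \<eta>" "\<forall>t\<in>{0..\<eta>}. hit_prob ?w ?v t < e'"
      using True by (auto simp: hit_prob_def)
    show ?thesis
    proof (intro exI conjI ballI impI)
      fix x t assume x: "x \<in> J" "\<bar>x - r\<bar> < d0 / 4" and t: "t \<in> {0..\<eta>}"
      have "hit_prob x ?v t \<le> hit_prob ?w ?v t"
      proof (rule hit_prob_between[OF x(1)])
        have "x < r + d0 / 4" "r - d0 / 4 < x" using x(2) by linarith+
        then show "?w \<in> closed_segment x ?v"
          using c d0(1) by (auto simp: closed_segment_eq_real_ivl)
      qed
      then show "hit_prob x ?v t \<le> e'" using \<eta>(2) t by force
    qed (rule \<eta>(1))
  qed (use e' in \<open>auto simp: hit_prob_def intro!: exI[of _ 1]\<close>)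
  obtain \<eta>1 where \<eta>1: "0 < \<eta>1" "\<forall>x\<in>J. \<bar>x - r\<bar> < d0 / 4 \<longrightarrow> (\<forall>t\<in>{0..\<eta>1}. hit_prob x (r + 1 * (d0 / 2)) t \<le> e')"
    using bound[of 1] by blast
  obtain \<eta>2 where \<eta>2: "0 < \<eta>2" "\<forall>x\<in>J. \<bar>x - r\<bar> < d0 / 4 \<longrightarrow> (\<forall>t\<in>{0..\<eta>2}. hit_prob x (r + -1 * (d0 / 2)) t \<le> e')"
    using bound[of "-1"] by blast
  show ?thesis
  proof (intro exI conjI ballI impI)
    show "0 < d0 / 4" "0 < min \<eta>1 \<eta>2" using d0 \<eta>1 \<eta>2 by auto
    fix x t assume x: "x \<in> J" "\<bar>x - r\<bar> < d0 / 4" and t: "t \<in> {0..min \<eta>1 \<eta>2}"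
    have t0: "0 \<le> t" using t by simp
    have "\<bar>T t f x - f r\<bar> \<le> e / 4 + 2 * B * (hit_prob x (r - d0 / 2) t + hit_prob x (r + d0 / 2) t)"
    proof (rule semigroup_local[OF x(1) _ _ t0 fX_meas[OF f t0] B(2)])
      show "r - d0 / 2 < x" "x < r + d0 / 2" using x(2) d0(1) by linarith+
      show "\<bar>f r\<bar> \<le> B" using B r by simp
      fix z assume "z \<in> J" "r - d0 / 2 < z" "z < r + d0 / 2"
      then show "\<bar>f z - f r\<bar> \<le> e / 4"
        using d0(1) by (intro less_imp_le[OF d0(2)]) (auto simp: abs_less_iff)
    qed (use e in auto)
    also have "\<dots> \<le> e / 4 + 2 * B * (e' + e')"
      using \<eta>1(2) \<eta>2(2) x t B by (intro add_left_mono mult_left_mono add_mono) auto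
    also have "\<dots> \<le> e / 4 + e / 4"
    proof -
      have "e' * (16 * (B + 1)) = e" using B by (simp add: e'_def)
      then have "16 * (B * e') + 16 * e' = e" by (simp add: algebra_simps)
      then show ?thesis using e' by (simp add: algebra_simps)
    qed
    finally have "\<bar>T t f x - f r\<bar> \<le> e / 4 + e / 4" .
    moreover have "\<bar>f x - f r\<bar> < e / 4" by (rule d0(2)) (use x d0(1) in auto)
    ultimately show "\<bar>T t f x - f x\<bar> \<le> e" using e by linarith
  qed
qed

text \<open>The estimates beyond \<open>q\<close> and below \<open>p\<close> leave a compact
  interval, which finitely many of the local estimates cover; the smallest of the finitely many
  times works.\<close>

lemma semigroup_uniform:
  assumes f: "f \<in> C0 J" and e: "0 < e"
  shows "\<exists>\<eta>>0. \<forall>t\<in>{0..\<eta>}. \<forall>x\<in>J. \<bar>T t f x - f x\<bar> \<le> e"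
proof -
  have c: "continuous_on J f" using f by (simp add: C0_def)
  obtain B where B: "0 \<le> B" "\<forall>x\<in>J. \<bar>f x\<bar> \<le> B" using C0_bounded[OF f] by blast
  obtain K where K: "compact K" "K \<subseteq> J" "\<forall>x\<in>J - K. \<bar>f x\<bar> \<le> e / 4" using C0_D[OF f, of "e / 4"] e by auto
  have e4: "0 \<le> e / 4" "0 < e / 2" "2 * (e / 4) + e / 2 = e" using e by auto
  obtain q \<eta>1 where q: "q \<in> J" "0 < \<eta>1" "\<forall>x\<in>J. q < x \<longrightarrow> (\<forall>t\<in>{0..\<eta>1}. \<bar>T t f x - f x\<bar> \<le> e)"
    using right_uniform[OF fX_meas[OF c] B K e4(1,2)] unfolding e4(3) by blast
  obtain p \<eta>2 where p: "p \<in> J" "0 < \<eta>2" "\<forall>x\<in>J. x < p \<longrightarrow> (\<forall>t\<in>{0..\<eta>2}. \<bar>T t f x - f x\<bar> \<le> e)"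
    using left_uniform[OF fX_meas[OF c] B K e4(1,2)] unfolding e4(3) by blast
  have pq: "{p..q} \<subseteq> J" by (rule J_Icc[OF p(1) q(1)])
  have "\<forall>r\<in>J. \<exists>d \<eta>. 0 < d \<and> 0 < \<eta> \<and> (\<forall>x\<in>J. \<bar>x - r\<bar> < d \<longrightarrow> (\<forall>t\<in>{0..\<eta>}. \<bar>T t f x - f x\<bar> \<le> e))"
    using semigroup_locally_uniform[OF c B _ e] by blast
  then obtain d \<eta> where d: "\<And>r. r \<in> J \<Longrightarrow> 0 < d r" "\<And>r. r \<in> J \<Longrightarrow> 0 < \<eta> r"
    "\<And>r x t. r \<in> J \<Longrightarrow> x \<in> J \<Longrightarrow> \<bar>x - r\<bar> < d r \<Longrightarrow> t \<in> {0..\<eta> r} \<Longrightarrow> \<bar>T t f x - f x\<bar> \<le> e"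
    by metis
  have "{p..q} \<subseteq> (\<Union>r\<in>{p..q}. ball r (d r))" using d(1) pq by fastforce
  then obtain C where C: "C \<subseteq> {p..q}" "finite C" "{p..q} \<subseteq> (\<Union>r\<in>C. ball r (d r))"
    using compactE_image[OF compact_Icc, of "{p..q}" "\<lambda>r. ball r (d r)" p q] by auto
  define \<eta>0 where "\<eta>0 = Min (insert \<eta>1 (insert \<eta>2 (\<eta> ` C)))"
  have pos: "0 < \<eta>0" using C pq d(2) p(2) q(2) unfolding \<eta>0_def by (subst Min_gr_iff) auto
  have le: "\<eta>0 \<le> \<eta>1" "\<eta>0 \<le> \<eta>2" "\<And>r. r \<in> C \<Longrightarrow> \<eta>0 \<le> \<eta> r"
    unfolding \<eta>0_def using C(2) by (intro Min_le; simp)+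
  have "\<bar>T t f x - f x\<bar> \<le> e" if t: "t \<in> {0..\<eta>0}" and x: "x \<in> J" for t x
  proof -
    consider "x < p" | "q < x" | "x \<in> {p..q}" by fastforce
    then show ?thesis
    proof cases
      case 1 then show ?thesis using p(3) x t le(2) by auto
    next
      case 2 then show ?thesis using q(3) x t le(1) by auto
    next
      case 3
      then obtain r where r: "r \<in> C" "x \<in> ball r (d r)" using C(3) by blast
      show ?thesis
      proof (rule d(3)[OF _ x])
        show "r \<in> J" using r C pq by blast
        show "\<bar>x - r\<bar> < d r" using r(2) by (simp add: dist_real_def abs_minus_commute)
        show "t \<in> {0..\<eta> r}" using t le(3)[OF r(1)] by simp
      qed
    qed
  qed
  then show ?thesis using pos by blast
qed

lemma semigroup_bound:
  assumes f: "f \<in> C0 J" and t: "0 \<le> t" and x: "x \<in> J" and B: "\<forall>z\<in>J. \<bar>f z\<bar> \<le> B"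
  shows "\<bar>T t f x\<bar> \<le> B"
proof -
  interpret prob_space "P x" by (rule prob_P[OF x])
  have int: "integrable (P x) (\<lambda>\<omega>. f (X t \<omega>))"
    by (rule fX_integrable[OF x t fX_meas[OF _ t] B]) (use f in \<open>simp add: C0_def\<close>)
  have "\<bar>T t f x\<bar> \<le> (\<integral>\<omega>. \<bar>f (X t \<omega>)\<bar> \<partial>P x)"
    unfolding transition_semigroup_def by (rule integral_abs_bound)
  also have "\<dots> \<le> (\<integral>\<omega>. B \<partial>P x)"
    by (rule integral_mono) (use int B X_in_J[OF t] x in auto)
  finally show ?thesis by (simp add: prob_space)
qed

lemma semigroup_compose:
  assumes rn: right_natural and ln: left_natural and f: "f \<in> C0 J" and s: "0 \<le> s" and t: "0 \<le> t" and x: "x \<in> J"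
  shows "T (s + t) f x = T s (T t f) x"
proof -
  obtain B where B: "0 \<le> B" "\<forall>x\<in>J. \<bar>f x\<bar> \<le> B" using C0_bounded[OF f] by blast
  have c: "continuous_on J f" using f by (simp add: C0_def)
  have ct: "continuous_on J (T t f)" by (rule semigroup_continuous[OF f t])
  have Tb: "\<forall>z\<in>J. \<bar>T t f z\<bar> \<le> B" using semigroup_bound[OF f t _ B(2)] by blast
  have st: "0 \<le> s + t" using s t by simp
  \<comment> \<open>The Markov property holds for nonnegative functionals. Adding \<open>B\<close>
    makes the integrands nonnegative, and as the measures are probabilities, it only adds
    \<open>B\<close> to the result.\<close>
  have shift_B: "(\<integral>\<^sup>+\<omega>. ennreal (g (X u \<omega>) + B) \<partial>P z) = ennreal (T u g z + B)"
    if z: "z \<in> J" and u: "0 \<le> u" and g: "continuous_on J g" "\<forall>z\<in>J. \<bar>g z\<bar> \<le> B" for g u z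
  proof -
    interpret prob_space "P z" by (rule prob_P[OF z])
    have int: "integrable (P z) (\<lambda>\<omega>. g (X u \<omega>))" by (rule fX_integrable[OF z u fX_meas[OF g(1) u] g(2)])
    have nn: "0 \<le> g (X u \<omega>) + B" if "\<omega> \<in> space A" for \<omega>
    proof -
      have "\<bar>g (X u \<omega>)\<bar> \<le> B" using g(2) X_in_J[OF u that] by blast
      then show ?thesis by linarith
    qed
    have "(\<integral>\<^sup>+\<omega>. ennreal (g (X u \<omega>) + B) \<partial>P z) = ennreal (\<integral>\<omega>. g (X u \<omega>) + B \<partial>P z)"
      by (rule nn_integral_eq_integral) (use int nn z in \<open>auto intro!: AE_I2\<close>)
    also have "(\<integral>\<omega>. g (X u \<omega>) + B \<partial>P z) = T u g z + B"
      using int by (simp add: transition_semigroup_def prob_space)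
    finally show ?thesis .
  qed
  have Zm: "(\<lambda>\<omega>. ennreal (f (X t \<omega>) + B)) \<in> borel_measurable (path_sigma A X)"
    using fX_path_meas[OF c t] by measurable
  have "ennreal (T (s + t) f x + B) = (\<integral>\<^sup>+\<omega>. 1 * ennreal (f (X t (\<theta> s \<omega>)) + B) \<partial>P x)"
    unfolding shift_B[OF x st c B(2), symmetric]
    by (rule nn_integral_cong) (use shift[OF t s] x in \<open>auto simp: add.commute\<close>)
  also have "\<dots> = (\<integral>\<^sup>+\<omega>. 1 * (\<integral>\<^sup>+\<omega>'. ennreal (f (X t \<omega>') + B) \<partial>P (X s \<omega>)) \<partial>P x)"
    by (rule Markov_integral[OF x s Zm]) simp
  also have "\<dots> = (\<integral>\<^sup>+\<omega>. ennreal (T t f (X s \<omega>) + B) \<partial>P x)"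
    by (rule nn_integral_cong) (use shift_B[OF X_in_J[OF s] t c B(2)] x in auto)
  also have "\<dots> = ennreal (T s (T t f) x + B)"
    by (rule shift_B[OF x s ct Tb])
  finally have e: "ennreal (T (s + t) f x + B) = ennreal (T s (T t f) x + B)" .
  have "0 \<le> T (s + t) f x + B" using semigroup_bound[OF f st x B(2)] by linarith
  moreover have "0 \<le> T s (T t f) x + B"
    using semigroup_bound[OF semigroup_C0[OF rn ln f t] s x Tb] by linarith
  ultimately show ?thesis using e by simp
qed

lemma natural_imp_FD:
  assumes rn: right_natural and ln: left_natural
  shows "FD_process J P X"
  unfolding FD_process_def strongly_continuous_semigroup_C0_def
proof (intro conjI allI ballI impI)
  fix t :: real and f assume t: "0 \<le> t" and f: "f \<in> C0 J"
  show "T t f \<in> C0 J" by (rule semigroup_C0[OF rn ln f t])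
next
  fix t \<alpha> \<beta> x :: real and f g assume t: "0 \<le> t" and f: "f \<in> C0 J" and g: "g \<in> C0 J" and x: "x \<in> J"
  have int: "integrable (P x) (\<lambda>\<omega>. h (X t \<omega>))" if "h \<in> C0 J" for h
  proof -
    obtain B where B: "\<forall>x\<in>J. \<bar>h x\<bar> \<le> B" using C0_bounded[OF \<open>h \<in> C0 J\<close>] by blast
    have "continuous_on J h" using \<open>h \<in> C0 J\<close> by (simp add: C0_def)
    from fX_integrable[OF x t fX_meas[OF this t] B] show ?thesis .
  qed
  show "T t (\<lambda>y. \<alpha> * f y + \<beta> * g y) x = \<alpha> * T t f x + \<beta> * T t g x"
    unfolding transition_semigroup_def using int[OF f] int[OF g] by simp
next
  fix t :: real assume t: "0 \<le> t"
  have "sup_norm J (T t f) \<le> 1 * sup_norm J f" if f: "f \<in> C0 J" for f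
  proof -
    obtain B where B: "\<forall>x\<in>J. \<bar>f x\<bar> \<le> B" using C0_bounded[OF f] by blast
    have "\<forall>z\<in>J. \<bar>f z\<bar> \<le> sup_norm J f"
      unfolding sup_norm_def using B by (auto intro!: cSUP_upper bdd_aboveI2[of _ _ B])
    then have "sup_norm J (T t f) \<le> sup_norm J f"
      unfolding sup_norm_def[of J "T t f"] by (intro cSUP_least nonempty semigroup_bound[OF f t])
    then show ?thesis by simp
  qed
  then show "\<exists>B. \<forall>f\<in>C0 J. sup_norm J (T t f) \<le> B * sup_norm J f" by blast
next
  fix f x assume "f \<in> C0 J" "x \<in> J"
  then show "T 0 f x = f x" by (rule semigroup_zero)
next
  fix s t x :: real and f assume "0 \<le> s" "0 \<le> t" "f \<in> C0 J" "x \<in> J"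
  then show "T (s + t) f x = T s (T t f) x" by (intro semigroup_compose[OF rn ln])
next
  fix f assume f: "f \<in> C0 J"
  show "((\<lambda>t. sup_norm J (\<lambda>x. T t f x - f x)) \<longlongrightarrow> 0) (at_right 0)"
  proof (rule tendstoI)
    fix e :: real assume e: "0 < e"
    obtain \<eta> where \<eta>: "0 < \<eta>" "\<forall>t\<in>{0..\<eta>}. \<forall>x\<in>J. \<bar>T t f x - f x\<bar> \<le> e / 2"
      using semigroup_uniform[OF f, of "e / 2"] e by auto
    have "dist (sup_norm J (\<lambda>x. T t f x - f x)) 0 < e" if t: "0 < t" "t < \<eta>" for t
    proof -
      have b: "\<forall>x\<in>J. \<bar>T t f x - f x\<bar> \<le> e / 2" using \<eta>(2) t by simp
      obtain z where z: "z \<in> J" using nonempty by blast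
      have "\<bar>T t f z - f z\<bar> \<le> sup_norm J (\<lambda>x. T t f x - f x)"
        unfolding sup_norm_def using b z by (intro cSUP_upper bdd_aboveI2[of _ _ "e / 2"]) auto
      moreover have "sup_norm J (\<lambda>x. T t f x - f x) \<le> e / 2"
        unfolding sup_norm_def using b nonempty by (intro cSUP_least) auto
      ultimately show ?thesis using e by (simp add: dist_real_def)
    qed
    then show "\<forall>\<^sub>F t in at_right 0. dist (sup_norm J (\<lambda>x. T t f x - f x)) 0 < e"
      unfolding eventually_at_right_field using \<eta>(1) by blast
  qed
qed

theorem FD_iff_martingale: "FD_process J P X \<longleftrightarrow> (\<forall>x\<in>interior J. martingale (P x) F X)"
proof -
  have "FD_process J P X \<longleftrightarrow> right_natural \<and> left_natural"
  proof
    assume "FD_process J P X"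
    then have "T t f \<in> C0 J" if "0 \<le> t" "f \<in> C0 J" for t f
      using that unfolding FD_process_def strongly_continuous_semigroup_C0_def by blast
    from FD_imp_natural[OF this] show "right_natural \<and> left_natural" by blast
  qed (use natural_imp_FD in blast)
  then show ?thesis using martingale_iff_natural by simp
qed

end

theorem corollary1p2:
  fixes J :: "real set"
    and A :: "'w measure"
    and F :: "real \<Rightarrow> 'w measure"
    and X :: "real \<Rightarrow> 'w \<Rightarrow> real"
    and \<theta> :: "real \<Rightarrow> 'w \<Rightarrow> 'w"
    and P :: "real \<Rightarrow> 'w measure"
    and M :: "real measure"
  assumes "regular_diffusion J A F X \<theta> P"
    and "natural_scale J P X"
    and "speed_measure J P X (\<lambda>x. x) M"
    and "\<forall>b\<in>boundary_points J.
           regular_boundary J (\<lambda>x. x) (restrict_space M (interior J)) b \<longrightarrow>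
           absorbing J (\<lambda>x. x) M b"
  shows "FD_process J P X \<longleftrightarrow> (\<forall>x\<in>interior J. martingale (P x) F X)"
proof -
  interpret regular_diffusion J A F X \<theta> P by fact
  interpret absorbing_natural_scale J A F X \<theta> P M
    by unfold_locales (use assms(2-4) in auto)
  show ?thesis by (rule absorbed_diffusion.FD_iff_martingale[OF absorbed])
qed

end
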